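(* Let $n\ge 2$, let $D\subset\mathbb{R}^n$ be an open disc, let $k\ge 2$ be an integer, and let $g$ be a $C^k$-smooth metric on $D$. Then for any $d\in\mathbb{N}$ and any $\varepsilon>0$ there exist a metric $\tilde g$ on $D$ which is $\varepsilon$-close to $g$ in the $C^k$-topology, and a number $\varepsilon'>0$, such that for any $C^2$-smooth metric $g'$ on $D$ which is $\varepsilon'$-close to $\tilde g$ in the $C^2$-topology, the geodesic flow of $g'$ does not admit a nontrivial integral polynomial in momenta of degree $d$.
   Context: "Metric" means pseudo-Riemannian metric of arbitrary signature (including Riemannian). An open disc in $\mathbb{R}^n$ is an open ball. Let $x=(x^1,\dots,x^n)$ be the standard coordinates on $D$ and $p=(p_1,\dots,p_n)$ the corresponding momenta on the cotangent spaces. The geodesic flow of a metric $g=g_{ij}(x)dx^idx^j$ is the Hamiltonian system on $T^*D$ with Hamiltonian $H(x,p)=\tfrac12 g^{ij}(x)p_ip_j$. A function $F:T^*D\to\mathbb{R}$ is polynomial in momenta of degree $d$ if it has the (homogeneous) form $F(x,p)=\sum_{i_1,\dots,i_d=1}^n K^{i_1\dots i_d}(x)\,p_{i_1}\cdots p_{i_d}$ with coefficients $K^{i_1\dots i_d}$ symmetric in their indices. The coefficients are arbitrary real functions on $D$; no regularity, not even continuity, is required of them. Such an $F$ is an integral of the geodesic flow of $g$ if for every (affinely parametrized) geodesic $\gamma$ of $g$ in $D$ the function $t\mapsto \sum_{i_1,\dots,i_d=1}^n K_{i_1\dots i_d}(\gamma(t))\,\dot\gamma(t)^{i_1}\cdots\dot\gamma(t)^{i_d}$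 does not depend on $t$, where the indices of $K$ are lowered with $g$. (For differentiable $F$ this is equivalent to $\{F,H\}\equiv 0$.) An integral is trivial if it is a function of $H$. Thus a trivial integral polynomial in momenta of odd degree is identically zero, and one of even degree $d=2q$ is $c\,H^q$ with $c\in\mathbb{R}$ constant. Nontrivial means not trivial. Two metrics on $D$ are $\varepsilon$-close in the $C^k$-topology if their components in the standard coordinates, together with all partial derivatives of these components up to order $k$, differ by less than $\varepsilon$ uniformly on $D$. *)

theory Defs
  imports "HOL-Analysis.Analysis" "HOL-Library.Multiset"
begin

section \<open>Partial derivatives and \<open>C\<^sup>k\<close> functions\<close>

text \<open>
  The Frechet derivative is a meaningful total function only at points of differentiability.
  Below, partial derivatives are only taken of functions that are differentiable on the open
  set in question, where this is the usual partial derivative.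
\<close>

definition partial_deriv :: "'n::finite \<Rightarrow> (real ^ 'n \<Rightarrow> real) \<Rightarrow> real ^ 'n \<Rightarrow> real" where
  "partial_deriv i f x = frechet_derivative f (at x) (axis i 1)"

definition iter_partial :: "'n::finite list \<Rightarrow> (real ^ 'n \<Rightarrow> real) \<Rightarrow> real ^ 'n \<Rightarrow> real" where
  "iter_partial I f = foldr partial_deriv I f"

definition Ck_on :: "nat \<Rightarrow> (real ^ 'n::finite) set \<Rightarrow> (real ^ 'n \<Rightarrow> real) \<Rightarrow> bool" where
  "Ck_on k D f \<longleftrightarrow>
     (\<forall>I. length I < k \<longrightarrow> (\<forall>x\<in>D. iter_partial I f differentiable (at x))) \<and>
     (\<forall>I. length I \<le> k \<longrightarrow> continuous_on D (iter_partial I f))"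

section \<open>Metrics on an open subset of Euclidean space\<close>

text \<open>
  A metric is given by its matrix of components \<open>g x $ i $ j\<close> in the standard coordinates; its
  values outside the open set \<open>D\<close> are irrelevant. It is pseudo-Riemannian of arbitrary
  signature: only symmetry and nondegeneracy are required.
\<close>

definition Ck_metric_on ::
  "nat \<Rightarrow> (real ^ 'n::finite) set \<Rightarrow> (real ^ 'n \<Rightarrow> real ^ 'n ^ 'n) \<Rightarrow> bool" where
  "Ck_metric_on k D g \<longleftrightarrow>
     (\<forall>i j. Ck_on k D (\<lambda>x. g x $ i $ j)) \<and>
     (\<forall>x\<in>D. transpose (g x) = g x \<and> invertible (g x))"

definition Ck_close_on ::
  "nat \<Rightarrow> (real ^ 'n::finite) set \<Rightarrow> real \<Rightarrow>
   (real ^ 'n \<Rightarrow> real ^ 'n ^ 'n) \<Rightarrow> (real ^ 'n \<Rightarrow> real ^ 'n ^ 'n) \<Rightarrow> bool" where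
  "Ck_close_on k D \<epsilon> g h \<longleftrightarrow>
     (\<forall>x\<in>D. \<forall>i j I. length I \<le> k \<longrightarrow>
        \<bar>iter_partial I (\<lambda>y. g y $ i $ j) x - iter_partial I (\<lambda>y. h y $ i $ j) x\<bar> < \<epsilon>)"

definition hamiltonian ::
  "(real ^ 'n::finite \<Rightarrow> real ^ 'n ^ 'n) \<Rightarrow> real ^ 'n \<Rightarrow> real ^ 'n \<Rightarrow> real" where
  "hamiltonian g x p = (\<Sum>i\<in>UNIV. \<Sum>j\<in>UNIV. matrix_inv (g x) $ i $ j * p $ i * p $ j) / 2"

section \<open>Geodesics\<close>

definition christoffel ::
  "(real ^ 'n::finite \<Rightarrow> real ^ 'n ^ 'n) \<Rightarrow> real ^ 'n \<Rightarrow> 'n \<Rightarrow> 'n \<Rightarrow> 'n \<Rightarrow> real" where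
  "christoffel g x k i j =
     (\<Sum>l\<in>UNIV. matrix_inv (g x) $ k $ l *
        (partial_deriv i (\<lambda>y. g y $ l $ j) x + partial_deriv j (\<lambda>y. g y $ i $ l) x
         - partial_deriv l (\<lambda>y. g y $ i $ j) x)) / 2"

text \<open>
  \<open>geodesic_on D g T \<gamma> v\<close>: on the open time interval \<open>T\<close>, the curve \<open>\<gamma>\<close> runs in \<open>D\<close>, has velocity
  \<open>v\<close>, and is an affinely parametrized geodesic of \<open>g\<close>.
\<close>

definition geodesic_on ::
  "(real ^ 'n::finite) set \<Rightarrow> (real ^ 'n \<Rightarrow> real ^ 'n ^ 'n) \<Rightarrow> real set \<Rightarrow>
   (real \<Rightarrow> real ^ 'n) \<Rightarrow> (real \<Rightarrow> real ^ 'n) \<Rightarrow> bool" where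
  "geodesic_on D g T \<gamma> v \<longleftrightarrow>
     open T \<and> is_interval T \<and>
     (\<forall>t\<in>T. \<gamma> t \<in> D \<and>
        (\<gamma> has_vector_derivative v t) (at t) \<and>
        (v has_vector_derivative
           (\<chi> k. - (\<Sum>i\<in>UNIV. \<Sum>j\<in>UNIV. christoffel g (\<gamma> t) k i j * v t $ i * v t $ j))) (at t))"

section \<open>Integrals polynomial in momenta\<close>

text \<open>
  A tensor field of rank \<open>d\<close> is a function of the point and of an index list of length \<open>d\<close>; its
  values at index lists of other lengths are irrelevant. No regularity in the point is assumed.
\<close>

definition symmetric_tensor_on ::
  "(real ^ 'n::finite) set \<Rightarrow> nat \<Rightarrow> (real ^ 'n \<Rightarrow> 'n list \<Rightarrow> real) \<Rightarrow> bool" where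
  "symmetric_tensor_on D d K \<longleftrightarrow>
     (\<forall>x\<in>D. \<forall>I J. length I = d \<and> mset I = mset J \<longrightarrow> K x I = K x J)"

definition tensor_eval :: "nat \<Rightarrow> ('n::finite list \<Rightarrow> real) \<Rightarrow> real ^ 'n \<Rightarrow> real" where
  "tensor_eval d K p = (\<Sum>I | length I = d. K I * (\<Prod>i\<leftarrow>I. p $ i))"

definition lower_indices ::
  "nat \<Rightarrow> (real ^ 'n::finite \<Rightarrow> real ^ 'n ^ 'n) \<Rightarrow> (real ^ 'n \<Rightarrow> 'n list \<Rightarrow> real) \<Rightarrow>
   real ^ 'n \<Rightarrow> 'n list \<Rightarrow> real" where
  "lower_indices d g K x J = (\<Sum>I | length I = d. (\<Prod>l<d. g x $ (J ! l) $ (I ! l)) * K x I)"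

definition polynomial_integral ::
  "(real ^ 'n::finite) set \<Rightarrow> (real ^ 'n \<Rightarrow> real ^ 'n ^ 'n) \<Rightarrow> nat \<Rightarrow>
   (real ^ 'n \<Rightarrow> real ^ 'n \<Rightarrow> real) \<Rightarrow> bool" where
  "polynomial_integral D g d F \<longleftrightarrow>
     (\<exists>K. symmetric_tensor_on D d K \<and>
        (\<forall>x\<in>D. \<forall>p. F x p = tensor_eval d (K x) p) \<and>
        (\<forall>T \<gamma> v. geodesic_on D g T \<gamma> v \<longrightarrow>
           (\<lambda>t. tensor_eval d (lower_indices d g K (\<gamma> t)) (v t)) constant_on T))"

definition trivial_integral ::
  "(real ^ 'n::finite) set \<Rightarrow> (real ^ 'n \<Rightarrow> real ^ 'n ^ 'n) \<Rightarrow>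
   (real ^ 'n \<Rightarrow> real ^ 'n \<Rightarrow> real) \<Rightarrow> bool" where
  "trivial_integral D g F \<longleftrightarrow>
     (\<exists>\<phi> :: real \<Rightarrow> real. \<forall>x\<in>D. \<forall>p. F x p = \<phi> (hamiltonian g x p))"

end

(*
  With its indices lowered, an integral polynomial in momenta is a function P(x, v) that is
  homogeneous of degree d in v and constant along geodesics. Locally any two points x, y are joined
  by a unique short geodesic, so P at x is determined by its values at the points of any small open
  set, because the initial velocities of the geodesics to these points form an open set. With
  finitely many points this is stable under C^2-small perturbations of the metric. Hence, without
  any regularity of the coefficients: integrals on a connected domain form a finite-dimensional
  space and satisfy unique continuation, and bounded sequences of integrals of converging metrics
  have convergent subsequences, whose limits are again integrals.

  Let P be a nontrivial integral on a ball. At some point beyond the ball and some velocity v, P is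
  not critical along the level set of the energy. A conformal bump (1 + f) g, C^k-small and supported
  near that point, pushes the geodesic through it in a direction chosen such that
  P - kappa ln(1 + f) is strictly monotone along the perturbed geodesic, although f vanishes at both
  ends. So P does not extend as an integral of the perturbed metric. Passing to slightly larger
  balls, the dimension of the space of integrals drops at each step until only trivial integrals are
  left on some ball. By compactness, this persists for all metrics that are C^2-close.
*)

theory Submission
  imports Defs
begin

text \<open>Two obstacles shape the proof. The coefficients have no regularity, so the Killing
  equation cannot be treated as a differential equation; and a C^2 metric has no smooth exponential
  map. So almost everything is drawn from one relation: an integral takes equal values at the two
  ends of a short geodesic. Short geodesics come from a contraction argument for the boundary value
  problem, with constants shared by all nearby metrics. One convergence statement over an arbitrary
  filter then yields continuity (filter \<open>nhds y\<close>), unique continuation (multiples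
  \<open>m * P\<close>) and compactness (subsequences).

  The bump works because, along a geodesic of (1 + f) g, P varies by its velocity derivative applied
  to the difference of the sprays, which is linear in df. For a radial bump about z, the derivative
  of P + kappa ln(1 + f) is a nonnegative factor times the inner product of z - c with a vector u.
  The choice of kappa makes u orthogonal to the initial velocity; u is nonzero since P is not
  critical on the energy level. Placing z off the geodesic in the direction u fixes the sign
  throughout the bump.\<close>

section \<open>Homogeneous polynomials\<close>

text \<open>Polynomials are kept as functions: tensors with the same symmetrization evaluate alike,
  and all later arguments compare values only.\<close>

definition hom_poly :: "nat \<Rightarrow> (real ^ 'n::finite \<Rightarrow> real) set" where
  "hom_poly d = range (tensor_eval d)"

lemma finite_index_lists [simp]: "finite {I :: 'n::finite list. length I = d}"
  using finite_lists_length_eq[of "UNIV :: 'n set" d] by simp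

lemma tensor_eval_in_hom_poly [simp]: "tensor_eval d K \<in> hom_poly d"
  by (simp add: hom_poly_def)

lemma hom_poly_zero: "(\<lambda>v. 0) \<in> hom_poly d"
proof -
  have "(\<lambda>v. 0) = tensor_eval d (\<lambda>I. 0)" by (simp add: tensor_eval_def fun_eq_iff)
  then show ?thesis by (metis tensor_eval_in_hom_poly)
qed

lemma hom_poly_add:
  assumes "p \<in> hom_poly d" "q \<in> hom_poly d"
  shows "(\<lambda>v. p v + q v) \<in> hom_poly d"
proof -
  obtain K L where "p = tensor_eval d K" "q = tensor_eval d L"
    using assms by (auto simp: hom_poly_def)
  then have "(\<lambda>v. p v + q v) = tensor_eval d (\<lambda>I. K I + L I)"
    by (simp add: tensor_eval_def fun_eq_iff sum.distrib algebra_simps)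
  then show ?thesis by simp
qed

lemma hom_poly_cmult:
  assumes "p \<in> hom_poly d"
  shows "(\<lambda>v. a * p v) \<in> hom_poly d"
proof -
  obtain K where "p = tensor_eval d K"
    using assms by (auto simp: hom_poly_def)
  then have "(\<lambda>v. a * p v) = tensor_eval d (\<lambda>I. a * K I)"
    by (simp add: tensor_eval_def fun_eq_iff sum_distrib_left algebra_simps)
  then show ?thesis by simp
qed

lemma hom_poly_diff:
  assumes "p \<in> hom_poly d" "q \<in> hom_poly d"
  shows "(\<lambda>v. p v - q v) \<in> hom_poly d"
  using hom_poly_add[OF assms(1) hom_poly_cmult[OF assms(2), of "-1"]] by simp

lemma hom_poly_sum:
  assumes "finite A" "\<And>i. i \<in> A \<Longrightarrow> p i \<in> hom_poly d"
  shows "(\<lambda>v. \<Sum>i\<in>A. a i * p i v) \<in> hom_poly d"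
  using assms
  by (induction A rule: finite_induct) (auto intro!: hom_poly_zero hom_poly_add hom_poly_cmult)

text \<open>Cutting an index list of length \<open>a + b\<close> at position \<open>a\<close> is a
  bijection onto pairs of index lists.\<close>

lemma tensor_eval_mult:
  "tensor_eval a K v * tensor_eval b L v
     = tensor_eval (a + b) (\<lambda>I. K (take a I) * L (drop a I)) v"
proof -
  have "tensor_eval a K v * tensor_eval b L v =
    (\<Sum>(I,J)\<in>{I. length I = a} \<times> {J. length J = b}.
       (K I * (\<Prod>i\<leftarrow>I. v $ i)) * (L J * (\<Prod>i\<leftarrow>J. v $ i)))"
    by (simp add: tensor_eval_def sum_product sum.cartesian_product)
  also have "\<dots> = (\<Sum>I | length I = a + b. K (take a I) * L (drop a I) * (\<Prod>i\<leftarrow>I. v $ i))"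
    by (rule sum.reindex_bij_witness[of _ "\<lambda>I. (take a I, drop a I)" "\<lambda>(I,J). I @ J"])
       (auto simp: algebra_simps)
  finally show ?thesis by (simp add: tensor_eval_def)
qed

lemma hom_poly_mult:
  assumes "p \<in> hom_poly a" "q \<in> hom_poly b"
  shows "(\<lambda>v. p v * q v) \<in> hom_poly (a + b)"
proof -
  obtain K L where "p = tensor_eval a K" "q = tensor_eval b L"
    using assms by (auto simp: hom_poly_def)
  then have "(\<lambda>v. p v * q v) = tensor_eval (a + b) (\<lambda>I. K (take a I) * L (drop a I))"
    by (simp add: tensor_eval_mult fun_eq_iff)
  then show ?thesis by simp
qed

lemma hom_poly_one: "(\<lambda>v. 1) \<in> hom_poly 0"
proof -
  have "(\<lambda>v. 1) = tensor_eval 0 (\<lambda>I. 1)" by (simp add: tensor_eval_def fun_eq_iff)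
  then show ?thesis by (metis tensor_eval_in_hom_poly)
qed

lemma hom_poly_power:
  assumes "p \<in> hom_poly a"
  shows "(\<lambda>v. p v ^ m) \<in> hom_poly (m * a)"
proof (induction m)
  case (Suc m)
  show ?case using hom_poly_mult[OF assms Suc] by simp
qed (simp add: hom_poly_one)

lemma hom_poly_linear:
  assumes "linear (f :: real ^ 'n::finite \<Rightarrow> real)"
  shows "f \<in> hom_poly 1"
proof -
  have *: "{I :: 'n list. length I = 1} = (\<lambda>i. [i]) ` UNIV"
    by (auto simp: length_Suc_conv)
  have "tensor_eval 1 (\<lambda>I. f (axis (hd I) 1)) v = f v" for v
  proof -
    have "tensor_eval 1 (\<lambda>I. f (axis (hd I) 1)) v = (\<Sum>i\<in>UNIV. f (axis i 1) * v $ i)"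
      unfolding tensor_eval_def * by (subst sum.reindex) (auto simp: inj_on_def)
    also have "\<dots> = f (\<Sum>i\<in>UNIV. v $ i *\<^sub>R axis i 1)"
      by (simp add: linear_sum[OF assms] linear_scale[OF assms] mult.commute)
    also have "(\<Sum>i\<in>UNIV. v $ i *\<^sub>R axis i 1) = v"
      by (simp add: vec_eq_iff axis_def if_distrib cong: if_cong)
    finally show ?thesis .
  qed
  then have "f = tensor_eval 1 (\<lambda>I. f (axis (hd I) 1))" by auto
  then show ?thesis by (metis tensor_eval_in_hom_poly)
qed

lemma hom_poly_scaleR:
  assumes "p \<in> hom_poly d"
  shows "p (t *\<^sub>R v) = t ^ d * p v"
proof -
  have *: "(\<Prod>i\<leftarrow>I. t * v $ i) = t ^ length I * (\<Prod>i\<leftarrow>I. v $ i)" for I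
    by (induction I) (auto simp: algebra_simps)
  obtain K where "p = tensor_eval d K" using assms by (auto simp: hom_poly_def)
  then show ?thesis
    by (simp add: tensor_eval_def * sum_distrib_left algebra_simps)
qed

text \<open>Used for lowering indices: it turns a polynomial in momenta into one in velocities of
  the same degree.\<close>

lemma hom_poly_comp_matrix:
  assumes "p \<in> hom_poly d"
  shows "(\<lambda>v. p (A *v v)) \<in> hom_poly d"
proof -
  have prod: "(\<lambda>v. \<Prod>i\<leftarrow>I. (A *v v) $ i) \<in> hom_poly (length I)" for I
  proof (induction I)
    case (Cons i I)
    have "linear (\<lambda>v. (A *v v) $ i)"
      by (rule linearI) (auto simp: matrix_vector_mult_def algebra_simps sum.distrib sum_distrib_left)
    then show ?case using hom_poly_mult[OF hom_poly_linear Cons] by simp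
  qed (simp add: hom_poly_one)
  obtain K where "p = tensor_eval d K" using assms by (auto simp: hom_poly_def)
  then show ?thesis
    unfolding tensor_eval_def using prod by (auto intro!: hom_poly_sum)
qed

lemma hom_poly_imp_real_polynomial_function:
  assumes "p \<in> hom_poly d"
  shows "real_polynomial_function p"
proof -
  have prod: "real_polynomial_function (\<lambda>v. \<Prod>i\<leftarrow>I. v $ i)" for I :: "'a list"
  proof (induction I)
    case (Cons i I)
    have "real_polynomial_function (\<lambda>v::real^'a. v $ i)"
      by (rule real_polynomial_function.intros(1)) (rule bounded_linear_vec_nth)
    then show ?case using Cons by (auto intro: real_polynomial_function.intros)
  qed (auto intro: real_polynomial_function.intros)
  obtain K where "p = tensor_eval d K" using assms by (auto simp: hom_poly_def)
  then have "p = (\<lambda>v. \<Sum>I | length I = d. K I * (\<Prod>i\<leftarrow>I. v $ i))"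
    by (simp add: tensor_eval_def[abs_def])
  moreover have "real_polynomial_function (\<lambda>v. K I * (\<Prod>i\<leftarrow>I. v $ i))" for I
    by (rule real_polynomial_function.intros(4)[OF real_polynomial_function.intros(2) prod])
  ultimately show ?thesis by (simp add: real_polynomial_function_sum)
qed

lemma hom_poly_differentiable:
  assumes "p \<in> hom_poly d"
  shows "p differentiable at v"
  using differentiable_at_real_polynomial_function[OF hom_poly_imp_real_polynomial_function[OF assms]] .

lemma hom_poly_has_derivative:
  assumes "p \<in> hom_poly d"
  shows "(p has_derivative frechet_derivative p (at v)) (at v)"
  using frechet_derivative_works[of p "at v"] hom_poly_differentiable[OF assms] by blast

lemma hom_poly_continuous_on:
  assumes "p \<in> hom_poly d"
  shows "continuous_on S p"
  using hom_poly_differentiable[OF assms]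
  by (meson continuous_at_imp_continuous_on differentiable_imp_continuous_within)

lemma hom_poly_tendsto:
  assumes "p \<in> hom_poly d" "(u \<longlongrightarrow> u0) F"
  shows "((\<lambda>x. p (u x)) \<longlongrightarrow> p u0) F"
  using hom_poly_continuous_on[OF assms(1), of UNIV] assms(2)
  by (metis UNIV_I continuous_on_def isCont_tendsto_compose continuous_on_eq_continuous_at open_UNIV)

lemma real_polynomial_function_line:
  assumes "real_polynomial_function (p :: 'a::real_normed_vector \<Rightarrow> real)"
  shows "real_polynomial_function (\<lambda>t. p (u + t *\<^sub>R v))"
proof -
  have "polynomial_function (\<lambda>t::real. u + t *\<^sub>R v)"
    by (intro polynomial_function_add polynomial_function_const
        polynomial_function_bounded_linear bounded_linear_scaleR_left)
  then show ?thesis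
    using real_polynomial_function_compose[OF _ assms] by (simp add: o_def)
qed

lemma real_polynomial_function_1_zero:
  assumes "real_polynomial_function (f :: real \<Rightarrow> real)" "infinite {t. f t = 0}"
  shows "f t = 0"
proof -
  obtain a n where f: "f = (\<lambda>x. \<Sum>i\<le>n. a i * x ^ i)"
    using assms(1) real_polynomial_function_imp_sum by blast
  have "\<forall>k\<le>n. a k = 0"
    using polyfun_finite_roots[of a n] assms(2) f by auto
  then show ?thesis using f by simp
qed

text \<open>On the line from a point of \<open>U\<close> to \<open>v\<close> the polynomial has one
  variable and infinitely many zeros.\<close>

lemma real_polynomial_function_zero_on_open:
  assumes p: "real_polynomial_function (p :: 'a::real_normed_vector \<Rightarrow> real)"
    and "open U" "u \<in> U" "\<And>v. v \<in> U \<Longrightarrow> p v = 0"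
  shows "p v = 0"
proof -
  let ?f = "\<lambda>t. p (u + t *\<^sub>R (v - u))"
  have "continuous_on UNIV (\<lambda>t::real. u + t *\<^sub>R (v - u))" by (intro continuous_intros)
  then have "open ((\<lambda>t::real. u + t *\<^sub>R (v - u)) -` U)"
    using \<open>open U\<close> by (simp add: open_vimage)
  moreover have "0 \<in> (\<lambda>t::real. u + t *\<^sub>R (v - u)) -` U" using \<open>u \<in> U\<close> by simp
  ultimately obtain e where "e > 0" "ball 0 e \<subseteq> (\<lambda>t::real. u + t *\<^sub>R (v - u)) -` U"
    using open_contains_ball by blast
  then have "ball 0 e \<subseteq> {t. ?f t = 0}" using assms(4) by auto
  moreover have "infinite (ball (0::real) e)"
    using \<open>e > 0\<close> uncountable_ball[of e "0::real"] uncountable_infinite by blast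
  ultimately have "infinite {t. ?f t = 0}" using finite_subset by blast
  then have "?f 1 = 0"
    using real_polynomial_function_1_zero[OF real_polynomial_function_line[OF p]] by blast
  then show ?thesis by simp
qed

lemma hom_poly_zero_on_open:
  assumes "p \<in> hom_poly d" "open U" "U \<noteq> {}" "\<And>v. v \<in> U \<Longrightarrow> p v = 0"
  shows "p v = 0"
proof -
  obtain u where "u \<in> U" using assms(3) by blast
  then show ?thesis
    using real_polynomial_function_zero_on_open[OF hom_poly_imp_real_polynomial_function[OF assms(1)] assms(2)]
      assms(4) by blast
qed

section \<open>Interpolation\<close>

text \<open>Such a \<open>U\<close> is a unisolvent set for the homogeneous polynomials of degree
  \<open>d\<close>.\<close>

definition separates :: "(real ^ 'n::finite) set \<Rightarrow> nat \<Rightarrow> bool" where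
  "separates U d \<longleftrightarrow> (\<forall>p\<in>hom_poly d. (\<forall>u\<in>U. p u = 0) \<longrightarrow> (\<forall>v. p v = 0))"

lemma separatesD:
  assumes "separates U d" "p \<in> hom_poly d" "\<And>u. u \<in> U \<Longrightarrow> p u = 0"
  shows "p v = 0"
  using assms unfolding separates_def by auto

lemma separates_open:
  assumes "open U" "U \<noteq> {}"
  shows "separates U d"
  unfolding separates_def using hom_poly_zero_on_open[OF _ assms] by blast

text \<open>Lagrange interpolation without a dimension count, built as in Newton's scheme: adding
  \<open>\<phi> n\<close>, look at the residual \<open>r\<close> left by the old nodes. If
  \<open>r\<close> vanishes on \<open>U\<close>, the old nodes suffice; otherwise a point where it
  does not becomes a new node. The coefficients \<open>\<beta>\<close> record that the interpolating
  functions lie in the span of the \<open>\<phi> i\<close>.\<close>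

lemma span_interpolation:
  fixes \<phi> :: "nat \<Rightarrow> 'x \<Rightarrow> real"
  shows "\<exists>(M::nat) u \<beta>. (\<forall>b<M. u b \<in> U) \<and>
    (\<forall>a. \<forall>v\<in>U. (\<Sum>i<n. a i * \<phi> i v) =
       (\<Sum>b<M. (\<Sum>i<n. a i * \<phi> i (u b)) * (\<Sum>i<n. \<beta> b i * \<phi> i v)))"
proof (induction n)
  case 0
  show ?case by (rule exI[of _ 0]) simp
next
  case (Suc n)
  then obtain M :: nat and u \<beta> where u: "\<forall>b<M. u b \<in> U" and
    IH: "\<And>a v. v \<in> U \<Longrightarrow> (\<Sum>i<n. a i * \<phi> i v) =
       (\<Sum>b<M. (\<Sum>i<n. a i * \<phi> i (u b)) * (\<Sum>i<n. \<beta> b i * \<phi> i v))"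
    by blast
  define l where "l b v = (\<Sum>i<n. \<beta> b i * \<phi> i v)" for b v
  define r where "r v = \<phi> n v - (\<Sum>b<M. \<phi> n (u b) * l b v)" for v
  have dec: "(\<Sum>i<Suc n. a i * \<phi> i v) =
    (\<Sum>b<M. (\<Sum>i<Suc n. a i * \<phi> i (u b)) * l b v) + a n * r v" if "v \<in> U" for a v
    using IH[OF that, of a]
    by (simp add: r_def l_def[symmetric] algebra_simps sum.distrib sum_distrib_left)
  show ?case
  proof (cases "\<forall>v\<in>U. r v = 0")
    case True
    let ?\<beta> = "\<lambda>b. (\<beta> b)(n := 0)"
    have "(\<Sum>i<Suc n. ?\<beta> b i * \<phi> i v) = l b v" for b v by (simp add: l_def)
    then show ?thesis using u dec True by (intro exI[of _ M] exI[of _ u] exI[of _ ?\<beta>]) simp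
  next
    case False
    then obtain w where w: "w \<in> U" "r w \<noteq> 0" by blast
    \<comment> \<open>Coefficients of the residual \<open>r\<close> with respect to the
      \<open>\<phi> i\<close>.\<close>
    define \<rho> where "\<rho> i = (if i = n then 1 else - (\<Sum>b<M. \<phi> n (u b) * \<beta> b i))" for i
    have r: "(\<Sum>i<Suc n. \<rho> i * \<phi> i v) = r v" for v
    proof -
      have "(\<Sum>b<M. \<phi> n (u b) * l b v) = (\<Sum>i<n. (\<Sum>b<M. \<phi> n (u b) * \<beta> b i) * \<phi> i v)"
        unfolding l_def sum_distrib_left sum_distrib_right
        by (subst sum.swap) (simp add: mult.assoc)
      then show ?thesis by (simp add: r_def \<rho>_def sum_negf)
    qed
    \<comment> \<open>The new node \<open>w\<close> gets \<open>r / r w\<close>; each old function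
      \<open>l b\<close> is corrected by a multiple of \<open>r\<close> so that it vanishes at
      \<open>w\<close>.\<close>
    define B where "B b i = (if b = M then \<rho> i / r w
       else ((\<beta> b)(n := 0)) i - l b w / r w * \<rho> i)" for b i
    have B: "(\<Sum>i<Suc n. B b i * \<phi> i v) = (if b = M then r v / r w else l b v - l b w / r w * r v)" for b v
    proof (cases "b = M")
      case True
      then show ?thesis
        using r[of v] by (simp add: B_def sum_divide_distrib[symmetric] divide_simps)
    next
      case False
      have "(\<Sum>i<Suc n. B b i * \<phi> i v) =
        (\<Sum>i<Suc n. ((\<beta> b)(n := 0)) i * \<phi> i v) - l b w / r w * (\<Sum>i<Suc n. \<rho> i * \<phi> i v)"
        using False by (simp add: B_def left_diff_distrib sum_subtractf sum_distrib_left algebra_simps)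
      also have "(\<Sum>i<Suc n. ((\<beta> b)(n := 0)) i * \<phi> i v) = l b v" by (simp add: l_def)
      finally show ?thesis using False r by simp
    qed
    let ?u = "\<lambda>b. if b = M then w else u b"
    have "(\<Sum>i<Suc n. a i * \<phi> i v) =
       (\<Sum>b<Suc M. (\<Sum>i<Suc n. a i * \<phi> i (?u b)) * (\<Sum>i<Suc n. B b i * \<phi> i v))"
      if v: "v \<in> U" for a v
    proof -
      define p where "p v = (\<Sum>i<Suc n. a i * \<phi> i v)" for v
      have "p w = (\<Sum>b<M. p (u b) * l b w) + a n * r w"
        using dec[OF w(1), of a] unfolding p_def .
      then have an: "a n = (p w - (\<Sum>b<M. p (u b) * l b w)) / r w" using w(2) by simp
      have "(\<Sum>b<Suc M. p (?u b) * (\<Sum>i<Suc n. B b i * \<phi> i v)) =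
        (\<Sum>b<M. p (u b) * (l b v - l b w / r w * r v)) + p w * (r v / r w)"
        unfolding B by simp
      also have "\<dots> = (\<Sum>b<M. p (u b) * l b v) - (\<Sum>b<M. p (u b) * l b w) * (r v / r w) + p w * (r v / r w)"
        unfolding sum_distrib_right by (simp add: sum_subtractf algebra_simps)
      also have "\<dots> = (\<Sum>b<M. p (u b) * l b v) + a n * r v"
        unfolding an using w(2) by (simp add: field_simps)
      also have "\<dots> = p v" using dec[OF v, of a] unfolding p_def by simp
      finally show ?thesis unfolding p_def by simp
    qed
    moreover have "\<forall>b<Suc M. ?u b \<in> U" using u w(1) by (auto simp: less_Suc_eq)
    ultimately show ?thesis
      by (intro exI[of _ "Suc M"] exI[of _ ?u] exI[of _ B] conjI allI ballI) (blast, assumption)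
  qed
qed

text \<open>The formula of \<open>span_interpolation\<close>, applied to monomials, holds on
  \<open>U\<close> only; both sides are homogeneous polynomials, so separation extends it to every
  \<open>v\<close>.\<close>

lemma separates_interpolation:
  assumes "separates (U :: (real ^ 'n::finite) set) d"
  obtains M u l where "\<And>b::nat. b < M \<Longrightarrow> u b \<in> U" "\<And>b. b < M \<Longrightarrow> l b \<in> hom_poly d"
    "\<And>p v. p \<in> hom_poly d \<Longrightarrow> p v = (\<Sum>b<M. p (u b) * l b v)"
proof -
  obtain h :: "nat \<Rightarrow> 'n list" and n where h: "bij_betw h {..<n} {I. length I = d}"
    using ex_bij_betw_nat_finite[OF finite_index_lists[of d]] by (metis atLeast0LessThan)
  define \<phi> where "\<phi> i v = (\<Prod>i\<leftarrow>h i. v $ i)" for i and v :: "real ^ 'n"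
  have te: "tensor_eval d K v = (\<Sum>i<n. K (h i) * \<phi> i v)" for K v
    unfolding tensor_eval_def \<phi>_def by (rule sum.reindex_bij_betw[OF h, symmetric])
  have te': "(\<lambda>v. \<Sum>i<n. a i * \<phi> i v) \<in> hom_poly d" for a
  proof -
    have "(\<Sum>i<n. a i * \<phi> i v) = tensor_eval d (\<lambda>I. a (the_inv_into {..<n} h I)) v" for v
      unfolding te using h by (intro sum.cong) (auto simp: bij_betw_def the_inv_into_f_f)
    then have "(\<lambda>v. \<Sum>i<n. a i * \<phi> i v) = tensor_eval d (\<lambda>I. a (the_inv_into {..<n} h I))" by auto
    then show ?thesis by simp
  qed
  obtain M :: nat and u \<beta> where u: "\<forall>b<M. u b \<in> U" and
    e: "\<And>a v. v \<in> U \<Longrightarrow> (\<Sum>i<n. a i * \<phi> i v) =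
       (\<Sum>b<M. (\<Sum>i<n. a i * \<phi> i (u b)) * (\<Sum>i<n. \<beta> b i * \<phi> i v))"
    using span_interpolation[where U=U and n=n and \<phi>=\<phi>] by blast
  define l where "l b v = (\<Sum>i<n. \<beta> b i * \<phi> i v)" for b v
  have l: "l b \<in> hom_poly d" for b
    using te'[of "\<beta> b"] unfolding l_def[abs_def] .
  show ?thesis
  proof
    show "p v = (\<Sum>b<M. p (u b) * l b v)" if p: "p \<in> hom_poly d" for p v
    proof -
      obtain K where K: "p = tensor_eval d K" using p by (auto simp: hom_poly_def)
      let ?q = "\<lambda>v. p v - (\<Sum>b<M. p (u b) * l b v)"
      have qh: "?q \<in> hom_poly d" using l p by (intro hom_poly_diff hom_poly_sum) auto
      have qz: "?q v = 0" if "v \<in> U" for v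
        using e[OF that, of "\<lambda>i. K (h i)"] by (simp add: K te l_def)
      have "?q v = 0" by (rule separatesD[OF assms qh qz])
      then show ?thesis by (rule eq_iff_diff_eq_0[THEN iffD2])
    qed
  qed (use u l in auto)
qed

text \<open>Expanding p(u b) - p(w b) by the interpolation formula bounds it by a small multiple of
  the sum over the nodes \<open>u\<close>, which is then absorbed on the left.\<close>

lemma interpolation_stable:
  fixes u :: "nat \<Rightarrow> real ^ 'n::finite" and l :: "nat \<Rightarrow> real ^ 'n \<Rightarrow> real"
  assumes l: "\<And>b. b < M \<Longrightarrow> l b \<in> hom_poly d"
    and rep: "\<And>p v. p \<in> hom_poly d \<Longrightarrow> p v = (\<Sum>b<M. p (u b) * l b v)"
  obtains \<delta> where "\<delta> > 0"
    "\<And>w (p :: real ^ 'n \<Rightarrow> real). (\<And>b. b < M \<Longrightarrow> dist (w b) (u b) < \<delta>) \<Longrightarrow> p \<in> hom_poly d \<Longrightarrow>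
       (\<Sum>b<M. \<bar>p (u b)\<bar>) \<le> 2 * (\<Sum>b<M. \<bar>p (w b)\<bar>)"
proof -
  \<comment> \<open>Ensures \<open>M * \<eta> \<le> 1 / 2\<close>, with a positive denominator even
    for \<open>M = 0\<close>.\<close>
  define \<eta> where "\<eta> = 1 / (2 * real M + 1)"
  have \<eta>: "\<eta> > 0" by (simp add: \<eta>_def add_nonneg_pos)
  have "\<exists>\<delta>>0. \<forall>w. dist w (u b) < \<delta> \<longrightarrow> dist (l c w) (l c (u b)) < \<eta>" if "b < M" "c < M" for b c
    using hom_poly_continuous_on[OF l[OF that(2)], of UNIV] \<eta>
    unfolding continuous_on_iff by blast
  then obtain D where D: "\<And>b c. b < M \<Longrightarrow> c < M \<Longrightarrow> D b c > (0::real)"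
    "\<And>b c w. b < M \<Longrightarrow> c < M \<Longrightarrow> dist w (u b) < D b c \<Longrightarrow> dist (l c w) (l c (u b)) < \<eta>"
    by metis
  define \<delta> where "\<delta> = Min (insert 1 ((\<lambda>(b,c). D b c) ` ({..<M} \<times> {..<M})))"
  have "\<delta> > 0" unfolding \<delta>_def using D(1) by (subst Min_gr_iff) auto
  have \<delta>D: "\<delta> \<le> D b c" if "b < M" "c < M" for b c
    unfolding \<delta>_def using that by (intro Min_le) auto
  show ?thesis
  proof
    show "\<delta> > 0" by fact
    fix w and p :: "real ^ 'n \<Rightarrow> real"
    assume w: "\<And>b. b < M \<Longrightarrow> dist (w b) (u b) < \<delta>" and p: "p \<in> hom_poly d"
    let ?S = "\<Sum>b<M. \<bar>p (u b)\<bar>"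
    have "\<bar>p (u b)\<bar> \<le> \<bar>p (w b)\<bar> + ?S * \<eta>" if b: "b < M" for b
    proof -
      have "p (u b) - p (w b) = (\<Sum>c<M. p (u c) * (l c (u b) - l c (w b)))"
        using rep[OF p, of "u b"] rep[OF p, of "w b"]
        by (simp add: algebra_simps sum_subtractf)
      also have "\<bar>\<dots>\<bar> \<le> (\<Sum>c<M. \<bar>p (u c)\<bar> * \<eta>)"
      proof (rule order_trans[OF sum_abs], rule sum_mono)
        fix c assume "c \<in> {..<M}"
        then have "dist (l c (w b)) (l c (u b)) < \<eta>"
          using D(2)[of b c "w b"] w[OF b] \<delta>D[of b c] b by auto
        then show "\<bar>p (u c) * (l c (u b) - l c (w b))\<bar> \<le> \<bar>p (u c)\<bar> * \<eta>"
          unfolding abs_mult by (intro mult_left_mono) (auto simp: dist_real_def)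
      qed
      finally show ?thesis by (simp add: sum_distrib_right)
    qed
    then have "?S \<le> (\<Sum>b<M. \<bar>p (w b)\<bar> + ?S * \<eta>)" by (intro sum_mono) auto
    also have "\<dots> = (\<Sum>b<M. \<bar>p (w b)\<bar>) + ?S * (real M * \<eta>)" by (simp add: sum.distrib)
    also have "\<dots> \<le> (\<Sum>b<M. \<bar>p (w b)\<bar>) + ?S * (1/2)"
      by (intro add_left_mono mult_left_mono sum_nonneg) (auto simp: \<eta>_def field_simps)
    finally show "?S \<le> 2 * (\<Sum>b<M. \<bar>p (w b)\<bar>)" by simp
  qed
qed

text \<open>Separation by finitely many nodes is an open condition. This is what makes a single
  finite set usable for all nearby base points and metrics.\<close>

lemma interpolation_separates:
  fixes u :: "nat \<Rightarrow> real ^ 'n::finite" and l :: "nat \<Rightarrow> real ^ 'n \<Rightarrow> real"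
  assumes l: "\<And>b. b < M \<Longrightarrow> l b \<in> hom_poly d"
    and rep: "\<And>p v. p \<in> hom_poly d \<Longrightarrow> p v = (\<Sum>b<M. p (u b) * l b v)"
  obtains \<delta> where "\<delta> > 0"
    "\<And>w. (\<And>b. b < M \<Longrightarrow> dist (w b) (u b) < \<delta>) \<Longrightarrow> separates (w ` {..<M}) d"
proof -
  obtain \<delta> where \<delta>: "\<delta> > 0"
    "\<And>w p. (\<And>b. b < M \<Longrightarrow> dist (w b) (u b) < \<delta>) \<Longrightarrow> p \<in> hom_poly d \<Longrightarrow>
       (\<Sum>b<M. \<bar>p (u b)\<bar>) \<le> 2 * (\<Sum>b<M. \<bar>p (w b)\<bar>)"
    using interpolation_stable[OF l rep] by blast
  have "separates (w ` {..<M}) d" if w: "\<And>b. b < M \<Longrightarrow> dist (w b) (u b) < \<delta>" for w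
    unfolding separates_def
  proof (intro ballI impI allI)
    fix p :: "real ^ 'n \<Rightarrow> real" and v
    assume p: "p \<in> hom_poly d" and "\<forall>u\<in>w ` {..<M}. p u = 0"
    then have "(\<Sum>b<M. \<bar>p (w b)\<bar>) = 0" by simp
    with \<delta>(2)[OF w p] have "(\<Sum>b<M. \<bar>p (u b)\<bar>) \<le> 0" by simp
    then have "(\<Sum>b<M. \<bar>p (u b)\<bar>) = 0" by (intro antisym sum_nonneg) auto
    then have "p (u b) = 0" if "b < M" for b
      using that by (subst (asm) sum_nonneg_eq_0_iff) auto
    then show "p v = 0" using rep[OF p, of v] by simp
  qed
  with \<delta>(1) that show ?thesis by blast
qed

text \<open>The polynomials are known only at nodes that move with the parameter. Stability bounds
  them at the limit nodes; then the difference between moving and limit nodes tends to 0, because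
  the \<open>l c\<close> are continuous.\<close>

lemma interpolation_tendsto:
  fixes u :: "nat \<Rightarrow> real ^ 'n::finite" and l :: "nat \<Rightarrow> real ^ 'n \<Rightarrow> real"
  assumes l: "\<And>b. b < M \<Longrightarrow> l b \<in> hom_poly d"
    and rep: "\<And>p v. p \<in> hom_poly d \<Longrightarrow> p v = (\<Sum>b<M. p (u b) * l b v)"
    and p: "eventually (\<lambda>x. p x \<in> hom_poly d) F"
    and w: "\<And>b. b < M \<Longrightarrow> ((\<lambda>x. w x b) \<longlongrightarrow> u b) F"
    and r: "\<And>b. b < M \<Longrightarrow> ((\<lambda>x. p x (w x b)) \<longlongrightarrow> r b) F"
  shows "((\<lambda>x. p x v) \<longlongrightarrow> (\<Sum>b<M. r b * l b v)) F"
proof -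
  obtain \<delta> where \<delta>: "\<delta> > 0"
    "\<And>w p. (\<And>b. b < M \<Longrightarrow> dist (w b) (u b) < \<delta>) \<Longrightarrow> p \<in> hom_poly d \<Longrightarrow>
       (\<Sum>b<M. \<bar>p (u b)\<bar>) \<le> 2 * (\<Sum>b<M. \<bar>p (w b)\<bar>)"
    using interpolation_stable[OF l rep] by blast
  have "eventually (\<lambda>x. \<forall>b\<in>{..<M}. dist (w x b) (u b) < \<delta>) F"
    using w \<open>\<delta> > 0\<close> by (intro eventually_ball_finite) (auto simp: tendsto_iff)
  moreover have "eventually (\<lambda>x. \<forall>b\<in>{..<M}. \<bar>p x (w x b)\<bar> < \<bar>r b\<bar> + 1) F"
  proof (intro eventually_ball_finite ballI)
    fix b assume "b \<in> {..<M}"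
    then have "((\<lambda>x. \<bar>p x (w x b)\<bar>) \<longlongrightarrow> \<bar>r b\<bar>) F" using r by (intro tendsto_rabs) auto
    then show "eventually (\<lambda>x. \<bar>p x (w x b)\<bar> < \<bar>r b\<bar> + 1) F"
      by (rule order_tendstoD(2)) simp
  qed simp
  ultimately have bdd: "eventually (\<lambda>x. (\<forall>c<M. \<bar>p x (u c)\<bar> \<le> 2 * (\<Sum>b<M. \<bar>r b\<bar> + 1))) F"
    using p
  proof eventually_elim
    case (elim x)
    have "(\<Sum>b<M. \<bar>p x (u b)\<bar>) \<le> 2 * (\<Sum>b<M. \<bar>p x (w x b)\<bar>)"
      using elim \<delta>(2) by auto
    also have "\<dots> \<le> 2 * (\<Sum>b<M. \<bar>r b\<bar> + 1)"
      using elim by (intro mult_left_mono sum_mono) (auto simp: less_imp_le)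
    finally show ?case
      by (meson lessThan_iff member_le_sum abs_ge_zero finite_lessThan order_trans)
  qed
  have pu: "((\<lambda>x. p x (u b)) \<longlongrightarrow> r b) F" if b: "b < M" for b
  proof -
    let ?C = "2 * (\<Sum>b<M. \<bar>r b\<bar> + 1)"
    have "((\<lambda>x. p x (u b) - p x (w x b)) \<longlongrightarrow> 0) F"
    proof (rule Lim_null_comparison)
      show "eventually (\<lambda>x. norm (p x (u b) - p x (w x b)) \<le>
         (\<Sum>c<M. ?C * \<bar>l c (u b) - l c (w x b)\<bar>)) F"
        using bdd p
      proof eventually_elim
        case (elim x)
        have "p x (u b) - p x (w x b) = (\<Sum>c<M. p x (u c) * (l c (u b) - l c (w x b)))"
          using rep[OF elim(2), of "u b"] rep[OF elim(2), of "w x b"]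
          by (simp add: algebra_simps sum_subtractf)
        also have "norm \<dots> \<le> (\<Sum>c<M. ?C * \<bar>l c (u b) - l c (w x b)\<bar>)"
          using elim(1)
          by (intro order_trans[OF norm_sum] sum_mono) (auto simp: abs_mult intro!: mult_right_mono)
        finally show ?case .
      qed
      show "((\<lambda>x. \<Sum>c<M. ?C * \<bar>l c (u b) - l c (w x b)\<bar>) \<longlongrightarrow> 0) F"
      proof (rule tendsto_null_sum)
        fix c assume "c \<in> {..<M}"
        then have "((\<lambda>x. l c (w x b)) \<longlongrightarrow> l c (u b)) F"
          using l w[OF b] hom_poly_tendsto by blast
        then have "((\<lambda>x. ?C * \<bar>l c (u b) - l c (w x b)\<bar>) \<longlongrightarrow> ?C * \<bar>l c (u b) - l c (u b)\<bar>) F"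
          by (intro tendsto_intros)
        then show "((\<lambda>x. ?C * \<bar>l c (u b) - l c (w x b)\<bar>) \<longlongrightarrow> 0) F" by simp
      qed
    qed
    from tendsto_add[OF this r[OF b]] show ?thesis by simp
  qed
  then have "((\<lambda>x. \<Sum>b<M. p x (u b) * l b v) \<longlongrightarrow> (\<Sum>b<M. r b * l b v)) F"
    by (intro tendsto_sum tendsto_mult_right) auto
  then show ?thesis
    by (rule tendsto_cong[THEN iffD1, rotated]) (use p in eventually_elim, use rep in auto)
qed

text \<open>The values at the vectors \<open>e b\<close> serve as coordinates, so a statement about
  polynomials can be tested at finitely many fixed vectors.\<close>

lemma hom_poly_coordinates:
  obtains M and e :: "nat \<Rightarrow> real ^ 'n::finite" and l where "\<And>b. b < M \<Longrightarrow> l b \<in> hom_poly d"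
    "\<And>p v. p \<in> hom_poly d \<Longrightarrow> p v = (\<Sum>b<M. p (e b) * l b v)"
  using separates_interpolation[of UNIV d] separates_open[of UNIV d] by (metis UNIV_not_empty open_UNIV)

text \<open>In finitely many coordinates, pointwise convergence is locally uniform; hence the
  argument may move along with the polynomial.\<close>

lemma hom_poly_limit:
  fixes q :: "real ^ 'a::finite \<Rightarrow> real"
  assumes p: "eventually (\<lambda>x. p x \<in> hom_poly d) F" and "F \<noteq> bot"
    and lim: "\<And>v. ((\<lambda>x. p x v) \<longlongrightarrow> q v) F"
  shows "q \<in> hom_poly d"
    and "(u \<longlongrightarrow> u0) F \<Longrightarrow> ((\<lambda>x. p x (u x)) \<longlongrightarrow> q u0) F"
proof -
  obtain M e and l :: "nat \<Rightarrow> real ^ 'a \<Rightarrow> real" where l: "\<And>b. b < M \<Longrightarrow> l b \<in> hom_poly d" and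
    rep: "\<And>p v. p \<in> hom_poly d \<Longrightarrow> p v = (\<Sum>b<M. p (e b) * l b v)"
    by (rule hom_poly_coordinates[of d]) auto
  have q: "q v = (\<Sum>b<M. q (e b) * l b v)" for v
  proof -
    have "((\<lambda>x. \<Sum>b<M. p x (e b) * l b v) \<longlongrightarrow> (\<Sum>b<M. q (e b) * l b v)) F"
      by (intro tendsto_intros lim)
    then have "((\<lambda>x. p x v) \<longlongrightarrow> (\<Sum>b<M. q (e b) * l b v)) F"
      by (rule tendsto_cong[THEN iffD1, rotated]) (use p in eventually_elim, use rep in auto)
    then show ?thesis using lim[of v] tendsto_unique[OF \<open>F \<noteq> bot\<close>] by blast
  qed
  have "(\<lambda>v. \<Sum>b<M. q (e b) * l b v) \<in> hom_poly d" by (intro hom_poly_sum) (auto simp: l)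
  moreover have "(\<lambda>v. \<Sum>b<M. q (e b) * l b v) = q" by (rule ext) (rule q[symmetric])
  ultimately show "q \<in> hom_poly d" by simp
  assume u: "(u \<longlongrightarrow> u0) F"
  have "((\<lambda>x. \<Sum>b<M. p x (e b) * l b (u x)) \<longlongrightarrow> (\<Sum>b<M. q (e b) * l b u0)) F"
    by (intro tendsto_sum tendsto_mult lim hom_poly_tendsto[OF l u]) auto
  then have "((\<lambda>x. p x (u x)) \<longlongrightarrow> (\<Sum>b<M. q (e b) * l b u0)) F"
    by (rule tendsto_cong[THEN iffD1, rotated]) (use p in eventually_elim, use rep in auto)
  then show "((\<lambda>x. p x (u x)) \<longlongrightarrow> q u0) F" unfolding q[of u0, symmetric] .
qed

text \<open>Gaussian elimination: either the last equation is void and one unknown is set to 0, or a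
  pivot \<open>m\<close> is solved for and eliminated from the other equations.\<close>

lemma underdetermined_system:
  fixes a :: "nat \<Rightarrow> nat \<Rightarrow> real"
  shows "\<exists>c. (\<exists>i\<le>n. c i \<noteq> 0) \<and> (\<forall>j<n. (\<Sum>i\<le>n. c i * a i j) = 0)"
proof (induction n arbitrary: a)
  case 0
  show ?case by (intro exI[of _ "\<lambda>i. 1"]) auto
next
  case (Suc n)
  show ?case
  proof (cases "\<forall>i\<le>Suc n. a i n = 0")
    case True
    obtain c where c: "\<exists>i\<le>n. c i \<noteq> 0" "\<forall>j<n. (\<Sum>i\<le>n. c i * a i j) = 0" using Suc[of a] by blast
    let ?c = "c(Suc n := 0)"
    have restr: "(\<Sum>i\<le>n. ?c i * a i j) = (\<Sum>i\<le>n. c i * a i j)" for j by (rule sum.cong) auto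
    then have "(\<Sum>i\<le>Suc n. ?c i * a i j) = 0" if "j < Suc n" for j
    proof (cases "j = n")
      case j: True
      show ?thesis using True j by (intro sum.neutral) simp
    next
      case False
      then have "(\<Sum>i\<le>n. ?c i * a i j) = 0" using c(2) that unfolding restr by simp
      then show ?thesis by (simp only: sum.atMost_Suc) simp
    qed
    moreover obtain i where "i \<le> n" "c i \<noteq> 0" using c(1) by blast
    then have "i \<le> Suc n \<and> ?c i \<noteq> 0" by simp
    ultimately show ?thesis by blast
  next
    case False
    then obtain m where m: "m \<le> Suc n" "a m n \<noteq> 0" by blast
    \<comment> \<open>Enumerates \<open>{..Suc n}\<close> with the pivot \<open>m\<close> left out;
      \<open>t\<close> below is its inverse.\<close>
    define s where "s i = (if i < m then i else Suc i)" for i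
    have bij: "bij_betw s {..n} ({..Suc n} - {m})"
      unfolding s_def
      by (rule bij_betw_byWitness[where f' = "\<lambda>i. if i < m then i else i - 1"])
         (use m(1) in auto)
    obtain c where c: "\<exists>i\<le>n. c i \<noteq> 0"
      "\<forall>j<n. (\<Sum>i\<le>n. c i * (a (s i) j - a (s i) n / a m n * a m j)) = 0"
      using Suc[of "\<lambda>i j. a (s i) j - a (s i) n / a m n * a m j"] by blast
    define t where "t = the_inv_into {..n} s"
    have t: "t (s i) = i" if "i \<le> n" for i
      unfolding t_def using that bij by (simp add: bij_betw_def the_inv_into_f_f)
    define C where "C i = (if i = m then - (\<Sum>i\<le>n. c i * (a (s i) n / a m n)) else c (t i))" for i
    have sm: "s i \<noteq> m" if "i \<le> n" for i using that by (auto simp: s_def)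
    have split: "(\<Sum>i\<le>Suc n. C i * a i j) = (\<Sum>i\<le>n. c i * a (s i) j) + C m * a m j" for j
    proof -
      have "(\<Sum>i\<le>Suc n. C i * a i j) = (\<Sum>i\<in>{..Suc n} - {m}. C i * a i j) + C m * a m j"
        using m(1) by (subst sum.remove[of _ m]) auto
      also have "(\<Sum>i\<in>{..Suc n} - {m}. C i * a i j) = (\<Sum>i\<le>n. C (s i) * a (s i) j)"
        by (rule sum.reindex_bij_betw[OF bij, symmetric])
      also have "\<dots> = (\<Sum>i\<le>n. c i * a (s i) j)"
        by (rule sum.cong) (auto simp: C_def sm t)
      finally show ?thesis .
    qed
    have "(\<Sum>i\<le>Suc n. C i * a i j) = 0" if "j < Suc n" for j
    proof (cases "j = n")
      case True
      then show ?thesis unfolding split True using m(2)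
        by (simp add: C_def sum_distrib_right)
    next
      case False
      then have "(\<Sum>i\<le>n. c i * (a (s i) j - a (s i) n / a m n * a m j)) = 0" using c(2) that by auto
      then show ?thesis unfolding split
        by (simp add: C_def algebra_simps sum_subtractf sum_distrib_right sum_distrib_left)
    qed
    moreover have "\<exists>i\<le>Suc n. C i \<noteq> 0"
    proof -
      obtain i where "i \<le> n" "c i \<noteq> 0" using c(1) by blast
      then have "C (s i) \<noteq> 0" "s i \<le> Suc n" by (auto simp: C_def sm t) (auto simp: s_def)
      then show ?thesis by blast
    qed
    ultimately show ?thesis by blast
  qed
qed

section \<open>Powers of a nondegenerate quadratic form\<close>

definition qform :: "real ^ 'n ^ 'n \<Rightarrow> real ^ 'n::finite \<Rightarrow> real" where
  "qform G v = v \<bullet> (G *v v)"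

text \<open>Up to a factor, the only homogeneous polynomial of degree \<open>d\<close> that is a function of the
  energy.\<close>

definition energy_power :: "nat \<Rightarrow> real \<Rightarrow> real" where
  "energy_power d E = (if even d then E ^ (d div 2) else 0)"

lemma inner_matrix_symmetric:
  assumes "transpose G = G"
  shows "v \<bullet> (G *v w) = w \<bullet> (G *v (v :: real ^ 'n::finite))"
  using assms by (metis dot_lmul_matrix inner_commute vector_transpose_matrix)

lemma qform_hom_poly: "qform G \<in> hom_poly 2"
proof -
  have "(\<lambda>v. v $ i * (G *v v) $ i) \<in> hom_poly (1 + 1)" for i
    by (intro hom_poly_mult hom_poly_linear)
       (auto intro!: linearI simp: matrix_vector_right_distrib matrix_vector_mult_scaleR)
  then have "(\<lambda>v. \<Sum>i\<in>UNIV. 1 * (v $ i * (G *v v) $ i)) \<in> hom_poly 2"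
    by (intro hom_poly_sum) (auto simp: numeral_2_eq_2)
  moreover have "(\<lambda>v. \<Sum>i\<in>UNIV. 1 * (v $ i * (G *v v) $ i)) = qform G"
    by (simp add: fun_eq_iff qform_def inner_vec_def)
  ultimately show ?thesis by simp
qed

lemma energy_power_hom_poly: "(\<lambda>v. energy_power d (qform G v)) \<in> hom_poly d"
proof (cases "even d")
  case True
  then show ?thesis using hom_poly_power[OF qform_hom_poly, of G "d div 2"]
    by (simp add: energy_power_def)
qed (simp add: energy_power_def hom_poly_zero)

lemma qform_add:
  assumes "transpose G = G"
  shows "qform G (v + w) = qform G v + 2 * (v \<bullet> (G *v w)) + qform G w"
  using inner_matrix_symmetric[OF assms, of v w]
  by (simp add: qform_def matrix_vector_right_distrib inner_add_left inner_add_right)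

lemma qform_scaleR: "qform G (t *\<^sub>R v) = t\<^sup>2 * qform G v"
  using hom_poly_scaleR[OF qform_hom_poly] .

lemma matrix_nondegenerate:
  assumes "invertible (G :: real ^ 'n::finite ^ 'n)" "G *v w = 0"
  shows "w = 0"
  using assms by (metis invertible_def matrix_left_invertible_ker)

text \<open>If the form vanished on \<open>U\<close>, it would vanish identically, and polarization
  would put every axis vector into the kernel of \<open>G\<close>.\<close>

lemma qform_nonzero_on_open:
  assumes G: "transpose G = G" "invertible (G :: real ^ 'n::finite ^ 'n)"
    and U: "open U" "U \<noteq> {}"
  obtains v where "v \<in> U" "qform G v \<noteq> 0"
proof (rule ccontr)
  assume "\<not> thesis"
  then have "\<And>v. v \<in> U \<Longrightarrow> qform G v = 0" using that by blast
  then have q: "qform G v = 0" for v using hom_poly_zero_on_open[OF qform_hom_poly U] by blast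
  fix i :: 'n
  have "v \<bullet> (G *v axis i 1) = 0" for v using qform_add[OF G(1), of v "axis i 1"] q by simp
  then have "G *v axis i 1 = 0" by (metis inner_eq_zero_iff)
  then have "axis i 1 = (0 :: real ^ 'n)" using matrix_nondegenerate[OF G(2)] by blast
  then have "axis i 1 $ i = (0 :: real)" by (metis zero_index)
  then show False by (simp add: axis_def)
qed

text \<open>Euler's identity: differentiate p(t v) at t = 1, by the chain rule and by
  homogeneity.\<close>

lemma euler_hom_poly:
  assumes "p \<in> hom_poly d"
  shows "frechet_derivative p (at v) v = real d * p v"
proof -
  have "((\<lambda>t. p (t *\<^sub>R v)) has_derivative (\<lambda>h. frechet_derivative p (at (1 *\<^sub>R v)) (h *\<^sub>R v))) (at (1::real))"
    by (rule has_derivative_compose[of "\<lambda>t. t *\<^sub>R v" "\<lambda>h. h *\<^sub>R v"])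
       (auto intro!: derivative_eq_intros hom_poly_has_derivative[OF assms])
  moreover have "(\<lambda>h. frechet_derivative p (at (1 *\<^sub>R v)) (h *\<^sub>R v)) =
      (\<lambda>h. frechet_derivative p (at v) v * h)"
    using linear_frechet_derivative[OF hom_poly_differentiable[OF assms], of v]
    by (simp add: linear_scale fun_eq_iff mult.commute)
  ultimately have "((\<lambda>t. p (t *\<^sub>R v)) has_real_derivative frechet_derivative p (at v) v) (at 1)"
    by (simp add: has_field_derivative_def)
  then have "((\<lambda>t. t ^ d * p v) has_real_derivative frechet_derivative p (at v) v) (at 1)"
    by (simp add: hom_poly_scaleR[OF assms])
  moreover have "((\<lambda>t. t ^ d * p v) has_real_derivative real d * p v) (at 1)"
    by (auto intro!: derivative_eq_intros)
  ultimately show ?thesis by (rule DERIV_unique)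
qed

text \<open>Where the form does not vanish, the hypothesis says that \<open>p\<close> is critical along the level
  sets of the form; hence suitable powers of \<open>p\<close> and of the form are proportional.\<close>

lemma power_proportional_qform:
  fixes p :: "real ^ 'n::finite \<Rightarrow> real"
  assumes G: "transpose G = G" "invertible G"
    and p: "p \<in> hom_poly d" and U: "open U" "U \<noteq> {}"
    and crit: "\<And>v e. v \<in> U \<Longrightarrow> qform G v \<noteq> 0 \<Longrightarrow> v \<bullet> (G *v e) = 0 \<Longrightarrow>
      frechet_derivative p (at v) e = 0"
    and ab: "a * d = 2 * b" "a > 0"
  shows "\<exists>c. \<forall>v. p v ^ a = c * qform G v ^ b"
proof -
  obtain v0 where v0: "v0 \<in> U" "qform G v0 \<noteq> 0" using qform_nonzero_on_open[OF G U] .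
  have "open (U \<inter> qform G -` (- {0}))"
    using U(1) hom_poly_continuous_on[OF qform_hom_poly, of U]
    by (intro continuous_open_preimage) auto
  then obtain r where r: "r > 0" "ball v0 r \<subseteq> U \<inter> qform G -` (- {0})"
    using v0 open_contains_ball by (metis ComplI IntI singletonD vimageI)
  \<comment> \<open>Split \<open>e\<close> into a multiple of \<open>v\<close> and a part orthogonal
    to \<open>v\<close>: the hypothesis kills the second part, Euler's identity evaluates the
    first.\<close>
  have dp: "qform G v * frechet_derivative p (at v) e = d * p v * (v \<bullet> (G *v e))"
    if v: "v \<in> ball v0 r" for v e
  proof -
    have q: "qform G v \<noteq> 0" "v \<in> U" using v r(2) by auto
    define s where "s = (v \<bullet> (G *v e)) / qform G v"
    have "v \<bullet> (G *v (e - s *\<^sub>R v)) = v \<bullet> (G *v e) - s * qform G v"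
      by (simp add: matrix_vector_mult_diff_distrib matrix_vector_mult_scaleR inner_diff_right qform_def)
    then have "v \<bullet> (G *v (e - s *\<^sub>R v)) = 0" using q by (simp add: s_def)
    from crit[OF q(2,1) this] have "frechet_derivative p (at v) e = s * (d * p v)"
      using linear_frechet_derivative[OF hom_poly_differentiable[OF p], of v]
      by (simp add: linear_diff linear_scale euler_hom_poly[OF p])
    then show ?thesis using q by (simp add: s_def)
  qed
  \<comment> \<open>The quotient has degree 0 because \<open>a * d = 2 * b\<close>; inserting
    \<open>dp\<close> makes the two terms of the quotient rule cancel.\<close>
  have D: "((\<lambda>v. p v ^ a / qform G v ^ b) has_derivative (\<lambda>e. 0)) (at v within ball v0 r)"
    if v: "v \<in> ball v0 r" for v
  proof -
    have q: "qform G v \<noteq> 0" using v r(2) by auto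
    have dq: "(qform G has_derivative (\<lambda>e. 2 * (v \<bullet> (G *v e)))) (at v within ball v0 r)"
    proof -
      have "((\<lambda>v. v \<bullet> (G *v v)) has_derivative (\<lambda>e. v \<bullet> (G *v e) + e \<bullet> (G *v v))) (at v within ball v0 r)"
        by (intro has_derivative_inner has_derivative_ident bounded_linear.has_derivative[OF matrix_vector_mul_bounded_linear])
      then show ?thesis
        using inner_matrix_symmetric[OF G(1), of _ v] by (simp add: qform_def[abs_def])
    qed
    have dP: "(p has_derivative frechet_derivative p (at v)) (at v within ball v0 r)"
      using hom_poly_has_derivative[OF p] has_derivative_at_withinI by blast
    have "((\<lambda>v. p v ^ a / qform G v ^ b) has_derivative
      (\<lambda>e. ((of_nat a * frechet_derivative p (at v) e * p v ^ (a - 1)) * qform G v ^ b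
         - p v ^ a * (of_nat b * (2 * (v \<bullet> (G *v e))) * qform G v ^ (b - 1)))
         / (qform G v ^ b * qform G v ^ b))) (at v within ball v0 r)"
      using q by (intro has_derivative_divide' has_derivative_power dP dq) auto
    moreover have "(of_nat a * frechet_derivative p (at v) e * p v ^ (a - 1)) * qform G v ^ b
         - p v ^ a * (of_nat b * (2 * (v \<bullet> (G *v e))) * qform G v ^ (b - 1)) = 0" for e
    proof -
      have pa: "p v ^ a = p v * p v ^ (a - 1)" using ab(2) by (metis power_eq_if not_gr_zero)
      show ?thesis
      \<comment> \<open>For \<open>b = 0\<close> the exponent \<open>b - 1\<close> is truncated, so
        the factorization used below fails; then \<open>d = 0\<close> and \<open>dp\<close> alone
        gives the claim.\<close>
      proof (cases "b = 0")
        case True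
        then have "d = 0" using ab by simp
        with dp[OF v, of e] q have "frechet_derivative p (at v) e = 0" by simp
        with True show ?thesis by simp
      next
        case False
        then have qb: "qform G v ^ b = qform G v * qform G v ^ (b - 1)" by (metis power_eq_if)
        have "(of_nat a * frechet_derivative p (at v) e * p v ^ (a - 1)) * qform G v ^ b =
          of_nat a * (qform G v * frechet_derivative p (at v) e) * (p v ^ (a - 1) * qform G v ^ (b - 1))"
          unfolding qb by (simp add: algebra_simps)
        also have "\<dots> = real (a * d) * (v \<bullet> (G *v e)) * (p v * p v ^ (a - 1)) * qform G v ^ (b - 1)"
          unfolding dp[OF v] by (simp add: algebra_simps)
        also have "\<dots> = p v ^ a * (of_nat b * (2 * (v \<bullet> (G *v e))) * qform G v ^ (b - 1))"
          unfolding ab(1) pa[symmetric] by (simp add: algebra_simps)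
        finally show ?thesis by simp
      qed
    qed
    ultimately show ?thesis by simp
  qed
  have "\<exists>c. \<forall>v\<in>ball v0 r. p v ^ a / qform G v ^ b = c"
    by (rule has_derivative_zero_constant[OF convex_ball D])
  then obtain c where c: "\<And>v. v \<in> ball v0 r \<Longrightarrow> p v ^ a / qform G v ^ b = c" by auto
  have h1: "(\<lambda>v. p v ^ a - c * qform G v ^ b) \<in> hom_poly (2 * b)"
    using hom_poly_diff[of _ "2 * b"] hom_poly_power[OF p, of a] hom_poly_cmult[OF hom_poly_power[OF qform_hom_poly, of G b], of c] ab(1)
    by (simp add: mult.commute)
  have h2: "p v ^ a - c * qform G v ^ b = 0" if "v \<in> ball v0 r" for v
  proof -
    have "qform G v \<noteq> 0" using that r(2) by blast
    then show ?thesis using c[OF that] by (simp add: divide_simps split: if_splits)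
  qed
  have "p v ^ a - c * qform G v ^ b = 0" for v
    by (rule hom_poly_zero_on_open[OF h1 open_ball _ h2]) (use r(1) in auto)
  then show ?thesis by (intro exI[of _ c]) auto
qed

text \<open>In dimension at least 2 there is a nonzero \<open>e\<close> orthogonal to
  \<open>v0\<close>. If the form vanished on the orthogonal complement of \<open>v0\<close>,
  polarization would make \<open>e\<close> orthogonal to that complement as well as to
  \<open>v0\<close>, hence to everything, against nondegeneracy.\<close>

lemma qform_orthogonal_vector:
  fixes v0 :: "real ^ 'n::finite"
  assumes G: "transpose G = G" "invertible G" and n: "CARD('n) \<ge> 2" and v0: "qform G v0 \<noteq> 0"
  shows "\<exists>e. v0 \<bullet> (G *v e) = 0 \<and> qform G e \<noteq> 0"
proof (rule ccontr)
  assume "\<nexists>e. v0 \<bullet> (G *v e) = 0 \<and> qform G e \<noteq> 0"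
  then have q: "qform G e = 0" if "v0 \<bullet> (G *v e) = 0" for e using that by blast
  obtain e where e: "e \<noteq> 0" "orthogonal (G *v v0) e"
    using orthogonal_to_vector_exists[of "G *v v0"] n by auto
  then have e0: "v0 \<bullet> (G *v e) = 0"
    using inner_matrix_symmetric[OF G(1), of v0 e] by (simp add: orthogonal_def inner_commute)
  have "w \<bullet> (G *v e) = 0" for w
  proof -
    define s where "s = (v0 \<bullet> (G *v w)) / qform G v0"
    define f where "f = w - s *\<^sub>R v0"
    have "v0 \<bullet> (G *v f) = v0 \<bullet> (G *v w) - s * qform G v0"
      by (simp add: f_def matrix_vector_mult_diff_distrib matrix_vector_mult_scaleR inner_diff_right qform_def)
    then have f0: "v0 \<bullet> (G *v f) = 0" using v0 by (simp add: s_def)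
    have "v0 \<bullet> (G *v (f + e)) = 0" using f0 e0 by (simp add: matrix_vector_right_distrib inner_add_right)
    from q[OF this] q[OF f0] q[OF e0] have "f \<bullet> (G *v e) = 0" using qform_add[OF G(1), of f e] by simp
    then show ?thesis using e0 by (simp add: f_def inner_diff_left)
  qed
  then have "G *v e = 0" by (metis inner_eq_zero_iff)
  then show False using matrix_nondegenerate[OF G(2)] e(1) by blast
qed

text \<open>For even \<open>d\<close> the proportionality is used with \<open>a = 1\<close>. For odd
  \<open>d\<close> it gives p^2 = c q^d, and c must vanish: otherwise some half circle from v0 to
  -v0 avoids the null cone, while the odd function p has a zero on it.\<close>

lemma hom_poly_eq_energy_power:
  fixes p :: "real ^ 'n::finite \<Rightarrow> real"
  assumes G: "transpose G = G" "invertible G" and n: "CARD('n) \<ge> 2"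
    and p: "p \<in> hom_poly d" and U: "open U" "U \<noteq> {}"
    and crit: "\<And>v e. v \<in> U \<Longrightarrow> qform G v \<noteq> 0 \<Longrightarrow> v \<bullet> (G *v e) = 0 \<Longrightarrow>
      frechet_derivative p (at v) e = 0"
  shows "\<exists>c. \<forall>v. p v = c * energy_power d (qform G v)"
proof (cases "even d")
  case True
  have "\<exists>c. \<forall>v. p v ^ 1 = c * qform G v ^ (d div 2)"
    by (rule power_proportional_qform[OF G p U crit]) (use True in auto)
  with True show ?thesis by (simp add: energy_power_def)
next
  case False
  have "\<exists>c. \<forall>v. p v ^ 2 = c * qform G v ^ d"
    by (rule power_proportional_qform[OF G p U crit]) auto
  then obtain c where c: "\<And>v. p v ^ 2 = c * qform G v ^ d" by auto
  have "c = 0"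
  proof (rule ccontr)
    assume "c \<noteq> 0"
    obtain v0 where v0: "qform G v0 \<noteq> 0" by (rule qform_nonzero_on_open[OF G U])
    obtain e where e: "v0 \<bullet> (G *v e) = 0" "qform G e \<noteq> 0"
      using qform_orthogonal_vector[OF G n v0] by blast
    have pos: "c * qform G v ^ d > 0" if "qform G v \<noteq> 0" for v
      using c[of v] \<open>c \<noteq> 0\<close> that by (metis less_eq_real_def mult_eq_0_iff power_eq_0_iff zero_le_power2)
    \<comment> \<open>Since c q^d is a nonzero square at both vectors and \<open>d\<close> is odd, q
      has the same sign at both.\<close>
    have same: "qform G v0 * qform G e > 0"
    proof -
      have "c * qform G v0 ^ d * (c * qform G e ^ d) > 0" using pos[OF v0] pos[OF e(2)] by (rule mult_pos_pos)
      then have "c\<^sup>2 * (qform G v0 * qform G e) ^ d > 0" by (simp add: power2_eq_square power_mult_distrib algebra_simps)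
      then have "(qform G v0 * qform G e) ^ d > 0" by (simp add: zero_less_mult_iff)
      then show ?thesis using False by (auto simp: zero_less_power_eq)
    qed
    \<comment> \<open>As \<open>v0\<close> and \<open>e\<close> are orthogonal and of equal sign,
      the form is nonzero on the whole circle they span; \<open>w\<close> runs from
      \<open>v0\<close> to \<open>- v0\<close>.\<close>
    define w where "w \<theta> = cos \<theta> *\<^sub>R v0 + sin \<theta> *\<^sub>R e" for \<theta> :: real
    have qw: "qform G (w \<theta>) = (cos \<theta>)\<^sup>2 * qform G v0 + (sin \<theta>)\<^sup>2 * qform G e" for \<theta>
      unfolding w_def qform_add[OF G(1)] qform_scaleR
      using e(1) by (simp add: matrix_vector_mult_scaleR)
    have nz: "qform G (w \<theta>) \<noteq> 0" for \<theta>
    proof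
      assume "qform G (w \<theta>) = 0"
      then have "(cos \<theta>)\<^sup>2 * (qform G v0 * qform G v0) + (sin \<theta>)\<^sup>2 * (qform G v0 * qform G e) = 0"
        unfolding qw by algebra
      moreover have "0 \<le> (cos \<theta>)\<^sup>2 * (qform G v0 * qform G v0)" "0 \<le> (sin \<theta>)\<^sup>2 * (qform G v0 * qform G e)"
        using same by auto
      ultimately have "(cos \<theta>)\<^sup>2 * (qform G v0 * qform G v0) = 0" "(sin \<theta>)\<^sup>2 * (qform G v0 * qform G e) = 0"
        by linarith+
      then have "(cos \<theta>)\<^sup>2 = 0" "(sin \<theta>)\<^sup>2 = 0" using same v0 by auto
      then show False using sin_cos_squared_add[of \<theta>] by simp
    qed
    have "continuous_on {0..pi} (\<lambda>\<theta>. p (w \<theta>))"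
      unfolding w_def
      by (intro continuous_on_compose2[OF hom_poly_continuous_on[OF p, of UNIV]] continuous_intros) auto
    moreover have "p (w pi) = - p (w 0)"
      using hom_poly_scaleR[OF p, of "-1" v0] False by (simp add: w_def)
    ultimately have "\<exists>\<theta>. p (w \<theta>) = 0"
      using IVT'[of "\<lambda>\<theta>. p (w \<theta>)" 0 0 pi] IVT2'[of "\<lambda>\<theta>. p (w \<theta>)" pi 0 0] pi_ge_zero
      by (cases "p (w 0) \<le> 0") auto
    then obtain \<theta> where "p (w \<theta>) = 0" by blast
    then show False using c[of "w \<theta>"] nz[of \<theta>] \<open>c \<noteq> 0\<close> by simp
  qed
  then have "p v = 0" for v using c[of v] by simp
  then show ?thesis by auto
qed

section \<open>The two-point boundary value problem for second-order equations\<close>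

text \<open>Quantitative hypotheses on the equation x'' = N(x, x'), in the form natural for a right
  side quadratic in the velocity: quadratic growth, and a Lipschitz estimate of the same
  homogeneity.\<close>

definition spray_bound ::
  "'a::euclidean_space \<Rightarrow> real \<Rightarrow> real \<Rightarrow> ('a \<Rightarrow> 'a \<Rightarrow> 'a) \<Rightarrow> bool" where
  "spray_bound p R L N \<longleftrightarrow>
     (\<forall>x\<in>cball p R. \<forall>v. norm (N x v) \<le> L * (norm v)\<^sup>2) \<and>
     (\<forall>x\<in>cball p R. \<forall>x'\<in>cball p R. \<forall>v v'.
        norm (N x v - N x' v') \<le> L * (norm (x - x') * (norm v)\<^sup>2 + norm (v - v') * (norm v + norm v')))"

text \<open>The curve with acceleration \<open>\<alpha>\<close> through \<open>x\<close> at time \<open>0\<close> and \<open>y\<close> at time \<open>1\<close>. The time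
  interval is \<open>[-1, 2]\<close>, so that both end points are interior.\<close>

definition int1 :: "(real \<Rightarrow> 'a::euclidean_space) \<Rightarrow> real \<Rightarrow> 'a" where
  "int1 \<alpha> t = integral {-1..t} \<alpha>"

definition int2 :: "(real \<Rightarrow> 'a::euclidean_space) \<Rightarrow> real \<Rightarrow> 'a" where
  "int2 \<alpha> = int1 (int1 \<alpha>)"

text \<open>Subtracting the affine interpolation of \<open>int2 \<alpha>\<close> at 0 and 1 imposes
  the end points and removes the constants that come from integrating from -1.\<close>

definition curve_acc :: "(real \<Rightarrow> 'a::euclidean_space) \<Rightarrow> 'a \<Rightarrow> 'a \<Rightarrow> real \<Rightarrow> 'a" where
  "curve_acc \<alpha> x y t = x + t *\<^sub>R (y - x) + int2 \<alpha> t - (1 - t) *\<^sub>R int2 \<alpha> 0 - t *\<^sub>R int2 \<alpha> 1"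

definition velocity_acc :: "(real \<Rightarrow> 'a::euclidean_space) \<Rightarrow> 'a \<Rightarrow> 'a \<Rightarrow> real \<Rightarrow> 'a" where
  "velocity_acc \<alpha> x y t = (y - x) + int1 \<alpha> t + int2 \<alpha> 0 - int2 \<alpha> 1"

text \<open>The boundary value problem as a fixed point equation for the acceleration: the end
  conditions are built into \<open>curve_acc\<close>, and a sup norm ball of continuous functions is
  the right domain.\<close>

definition bvp_solution ::
  "('a::euclidean_space \<Rightarrow> 'a \<Rightarrow> 'a) \<Rightarrow> real \<Rightarrow> 'a \<Rightarrow> 'a \<Rightarrow> (real \<Rightarrow> 'a) \<Rightarrow> bool" where
  "bvp_solution N \<rho> x y \<alpha> \<longleftrightarrow> continuous_on {-1..2} \<alpha> \<and>
     (\<forall>t\<in>{-1..2}. norm (\<alpha> t) \<le> \<rho> \<and> \<alpha> t = N (curve_acc \<alpha> x y t) (velocity_acc \<alpha> x y t))"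

section \<open>A priori estimates for curves given by their acceleration\<close>

lemma norm_add_bound: "norm a \<le> A \<Longrightarrow> norm b \<le> B \<Longrightarrow> norm (a + b) \<le> A + B"
  by (rule norm_triangle_le) (rule add_mono)

lemma norm_diff_bound: "norm a \<le> A \<Longrightarrow> norm b \<le> B \<Longrightarrow> norm (a - b) \<le> A + B"
  by (rule norm_triangle_le_diff) (rule add_mono)

lemma bvp_solutionD:
  assumes "bvp_solution N \<rho> x y \<alpha>"
  shows "continuous_on {-1..2} \<alpha>" "\<And>t. t \<in> {-1..2} \<Longrightarrow> norm (\<alpha> t) \<le> \<rho>"
    "\<And>t. t \<in> {-1..2} \<Longrightarrow> N (curve_acc \<alpha> x y t) (velocity_acc \<alpha> x y t) = \<alpha> t"
  using assms unfolding bvp_solution_def by (blast, blast, metis)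

lemma int1_bound:
  assumes "continuous_on {-1..2} \<alpha>" "\<And>t. t \<in> {-1..2} \<Longrightarrow> norm (\<alpha> t) \<le> a" "t \<in> {-1..2}"
  shows "norm (int1 \<alpha> t) \<le> 3 * a"
proof -
  have "0 \<le> a" by (rule order_trans[OF norm_ge_zero assms(2)[of 0]]) simp
  have "norm (int1 \<alpha> t) \<le> a * (t - (-1))"
    unfolding int1_def using assms by (intro integral_bound) (auto intro: continuous_on_subset)
  also have "\<dots> \<le> a * 3" using \<open>0 \<le> a\<close> assms(3) by (intro mult_left_mono) auto
  finally show ?thesis by simp
qed

lemma int1_diff:
  assumes "continuous_on {-1..2} \<alpha>" "continuous_on {-1..2} \<beta>" "t \<in> {-1..2}"
  shows "int1 (\<lambda>t. \<alpha> t - \<beta> t) t = int1 \<alpha> t - int1 \<beta> t"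
  unfolding int1_def using assms
  by (intro integral_diff integrable_continuous_real) (auto intro: continuous_on_subset)

lemma int1_deriv:
  assumes "continuous_on {-1..2} \<alpha>" "t \<in> {-1..2}"
  shows "(int1 \<alpha> has_vector_derivative \<alpha> t) (at t within {-1..2})"
  unfolding int1_def[abs_def] using integral_has_vector_derivative[OF assms] .

lemma int1_continuous:
  assumes "continuous_on {-1..2} \<alpha>"
  shows "continuous_on {-1..2} (int1 \<alpha>)"
  using int1_deriv[OF assms] by (rule continuous_on_vector_derivative)

lemma int2_bound:
  assumes "continuous_on {-1..2} \<alpha>" "\<And>t. t \<in> {-1..2} \<Longrightarrow> norm (\<alpha> t) \<le> a" "t \<in> {-1..2}"
  shows "norm (int2 \<alpha> t) \<le> 9 * a"
  using int1_bound[OF int1_continuous[OF assms(1)] int1_bound[OF assms(1,2)] assms(3)]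
  by (simp add: int2_def)

lemma int2_diff:
  assumes "continuous_on {-1..2} \<alpha>" "continuous_on {-1..2} \<beta>" "t \<in> {-1..2}"
  shows "int2 (\<lambda>t. \<alpha> t - \<beta> t) t = int2 \<alpha> t - int2 \<beta> t"
proof -
  have "int2 (\<lambda>t. \<alpha> t - \<beta> t) t = int1 (\<lambda>t. int1 \<alpha> t - int1 \<beta> t) t"
    unfolding int2_def using assms int1_diff[OF assms(1,2)]
    by (subst (1 2) int1_def, intro integral_cong) auto
  also have "\<dots> = int2 \<alpha> t - int2 \<beta> t"
    unfolding int2_def using assms by (intro int1_diff int1_continuous)
  finally show ?thesis .
qed

lemma curve_acc_deriv:
  assumes "continuous_on {-1..2} \<alpha>" "t \<in> {-1..2}"
  shows "(curve_acc \<alpha> x y has_vector_derivative velocity_acc \<alpha> x y t) (at t within {-1..2})"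
    "(velocity_acc \<alpha> x y has_vector_derivative \<alpha> t) (at t within {-1..2})"
proof -
  have d2: "(int2 \<alpha> has_vector_derivative int1 \<alpha> t) (at t within {-1..2})"
    unfolding int2_def using int1_deriv[OF int1_continuous[OF assms(1)] assms(2)] .
  show "(curve_acc \<alpha> x y has_vector_derivative velocity_acc \<alpha> x y t) (at t within {-1..2})"
    unfolding curve_acc_def[abs_def] velocity_acc_def
    by (auto intro!: derivative_eq_intros d2)
  show "(velocity_acc \<alpha> x y has_vector_derivative \<alpha> t) (at t within {-1..2})"
    unfolding velocity_acc_def[abs_def]
    by (auto intro!: derivative_eq_intros int1_deriv assms)
qed

lemma curve_acc_ends [simp]: "curve_acc \<alpha> x y 0 = x" "curve_acc \<alpha> x y 1 = y"
  by (auto simp: curve_acc_def)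

text \<open>The chords are subtracted, so the estimates depend on the accelerations alone and the
  end points may differ. Two integrations over an interval of length 3 give factors 3 and 9; the
  sums 21 and 45 are rounded up.\<close>

lemma curve_acc_close:
  assumes "continuous_on {-1..2} \<alpha>" "continuous_on {-1..2} \<beta>"
    and a: "\<And>t. t \<in> {-1..2} \<Longrightarrow> norm (\<alpha> t - \<beta> t) \<le> a" and t: "t \<in> {-1..2}"
  shows "norm ((velocity_acc \<alpha> x y t - (y - x)) - (velocity_acc \<beta> x' y' t - (y' - x'))) \<le> 30 * a"
    and "norm ((curve_acc \<alpha> x y t - (x + t *\<^sub>R (y - x))) - (curve_acc \<beta> x' y' t - (x' + t *\<^sub>R (y' - x')))) \<le> 60 * a"
proof -
  let ?d = "\<lambda>t. \<alpha> t - \<beta> t"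
  have d: "continuous_on {-1..2} ?d" using assms by (intro continuous_intros)
  have "0 \<le> a" by (rule order_trans[OF norm_ge_zero a[of 0]]) simp
  have b1: "norm (int1 \<alpha> t - int1 \<beta> t) \<le> 3 * a" if "t \<in> {-1..2}" for t
    using int1_bound[OF d a that] int1_diff[OF assms(1,2) that] by simp
  have b2: "norm (int2 \<alpha> t - int2 \<beta> t) \<le> 9 * a" if "t \<in> {-1..2}" for t
    using int2_bound[OF d a that] int2_diff[OF assms(1,2) that] by simp
  have "(velocity_acc \<alpha> x y t - (y - x)) - (velocity_acc \<beta> x' y' t - (y' - x')) =
    (int1 \<alpha> t - int1 \<beta> t) + (int2 \<alpha> 0 - int2 \<beta> 0) - (int2 \<alpha> 1 - int2 \<beta> 1)"
    by (simp add: velocity_acc_def algebra_simps)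
  also have "norm \<dots> \<le> 3 * a + 9 * a + 9 * a"
    by (intro norm_diff_bound[OF norm_add_bound] b1[OF t] b2) auto
  finally show "norm ((velocity_acc \<alpha> x y t - (y - x)) - (velocity_acc \<beta> x' y' t - (y' - x'))) \<le> 30 * a"
    using \<open>0 \<le> a\<close> by simp
  have sc: "norm (s *\<^sub>R z) \<le> 2 * (9 * a)" if "\<bar>s\<bar> \<le> 2" "norm z \<le> 9 * a" for s and z :: 'a
    unfolding norm_scaleR using that by (intro mult_mono) auto
  have "(curve_acc \<alpha> x y t - (x + t *\<^sub>R (y - x))) - (curve_acc \<beta> x' y' t - (x' + t *\<^sub>R (y' - x'))) =
    (int2 \<alpha> t - int2 \<beta> t) - (1 - t) *\<^sub>R (int2 \<alpha> 0 - int2 \<beta> 0) - t *\<^sub>R (int2 \<alpha> 1 - int2 \<beta> 1)"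
    by (simp add: curve_acc_def algebra_simps)
  also have "norm \<dots> \<le> 9 * a + 2 * (9 * a) + 2 * (9 * a)"
    by (intro norm_diff_bound sc b2) (use t in auto)
  finally show "norm ((curve_acc \<alpha> x y t - (x + t *\<^sub>R (y - x))) - (curve_acc \<beta> x' y' t - (x' + t *\<^sub>R (y' - x')))) \<le> 60 * a"
    using \<open>0 \<le> a\<close> by simp
qed

lemma curve_acc_zero [simp]:
  "curve_acc (\<lambda>t. 0) x y t = x + t *\<^sub>R (y - x)" "velocity_acc (\<lambda>t. 0) x y t = y - x"
  by (simp_all add: curve_acc_def velocity_acc_def int1_def int2_def[abs_def] int1_def[abs_def])

lemma spray_bound_continuous_on:
  assumes N: "spray_bound p R L N"
    and c: "continuous_on S c" "c ` S \<subseteq> cball p R" and v: "continuous_on S v"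
  shows "continuous_on S (\<lambda>t. N (c t) (v t))"
  unfolding continuous_on_def
proof
  fix t assume t: "t \<in> S"
  have ct: "(c \<longlongrightarrow> c t) (at t within S)" and vt: "(v \<longlongrightarrow> v t) (at t within S)"
    using c(1) v t by (auto simp: continuous_on_def)
  have "((\<lambda>s. N (c t) (v t) - N (c s) (v s)) \<longlongrightarrow> 0) (at t within S)"
  proof (rule Lim_null_comparison)
    show "\<forall>\<^sub>F s in at t within S. norm (N (c t) (v t) - N (c s) (v s)) \<le>
      L * (norm (c t - c s) * (norm (v t))\<^sup>2 + norm (v t - v s) * (norm (v t) + norm (v s)))"
      using N c(2) t by (auto simp: spray_bound_def eventually_at_filter image_subset_iff)
    have "((\<lambda>s. L * (norm (c t - c s) * (norm (v t))\<^sup>2 + norm (v t - v s) * (norm (v t) + norm (v s)))) \<longlongrightarrow>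
      L * (norm (c t - c t) * (norm (v t))\<^sup>2 + norm (v t - v t) * (norm (v t) + norm (v t)))) (at t within S)"
      by (intro tendsto_intros ct vt)
    then show "((\<lambda>s. L * (norm (c t - c s) * (norm (v t))\<^sup>2 + norm (v t - v s) * (norm (v t) + norm (v s)))) \<longlongrightarrow> 0) (at t within S)"
      by simp
  qed
  from tendsto_diff[OF tendsto_const[of "N (c t) (v t)"] this]
  show "((\<lambda>s. N (c s) (v s)) \<longlongrightarrow> N (c t) (v t)) (at t within S)" by simp
qed

text \<open>The numerical constants are generous; only their existence matters.\<close>

locale bvp =
  fixes p :: "'a::euclidean_space" and R L \<rho> :: real
  assumes pos: "0 < \<rho>" and L1: "1 \<le> L" and \<rho>L: "\<rho> * L \<le> 1 / 10 ^ 6" and \<rho>R: "100 * \<rho> \<le> R"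
begin

section \<open>Contraction, existence, uniqueness and dependence on parameters\<close>

lemma \<rho>_small: "\<rho> \<le> 1 / 10 ^ 6"
proof -
  have "\<rho> * 1 \<le> \<rho> * L" using pos L1 by (intro mult_left_mono) auto
  then show ?thesis using \<rho>L by simp
qed

lemma curve_acc_bounds:
  assumes "continuous_on {-1..2} \<alpha>" "\<And>t. t \<in> {-1..2} \<Longrightarrow> norm (\<alpha> t) \<le> \<rho>"
    and xy: "x \<in> ball p \<rho>" "y \<in> ball p \<rho>" and t: "t \<in> {-1..2}"
  shows "dist p (curve_acc \<alpha> x y t) \<le> 65 * \<rho>" "norm (velocity_acc \<alpha> x y t) \<le> 32 * \<rho>"
    "curve_acc \<alpha> x y t \<in> cball p R"
proof -
  have d: "norm (y - x) \<le> 2 * \<rho>"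
    using xy dist_triangle2[of y x p] by (simp add: dist_norm norm_minus_commute)
  have t2: "\<bar>t\<bar> \<le> 2" using t by auto
  have "norm ((curve_acc \<alpha> x y t - (x + t *\<^sub>R (y - x))) - (curve_acc (\<lambda>t. 0) x y t - (x + t *\<^sub>R (y - x)))) \<le> 60 * \<rho>"
    using assms by (intro curve_acc_close) auto
  then have "norm (curve_acc \<alpha> x y t - (x + t *\<^sub>R (y - x))) \<le> 60 * \<rho>" by simp
  moreover have "norm (t *\<^sub>R (y - x)) \<le> 2 * (2 * \<rho>)"
    unfolding norm_scaleR using t2 d by (intro mult_mono) auto
  moreover have "norm (x - p) \<le> \<rho>" using xy by (simp add: dist_norm norm_minus_commute)
  moreover have "curve_acc \<alpha> x y t - p = (curve_acc \<alpha> x y t - (x + t *\<^sub>R (y - x))) + t *\<^sub>R (y - x) + (x - p)"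
    by simp
  ultimately have "norm (curve_acc \<alpha> x y t - p) \<le> 60 * \<rho> + 2 * (2 * \<rho>) + \<rho>"
    by (metis add_mono norm_triangle_le order_refl)
  then show A: "dist p (curve_acc \<alpha> x y t) \<le> 65 * \<rho>"
    by (simp add: dist_norm norm_minus_commute)
  have "norm ((velocity_acc \<alpha> x y t - (y - x)) - (velocity_acc (\<lambda>t. 0) x y t - (y - x))) \<le> 30 * \<rho>"
    using assms by (intro curve_acc_close) auto
  then have "norm (velocity_acc \<alpha> x y t - (y - x)) \<le> 30 * \<rho>" by simp
  then show "norm (velocity_acc \<alpha> x y t) \<le> 32 * \<rho>"
    using d norm_triangle_ineq[of "velocity_acc \<alpha> x y t - (y - x)" "y - x"] by simp
  show "curve_acc \<alpha> x y t \<in> cball p R" using A \<rho>R pos by simp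
qed

text \<open>One estimate for three purposes: with equal sprays and end points it is the contraction,
  and in general it gives uniqueness and the dependence of solutions on spray and end points. The
  point is the factor 1/10 in front of \<open>a\<close>.\<close>

lemma spray_close:
  assumes N: "spray_bound p R L N"
    and \<eta>: "\<And>x v. x \<in> cball p R \<Longrightarrow> norm (N x v - N' x v) \<le> \<eta> * (norm v)\<^sup>2" "0 \<le> \<eta>"
    and \<alpha>: "continuous_on {-1..2} \<alpha>" "\<And>t. t \<in> {-1..2} \<Longrightarrow> norm (\<alpha> t) \<le> \<rho>"
    and \<beta>: "continuous_on {-1..2} \<beta>" "\<And>t. t \<in> {-1..2} \<Longrightarrow> norm (\<beta> t) \<le> \<rho>"
    and xy: "x \<in> ball p \<rho>" "y \<in> ball p \<rho>" "x' \<in> ball p \<rho>" "y' \<in> ball p \<rho>"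
    and a: "\<And>t. t \<in> {-1..2} \<Longrightarrow> norm (\<alpha> t - \<beta> t) \<le> a" and t: "t \<in> {-1..2}"
  shows "norm (N (curve_acc \<alpha> x y t) (velocity_acc \<alpha> x y t) - N' (curve_acc \<beta> x' y' t) (velocity_acc \<beta> x' y' t))
    \<le> \<eta> + (norm (x - x') + norm (y - y')) / 200 + a / 10"
proof -
  define D where "D = norm (x - x') + norm (y - y')"
  have D0: "D \<ge> 0" by (simp add: D_def)
  have a0: "0 \<le> a" by (rule order_trans[OF norm_ge_zero a[of 0]]) simp
  let ?c = "curve_acc \<alpha> x y t" and ?v = "velocity_acc \<alpha> x y t"
  let ?c' = "curve_acc \<beta> x' y' t" and ?v' = "velocity_acc \<beta> x' y' t"
  note b = curve_acc_bounds[OF \<alpha> xy(1,2) t] and b' = curve_acc_bounds[OF \<beta> xy(3,4) t]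
  have dv: "norm (?v - ?v') \<le> 2 * D + 60 * a"
  proof -
    have "?v - ?v' = ((?v - (y - x)) - (?v' - (y' - x'))) + ((y - y') - (x - x'))" by simp
    also have "norm \<dots> \<le> 30 * a + (norm (y - y') + norm (x - x'))"
      by (intro norm_add_bound norm_diff_bound curve_acc_close[OF \<alpha>(1) \<beta>(1) a t]) auto
    also have "\<dots> = 30 * a + D" by (simp add: D_def)
    also have "\<dots> \<le> 2 * D + 60 * a" using a0 D0 by simp
    finally show ?thesis .
  qed
  have dc: "norm (?c - ?c') \<le> 2 * D + 60 * a"
  proof -
    have "?c - ?c' = ((?c - (x + t *\<^sub>R (y - x))) - (?c' - (x' + t *\<^sub>R (y' - x')))) +
      ((1 - t) *\<^sub>R (x - x') + t *\<^sub>R (y - y'))" by (simp add: algebra_simps)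
    also have "norm \<dots> \<le> 60 * a + (2 * norm (x - x') + 2 * norm (y - y'))"
      using t by (intro norm_triangle_le add_mono curve_acc_close[OF \<alpha>(1) \<beta>(1) a t])
         (auto intro!: mult_right_mono)
    finally show ?thesis by (simp add: D_def)
  qed
  have \<rho>2: "\<rho>\<^sup>2 \<le> \<rho>" using pos \<rho>_small by (simp add: power2_eq_square mult_left_le)
  have v2: "(norm ?v)\<^sup>2 \<le> 1024 * \<rho>"
    using power_mono[OF b(2), of 2] \<rho>2 by (simp add: power_mult_distrib)
  have v2': "(norm ?v')\<^sup>2 \<le> 1024 * \<rho>"
    using power_mono[OF b'(2), of 2] \<rho>2 by (simp add: power_mult_distrib)
  have "norm (N ?c ?v - N ?c' ?v') \<le> L * (norm (?c - ?c') * (norm ?v)\<^sup>2 + norm (?v - ?v') * (norm ?v + norm ?v'))"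
    using N b(3) b'(3) unfolding spray_bound_def by blast
  also have "\<dots> \<le> L * ((2 * D + 60 * a) * (1024 * \<rho>) + (2 * D + 60 * a) * (32 * \<rho> + 32 * \<rho>))"
    using L1 dv dc v2 b(2) b'(2) D0 a0 by (intro mult_left_mono add_mono mult_mono) auto
  \<comment> \<open>Here 1088 = 1024 + 64, and \<open>\<rho> * L\<close> is at most one millionth,
    so the coefficients of \<open>a\<close> and \<open>D\<close> fall below 1/10 and 1/200.\<close>
  also have "\<dots> = (2 * D + 60 * a) * 1088 * (\<rho> * L)" by (simp add: algebra_simps)
  also have "\<dots> \<le> (2 * D + 60 * a) * 1088 * (1 / 10 ^ 6)"
    using \<rho>L D0 a0 by (intro mult_left_mono) auto
  also have "\<dots> \<le> D / 200 + a / 10" using D0 a0 by simp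
  finally have 1: "norm (N ?c ?v - N ?c' ?v') \<le> D / 200 + a / 10" .
  have "norm (N ?c' ?v' - N' ?c' ?v') \<le> \<eta> * (norm ?v')\<^sup>2" using \<eta>(1) b'(3) .
  also have "\<dots> \<le> \<eta> * 1" using v2' \<rho>_small \<eta>(2) by (intro mult_left_mono) auto
  finally have 2: "norm (N ?c' ?v' - N' ?c' ?v') \<le> \<eta>" by simp
  have "N ?c ?v - N' ?c' ?v' = (N ?c ?v - N ?c' ?v') + (N ?c' ?v' - N' ?c' ?v')" by simp
  also have "norm \<dots> \<le> (D / 200 + a / 10) + \<eta>" by (intro norm_triangle_le add_mono 1 2)
  finally show ?thesis by (simp add: D_def)
qed

text \<open>Apply \<open>spray_close\<close> at the time where the accelerations differ most; the
  term \<open>a / 10\<close> is then absorbed.\<close>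

lemma solution_close:
  assumes N: "spray_bound p R L N"
    and \<eta>: "\<And>x v. x \<in> cball p R \<Longrightarrow> norm (N x v - N' x v) \<le> \<eta> * (norm v)\<^sup>2" "0 \<le> \<eta>"
    and \<alpha>: "bvp_solution N \<rho> x y \<alpha>" and \<beta>: "bvp_solution N' \<rho> x' y' \<beta>"
    and xy: "x \<in> ball p \<rho>" "y \<in> ball p \<rho>" "x' \<in> ball p \<rho>" "y' \<in> ball p \<rho>"
    and t: "t \<in> {-1..2}"
  shows "norm (\<alpha> t - \<beta> t) \<le> 2 * \<eta> + (norm (x - x') + norm (y - y')) / 180"
proof -
  have c: "continuous_on {-1..2} \<alpha>" "continuous_on {-1..2} \<beta>"
    using \<alpha> \<beta> by (auto simp: bvp_solution_def)
  have "\<exists>s\<in>{-1..2}. \<forall>t\<in>{-1..2}. norm (\<alpha> t - \<beta> t) \<le> norm (\<alpha> s - \<beta> s)"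
    using c by (intro continuous_attains_sup continuous_intros) auto
  then obtain s where s: "s \<in> {-1..2}" "\<And>t. t \<in> {-1..2} \<Longrightarrow> norm (\<alpha> t - \<beta> t) \<le> norm (\<alpha> s - \<beta> s)"
    by blast
  have "norm (N (curve_acc \<alpha> x y s) (velocity_acc \<alpha> x y s) - N' (curve_acc \<beta> x' y' s) (velocity_acc \<beta> x' y' s))
    \<le> \<eta> + (norm (x - x') + norm (y - y')) / 200 + norm (\<alpha> s - \<beta> s) / 10"
    by (rule spray_close[OF N \<eta> c(1) bvp_solutionD(2)[OF \<alpha>] c(2) bvp_solutionD(2)[OF \<beta>] xy s(2) s(1)])
  moreover have "N (curve_acc \<alpha> x y s) (velocity_acc \<alpha> x y s) = \<alpha> s"
    "N' (curve_acc \<beta> x' y' s) (velocity_acc \<beta> x' y' s) = \<beta> s"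
    using bvp_solutionD(3)[OF \<alpha> s(1)] bvp_solutionD(3)[OF \<beta> s(1)] by simp_all
  ultimately have "norm (\<alpha> s - \<beta> s) \<le> 2 * \<eta> + (norm (x - x') + norm (y - y')) / 180"
    using \<eta>(2) by simp
  with s(2)[OF t] show ?thesis by simp
qed

text \<open>Banach's fixed point theorem in the ball of radius \<open>\<rho>\<close> of bounded
  continuous accelerations.\<close>

lemma bvp_solution_exists:
  assumes N: "spray_bound p R L N" and xy: "x \<in> ball p \<rho>" "y \<in> ball p \<rho>"
  shows "\<exists>\<alpha>. bvp_solution N \<rho> x y \<alpha>"
proof -
  \<comment> \<open>Clamping time to [-1, 2] makes the accelerations bounded continuous functions on
    the whole line, constant outside the interval.\<close>
  define \<tau> where "\<tau> t = max (-1) (min 2 t)" for t :: real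
  have \<tau>: "\<tau> t \<in> {-1..2}" for t by (auto simp: \<tau>_def)
  have \<tau>id: "\<tau> t = t" if "t \<in> {-1..2}" for t using that by (auto simp: \<tau>_def)
  have \<tau>c: "continuous_on UNIV \<tau>" unfolding \<tau>_def by (intro continuous_intros)
  define F where "F \<alpha> t = N (curve_acc \<alpha> x y (\<tau> t)) (velocity_acc \<alpha> x y (\<tau> t))" for \<alpha> :: "real \<Rightarrow> 'a" and t
  define S where "S = cball (0 :: real \<Rightarrow>\<^sub>C 'a) \<rho>"
  have S: "norm (apply_bcontfun f t) \<le> \<rho>" if "f \<in> S" for f t
    using that norm_bounded[of f t] by (simp add: S_def)
  have cont: "continuous_on UNIV (F (apply_bcontfun f))" if "f \<in> S" for f
  proof -
    let ?\<alpha> = "apply_bcontfun f"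
    have "continuous_on {-1..2} (curve_acc ?\<alpha> x y)" "continuous_on {-1..2} (velocity_acc ?\<alpha> x y)"
      using continuous_on_vector_derivative[OF curve_acc_deriv(1)[of ?\<alpha>]]
        continuous_on_vector_derivative[OF curve_acc_deriv(2)[of ?\<alpha>]] by auto
    then have "continuous_on {-1..2} (\<lambda>t. N (curve_acc ?\<alpha> x y t) (velocity_acc ?\<alpha> x y t))"
      using curve_acc_bounds(3)[OF _ S[OF that] xy] by (intro spray_bound_continuous_on[OF N]) auto
    then show ?thesis unfolding F_def
      by (rule continuous_on_compose2[OF _ \<tau>c]) (use \<tau> in auto)
  qed
  have bnd: "norm (F (apply_bcontfun f) t) \<le> \<rho>" if "f \<in> S" for f t
  proof -
    have b: "curve_acc f x y (\<tau> t) \<in> cball p R" "norm (velocity_acc f x y (\<tau> t)) \<le> 32 * \<rho>"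
      using curve_acc_bounds[OF _ S[OF that] xy \<tau>] by auto
    have "norm (F (apply_bcontfun f) t) \<le> L * (norm (velocity_acc f x y (\<tau> t)))\<^sup>2"
      using N b(1) unfolding F_def spray_bound_def by blast
    also have "\<dots> \<le> L * (32 * \<rho>)\<^sup>2"
      using b(2) L1 by (intro mult_left_mono power_mono) auto
    also have "\<dots> = 1024 * (\<rho> * L) * \<rho>" by (simp add: power2_eq_square)
    also have "\<dots> \<le> 1 * \<rho>" using \<rho>L pos by (intro mult_right_mono) auto
    finally show ?thesis by simp
  qed
  have in_b: "F (apply_bcontfun f) \<in> bcontfun" if "f \<in> S" for f
    using bcontfun_normI[OF cont[OF that] bnd[OF that]] .
  define T where "T f = Bcontfun (F (apply_bcontfun f))" for f
  have T: "apply_bcontfun (T f) = F (apply_bcontfun f)" if "f \<in> S" for f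
    unfolding T_def by (rule Bcontfun_inverse[OF in_b[OF that]])
  have "\<exists>!f\<in>S. T f = f"
  proof (rule Banach_fix[where c = "1/10"])
    show "complete S" unfolding S_def by (simp add: complete_eq_closed)
    show "S \<noteq> {}" using pos by (auto simp: S_def)
    show "T ` S \<subseteq> S"
    proof
      fix h assume "h \<in> T ` S"
      then obtain f where f: "f \<in> S" "h = T f" by blast
      have "norm h \<le> \<rho>" by (rule norm_bound) (simp add: f T bnd)
      then show "h \<in> S" by (simp add: S_def)
    qed
    fix f h assume fh: "f \<in> S" "h \<in> S"
    show "dist (T f) (T h) \<le> 1 / 10 * dist f h"
    proof (rule dist_bound)
      fix t
      have "norm (f t - h t) \<le> dist f h" for t
        using dist_bounded[of f t h] by (simp add: dist_norm)
      then have "norm (F f t - F h t) \<le> 0 + (norm (x - x) + norm (y - y)) / 200 + dist f h / 10"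
        unfolding F_def using S[OF fh(1)] S[OF fh(2)] xy \<tau>
        by (intro spray_close[OF N]) auto
      then show "dist (T f t) (T h t) \<le> 1 / 10 * dist f h" by (simp add: T fh dist_norm)
    qed
  qed auto
  then obtain f where f: "f \<in> S" "T f = f" by blast
  have "bvp_solution N \<rho> x y f"
    unfolding bvp_solution_def
  proof (intro conjI ballI)
    show "continuous_on {-1..2} (apply_bcontfun f)" by simp
    fix t :: real assume t: "t \<in> {-1..2}"
    show "norm (f t) \<le> \<rho>" using S f(1) .
    show "f t = N (curve_acc f x y t) (velocity_acc f x y t)"
      using T[OF f(1)] f(2) by (simp add: F_def fun_eq_iff) (metis \<tau>id[OF t])
  qed
  then show ?thesis by blast
qed

text \<open>The choice is unambiguous on [-1, 2]: two solutions with the same data agree there by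
  \<open>solution_close\<close> with \<open>\<eta> = 0\<close>.\<close>

definition acc :: "('a \<Rightarrow> 'a \<Rightarrow> 'a) \<Rightarrow> 'a \<Rightarrow> 'a \<Rightarrow> real \<Rightarrow> 'a" where
  "acc N x y = (SOME \<alpha>. bvp_solution N \<rho> x y \<alpha>)"

definition path :: "('a \<Rightarrow> 'a \<Rightarrow> 'a) \<Rightarrow> 'a \<Rightarrow> 'a \<Rightarrow> real \<Rightarrow> 'a" where
  "path N x y = curve_acc (acc N x y) x y"

definition vel :: "('a \<Rightarrow> 'a \<Rightarrow> 'a) \<Rightarrow> 'a \<Rightarrow> 'a \<Rightarrow> real \<Rightarrow> 'a" where
  "vel N x y = velocity_acc (acc N x y) x y"

lemma acc:
  assumes "spray_bound p R L N" "x \<in> ball p \<rho>" "y \<in> ball p \<rho>"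
  shows "bvp_solution N \<rho> x y (acc N x y)"
  unfolding acc_def using bvp_solution_exists[OF assms] by (rule someI_ex)

lemma path_ends [simp]: "path N x y 0 = x" "path N x y 1 = y"
  by (simp_all add: path_def)

context
  fixes N x y
  assumes N: "spray_bound p R L N" and x: "x \<in> ball p \<rho>" and y: "y \<in> ball p \<rho>"
begin

lemma acc_continuous: "continuous_on {-1..2} (acc N x y)"
  and acc_eq: "t \<in> {-1..2} \<Longrightarrow> acc N x y t = N (path N x y t) (vel N x y t)"
  and acc_bound: "t \<in> {-1..2} \<Longrightarrow> norm (acc N x y t) \<le> \<rho>"
  using bvp_solutionD[OF acc[OF N x y]] by (simp_all add: path_def vel_def)

lemma path_deriv_within:
  assumes "t \<in> {-1..2}"
  shows "(path N x y has_vector_derivative vel N x y t) (at t within {-1..2})"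
    "(vel N x y has_vector_derivative N (path N x y t) (vel N x y t)) (at t within {-1..2})"
  using curve_acc_deriv[OF acc_continuous assms] acc_eq[OF assms]
  by (simp_all add: path_def vel_def)

lemma path_deriv:
  assumes "t \<in> {-1<..<2}"
  shows "(path N x y has_vector_derivative vel N x y t) (at t)"
    "(vel N x y has_vector_derivative N (path N x y t) (vel N x y t)) (at t)"
  using path_deriv_within[of t] assms at_within_interior[of t "{-1..2}"]
  by (auto simp: interior_atLeastAtMost_real)

lemma path_bound:
  assumes "t \<in> {-1..2}"
  shows "path N x y t \<in> cball p R" "norm (vel N x y t) \<le> 32 * \<rho>"
  using curve_acc_bounds[OF acc_continuous acc_bound x y assms] by (simp_all add: path_def vel_def)

text \<open>The maximal speed m satisfies m \<le> |y - x| + 30 L m^2, and the last term is at most m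
  / 2 because the speed is a priori small. So m \<le> 2 |y - x|, and the acceleration is quadratic
  in it.\<close>

lemma acc_quadratic:
  assumes t: "t \<in> {-1..2}"
  shows "norm (acc N x y t) \<le> 4 * L * (norm (y - x))\<^sup>2"
    and "norm (vel N x y t - (y - x)) \<le> 120 * L * (norm (y - x))\<^sup>2"
proof -
  have "continuous_on {-1..2} (vel N x y)"
    using path_deriv_within(2) by (rule continuous_on_vector_derivative)
  then have "\<exists>s\<in>{-1..2}. \<forall>t\<in>{-1..2}. norm (vel N x y t) \<le> norm (vel N x y s)"
    by (intro continuous_attains_sup continuous_intros) auto
  then obtain s where s: "s \<in> {-1..2}" "\<And>t. t \<in> {-1..2} \<Longrightarrow> norm (vel N x y t) \<le> norm (vel N x y s)"
    by blast
  define m where "m = norm (vel N x y s)"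
  have a: "norm (acc N x y t) \<le> L * m\<^sup>2" if t: "t \<in> {-1..2}" for t
  proof -
    have "norm (acc N x y t) \<le> L * (norm (vel N x y t))\<^sup>2"
      using N path_bound(1)[OF t] acc_eq[OF t] by (auto simp: spray_bound_def)
    also have "\<dots> \<le> L * m\<^sup>2"
      unfolding m_def using s(2)[OF t] L1 by (intro mult_left_mono power_mono) auto
    finally show ?thesis .
  qed
  have v: "norm (vel N x y t - (y - x)) \<le> 30 * (L * m\<^sup>2)" if t: "t \<in> {-1..2}" for t
    using curve_acc_close(1)[OF acc_continuous continuous_on_const[of _ 0] _ t, of "L * m\<^sup>2" x y x y] a
    by (simp add: vel_def)
  have "m \<le> norm (y - x) + 30 * (L * m\<^sup>2)"
    using v[OF s(1)] norm_triangle_ineq[of "vel N x y s - (y - x)" "y - x"] by (simp add: m_def)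
  also have "30 * (L * m\<^sup>2) \<le> m / 2"
  proof -
    have "30 * (L * m\<^sup>2) \<le> 30 * (L * ((32 * \<rho>) * m))"
      unfolding power2_eq_square m_def using path_bound(2)[OF s(1)] L1
      by (intro mult_left_mono mult_right_mono) auto
    also have "\<dots> = 960 * (\<rho> * L) * m" by simp
    also have "\<dots> \<le> (1 / 2) * m" using \<rho>L by (intro mult_right_mono) (auto simp: m_def)
    finally show ?thesis by simp
  qed
  finally have "m \<le> 2 * norm (y - x)" by simp
  then have "m\<^sup>2 \<le> (2 * norm (y - x))\<^sup>2" by (intro power_mono) (auto simp: m_def)
  then have m2: "L * m\<^sup>2 \<le> 4 * L * (norm (y - x))\<^sup>2"
    using L1 mult_left_mono[of "m\<^sup>2" "(2 * norm (y - x))\<^sup>2" L] by (simp add: power_mult_distrib)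
  show "norm (acc N x y t) \<le> 4 * L * (norm (y - x))\<^sup>2" using a[OF t] m2 by simp
  show "norm (vel N x y t - (y - x)) \<le> 120 * L * (norm (y - x))\<^sup>2" using v[OF t] m2 by simp
qed

text \<open>Identifies a solution obtained elsewhere with the chosen short one. Twice integrating
  its own acceleration recovers it up to an affine function, which the two end conditions
  kill.\<close>

lemma path_unique:
  assumes c: "\<And>t. t \<in> {-1..2} \<Longrightarrow> (c has_vector_derivative w t) (at t within {-1..2})"
    and w: "\<And>t. t \<in> {-1..2} \<Longrightarrow> (w has_vector_derivative N (c t) (w t)) (at t within {-1..2})"
    and ends: "c 0 = x" "c 1 = y"
    and small: "\<And>t. t \<in> {-1..2} \<Longrightarrow> norm (N (c t) (w t)) \<le> \<rho>"
    and cont: "continuous_on {-1..2} (\<lambda>t. N (c t) (w t))"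
    and t: "t \<in> {-1..2}"
  shows "path N x y t = c t" "vel N x y t = w t"
proof -
  \<comment> \<open>The acceleration of the given curve; it will solve the fixed point equation and
    hence coincide with \<open>acc N x y\<close>.\<close>
  define \<beta> where "\<beta> t = N (c t) (w t)" for t
  have \<beta>: "continuous_on {-1..2} \<beta>" using cont by (simp add: \<beta>_def[abs_def])
  have "\<exists>k. \<forall>t\<in>{-1..2}. w t - velocity_acc \<beta> x y t = k"
  proof (rule has_derivative_zero_constant)
    fix t :: real assume t: "t \<in> {-1..2}"
    have "((\<lambda>t. w t - velocity_acc \<beta> x y t) has_vector_derivative \<beta> t - \<beta> t) (at t within {-1..2})"
      using w[OF t] curve_acc_deriv(2)[OF \<beta> t] unfolding \<beta>_def[symmetric]
      by (rule has_vector_derivative_diff)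
    then show "((\<lambda>t. w t - velocity_acc \<beta> x y t) has_derivative (\<lambda>h. 0)) (at t within {-1..2})"
      by (simp add: has_vector_derivative_def)
  qed simp
  then obtain k where k: "\<And>t. t \<in> {-1..2} \<Longrightarrow> w t = velocity_acc \<beta> x y t + k"
    by (metis add.commute diff_add_cancel)
  have "\<exists>l. \<forall>t\<in>{-1..2}. c t - curve_acc \<beta> x y t - t *\<^sub>R k = l"
  proof (rule has_derivative_zero_constant)
    fix t :: real assume t: "t \<in> {-1..2}"
    have "((\<lambda>t. c t - curve_acc \<beta> x y t - t *\<^sub>R k) has_vector_derivative w t - velocity_acc \<beta> x y t - k) (at t within {-1..2})"
      by (auto intro!: derivative_eq_intros c[OF t] curve_acc_deriv(1)[OF \<beta> t])
    then show "((\<lambda>t. c t - curve_acc \<beta> x y t - t *\<^sub>R k) has_derivative (\<lambda>h. 0)) (at t within {-1..2})"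
      using k[OF t] by (simp add: has_vector_derivative_def)
  qed simp
  then obtain l where l: "\<And>t. t \<in> {-1..2} \<Longrightarrow> c t - curve_acc \<beta> x y t - t *\<^sub>R k = l" by blast
  have "l = 0" using l[of 0] ends by simp
  moreover have "k = 0" using l[of 1] \<open>l = 0\<close> ends by simp
  ultimately have cw: "c t = curve_acc \<beta> x y t" "w t = velocity_acc \<beta> x y t" if "t \<in> {-1..2}" for t
    using l[OF that] k[OF that] by auto
  have "bvp_solution N \<rho> x y \<beta>"
    using \<beta> small cw by (auto simp: bvp_solution_def) (auto simp: \<beta>_def)
  then have "norm (acc N x y t - \<beta> t) \<le> 2 * 0 + (norm (x - x) + norm (y - y)) / 180" if "t \<in> {-1..2}" for t
    using that by (intro solution_close[OF N _ _ acc[OF N x y] _ x y x y]) auto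
  then have eq: "norm (acc N x y t - \<beta> t) \<le> 0" if "t \<in> {-1..2}" for t using that by simp
  have "norm ((velocity_acc (acc N x y) x y t - (y - x)) - (velocity_acc \<beta> x y t - (y - x))) \<le> 30 * 0"
    "norm ((curve_acc (acc N x y) x y t - (x + t *\<^sub>R (y - x))) - (curve_acc \<beta> x y t - (x + t *\<^sub>R (y - x)))) \<le> 60 * 0"
    using curve_acc_close[OF acc_continuous \<beta> eq t] by blast+
  then show "path N x y t = c t" "vel N x y t = w t"
    using cw[OF t] by (simp_all add: path_def vel_def)
qed

end

text \<open>In the velocity estimate the change of the chord is subtracted and the remainder has
  Lipschitz constant 1/6: velocity as a function of the end point is close to a translation.\<close>

lemma path_close:
  assumes N: "spray_bound p R L N" and N': "spray_bound p R L N'"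
    and \<eta>: "\<And>x v. x \<in> cball p R \<Longrightarrow> norm (N x v - N' x v) \<le> \<eta> * (norm v)\<^sup>2" "0 \<le> \<eta>"
    and xy: "x \<in> ball p \<rho>" "y \<in> ball p \<rho>" "x' \<in> ball p \<rho>" "y' \<in> ball p \<rho>"
    and t: "t \<in> {-1..2}"
  shows "norm (vel N x y t - vel N' x' y' t - ((y - x) - (y' - x'))) \<le> 60 * \<eta> + (norm (x - x') + norm (y - y')) / 6"
    and "norm (path N x y t - path N' x' y' t) \<le> 120 * \<eta> + 3 * (norm (x - x') + norm (y - y'))"
proof -
  let ?a = "2 * \<eta> + (norm (x - x') + norm (y - y')) / 180"
  have a: "norm (acc N x y t - acc N' x' y' t) \<le> ?a" if "t \<in> {-1..2}" for t
    using solution_close[OF N \<eta> acc[OF N xy(1,2)] acc[OF N' xy(3,4)] xy that] .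
  note C = curve_acc_close[OF acc_continuous[OF N xy(1,2)] acc_continuous[OF N' xy(3,4)] a t]
  have "norm ((velocity_acc (acc N x y) x y t - (y - x)) - (velocity_acc (acc N' x' y') x' y' t - (y' - x'))) \<le> 30 * ?a"
    using C(1) .
  moreover have "(velocity_acc (acc N x y) x y t - (y - x)) - (velocity_acc (acc N' x' y') x' y' t - (y' - x'))
    = vel N x y t - vel N' x' y' t - ((y - x) - (y' - x'))"
    by (simp add: vel_def)
  ultimately have "norm (vel N x y t - vel N' x' y' t - ((y - x) - (y' - x'))) \<le> 30 * ?a" by (simp only:)
  also have "30 * ?a = 60 * \<eta> + (norm (x - x') + norm (y - y')) / 6" by (simp add: field_simps)
  finally show "norm (vel N x y t - vel N' x' y' t - ((y - x) - (y' - x'))) \<le> 60 * \<eta> + (norm (x - x') + norm (y - y')) / 6" .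
  have "path N x y t - path N' x' y' t =
    ((path N x y t - (x + t *\<^sub>R (y - x))) - (path N' x' y' t - (x' + t *\<^sub>R (y' - x'))))
     + ((1 - t) *\<^sub>R (x - x') + t *\<^sub>R (y - y'))" by (simp add: algebra_simps)
  also have "norm \<dots> \<le> 60 * ?a + (2 * norm (x - x') + 2 * norm (y - y'))"
    using t C(2) unfolding path_def
    by (intro norm_triangle_le add_mono) (auto intro!: mult_right_mono)
  also have "\<dots> = 120 * \<eta> + (7 / 3) * (norm (x - x') + norm (y - y'))" by (simp add: field_simps)
  also have "\<dots> \<le> 120 * \<eta> + 3 * (norm (x - x') + norm (y - y'))"
    by (intro add_left_mono mult_right_mono) auto
  finally show "norm (path N x y t - path N' x' y' t) \<le> 120 * \<eta> + 3 * (norm (x - x') + norm (y - y'))" .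
qed

text \<open>The map from the end point to the initial velocity is the inverse of the exponential
  map. It differs from y - x by a map with Lipschitz constant 1/6, hence is injective and
  continuous; openness then follows from invariance of domain, without differentiability.\<close>

lemma vel_open_map:
  assumes N: "spray_bound p R L N" and x: "x \<in> ball p \<rho>" and U: "open U" "U \<subseteq> ball p \<rho>"
  shows "open ((\<lambda>y. vel N x y 0) ` U)"
proof (rule invariance_of_domain)
  have *: "norm (vel N x y 0 - vel N x y' 0 - (y - y')) \<le> norm (y - y') / 6" if "y \<in> U" "y' \<in> U" for y y'
  proof -
    have "norm (vel N x y 0 - vel N x y' 0 - ((y - x) - (y' - x))) \<le> 60 * 0 + (norm (x - x) + norm (y - y')) / 6"
      using that U(2) by (intro path_close(1)[OF N N _ _ x _ x]) auto
    then show ?thesis by simp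
  qed
  show "inj_on (\<lambda>y. vel N x y 0) U"
  proof (rule inj_onI)
    fix y y' assume "y \<in> U" "y' \<in> U" "vel N x y 0 = vel N x y' 0"
    with *[of y y'] have "norm (y' - y) \<le> norm (y - y') / 6" by simp
    then show "y = y'" by (simp add: norm_minus_commute)
  qed
  show "continuous_on U (\<lambda>y. vel N x y 0)"
    unfolding continuous_on_iff
  proof (intro ballI allI impI)
    fix y and e :: real assume y: "y \<in> U" "0 < e"
    show "\<exists>d>0. \<forall>y'\<in>U. dist y' y < d \<longrightarrow> dist (vel N x y' 0) (vel N x y 0) < e"
    proof (intro exI conjI ballI impI)
      show "0 < e / 2" using y by simp
      fix y' assume y': "y' \<in> U" "dist y' y < e / 2"
      have "norm (vel N x y' 0 - vel N x y 0) \<le> norm (vel N x y' 0 - vel N x y 0 - (y' - y)) + norm (y' - y)"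
        using norm_triangle_ineq[of "vel N x y' 0 - vel N x y 0 - (y' - y)" "y' - y"] by simp
      also have "\<dots> \<le> 7 / 6 * norm (y' - y)" using *[OF y'(1) y(1)] by simp
      finally show "dist (vel N x y' 0) (vel N x y 0) < e" using y' y(2) by (simp add: dist_norm)
    qed
  qed
qed (fact U(1))

end

section \<open>Calculus of iterated partial derivatives\<close>

lemma partial_derivI:
  assumes "(f has_derivative f') (at x)"
  shows "partial_deriv i f x = f' (axis i 1)"
  unfolding partial_deriv_def using frechet_derivative_at[OF assms] by simp

lemma partial_deriv_cong:
  assumes "open D" "x \<in> D" "\<And>y. y \<in> D \<Longrightarrow> f y = g y"
  shows "partial_deriv i f x = partial_deriv i g x"
proof -
  have "(f has_derivative f') (at x) \<longleftrightarrow> (g has_derivative f') (at x)" for f'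
    using has_derivative_transform_within_open[OF _ assms(1,2)] assms(3) by metis
  then show ?thesis by (simp add: partial_deriv_def frechet_derivative_def)
qed

lemma iter_partial_Nil [simp]: "iter_partial [] f = f"
  by (simp add: iter_partial_def)

lemma iter_partial_Cons [simp]: "iter_partial (i # I) f = partial_deriv i (iter_partial I f)"
  by (simp add: iter_partial_def)

lemma iter_partial_snoc: "iter_partial (I @ [i]) f = iter_partial I (partial_deriv i f)"
  by (simp add: iter_partial_def)

lemma iter_partial_cong:
  assumes "open D" "\<And>y. y \<in> D \<Longrightarrow> f y = g y" "x \<in> D"
  shows "iter_partial I f x = iter_partial I g x"
  using assms(3)
proof (induction I arbitrary: x)
  case (Cons i I)
  show ?case unfolding iter_partial_Cons
    by (rule partial_deriv_cong[OF assms(1) Cons.prems Cons.IH])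
qed (simp add: assms)

lemma Ck_on_0: "Ck_on 0 D f \<longleftrightarrow> continuous_on D f"
  by (simp add: Ck_on_def)

text \<open>Peels off the derivative taken first, which \<open>foldr\<close> keeps at the end of the
  list, so that inductions on \<open>k\<close> can pass to partial derivatives.\<close>

lemma Ck_on_Suc:
  "Ck_on (Suc k) D f \<longleftrightarrow> (\<forall>x\<in>D. f differentiable (at x)) \<and> continuous_on D f \<and>
     (\<forall>i. Ck_on k D (partial_deriv i f))"
proof -
  have *: "(\<forall>I :: 'a list. P I) \<longleftrightarrow> P [] \<and> (\<forall>i I. P (I @ [i]))" for P
    by (metis rev_exhaust)
  show ?thesis
    unfolding Ck_on_def
    by (subst (1 2) *) (auto simp: iter_partial_snoc)
qed

lemma Ck_on_Suc_imp: "Ck_on (Suc k) D f \<Longrightarrow> Ck_on k D f"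
  unfolding Ck_on_def by auto

lemma Ck_on_mono: "Ck_on k D f \<Longrightarrow> m \<le> k \<Longrightarrow> Ck_on m D f"
  unfolding Ck_on_def by auto

lemma Ck_on_subset: "Ck_on k D f \<Longrightarrow> S \<subseteq> D \<Longrightarrow> Ck_on k S f"
  unfolding Ck_on_def by (meson continuous_on_subset subset_iff)

lemma Ck_on_cong:
  fixes D :: "(real ^ 'n::finite) set"
  assumes D: "open D" and fg: "\<And>x. x \<in> D \<Longrightarrow> f x = g x" and f: "Ck_on k D f"
  shows "Ck_on k D g"
  unfolding Ck_on_def
proof (intro conjI allI impI ballI)
  have eq: "iter_partial I f y = iter_partial I g y" if "y \<in> D" for I y
    using iter_partial_cong[of D f g y I] D fg that by blast
  fix I :: "'n list"
  {
    fix x assume "length I < k" and x: "x \<in> D"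
    then have "iter_partial I f differentiable at x" using f unfolding Ck_on_def by blast
    then obtain f' where "(iter_partial I f has_derivative f') (at x)"
      unfolding differentiable_def by blast
    then have "(iter_partial I g has_derivative f') (at x)"
      by (rule has_derivative_transform_within_open[OF _ D x eq])
    then show "iter_partial I g differentiable at x" by (auto simp: differentiable_def)
  next
    assume "length I \<le> k"
    then show "continuous_on D (iter_partial I g)"
      using f eq by (auto simp: Ck_on_def cong: continuous_on_cong)
  }
qed

lemma partial_deriv_add:
  assumes "f differentiable at x" "g differentiable at x"
  shows "partial_deriv i (\<lambda>y. f y + g y) x = partial_deriv i f x + partial_deriv i g x"
  using partial_derivI[OF has_derivative_add[OF assms[unfolded frechet_derivative_works]]]
  by (simp add: partial_deriv_def)

lemma partial_deriv_mult:
  assumes "f differentiable at x" "g differentiable at x"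
  shows "partial_deriv i (\<lambda>y. f y * g y) x = f x * partial_deriv i g x + partial_deriv i f x * g x"
  using partial_derivI[OF has_derivative_mult[OF assms[unfolded frechet_derivative_works]]]
  by (simp add: partial_deriv_def)

lemma partial_deriv_const: "partial_deriv i (\<lambda>y. c) x = 0"
  by (rule partial_derivI[OF has_derivative_const])

lemma Ck_on_const: "Ck_on k D (\<lambda>x. c)"
proof (induction k arbitrary: c)
  case (Suc k)
  have "partial_deriv i (\<lambda>y. c) = (\<lambda>x. 0)" for i :: 'a by (simp add: fun_eq_iff partial_deriv_const)
  then show ?case using Suc by (simp add: Ck_on_Suc)
qed (simp add: Ck_on_0)

lemma Ck_on_add:
  assumes "open D" "Ck_on k D f" "Ck_on k D g"
  shows "Ck_on k D (\<lambda>x. f x + g x)"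
  using assms(2,3)
proof (induction k arbitrary: f g)
  case 0
  then show ?case by (auto simp: Ck_on_0 intro: continuous_intros)
next
  case (Suc k)
  have d: "f differentiable at x" "g differentiable at x" if "x \<in> D" for x
    using Suc.prems that by (auto simp: Ck_on_Suc)
  have "Ck_on k D (partial_deriv i (\<lambda>x. f x + g x))" for i
  proof (rule Ck_on_cong[OF assms(1)])
    show "Ck_on k D (\<lambda>x. partial_deriv i f x + partial_deriv i g x)"
      using Suc by (auto simp: Ck_on_Suc)
  qed (simp add: partial_deriv_add d)
  then show ?case using Suc.prems d by (auto simp: Ck_on_Suc intro: continuous_intros)
qed

lemma Ck_on_mult:
  assumes "open D" "Ck_on k D f" "Ck_on k D g"
  shows "Ck_on k D (\<lambda>x. f x * g x)"
  using assms(2,3)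
proof (induction k arbitrary: f g)
  case 0
  then show ?case by (auto simp: Ck_on_0 intro: continuous_intros)
next
  case (Suc k)
  have d: "f differentiable at x" "g differentiable at x" if "x \<in> D" for x
    using Suc.prems that by (auto simp: Ck_on_Suc)
  have "Ck_on k D (partial_deriv i (\<lambda>x. f x * g x))" for i
  proof (rule Ck_on_cong[OF assms(1)])
    show "Ck_on k D (\<lambda>x. f x * partial_deriv i g x + partial_deriv i f x * g x)"
      using Suc Ck_on_Suc_imp[OF Suc.prems(1)] Ck_on_Suc_imp[OF Suc.prems(2)]
      by (intro Ck_on_add[OF assms(1)]) (auto simp: Ck_on_Suc)
  qed (simp add: partial_deriv_mult d)
  then show ?case using Suc.prems d by (auto simp: Ck_on_Suc intro: continuous_intros)
qed

lemma iter_partial_add_cmult: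
  assumes "open D" "Ck_on k D f" "Ck_on k D h" "length I \<le> k" "x \<in> D"
  shows "iter_partial I (\<lambda>y. f y + a * h y) x = iter_partial I f x + a * iter_partial I h x"
  using assms(2-5)
proof (induction I arbitrary: f h k x rule: rev_induct)
  case (snoc i I)
  from snoc.prems(3) obtain m where m: "k = Suc m" "length I \<le> m" by (cases k) auto
  have d: "f differentiable at y" "h differentiable at y" if "y \<in> D" for y
    using snoc.prems that m by (auto simp: Ck_on_Suc)
  have "iter_partial I (partial_deriv i (\<lambda>y. f y + a * h y)) x =
    iter_partial I (\<lambda>y. partial_deriv i f y + a * partial_deriv i h y) x"
  proof (rule iter_partial_cong[OF assms(1) _ snoc.prems(4)])
    fix y assume y: "y \<in> D"
    show "partial_deriv i (\<lambda>y. f y + a * h y) y = partial_deriv i f y + a * partial_deriv i h y"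
      using d[OF y] by (simp add: partial_deriv_add partial_deriv_mult partial_deriv_const)
  qed
  also have "\<dots> = iter_partial I (partial_deriv i f) x + a * iter_partial I (partial_deriv i h) x"
    using snoc.prems m by (intro snoc.IH[of m]) (auto simp: Ck_on_Suc)
  finally show ?case by (simp add: iter_partial_snoc)
qed simp

lemma iter_partial_zero [simp]: "iter_partial I (\<lambda>y. 0) = (\<lambda>x. 0)"
proof (induction I)
  case (Cons i I)
  show ?case unfolding iter_partial_Cons Cons by (rule ext) (rule partial_deriv_const)
qed simp

text \<open>Derivatives are bounded on \<open>C\<close> by compactness and vanish on the open
  complement; there are finitely many index lists up to length \<open>k\<close>.\<close>

lemma Ck_on_compact_support_bound:
  assumes D: "open D" and C: "compact C" "C \<subseteq> D" and f: "Ck_on k D f"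
    and z: "\<And>x. x \<in> D - C \<Longrightarrow> f x = 0"
  obtains M where "M > 0" "\<And>I x. length I \<le> k \<Longrightarrow> x \<in> D \<Longrightarrow> \<bar>iter_partial I f x\<bar> \<le> M"
proof -
  have "\<exists>M>0. \<forall>x\<in>D. \<bar>iter_partial I f x\<bar> \<le> M" if I: "length I \<le> k" for I
  proof -
    have "continuous_on C (iter_partial I f)"
      using f I C(2) by (auto simp: Ck_on_def intro: continuous_on_subset)
    then have "bounded (iter_partial I f ` C)" using C(1) compact_continuous_image compact_imp_bounded by blast
    then obtain M where M: "M > 0" "\<And>x. x \<in> C \<Longrightarrow> \<bar>iter_partial I f x\<bar> \<le> M"
      by (auto simp: bounded_pos)
    have "iter_partial I f x = 0" if "x \<in> D - C" for x
      using iter_partial_cong[of "D - C" f "\<lambda>y. 0" x I] D C(1) z that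
      by (simp add: open_Diff compact_imp_closed)
    then show ?thesis using M by (metis Diff_iff abs_zero less_eq_real_def)
  qed
  then obtain m where m: "\<And>I. length I \<le> k \<Longrightarrow> m I > 0"
    "\<And>I x. length I \<le> k \<Longrightarrow> x \<in> D \<Longrightarrow> \<bar>iter_partial I f x\<bar> \<le> m I" by metis
  let ?S = "{I :: 'a list. set I \<subseteq> UNIV \<and> length I \<le> k}"
  have fin: "finite ?S" by (rule finite_lists_length_le) simp
  show ?thesis
  proof
    show "sum m ?S > 0"
      by (rule sum_pos[OF fin]) (use m(1) in \<open>auto intro: exI[of _ "[]"]\<close>)
    fix I x assume I: "length (I :: 'a list) \<le> k" and x: "x \<in> D"
    have "\<bar>iter_partial I f x\<bar> \<le> m I" using m(2)[OF I x] .
    also have "\<dots> \<le> sum m ?S"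
      using fin I m(1) by (intro member_le_sum) (auto intro: less_imp_le)
    finally show "\<bar>iter_partial I f x\<bar> \<le> sum m ?S" .
  qed
qed

subsection \<open>Bump functions\<close>

text \<open>Finite smoothness is enough in the C^k topology, and for this bump the differential is
  an explicit nonnegative multiple of \<open>z - x\<close>, which later fixes the sign of a
  derivative.\<close>

definition bump :: "nat \<Rightarrow> real ^ 'n::finite \<Rightarrow> real \<Rightarrow> real ^ 'n \<Rightarrow> real" where
  "bump m z \<rho> x = max 0 (\<rho>\<^sup>2 - (norm (x - z))\<^sup>2) ^ m"

lemma max0_power_deriv:
  assumes "m \<ge> 1"
  shows "((\<lambda>u. max 0 u ^ Suc m) has_real_derivative real (Suc m) * max 0 u ^ m) (at u)"
proof -
  consider "u > 0" | "u < 0" | "u = 0" by linarith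
  then show ?thesis
  proof cases
    case 1
    have "((\<lambda>u. u ^ Suc m) has_real_derivative real (Suc m) * max 0 u ^ m) (at u)"
      using DERIV_pow[of "Suc m" u] 1 by (simp add: max_def)
    then show ?thesis
      by (rule has_field_derivative_transform_within_open[of _ _ _ "{0<..}"]) (use 1 in auto)
  next
    case 2
    have "((\<lambda>u. 0) has_real_derivative real (Suc m) * max 0 u ^ m) (at u)"
      using 2 assms by (simp add: max_def power_0_left)
    then show ?thesis
      by (rule has_field_derivative_transform_within_open[of _ _ _ "{..<0}"]) (use 2 in auto)
  next
    case 3
    have "((\<lambda>h::real. max 0 h ^ Suc m / h) \<longlongrightarrow> 0) (at 0)"
    proof (rule Lim_null_comparison)
      show "\<forall>\<^sub>F h::real in at 0. norm (max 0 h ^ Suc m / h) \<le> max 0 h ^ m"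
        by (auto simp: eventually_at_filter max_def abs_mult)
      have "((\<lambda>h::real. max 0 h ^ m) \<longlongrightarrow> max 0 0 ^ m) (at 0)" by (intro tendsto_intros)
      moreover have "max 0 0 ^ m = (0 :: real)" using assms by (simp add: power_0_left)
      ultimately show "((\<lambda>h::real. max 0 h ^ m) \<longlongrightarrow> 0) (at 0)" by (simp only:)
    qed
    then show ?thesis using 3 assms by (simp add: DERIV_def power_0_left)
  qed
qed

lemma bump_deriv:
  assumes "m \<ge> 1"
  shows "(bump (Suc m) z \<rho> has_derivative (\<lambda>e. real (Suc m) * bump m z \<rho> x * (2 * ((z - x) \<bullet> e)))) (at x)"
proof -
  have "((\<lambda>x. \<rho>\<^sup>2 - (x - z) \<bullet> (x - z)) has_derivative (\<lambda>e. 2 * ((z - x) \<bullet> e))) (at x)"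
    by (auto intro!: derivative_eq_intros simp: inner_diff inner_commute algebra_simps)
  from has_derivative_compose[OF this max0_power_deriv[OF assms, unfolded has_field_derivative_def]]
  show ?thesis by (simp add: bump_def[abs_def] power2_norm_eq_inner)
qed

lemma bump_Ck:
  "Ck_on k UNIV (bump (k + m + 1) z \<rho>)"
proof (induction k arbitrary: m)
  case 0
  show ?case unfolding Ck_on_0 bump_def[abs_def] by (intro continuous_intros)
next
  case (Suc k)
  let ?f = "bump (Suc (k + m + 1)) z \<rho>"
  have D: "(?f has_derivative (\<lambda>e. real (Suc (k + m + 1)) * bump (k + m + 1) z \<rho> x * (2 * ((z - x) \<bullet> e)))) (at x)" for x
    by (rule bump_deriv) simp
  have coord: "Ck_on k UNIV (\<lambda>x. 2 * real (Suc (k + m + 1)) * ((z - x) \<bullet> axis i 1))" for i :: 'a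
  proof -
    have d: "((\<lambda>x. 2 * real (Suc (k + m + 1)) * ((z - x) \<bullet> axis i 1)) has_derivative
       (\<lambda>e. 2 * real (Suc (k + m + 1)) * (- e \<bullet> axis i 1))) (at x)" for x
      by (auto intro!: derivative_eq_intros)
    have "partial_deriv j (\<lambda>x. 2 * real (Suc (k + m + 1)) * ((z - x) \<bullet> axis i 1)) =
        (\<lambda>x. 2 * real (Suc (k + m + 1)) * (- axis j 1 \<bullet> axis i (1::real)))" for j
      by (rule ext) (rule partial_derivI[OF d])
    then have "Ck_on (Suc k) UNIV (\<lambda>x. 2 * real (Suc (k + m + 1)) * ((z - x) \<bullet> axis i 1))"
      using d unfolding Ck_on_Suc differentiable_def
      by (auto simp: Ck_on_const intro!: continuous_intros)
    then show ?thesis by (rule Ck_on_Suc_imp)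
  qed
  have "partial_deriv i ?f = (\<lambda>x. 2 * real (Suc (k + m + 1)) * ((z - x) \<bullet> axis i 1) * bump (k + m + 1) z \<rho> x)" for i
    using partial_derivI[OF D] by (simp add: fun_eq_iff)
  then have "Ck_on k UNIV (partial_deriv i ?f)" for i
    using Ck_on_mult[OF open_UNIV coord Suc[of m], of i] by simp
  moreover have "continuous_on UNIV ?f" unfolding bump_def[abs_def] by (intro continuous_intros)
  ultimately show ?case using D unfolding add_Suc Ck_on_Suc differentiable_def by auto
qed

lemma bump_nonneg: "bump m z \<rho> x \<ge> 0"
  by (simp add: bump_def)

lemma bump_pos: "norm (x - z) < \<rho> \<Longrightarrow> bump m z \<rho> x > 0"
  using power_strict_mono[of "norm (x - z)" \<rho> 2] by (simp add: bump_def max_def)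

lemma bump_zero:
  assumes "m \<ge> 1" "\<rho> \<ge> 0" "norm (x - z) \<ge> \<rho>"
  shows "bump m z \<rho> x = 0"
  using assms power_mono[of \<rho> "norm (x - z)" 2] by (simp add: bump_def max_def)

section \<open>The geodesic spray\<close>

definition spray :: "(real ^ 'n::finite \<Rightarrow> real ^ 'n ^ 'n) \<Rightarrow> real ^ 'n \<Rightarrow> real ^ 'n \<Rightarrow> real ^ 'n" where
  "spray g x v = (\<chi> k. - (\<Sum>i\<in>UNIV. \<Sum>j\<in>UNIV. christoffel g x k i j * v $ i * v $ j))"

lemma matrix_inv_works:
  assumes "invertible (A :: real ^ 'n::finite ^ 'n)"
  shows "A ** matrix_inv A = mat 1" "matrix_inv A ** A = mat 1"
  using someI_ex[OF assms[unfolded invertible_def]] by (simp_all add: matrix_inv_def)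

lemma matrix_inv_eqI:
  assumes "A ** B = mat 1" "B ** A = mat 1"
  shows "matrix_inv A = (B :: real ^ 'n::finite ^ 'n)"
proof -
  have "invertible A" using assms by (auto simp: invertible_def)
  have "matrix_inv A = matrix_inv A ** (A ** B)" by (simp add: assms)
  also have "\<dots> = B" by (simp add: matrix_mul_assoc matrix_inv_works[OF \<open>invertible A\<close>])
  finally show ?thesis .
qed

lemma matrix_inv_scaleR:
  assumes "invertible (A :: real ^ 'n::finite ^ 'n)" "c \<noteq> 0"
  shows "matrix_inv (c *\<^sub>R A) = (1 / c) *\<^sub>R matrix_inv A" "invertible (c *\<^sub>R A)"
proof -
  have *: "(c *\<^sub>R A) ** ((1 / c) *\<^sub>R matrix_inv A) = mat 1" "((1 / c) *\<^sub>R matrix_inv A) ** (c *\<^sub>R A) = mat 1"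
    using matrix_inv_works[OF assms(1)] assms(2)
    by (simp_all add: matrix_scaleR_vector_ac scalar_matrix_assoc[symmetric] matrix_scalar_ac scalar_mult_eq_scaleR)
  then show "matrix_inv (c *\<^sub>R A) = (1 / c) *\<^sub>R matrix_inv A" by (rule matrix_inv_eqI)
  show "invertible (c *\<^sub>R A)" using * by (auto simp: invertible_def)
qed

lemma matrix_inv_entries:
  assumes "invertible (A :: real ^ 'n::finite ^ 'n)"
  shows "(\<Sum>l\<in>UNIV. A $ i $ l * matrix_inv A $ l $ j) = (if i = j then 1 else 0)"
    "(\<Sum>l\<in>UNIV. matrix_inv A $ i $ l * A $ l $ j) = (if i = j then 1 else 0)"
  using matrix_inv_works[OF assms]
  by (simp_all add: vec_eq_iff matrix_matrix_mult_def mat_def)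

text \<open>A column w of the inverse of A satisfies A0 w = e_j - (A - A0) w. Applying the inverse
  of A0 gives S \<le> b + S / 2 for the l1 norm S of w, once the entries of A - A0 are below 1 / (2
  b).\<close>

lemma matrix_inv_bound_near:
  fixes A0 :: "real ^ 'n::finite ^ 'n"
  assumes "invertible A0"
  obtains \<delta> B where "\<delta> > 0" "B \<ge> 1"
    "\<And>A i j. invertible A \<Longrightarrow> (\<And>k l. \<bar>A $ k $ l - A0 $ k $ l\<bar> < \<delta>) \<Longrightarrow> \<bar>matrix_inv A $ i $ j\<bar> \<le> B"
proof -
  define b where "b = (\<Sum>i\<in>UNIV. \<Sum>j\<in>UNIV. \<bar>matrix_inv A0 $ i $ j\<bar>) + 1"
  have b1: "b \<ge> 1" unfolding b_def by (simp add: sum_nonneg)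
  have "\<bar>matrix_inv A $ i $ j\<bar> \<le> 2 * b"
    if A: "invertible A" and cl: "\<And>k l. \<bar>A $ k $ l - A0 $ k $ l\<bar> < 1 / (2 * b)" for A :: "real ^ 'n ^ 'n" and i j
  proof -
    define w where "w k = matrix_inv A $ k $ j" for k
    define S where "S = (\<Sum>k\<in>UNIV. \<bar>w k\<bar>)"
    define e where "e l = (\<Sum>m\<in>UNIV. A0 $ l $ m * w m)" for l
    have e: "\<bar>e l\<bar> \<le> (if l = j then 1 else 0) + S / (2 * b)" for l
    proof -
      have "e l = (if l = j then 1 else 0) - (\<Sum>m\<in>UNIV. (A $ l $ m - A0 $ l $ m) * w m)"
        using matrix_inv_entries(1)[OF A, of l j]
        by (simp add: e_def w_def left_diff_distrib sum_subtractf)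
      moreover have "\<bar>\<Sum>m\<in>UNIV. (A $ l $ m - A0 $ l $ m) * w m\<bar> \<le> (\<Sum>m\<in>UNIV. 1 / (2 * b) * \<bar>w m\<bar>)"
        unfolding abs_mult[symmetric]
        by (rule order_trans[OF sum_abs], rule sum_mono, unfold abs_mult)
           (intro mult_right_mono less_imp_le[OF cl] abs_ge_zero)
      ultimately show ?thesis by (auto simp: S_def sum_distrib_left[symmetric] sum_divide_distrib[symmetric])
    qed
    have "(\<Sum>l\<in>UNIV. matrix_inv A0 $ k $ l * e l) = w k" for k
    proof -
      have "(\<Sum>l\<in>UNIV. matrix_inv A0 $ k $ l * e l) =
        (\<Sum>m\<in>UNIV. (\<Sum>l\<in>UNIV. matrix_inv A0 $ k $ l * A0 $ l $ m) * w m)"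
        unfolding e_def sum_distrib_left sum_distrib_right
        by (subst sum.swap) (simp add: mult.assoc)
      then show ?thesis by (simp add: matrix_inv_entries(2)[OF assms] if_distrib[of "\<lambda>c. c * _"] cong: if_cong)
    qed
    note w = this
    have Sn: "S \<ge> 0" by (simp add: S_def sum_nonneg)
    have "\<bar>w k\<bar> \<le> (\<Sum>l\<in>UNIV. \<bar>matrix_inv A0 $ k $ l\<bar> * (1 + S / (2 * b)))" for k
    proof -
      have "\<bar>w k\<bar> \<le> (\<Sum>l\<in>UNIV. \<bar>matrix_inv A0 $ k $ l * e l\<bar>)" unfolding w[symmetric] by (rule sum_abs)
      also have "\<dots> \<le> (\<Sum>l\<in>UNIV. \<bar>matrix_inv A0 $ k $ l\<bar> * (1 + S / (2 * b)))"
      proof (rule sum_mono)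
        fix l
        have "\<bar>e l\<bar> \<le> 1 + S / (2 * b)" using e[of l] by (auto split: if_splits)
        then show "\<bar>matrix_inv A0 $ k $ l * e l\<bar> \<le> \<bar>matrix_inv A0 $ k $ l\<bar> * (1 + S / (2 * b))"
          unfolding abs_mult by (intro mult_left_mono) auto
      qed
      finally show ?thesis .
    qed
    then have "S \<le> (\<Sum>k\<in>UNIV. \<Sum>l\<in>UNIV. \<bar>matrix_inv A0 $ k $ l\<bar> * (1 + S / (2 * b)))"
      unfolding S_def by (intro sum_mono)
    also have "\<dots> = (b - 1) * (1 + S / (2 * b))" by (simp add: b_def sum_distrib_right)
    also have "\<dots> \<le> b * (1 + S / (2 * b))" using Sn b1 by (intro mult_right_mono) auto
    also have "\<dots> = b + S / 2" using b1 by (simp add: field_simps)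
    finally have "S \<le> 2 * b" by simp
    moreover have "\<bar>w i\<bar> \<le> S" unfolding S_def by (intro member_le_sum) auto
    ultimately show ?thesis by (simp add: w_def)
  qed
  then show ?thesis using that[of "1 / (2 * b)" "2 * b"] b1 by auto
qed

lemma matrix_mult_diff_right: "A ** (B - C) = A ** B - A ** (C :: real ^ 'n ^ 'm :: finite)"
  by (simp add: matrix_matrix_mult_def vec_eq_iff sum_subtractf algebra_simps)

lemma matrix_mult_diff_left: "(A - B) ** C = A ** C - B ** (C :: real ^ 'n ^ 'm :: finite)"
  by (simp add: matrix_matrix_mult_def vec_eq_iff sum_subtractf algebra_simps)

text \<open>Resolvent identity: the difference of the inverses is the inverse of A times (A' - A)
  times the inverse of A'.\<close>

lemma matrix_inv_close:
  fixes A :: "real ^ 'n::finite ^ 'n"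
  assumes "invertible A" "invertible A'" "\<And>i j. \<bar>matrix_inv A $ i $ j\<bar> \<le> B" "\<And>i j. \<bar>matrix_inv A' $ i $ j\<bar> \<le> B"
    "\<And>i j. \<bar>A $ i $ j - A' $ i $ j\<bar> \<le> e"
  shows "\<bar>matrix_inv A $ i $ j - matrix_inv A' $ i $ j\<bar> \<le> (real CARD('n))\<^sup>2 * B\<^sup>2 * e"
proof -
  have B: "B \<ge> 0" using assms(3)[of i j] by linarith
  have e: "e \<ge> 0" using assms(5)[of i j] by linarith
  have "matrix_inv A ** (A' - A) ** matrix_inv A' = matrix_inv A - matrix_inv A'"
    using matrix_inv_works[OF assms(1)] matrix_inv_works[OF assms(2)]
    by (simp add: matrix_mult_diff_left matrix_mult_diff_right matrix_mul_assoc[symmetric])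
  then have "matrix_inv A $ i $ j - matrix_inv A' $ i $ j =
    (\<Sum>l\<in>UNIV. (\<Sum>k\<in>UNIV. matrix_inv A $ i $ k * (A' $ k $ l - A $ k $ l)) * matrix_inv A' $ l $ j)"
    by (simp add: vec_eq_iff matrix_matrix_mult_def)
  also have "\<bar>\<dots>\<bar> \<le> (\<Sum>l\<in>(UNIV::'n set). (\<Sum>k\<in>(UNIV::'n set). B * e) * B)"
  proof (rule order_trans[OF sum_abs], rule sum_mono)
    fix l
    have "\<bar>\<Sum>k\<in>UNIV. matrix_inv A $ i $ k * (A' $ k $ l - A $ k $ l)\<bar> \<le> (\<Sum>k\<in>(UNIV::'n set). B * e)"
    proof (rule order_trans[OF sum_abs], rule sum_mono)
      fix k
      show "\<bar>matrix_inv A $ i $ k * (A' $ k $ l - A $ k $ l)\<bar> \<le> B * e"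
        unfolding abs_mult using assms(3)[of i k] assms(5)[of k l] B
        by (intro mult_mono) (simp_all add: abs_minus_commute)
    qed
    then show "\<bar>(\<Sum>k\<in>UNIV. matrix_inv A $ i $ k * (A' $ k $ l - A $ k $ l)) * matrix_inv A' $ l $ j\<bar>
      \<le> (\<Sum>k\<in>(UNIV::'n set). B * e) * B"
      unfolding abs_mult using assms(4)[of l j] B e by (intro mult_mono sum_nonneg) auto
  qed
  finally show ?thesis by (simp add: power2_eq_square algebra_simps)
qed

lemma prod_diff_bound:
  fixes a :: real
  assumes "\<bar>a - a'\<bar> \<le> e1" "\<bar>b - b'\<bar> \<le> e2" "\<bar>a'\<bar> \<le> A" "\<bar>b\<bar> \<le> B"
  shows "\<bar>a * b - a' * b'\<bar> \<le> e1 * B + A * e2"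
proof -
  have "a * b - a' * b' = (a - a') * b + a' * (b - b')" by (simp add: algebra_simps)
  also have "\<bar>\<dots>\<bar> \<le> \<bar>a - a'\<bar> * \<bar>b\<bar> + \<bar>a'\<bar> * \<bar>b - b'\<bar>"
    by (metis abs_mult abs_triangle_ineq)
  also have "\<dots> \<le> e1 * B + A * e2" using assms by (intro add_mono mult_mono) auto
  finally show ?thesis .
qed

definition metric_bounded :: "real \<Rightarrow> (real ^ 'n::finite \<Rightarrow> real ^ 'n ^ 'n) \<Rightarrow> real ^ 'n \<Rightarrow> bool" where
  "metric_bounded B g x \<longleftrightarrow> B \<ge> 1 \<and> invertible (g x) \<and> (\<forall>i j. \<bar>matrix_inv (g x) $ i $ j\<bar> \<le> B) \<and>
     (\<forall>i j k. \<bar>partial_deriv k (\<lambda>y. g y $ i $ j) x\<bar> \<le> B)"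

section \<open>Bounds on the spray, uniform over nearby metrics\<close>

lemma christoffel_bound:
  fixes g :: "real ^ 'n::finite \<Rightarrow> real ^ 'n ^ 'n"
  assumes "metric_bounded B g x"
  shows "\<bar>christoffel g x k i j\<bar> \<le> 3 * real CARD('n) * B\<^sup>2"
proof -
  have B: "B \<ge> 1" "\<And>i j. \<bar>matrix_inv (g x) $ i $ j\<bar> \<le> B" "\<And>i j k. \<bar>partial_deriv k (\<lambda>y. g y $ i $ j) x\<bar> \<le> B"
    using assms by (auto simp: metric_bounded_def)
  have "\<bar>christoffel g x k i j\<bar> \<le> (\<Sum>l\<in>(UNIV::'n set). B * (3 * B)) / 2"
    unfolding christoffel_def abs_divide
  proof (simp, rule order_trans[OF sum_abs sum_bounded_above[where K = "B * (3 * B)", simplified]])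
    fix l
    have "\<bar>partial_deriv i (\<lambda>y. g y $ l $ j) x + partial_deriv j (\<lambda>y. g y $ i $ l) x - partial_deriv l (\<lambda>y. g y $ i $ j) x\<bar> \<le> 3 * B"
      using B(3)[of i l j] B(3)[of j i l] B(3)[of l i j] by linarith
    then show "\<bar>matrix_inv (g x) $ k $ l * (partial_deriv i (\<lambda>y. g y $ l $ j) x + partial_deriv j (\<lambda>y. g y $ i $ l) x - partial_deriv l (\<lambda>y. g y $ i $ j) x)\<bar> \<le> B * (3 * B)"
      unfolding abs_mult using B(1,2) by (intro mult_mono) auto
  qed
  also have "\<dots> \<le> 3 * real CARD('n) * B\<^sup>2" by (simp add: power2_eq_square)
  finally show ?thesis .
qed

lemma christoffel_close:
  fixes g g' :: "real ^ 'n::finite \<Rightarrow> real ^ 'n ^ 'n"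
  assumes b: "metric_bounded B g x" "metric_bounded B g' x'"
    and e0: "\<And>i j. \<bar>g x $ i $ j - g' x' $ i $ j\<bar> \<le> e"
    and e1: "\<And>i j k. \<bar>partial_deriv k (\<lambda>y. g y $ i $ j) x - partial_deriv k (\<lambda>y. g' y $ i $ j) x'\<bar> \<le> e"
  shows "\<bar>christoffel g x k i j - christoffel g' x' k i j\<bar> \<le> 3 * real CARD('n) ^ 3 * B ^ 3 * e"
proof -
  let ?n = "real CARD('n)"
  have B: "B \<ge> 1" "\<And>i j. \<bar>matrix_inv (g x) $ i $ j\<bar> \<le> B" "\<And>i j k. \<bar>partial_deriv k (\<lambda>y. g y $ i $ j) x\<bar> \<le> B"
    "\<And>i j. \<bar>matrix_inv (g' x') $ i $ j\<bar> \<le> B" "invertible (g x)" "invertible (g' x')"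
    using b by (auto simp: metric_bounded_def)
  have e: "e \<ge> 0" using e0[of i j] by linarith
  have n1: "?n \<ge> 1" by (simp add: Suc_leI)
  have inv: "\<bar>matrix_inv (g x) $ i $ j - matrix_inv (g' x') $ i $ j\<bar> \<le> ?n\<^sup>2 * B\<^sup>2 * e" for i j
    by (rule matrix_inv_close[OF B(5,6,2,4) e0])
  have nB: "1 \<le> ?n\<^sup>2 * B" using mult_mono[of 1 "?n\<^sup>2" 1 B] n1 B(1) by simp
  define q where "q g x l = partial_deriv i (\<lambda>y. g y $ l $ j) x + partial_deriv j (\<lambda>y. g y $ i $ l) x - partial_deriv l (\<lambda>y. g y $ i $ j) x"
    for g :: "real ^ 'n \<Rightarrow> real ^ 'n ^ 'n" and x l
  have "\<bar>matrix_inv (g x) $ k $ l * q g x l - matrix_inv (g' x') $ k $ l * q g' x' l\<bar> \<le> 6 * ?n\<^sup>2 * B ^ 3 * e" for l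
  proof -
    have "\<bar>q g x l - q g' x' l\<bar> \<le> 3 * e"
      using e1[of i l j] e1[of j i l] e1[of l i j] unfolding q_def by linarith
    moreover have "\<bar>q g x l\<bar> \<le> 3 * B"
      using B(3)[of i l j] B(3)[of j i l] B(3)[of l i j] unfolding q_def by linarith
    ultimately have "\<bar>matrix_inv (g x) $ k $ l * q g x l - matrix_inv (g' x') $ k $ l * q g' x' l\<bar>
      \<le> (?n\<^sup>2 * B\<^sup>2 * e) * (3 * B) + B * (3 * e)"
      by (intro prod_diff_bound inv B)
    also have "B * (3 * e) \<le> B * (3 * e) * ((?n\<^sup>2 * B) * B)"
      using mult_left_mono[of 1 "(?n\<^sup>2 * B) * B" "B * (3 * e)"] mult_mono[of 1 "?n\<^sup>2 * B" 1 B] nB B(1) e by simp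
    finally show ?thesis by (simp add: power2_eq_square power3_eq_cube algebra_simps)
  qed
  then have "(\<Sum>l\<in>UNIV. \<bar>matrix_inv (g x) $ k $ l * q g x l - matrix_inv (g' x') $ k $ l * q g' x' l\<bar>)
    \<le> (\<Sum>l\<in>(UNIV :: 'n set). 6 * ?n\<^sup>2 * B ^ 3 * e)" by (intro sum_mono)
  then have "\<bar>\<Sum>l\<in>UNIV. matrix_inv (g x) $ k $ l * q g x l - matrix_inv (g' x') $ k $ l * q g' x' l\<bar> \<le> 6 * ?n ^ 3 * B ^ 3 * e"
    by (rule order_trans[OF sum_abs order_trans])
       (simp add: power2_eq_square power3_eq_cube algebra_simps)
  then show ?thesis unfolding christoffel_def q_def[symmetric] by (simp add: sum_subtractf)
qed

lemma norm_le_of_components: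
  fixes w :: "real ^ 'n::finite"
  assumes "\<And>k. \<bar>w $ k\<bar> \<le> C"
  shows "norm w \<le> real CARD('n) * C"
  using norm_le_l1_cart[of w] sum_bounded_above[of UNIV "\<lambda>k. \<bar>w $ k\<bar>" C] assms by simp

text \<open>Metric, point and velocity vary together: equal metrics give the Lipschitz estimate of
  \<open>spray_bound\<close>, equal points and velocities the comparison of two metrics.\<close>

lemma spray_diff:
  fixes g g' :: "real ^ 'n::finite \<Rightarrow> real ^ 'n ^ 'n"
  assumes b: "metric_bounded B g x" "metric_bounded B g' x'"
    and e0: "\<And>i j. \<bar>g x $ i $ j - g' x' $ i $ j\<bar> \<le> e"
    and e1: "\<And>i j k. \<bar>partial_deriv k (\<lambda>y. g y $ i $ j) x - partial_deriv k (\<lambda>y. g' y $ i $ j) x'\<bar> \<le> e"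
  shows "norm (spray g x v - spray g' x' v') \<le>
    3 * real CARD('n) ^ 6 * B ^ 3 * (e * (norm v)\<^sup>2 + norm (v - v') * (norm v + norm v'))"
proof -
  let ?n = "real CARD('n)"
  have B: "B \<ge> 1" using b by (simp add: metric_bounded_def)
  have n1: "?n \<ge> 1" by (simp add: Suc_leI)
  have e: "e \<ge> 0" using e0[of undefined undefined] by linarith
  let ?K = "3 * ?n ^ 3 * B ^ 3"
  have K: "3 * ?n * B\<^sup>2 \<le> ?K" using n1 B
    by (intro mult_mono) (auto intro: power_increasing self_le_power)
  define W where "W = norm (v - v') * (norm v + norm v')"
  have ww: "\<bar>v $ i * v $ j - v' $ i * v' $ j\<bar> \<le> W" for i j
  proof -
    have "\<bar>v $ i * v $ j - v' $ i * v' $ j\<bar> \<le> norm (v - v') * norm v + norm v' * norm (v - v')"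
      using component_le_norm_cart[of "v - v'"] component_le_norm_cart[of v] component_le_norm_cart[of v']
      by (intro prod_diff_bound) auto
    then show ?thesis by (simp add: W_def algebra_simps)
  qed
  have "\<bar>christoffel g x k i j * v $ i * v $ j - christoffel g' x' k i j * v' $ i * v' $ j\<bar> \<le> ?K * (e * (norm v)\<^sup>2 + W)" for k i j
  proof -
    have "\<bar>v $ i * v $ j\<bar> \<le> (norm v)\<^sup>2"
      unfolding abs_mult power2_eq_square by (intro mult_mono component_le_norm_cart) auto
    then have "\<bar>christoffel g x k i j * (v $ i * v $ j) - christoffel g' x' k i j * (v' $ i * v' $ j)\<bar> \<le>
       ?K * e * (norm v)\<^sup>2 + 3 * ?n * B\<^sup>2 * W"
      by (intro prod_diff_bound christoffel_close[OF b e0 e1] ww christoffel_bound[OF b(2)])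
    also have "3 * ?n * B\<^sup>2 * W \<le> ?K * W" by (rule mult_right_mono[OF K]) (simp add: W_def)
    finally show ?thesis by (simp add: algebra_simps)
  qed
  note c = this
  have "\<bar>(spray g x v - spray g' x' v') $ k\<bar> \<le> ?n * (?n * (?K * (e * (norm v)\<^sup>2 + W)))" for k
  proof -
    have "(spray g x v - spray g' x' v') $ k = - (\<Sum>i\<in>UNIV. \<Sum>j\<in>UNIV.
       christoffel g x k i j * v $ i * v $ j - christoffel g' x' k i j * v' $ i * v' $ j)"
      by (simp add: spray_def sum_subtractf)
    also have "\<bar>\<dots>\<bar> \<le> (\<Sum>i\<in>(UNIV :: 'n set). \<Sum>j\<in>(UNIV :: 'n set). ?K * (e * (norm v)\<^sup>2 + W))"
      unfolding abs_minus_cancel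
      by (intro order_trans[OF sum_abs] sum_mono c)
    finally show ?thesis by simp
  qed
  then have "norm (spray g x v - spray g' x' v') \<le> ?n * (?n * (?n * (?K * (e * (norm v)\<^sup>2 + W))))"
    by (rule norm_le_of_components)
  then show ?thesis unfolding W_def by (simp add: numeral_eq_Suc algebra_simps)
qed

lemma spray_zero [simp]: "spray g x 0 = 0"
  by (simp add: spray_def vec_eq_iff)

lemma spray_norm:
  fixes g :: "real ^ 'n::finite \<Rightarrow> real ^ 'n ^ 'n"
  assumes "metric_bounded B g x"
  shows "norm (spray g x v) \<le> 3 * real CARD('n) ^ 6 * B ^ 3 * (norm v)\<^sup>2"
  using spray_diff[OF assms assms, of 0 v 0] by (simp add: power2_eq_square)

lemma partial_lipschitz:
  fixes f :: "real ^ 'n::finite \<Rightarrow> real"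
  assumes S: "convex S" and d: "\<And>x. x \<in> S \<Longrightarrow> f differentiable at x"
    and b: "\<And>x i. x \<in> S \<Longrightarrow> \<bar>partial_deriv i f x\<bar> \<le> B" and xy: "x \<in> S" "y \<in> S"
  shows "\<bar>f x - f y\<bar> \<le> real CARD('n) * B * norm (x - y)"
proof -
  have B: "B \<ge> 0" using b[OF xy(1), of undefined] by linarith
  have "norm (f x - f y) \<le> (real CARD('n) * B) * norm (x - y)"
  proof (rule differentiable_bound[OF S _ _ xy])
    fix x assume x: "x \<in> S"
    let ?f = "frechet_derivative f (at x)"
    have "(f has_derivative ?f) (at x)" using d[OF x] frechet_derivative_works by blast
    then show "(f has_derivative ?f) (at x within S)" by (rule has_derivative_at_withinI)
    have lin: "linear ?f" using linear_frechet_derivative[OF d[OF x]] .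
    show "onorm ?f \<le> real CARD('n) * B"
    proof (rule onorm_le)
      fix e
      have "?f e = (\<Sum>i\<in>UNIV. e $ i * partial_deriv i f x)"
      proof -
        have "?f (\<Sum>i\<in>UNIV. e $ i *\<^sub>R axis i 1) = (\<Sum>i\<in>UNIV. e $ i * partial_deriv i f x)"
          by (simp add: linear_sum[OF lin] linear_scale[OF lin] partial_deriv_def)
        moreover have "(\<Sum>i\<in>UNIV. e $ i *\<^sub>R axis i 1) = e"
          by (simp add: vec_eq_iff axis_def if_distrib cong: if_cong)
        ultimately show ?thesis by simp
      qed
      also have "norm \<dots> \<le> (\<Sum>i\<in>(UNIV::'n set). norm e * B)"
        using b[OF x] component_le_norm_cart[of e]
        by (intro order_trans[OF norm_sum] sum_mono) (auto simp: abs_mult intro!: mult_mono)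
      finally show "norm (?f e) \<le> real CARD('n) * B * norm e" by (simp add: algebra_simps)
    qed
  qed
  then show ?thesis by simp
qed

lemma Ck_metric_onD:
  assumes "Ck_metric_on k D g"
  shows "Ck_on k D (\<lambda>x. g x $ i $ j)" "x \<in> D \<Longrightarrow> transpose (g x) = g x" "x \<in> D \<Longrightarrow> invertible (g x)"
  using assms by (auto simp: Ck_metric_on_def)

lemma metric_sym: "Ck_metric_on k D g \<Longrightarrow> x \<in> D \<Longrightarrow> g x $ i $ j = g x $ j $ i"
  using Ck_metric_onD(2)[of k D g x] by (metis transpose_def vec_lambda_beta)

lemma Ck_metric_on_mono:
  assumes g: "Ck_metric_on k D g" and "m \<le> k" "S \<subseteq> D"
  shows "Ck_metric_on m S g"
  unfolding Ck_metric_on_def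
proof (intro conjI allI ballI)
  show "Ck_on m S (\<lambda>x. g x $ i $ j)" for i j
    by (rule Ck_on_subset[OF Ck_on_mono[OF Ck_metric_onD(1)[OF g] assms(2)] assms(3)])
qed (use assms(3) Ck_metric_onD(2,3)[OF g] in auto)

lemma Ck_close_onD:
  assumes "Ck_close_on k D \<epsilon> g h" "x \<in> D" "length I \<le> k"
  shows "\<bar>iter_partial I (\<lambda>y. g y $ i $ j) x - iter_partial I (\<lambda>y. h y $ i $ j) x\<bar> < \<epsilon>"
  using assms unfolding Ck_close_on_def by blast

lemma Ck_close_on_mono:
  assumes "Ck_close_on k D \<epsilon> g h" "m \<le> k" "S \<subseteq> D" "\<epsilon> \<le> \<epsilon>'"
  shows "Ck_close_on m S \<epsilon>' g h"
  unfolding Ck_close_on_def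
proof (intro ballI allI impI)
  fix x i j and I :: "'a list" assume "x \<in> S" "length I \<le> m"
  then show "\<bar>iter_partial I (\<lambda>y. g y $ i $ j) x - iter_partial I (\<lambda>y. h y $ i $ j) x\<bar> < \<epsilon>'"
    using Ck_close_onD[OF assms(1), of x I i j] assms(2-4) by auto
qed

lemma Ck_close_on_refl: "\<epsilon> > 0 \<Longrightarrow> Ck_close_on k D \<epsilon> g g"
  by (simp add: Ck_close_on_def)

lemma Ck_close_on_trans:
  assumes "Ck_close_on k D a g h" "Ck_close_on k D b h f"
  shows "Ck_close_on k D (a + b) g f"
  unfolding Ck_close_on_def
proof (intro ballI allI impI)
  fix x i j I assume *: "x \<in> D" "length (I :: 'a list) \<le> k"
  show "\<bar>iter_partial I (\<lambda>y. g y $ i $ j) x - iter_partial I (\<lambda>y. f y $ i $ j) x\<bar> < a + b"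
    using Ck_close_onD[OF assms(1) *, of i j] Ck_close_onD[OF assms(2) *, of i j] by linarith
qed

lemma C2_metric_partials:
  assumes "Ck_metric_on 2 D g" "x \<in> D"
  shows "(\<lambda>y. g y $ i $ j) differentiable at x" "partial_deriv k (\<lambda>y. g y $ i $ j) differentiable at x"
  using Ck_metric_onD(1)[OF assms(1), of i j] assms(2) by (simp_all add: numeral_2_eq_2 Ck_on_Suc)

text \<open>One choice of \<open>R\<close> and \<open>L\<close> serves all metrics close to
  \<open>g\<close>. Closeness in C^2 is what is used: the Lipschitz constant of the Christoffel
  symbols involves second derivatives of the metric.\<close>

lemma local_spray_bounds:
  fixes g :: "real ^ 'n::finite \<Rightarrow> real ^ 'n ^ 'n"
  assumes g: "Ck_metric_on 2 D g" and D: "open D" and p: "p \<in> D"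
  obtains R L \<epsilon> where "R > 0" "L \<ge> 1" "\<epsilon> > 0" "cball p R \<subseteq> D"
    "\<And>g'. Ck_metric_on 2 D g' \<Longrightarrow> Ck_close_on 2 D \<epsilon> g g' \<Longrightarrow> spray_bound p R L (spray g')"
    "\<And>g' e x v. Ck_metric_on 2 D g' \<Longrightarrow> Ck_close_on 2 D \<epsilon> g g' \<Longrightarrow> Ck_close_on 2 D e g g' \<Longrightarrow> x \<in> cball p R \<Longrightarrow>
       norm (spray g x v - spray g' x v) \<le> L * e * (norm v)\<^sup>2"
proof -
  let ?n = "real CARD('n)"
  obtain \<delta> B0 where \<delta>: "\<delta> > 0" "B0 \<ge> 1"
    "\<And>A i j. invertible A \<Longrightarrow> (\<And>k l. \<bar>A $ k $ l - g p $ k $ l\<bar> < \<delta>) \<Longrightarrow> \<bar>matrix_inv A $ i $ j\<bar> \<le> B0"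
    using matrix_inv_bound_near[OF Ck_metric_onD(3)[OF g p]] by metis
  obtain R1 where R1: "R1 > 0" "cball p R1 \<subseteq> D" using D p open_contains_cball by blast
  have "\<exists>r>0. \<forall>x\<in>D. dist x p < r \<longrightarrow> \<bar>g x $ i $ j - g p $ i $ j\<bar> < \<delta> / 2" for i j
  proof -
    have "continuous_on D (\<lambda>x. g x $ i $ j)"
      using Ck_metric_onD(1)[OF g, of i j] by (simp add: numeral_2_eq_2 Ck_on_Suc)
    then show ?thesis using p \<delta>(1) unfolding continuous_on_iff by (metis dist_real_def half_gt_zero)
  qed
  then obtain r where r: "\<And>i j. r i j > 0" "\<And>i j x. x \<in> D \<Longrightarrow> dist x p < r i j \<Longrightarrow> \<bar>g x $ i $ j - g p $ i $ j\<bar> < \<delta> / 2"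
    by metis
  define R where "R = min R1 (Min ((\<lambda>(i,j). r i j) ` UNIV) / 2)"
  have "Min ((\<lambda>(i,j). r i j) ` UNIV) > 0" using r(1) by (subst Min_gr_iff) auto
  then have R: "R > 0" using R1 by (simp add: R_def)
  have Rr: "R < r i j" for i j
  proof -
    have "Min ((\<lambda>(i,j). r i j) ` UNIV) \<le> r i j" by (rule Min_le) (auto intro!: image_eqI[of _ _ "(i,j)"])
    moreover have "R \<le> Min ((\<lambda>(i,j). r i j) ` UNIV) / 2" unfolding R_def by (rule min.cobounded2)
    ultimately show ?thesis using \<open>Min _ > 0\<close> by linarith
  qed
  have RD: "cball p R \<subseteq> D" using R1(2) by (auto simp: R_def)
  have near: "\<bar>g x $ i $ j - g p $ i $ j\<bar> < \<delta> / 2" if "x \<in> cball p R" for x i j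
    using r(2)[of x i j] Rr[of i j] that RD by (auto simp: dist_commute)
  have "\<exists>M. \<forall>x\<in>cball p R. \<bar>iter_partial I (\<lambda>y. g y $ i $ j) x\<bar> \<le> M" if "length I \<le> 2" for I i j
  proof -
    have "continuous_on (cball p R) (iter_partial I (\<lambda>y. g y $ i $ j))"
      using Ck_metric_onD(1)[OF g, of i j] that RD by (auto simp: Ck_on_def intro: continuous_on_subset)
    then have "bounded (iter_partial I (\<lambda>y. g y $ i $ j) ` cball p R)"
      using compact_cball compact_continuous_image compact_imp_bounded by blast
    then show ?thesis by (auto simp: bounded_iff)
  qed
  then obtain M where M: "\<And>I i j x. length I \<le> 2 \<Longrightarrow> x \<in> cball p R \<Longrightarrow> \<bar>iter_partial I (\<lambda>y. g y $ i $ j) x\<bar> \<le> M I i j"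
    by metis
  have fin: "finite {I :: 'n list. set I \<subseteq> UNIV \<and> length I \<le> 2}" by (rule finite_lists_length_le) simp
  define \<Lambda> where "\<Lambda> = Max ((\<lambda>(I,i,j). M I i j) ` ({I. set I \<subseteq> UNIV \<and> length I \<le> 2} \<times> UNIV \<times> UNIV))"
  have \<Lambda>: "\<bar>iter_partial I (\<lambda>y. g y $ i $ j) x\<bar> \<le> \<Lambda>" if "length I \<le> 2" "x \<in> cball p R" for I i j x
  proof -
    have "M I i j \<le> \<Lambda>" unfolding \<Lambda>_def
      using fin that(1) by (intro Max_ge) (auto intro!: image_eqI[of _ _ "(I,i,j)"])
    with M[OF that, of i j] show ?thesis by simp
  qed
  \<comment> \<open>\<open>\<Lambda>\<close> bounds the derivatives of \<open>g\<close>; the added 1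
    allows for a metric within \<open>\<epsilon> \<le> 1\<close> of it.\<close>
  define B where "B = max B0 (\<Lambda> + 1)"
  have B1: "B \<ge> 1" using \<delta>(2) by (simp add: B_def)
  \<comment> \<open>Half of \<open>\<delta>\<close> is spent on moving from \<open>p\<close> to
    \<open>x\<close>, the other half on changing the metric.\<close>
  define \<epsilon> where "\<epsilon> = min 1 (\<delta> / 2)"
  have \<epsilon>: "\<epsilon> > 0" "\<epsilon> \<le> 1" "\<epsilon> \<le> \<delta> / 2" using \<delta>(1) by (auto simp: \<epsilon>_def)
  define K where "K = 3 * ?n ^ 6 * B ^ 3"
  have n1: "?n \<ge> 1" by (simp add: Suc_leI)
  have "1 * 1 \<le> ?n * B" by (rule mult_mono) (use n1 B1 in auto)
  then have nB: "?n * B \<ge> 1" by (simp only: mult_1)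
  have "1 * 1 \<le> ?n ^ 6 * B ^ 3" by (rule mult_mono) (use one_le_power[OF n1] one_le_power[OF B1] B1 in auto)
  then have "1 \<le> 3 * (?n ^ 6 * B ^ 3)" by linarith
  then have K1: "K \<ge> 1" by (simp only: K_def mult.assoc)
  have part: "\<bar>iter_partial I (\<lambda>y. g' y $ i $ j) x\<bar> \<le> B"
    if g': "Ck_close_on 2 D \<epsilon> g g'" and "length I \<le> 2" "x \<in> cball p R" for g' I i j x
  proof -
    have "\<bar>iter_partial I (\<lambda>y. g y $ i $ j) x - iter_partial I (\<lambda>y. g' y $ i $ j) x\<bar> < \<epsilon>"
      by (rule Ck_close_onD[OF g']) (use that RD in auto)
    with \<Lambda>[OF that(2,3), of i j] \<epsilon>(2) show ?thesis unfolding B_def by linarith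
  qed
  have mb: "metric_bounded B g' x"
    if g': "Ck_metric_on 2 D g'" "Ck_close_on 2 D \<epsilon> g g'" and x: "x \<in> cball p R" for g' x
  proof -
    have "\<bar>g' x $ k $ l - g p $ k $ l\<bar> < \<delta>" for k l
    proof -
      have "\<bar>iter_partial [] (\<lambda>y. g y $ k $ l) x - iter_partial [] (\<lambda>y. g' y $ k $ l) x\<bar> < \<epsilon>"
        by (rule Ck_close_onD[OF g'(2)]) (use x RD in auto)
      then have "\<bar>g x $ k $ l - g' x $ k $ l\<bar> < \<epsilon>" by simp
      then show ?thesis using near[OF x, of k l] \<epsilon>(3) by linarith
    qed
    then have "\<bar>matrix_inv (g' x) $ i $ j\<bar> \<le> B" for i j
      using \<delta>(3)[OF Ck_metric_onD(3)[OF g'(1)], of x i j] x RD by (auto simp: B_def max_def)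
    moreover have "\<bar>partial_deriv k (\<lambda>y. g' y $ i $ j) x\<bar> \<le> B" for i j k
      using part[OF g'(2) _ x, of "[k]" i j] by simp
    ultimately show ?thesis using B1 Ck_metric_onD(3)[OF g'(1)] x RD by (auto simp: metric_bounded_def)
  qed
  define L where "L = K * (?n * B)"
  have "K * 1 \<le> K * (?n * B)" by (rule mult_left_mono[OF nB]) (use K1 in linarith)
  then have LK: "L \<ge> K" by (simp only: L_def mult_1_right)
  show ?thesis
  proof
    show "R > 0" "\<epsilon> > 0" "cball p R \<subseteq> D" using R \<epsilon> RD by auto
    show "L \<ge> 1" using LK K1 by linarith
    fix g' assume g': "Ck_metric_on 2 D g'" "Ck_close_on 2 D \<epsilon> g g'"
    show "spray_bound p R L (spray g')"
      unfolding spray_bound_def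
    proof (intro conjI ballI allI)
      fix x v assume x: "x \<in> cball p R"
      have "norm (spray g' x v) \<le> K * (norm v)\<^sup>2" unfolding K_def by (rule spray_norm[OF mb[OF g' x]])
      also have "\<dots> \<le> L * (norm v)\<^sup>2" using LK by (intro mult_right_mono) auto
      finally show "norm (spray g' x v) \<le> L * (norm v)\<^sup>2" .
      fix x' v' assume x': "x' \<in> cball p R"
      have d0: "\<bar>g' x $ i $ j - g' x' $ i $ j\<bar> \<le> ?n * B * norm (x - x')" for i j
        using C2_metric_partials(1)[OF g'(1)] RD x x' part[OF g'(2), of "[_]"]
        by (intro partial_lipschitz[of "cball p R"]) auto
      have d1: "\<bar>partial_deriv k (\<lambda>y. g' y $ i $ j) x - partial_deriv k (\<lambda>y. g' y $ i $ j) x'\<bar> \<le> ?n * B * norm (x - x')" for i j k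
        using C2_metric_partials(2)[OF g'(1)] RD x x' part[OF g'(2), of "[_,_]"]
        by (intro partial_lipschitz[of "cball p R"]) auto
      have "norm (spray g' x v - spray g' x' v') \<le>
        K * (?n * B * norm (x - x') * (norm v)\<^sup>2 + norm (v - v') * (norm v + norm v'))"
        unfolding K_def by (rule spray_diff[OF mb[OF g' x] mb[OF g' x'] d0 d1])
      also have "\<dots> \<le> K * ((?n * B) * (norm (x - x') * (norm v)\<^sup>2 + norm (v - v') * (norm v + norm v')))"
      proof (rule mult_left_mono)
        show "?n * B * norm (x - x') * (norm v)\<^sup>2 + norm (v - v') * (norm v + norm v')
          \<le> (?n * B) * (norm (x - x') * (norm v)\<^sup>2 + norm (v - v') * (norm v + norm v'))"
          using mult_right_mono[OF nB, of "norm (v - v') * (norm v + norm v')"]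
          by (simp add: distrib_left mult.assoc)
      qed (use K1 in simp)
      also have "\<dots> = L * (norm (x - x') * (norm v)\<^sup>2 + norm (v - v') * (norm v + norm v'))"
        by (simp only: L_def mult.assoc)
      finally show "norm (spray g' x v - spray g' x' v') \<le>
        L * (norm (x - x') * (norm v)\<^sup>2 + norm (v - v') * (norm v + norm v'))" .
    qed
    fix e x v assume e: "Ck_close_on 2 D e g g'" and x: "x \<in> cball p R"
    have cl: "\<bar>iter_partial I (\<lambda>y. g y $ i $ j) x - iter_partial I (\<lambda>y. g' y $ i $ j) x\<bar> \<le> e" if "length I \<le> 2" for I i j
      by (rule less_imp_le, rule Ck_close_onD[OF e]) (use x RD that in auto)
    have e0: "e \<ge> 0" using cl[of "[]" undefined undefined] by simp
    have "norm (spray g x v - spray g' x v) \<le> K * (e * (norm v)\<^sup>2 + norm (v - v) * (norm v + norm v))"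
      unfolding K_def using cl[of "[]"] cl[of "[_]"]
      by (intro spray_diff mb[OF g _ x] mb[OF g' x] Ck_close_on_refl \<epsilon>(1)) auto
    also have "\<dots> \<le> L * e * (norm v)\<^sup>2" using LK e0 by (simp add: mult.assoc mult_right_mono)
    finally show "norm (spray g x v - spray g' x v) \<le> L * e * (norm v)\<^sup>2" .
  qed
qed

section \<open>Conservation of energy and conformal change of the spray\<close>

lemma has_real_derivative_along_curve:
  fixes f :: "real ^ 'n::finite \<Rightarrow> real"
  assumes f: "f differentiable at (c t)" and c: "(c has_vector_derivative v) (at t)"
  shows "((\<lambda>s. f (c s)) has_real_derivative (\<Sum>k\<in>UNIV. v $ k * partial_deriv k f (c t))) (at t)"
proof -
  let ?f = "frechet_derivative f (at (c t))"
  have lin: "linear ?f" using linear_frechet_derivative[OF f] .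
  have "?f (\<Sum>k\<in>UNIV. v $ k *\<^sub>R axis k 1) = (\<Sum>k\<in>UNIV. v $ k * partial_deriv k f (c t))"
    by (simp add: linear_sum[OF lin] linear_scale[OF lin] partial_deriv_def)
  moreover have "(\<Sum>k\<in>UNIV. v $ k *\<^sub>R axis k 1) = v"
    by (simp add: vec_eq_iff axis_def if_distrib cong: if_cong)
  ultimately have "?f v = (\<Sum>k\<in>UNIV. v $ k * partial_deriv k f (c t))" by simp
  moreover have "((\<lambda>s. f (c s)) has_derivative (\<lambda>h. ?f (h *\<^sub>R v))) (at t)"
    using has_derivative_compose[OF c[unfolded has_vector_derivative_def] f[unfolded frechet_derivative_works]] .
  ultimately show ?thesis
    by (simp add: has_field_derivative_def linear_scale[OF lin] mult.commute[of _ "\<Sum>k\<in>UNIV. _ k"])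
qed

lemma geodesic_on_spray:
  "geodesic_on D g T c v \<longleftrightarrow> open T \<and> is_interval T \<and>
     (\<forall>t\<in>T. c t \<in> D \<and> (c has_vector_derivative v t) (at t) \<and>
        (v has_vector_derivative spray g (c t) (v t)) (at t))"
  by (simp add: geodesic_on_def spray_def)

text \<open>These are the Christoffel symbols of the first kind; the inverse matrix has
  cancelled.\<close>

lemma lower_christoffel:
  assumes "invertible (g x)"
  shows "(\<Sum>k\<in>UNIV. g x $ j $ k * christoffel g x k l m) =
    (partial_deriv l (\<lambda>y. g y $ j $ m) x + partial_deriv m (\<lambda>y. g y $ l $ j) x
      - partial_deriv j (\<lambda>y. g y $ l $ m) x) / 2"
proof -
  define X where "X p = (partial_deriv l (\<lambda>y. g y $ p $ m) x + partial_deriv m (\<lambda>y. g y $ l $ p) x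
      - partial_deriv p (\<lambda>y. g y $ l $ m) x) / 2" for p
  have "(\<Sum>k\<in>UNIV. g x $ j $ k * christoffel g x k l m) =
    (\<Sum>k\<in>UNIV. \<Sum>p\<in>UNIV. g x $ j $ k * matrix_inv (g x) $ k $ p * X p)"
    by (simp add: christoffel_def X_def sum_distrib_left sum_divide_distrib mult.assoc)
  also have "\<dots> = (\<Sum>p\<in>UNIV. (\<Sum>k\<in>UNIV. g x $ j $ k * matrix_inv (g x) $ k $ p) * X p)"
    by (subst sum.swap) (simp add: sum_distrib_right)
  also have "\<dots> = X j"
    by (simp add: matrix_inv_entries(1)[OF assms] if_distrib[of "\<lambda>c. c * _"] cong: if_cong)
  finally show ?thesis by (simp add: X_def)
qed

lemma qform_sum: "qform G v = (\<Sum>i\<in>UNIV. \<Sum>j\<in>UNIV. v $ i * (G $ i $ j * v $ j))"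
  by (simp add: qform_def inner_vec_def matrix_vector_mult_def sum_distrib_left)

text \<open>The derivative is 2 S + C, where C is the derivative of the metric contracted with three
  velocities and S pairs velocity and acceleration. In S, the three terms of the Christoffel symbol
  of the first kind contract to C each, so S = - C / 2.\<close>

lemma energy_conserved:
  fixes g :: "real ^ 'n::finite \<Rightarrow> real ^ 'n ^ 'n"
  assumes g: "Ck_metric_on 2 D g" and c: "geodesic_on D g T c v" and t: "t \<in> T"
  shows "((\<lambda>t. qform (g (c t)) (v t)) has_real_derivative 0) (at t)"
proof -
  have ct: "c t \<in> D" and dc: "(c has_vector_derivative v t) (at t)"
    and dv: "(v has_vector_derivative spray g (c t) (v t)) (at t)"
    using c t by (auto simp: geodesic_on_spray)
  define w where "w = v t"
  define a where "a = spray g (c t) w"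
  define G where "G = g (c t)"
  define d where "d k i j = partial_deriv k (\<lambda>y. g y $ i $ j) (c t)" for k i j
  have sym: "G $ i $ j = G $ j $ i" for i j unfolding G_def by (rule metric_sym[OF g ct])
  have inv: "invertible (g (c t))" using Ck_metric_onD(3)[OF g ct] .
  have dv': "((\<lambda>t. v t $ i) has_real_derivative a $ i) (at t)" for i
    using bounded_linear.has_vector_derivative[OF bounded_linear_vec_nth dv]
    by (simp add: has_real_derivative_iff_has_vector_derivative a_def w_def)
  have dg: "((\<lambda>t. g (c t) $ i $ j) has_real_derivative (\<Sum>k\<in>UNIV. w $ k * d k i j)) (at t)" for i j
    using has_real_derivative_along_curve[OF C2_metric_partials(1)[OF g ct] dc] by (simp add: w_def d_def)
  have "((\<lambda>t. qform (g (c t)) (v t)) has_real_derivative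
      (\<Sum>i\<in>UNIV. \<Sum>j\<in>UNIV. a $ i * (G $ i $ j * w $ j) + ((\<Sum>k\<in>UNIV. w $ k * d k i j) * w $ j + a $ j * G $ i $ j) * w $ i)) (at t)"
    unfolding qform_sum w_def G_def
    by (intro DERIV_sum DERIV_mult dv' dg[unfolded w_def])
  moreover have "(\<Sum>i\<in>UNIV. \<Sum>j\<in>UNIV. a $ i * (G $ i $ j * w $ j) + ((\<Sum>k\<in>UNIV. w $ k * d k i j) * w $ j + a $ j * G $ i $ j) * w $ i) = 0"
  proof -
    define h where "h i j k = w $ i * w $ j * w $ k * d k i j" for i j k
    define C where "C = (\<Sum>i\<in>UNIV. \<Sum>j\<in>UNIV. \<Sum>k\<in>UNIV. h i j k)"
    define S where "S = (\<Sum>i\<in>UNIV. \<Sum>j\<in>UNIV. a $ i * (G $ i $ j * w $ j))"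
    have "(\<Sum>i\<in>UNIV. \<Sum>j\<in>UNIV. a $ j * G $ i $ j * w $ i) = S"
      unfolding S_def by (subst sum.swap) (simp add: sym mult.assoc)
    moreover have "(\<Sum>i\<in>UNIV. \<Sum>j\<in>UNIV. (\<Sum>k\<in>UNIV. w $ k * d k i j) * w $ j * w $ i) = C"
      unfolding C_def h_def sum_distrib_right by (simp add: algebra_simps)
    moreover have "S = - C / 2"
    proof -
      have low: "(\<Sum>i\<in>UNIV. G $ j $ i * a $ i) = - (\<Sum>l\<in>UNIV. \<Sum>m\<in>UNIV. (d l j m + d m l j - d j l m) / 2 * w $ l * w $ m)" for j
      proof -
        have "(\<Sum>i\<in>UNIV. G $ j $ i * a $ i) =
          - (\<Sum>i\<in>UNIV. \<Sum>l\<in>UNIV. \<Sum>m\<in>UNIV. G $ j $ i * christoffel g (c t) i l m * w $ l * w $ m)"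
          by (simp add: a_def spray_def sum_negf sum_distrib_left mult.assoc)
        also have "(\<Sum>i\<in>UNIV. \<Sum>l\<in>UNIV. \<Sum>m\<in>UNIV. G $ j $ i * christoffel g (c t) i l m * w $ l * w $ m) =
          (\<Sum>l\<in>UNIV. \<Sum>m\<in>UNIV. (\<Sum>i\<in>UNIV. G $ j $ i * christoffel g (c t) i l m) * w $ l * w $ m)"
          unfolding sum_distrib_right
          by (subst sum.swap, rule sum.cong[OF refl], subst sum.swap, rule refl)
        finally show ?thesis unfolding G_def lower_christoffel[where g=g and x="c t", OF inv] d_def .
      qed
      have "S = (\<Sum>j\<in>UNIV. w $ j * (\<Sum>i\<in>UNIV. G $ j $ i * a $ i))"
        unfolding S_def by (subst sum.swap) (simp add: sum_distrib_left sym[of _ "_"] algebra_simps)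
      also have "\<dots> = - ((\<Sum>j\<in>UNIV. \<Sum>l\<in>UNIV. \<Sum>m\<in>UNIV. h j m l) + (\<Sum>j\<in>UNIV. \<Sum>l\<in>UNIV. \<Sum>m\<in>UNIV. h l j m)
         - (\<Sum>j\<in>UNIV. \<Sum>l\<in>UNIV. \<Sum>m\<in>UNIV. h l m j)) / 2"
        unfolding low h_def
        by (simp add: sum_distrib_left sum_negf sum_divide_distrib[symmetric] sum.distrib[symmetric] sum_subtractf[symmetric] algebra_simps)
      also have "(\<Sum>j\<in>UNIV. \<Sum>l\<in>UNIV. \<Sum>m\<in>UNIV. h j m l) = C"
        unfolding C_def by (rule sum.cong[OF refl], rule sum.swap)
      also have "(\<Sum>j\<in>UNIV. \<Sum>l\<in>UNIV. \<Sum>m\<in>UNIV. h l j m) = C"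
        unfolding C_def by (rule sum.swap)
      also have "(\<Sum>j\<in>UNIV. \<Sum>l\<in>UNIV. \<Sum>m\<in>UNIV. h l m j) = C"
        unfolding C_def by (subst sum.swap, rule sum.cong[OF refl], rule sum.swap)
      finally show ?thesis by simp
    qed
    ultimately show ?thesis
      by (simp add: distrib_right sum.distrib S_def[symmetric])
  qed
  ultimately show ?thesis by simp
qed

definition gradient :: "(real ^ 'n::finite \<Rightarrow> real ^ 'n ^ 'n) \<Rightarrow> (real ^ 'n \<Rightarrow> real) \<Rightarrow> real ^ 'n \<Rightarrow> real ^ 'n" where
  "gradient g f' x = (\<chi> k. \<Sum>l\<in>UNIV. matrix_inv (g x) $ k $ l * f' (axis l 1))"

text \<open>The classical conformal change of Christoffel symbols. The term along \<open>v\<close>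
  only reparametrizes geodesics; the gradient term bends them.\<close>

lemma spray_conformal:
  fixes g :: "real ^ 'n::finite \<Rightarrow> real ^ 'n ^ 'n"
  assumes inv: "invertible (g x)" and dg: "\<And>i j. (\<lambda>y. g y $ i $ j) differentiable at x"
    and f: "(f has_derivative f') (at x)" and nz: "1 + f x \<noteq> 0"
    and sym: "\<And>i j. g x $ i $ j = g x $ j $ i"
  shows "spray (\<lambda>y. (1 + f y) *\<^sub>R g y) x v = spray g x v
    - (1 / (1 + f x)) *\<^sub>R (f' v *\<^sub>R v - (qform (g x) v / 2) *\<^sub>R gradient g f' x)"
proof -
  define u where "u = 1 + f x"
  define F where "F k = f' (axis k 1)" for k
  define G where "G = g x"
  define H where "H = matrix_inv G"
  have u: "u \<noteq> 0" using nz by (simp add: u_def)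
  have lin: "linear f'" using f has_derivative_linear by blast
  have f'v: "f' v = (\<Sum>i\<in>UNIV. F i * v $ i)"
  proof -
    have "(\<Sum>i\<in>UNIV. v $ i *\<^sub>R axis i 1) = v"
      by (simp add: vec_eq_iff axis_def if_distrib cong: if_cong)
    moreover have "f' (\<Sum>i\<in>UNIV. v $ i *\<^sub>R axis i 1) = (\<Sum>i\<in>UNIV. F i * v $ i)"
      by (simp add: linear_sum[OF lin] linear_scale[OF lin] F_def mult.commute)
    ultimately show ?thesis by simp
  qed
  have dp: "partial_deriv k (\<lambda>y. ((1 + f y) *\<^sub>R g y) $ i $ j) x = u * partial_deriv k (\<lambda>y. g y $ i $ j) x + F k * G $ i $ j" for i j k
  proof -
    have "((\<lambda>y. 1 + f y) has_derivative f') (at x)" using f by (auto intro!: derivative_eq_intros)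
    then have *: "(\<lambda>y. 1 + f y) differentiable at x" "partial_deriv k (\<lambda>y. 1 + f y) x = F k"
      using partial_derivI by (auto simp: differentiable_def F_def)
    show ?thesis using partial_deriv_mult[OF *(1) dg, of k i j] *(2) by (simp add: u_def G_def)
  qed
  have inv_u: "matrix_inv ((1 + f x) *\<^sub>R g x) = (1 / u) *\<^sub>R H"
    using matrix_inv_scaleR(1)[OF inv nz] by (simp add: u_def H_def G_def)
  have HG: "(\<Sum>l\<in>UNIV. H $ k $ l * G $ l $ j) = (if k = j then 1 else 0)" for k j
    using matrix_inv_entries(2)[OF inv] by (simp add: H_def G_def)
  have chr: "christoffel (\<lambda>y. (1 + f y) *\<^sub>R g y) x k i j = christoffel g x k i j
    + (F i * (if k = j then 1 else 0) + F j * (if k = i then 1 else 0) - G $ i $ j * gradient g f' x $ k) / (2 * u)" for k i j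
  proof -
    define X where "X l = partial_deriv i (\<lambda>y. g y $ l $ j) x + partial_deriv j (\<lambda>y. g y $ i $ l) x - partial_deriv l (\<lambda>y. g y $ i $ j) x" for l
    have "christoffel (\<lambda>y. (1 + f y) *\<^sub>R g y) x k i j =
      (\<Sum>l\<in>UNIV. (1 / u * H $ k $ l) * (u * X l + (F i * G $ l $ j + F j * G $ i $ l - F l * G $ i $ j))) / 2"
      unfolding christoffel_def inv_u dp X_def by (simp add: algebra_simps)
    also have "(\<Sum>l\<in>UNIV. (1 / u * H $ k $ l) * (u * X l + (F i * G $ l $ j + F j * G $ i $ l - F l * G $ i $ j))) =
       (\<Sum>l\<in>UNIV. H $ k $ l * X l) + (F i * (\<Sum>l\<in>UNIV. H $ k $ l * G $ l $ j)
        + F j * (\<Sum>l\<in>UNIV. H $ k $ l * G $ l $ i) - G $ i $ j * (\<Sum>l\<in>UNIV. H $ k $ l * F l)) / u"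
    proof -
      have "(1 / u * H $ k $ l) * (u * X l + (F i * G $ l $ j + F j * G $ i $ l - F l * G $ i $ j)) =
        H $ k $ l * X l + (F i * (H $ k $ l * G $ l $ j) + F j * (H $ k $ l * G $ l $ i) - G $ i $ j * (H $ k $ l * F l)) / u" for l
        using u sym[of i l] by (simp add: G_def field_simps)
      then show ?thesis
        by (simp add: sum.distrib sum_subtractf sum_distrib_left[symmetric] sum_divide_distrib[symmetric])
    qed
    also have "(\<Sum>l\<in>UNIV. H $ k $ l * F l) = gradient g f' x $ k"
      by (simp add: gradient_def H_def G_def F_def)
    finally have "christoffel (\<lambda>y. (1 + f y) *\<^sub>R g y) x k i j = ((\<Sum>l\<in>UNIV. H $ k $ l * X l)
      + (F i * (if k = j then 1 else 0) + F j * (if k = i then 1 else 0) - G $ i $ j * gradient g f' x $ k) / u) / 2"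
      unfolding HG .
    also have "\<dots> = (\<Sum>l\<in>UNIV. H $ k $ l * X l) / 2
      + (F i * (if k = j then 1 else 0) + F j * (if k = i then 1 else 0) - G $ i $ j * gradient g f' x $ k) / (2 * u)"
      by (simp only: add_divide_distrib divide_divide_eq_left mult.commute[of u 2])
    finally show ?thesis by (simp only: christoffel_def X_def H_def G_def)
  qed
  show ?thesis
  proof (rule vec_eq_iff[THEN iffD2], rule allI)
    fix k
    have "spray (\<lambda>y. (1 + f y) *\<^sub>R g y) x v $ k = - (\<Sum>i\<in>UNIV. \<Sum>j\<in>UNIV. christoffel g x k i j * v $ i * v $ j)
      - (\<Sum>i\<in>UNIV. \<Sum>j\<in>UNIV. (F i * (if k = j then 1 else 0) + F j * (if k = i then 1 else 0) - G $ i $ j * gradient g f' x $ k) * v $ i * v $ j) / (2 * u)"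
      unfolding spray_def chr
      by (simp add: distrib_right sum.distrib sum_divide_distrib)
    also have "(\<Sum>i\<in>UNIV. \<Sum>j\<in>UNIV. (F i * (if k = j then 1 else 0) + F j * (if k = i then 1 else 0) - G $ i $ j * gradient g f' x $ k) * v $ i * v $ j)
      = 2 * f' v * v $ k - qform G v * gradient g f' x $ k"
    proof -
      have "(\<Sum>i\<in>UNIV. \<Sum>j\<in>UNIV. F i * (if k = j then 1 else 0) * v $ i * v $ j) = f' v * v $ k"
      proof -
        have "(\<Sum>j\<in>UNIV. F i * (if k = j then 1 else 0) * v $ i * v $ j) = F i * v $ i * v $ k" for i
        proof -
          have "(\<Sum>j\<in>UNIV. F i * (if k = j then 1 else 0) * v $ i * v $ j) = (\<Sum>j\<in>UNIV. if k = j then F i * v $ i * v $ j else 0)"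
            by (rule sum.cong) auto
          then show ?thesis by simp
        qed
        then show ?thesis by (simp add: f'v sum_distrib_right)
      qed
      moreover have "(\<Sum>i\<in>UNIV. \<Sum>j\<in>UNIV. F j * (if k = i then 1 else 0) * v $ i * v $ j) = f' v * v $ k"
      proof -
        have "(\<Sum>i\<in>UNIV. \<Sum>j\<in>UNIV. F j * (if k = i then 1 else 0) * v $ i * v $ j) =
          (\<Sum>i\<in>UNIV. if k = i then (\<Sum>j\<in>UNIV. F j * v $ i * v $ j) else 0)"
          by (rule sum.cong) auto
        also have "\<dots> = f' v * v $ k" unfolding f'v sum_distrib_right by simp (simp add: algebra_simps)
        finally show ?thesis .
      qed
      moreover have "(\<Sum>i\<in>UNIV. \<Sum>j\<in>UNIV. G $ i $ j * gradient g f' x $ k * v $ i * v $ j) = qform G v * gradient g f' x $ k"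
        unfolding qform_sum sum_distrib_right by (intro sum.cong refl) simp
      ultimately show ?thesis by (simp add: distrib_right left_diff_distrib sum.distrib sum_subtractf)
    qed
    also have "(2 * f' v * v $ k - qform G v * gradient g f' x $ k) / (2 * u) =
      1 / u * (f' v * v $ k - qform G v / 2 * gradient g f' x $ k)" using u by (simp add: field_simps)
    finally show "spray (\<lambda>y. (1 + f y) *\<^sub>R g y) x v $ k = (spray g x v
      - (1 / (1 + f x)) *\<^sub>R (f' v *\<^sub>R v - (qform (g x) v / 2) *\<^sub>R gradient g f' x)) $ k"
      by (simp add: spray_def u_def G_def)
  qed
qed

section \<open>Functions on the tangent bundle that are constant along geodesics\<close>

text \<open>With lowered indices, a polynomial integral is a function of position and velocity.\<close>

definition killing :: "nat \<Rightarrow> (real ^ 'n::finite) set \<Rightarrow> (real ^ 'n \<Rightarrow> real ^ 'n ^ 'n) \<Rightarrow>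
   (real ^ 'n \<Rightarrow> real ^ 'n \<Rightarrow> real) \<Rightarrow> bool" where
  "killing d D g P \<longleftrightarrow> (\<forall>x\<in>D. P x \<in> hom_poly d) \<and>
     (\<forall>T c v. geodesic_on D g T c v \<longrightarrow> (\<lambda>t. P (c t) (v t)) constant_on T)"

lemma killingD:
  assumes "killing d D g P"
  shows "x \<in> D \<Longrightarrow> P x \<in> hom_poly d"
    and "geodesic_on D g T c v \<Longrightarrow> s \<in> T \<Longrightarrow> t \<in> T \<Longrightarrow> P (c s) (v s) = P (c t) (v t)"
  using assms unfolding killing_def constant_on_def by (blast, metis)

lemma killingI:
  assumes "\<And>x. x \<in> D \<Longrightarrow> P x \<in> hom_poly d"
    "\<And>T c v s t. geodesic_on D g T c v \<Longrightarrow> s \<in> T \<Longrightarrow> t \<in> T \<Longrightarrow> P (c s) (v s) = P (c t) (v t)"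
  shows "killing d D g P"
  unfolding killing_def constant_on_def
proof (intro conjI ballI allI impI)
  fix T c v assume *: "geodesic_on D g T c v"
  show "\<exists>y. \<forall>x\<in>T. P (c x) (v x) = y"
    by (cases "T = {}") (use assms(2)[OF *] in blast)+
qed (use assms(1) in blast)

lemma killing_sum:
  assumes "finite A" "\<And>i. i \<in> A \<Longrightarrow> killing d D g (P i)"
  shows "killing d D g (\<lambda>x v. \<Sum>i\<in>A. a i * P i x v)"
proof (rule killingI)
  fix x assume "x \<in> D"
  then show "(\<lambda>v. \<Sum>i\<in>A. a i * P i x v) \<in> hom_poly d"
    using assms killingD(1) by (intro hom_poly_sum) blast+
next
  fix T c v s t assume *: "geodesic_on D g T c v" "s \<in> T" "t \<in> T"
  show "(\<Sum>i\<in>A. a i * P i (c s) (v s)) = (\<Sum>i\<in>A. a i * P i (c t) (v t))"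
    by (rule sum.cong[OF refl]) (use killingD(2)[OF assms(2) *] in simp)
qed

lemma killing_cmult:
  assumes "killing d D g P"
  shows "killing d D g (\<lambda>x v. a * P x v)"
  using killing_sum[of "{()}" d D g "\<lambda>_. P" "\<lambda>_. a"] assms by simp

lemma killing_diff:
  assumes "killing d D g P" "killing d D g Q"
  shows "killing d D g (\<lambda>x v. P x v - a * Q x v)"
proof -
  have "killing d D g (\<lambda>x v. \<Sum>i\<in>{True, False}. (if i then 1 else - a) * (if i then P else Q) x v)"
    using assms by (intro killing_sum) auto
  then show ?thesis by simp
qed

lemma geodesic_on_subset: "geodesic_on D g T c v \<Longrightarrow> D \<subseteq> D' \<Longrightarrow> geodesic_on D' g T c v"
  unfolding geodesic_on_def by auto

lemma killing_subset: "killing d D' g P \<Longrightarrow> D \<subseteq> D' \<Longrightarrow> killing d D g P"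
  by (rule killingI) (blast dest: killingD(1), blast dest: killingD(2) geodesic_on_subset)

lemma spray_cong:
  assumes "open D" "x \<in> D" "\<And>y. y \<in> D \<Longrightarrow> g y = g' y"
  shows "spray g x v = spray g' x v"
proof -
  have "partial_deriv k (\<lambda>y. g y $ i $ j) x = partial_deriv k (\<lambda>y. g' y $ i $ j) x" for i j k
    using assms by (intro partial_deriv_cong[of D]) auto
  then show ?thesis using assms by (simp add: spray_def christoffel_def)
qed

lemma geodesic_on_cong:
  assumes "open D" "\<And>y. y \<in> D \<Longrightarrow> g y = g' y"
  shows "geodesic_on D g T c v \<longleftrightarrow> geodesic_on D g' T c v"
  using spray_cong[of D _ g g'] assms unfolding geodesic_on_spray by metis

lemma killing_cong:
  assumes "open D" "\<And>y. y \<in> D \<Longrightarrow> g y = g' y"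
  shows "killing d D g P \<longleftrightarrow> killing d D g' P"
  unfolding killing_def using geodesic_on_cong[of D g g'] assms by simp

lemma killing_energy:
  fixes g :: "real ^ 'n::finite \<Rightarrow> real ^ 'n ^ 'n"
  assumes "Ck_metric_on 2 D g"
  shows "killing d D g (\<lambda>x v. energy_power d (qform (g x) v))"
proof (rule killingI)
  fix T and c v :: "real \<Rightarrow> real ^ 'n" and s t assume c: "geodesic_on D g T c v" and T: "s \<in> T" "t \<in> T"
  have "\<exists>k. \<forall>t\<in>T. qform (g (c t)) (v t) = k"
  proof (rule has_derivative_zero_constant)
    show "convex T" using c by (simp add: geodesic_on_def is_interval_convex)
    show "((\<lambda>t. qform (g (c t)) (v t)) has_derivative (\<lambda>h. 0)) (at t within T)" if "t \<in> T" for t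
      using has_field_derivative_at_within[OF energy_conserved[OF assms c that], of T]
      unfolding has_field_derivative_def lambda_zero[symmetric] .
  qed
  then show "energy_power d (qform (g (c s)) (v s)) = energy_power d (qform (g (c t)) (v t))"
    using T by metis
qed (rule energy_power_hom_poly)

text \<open>By homogeneity, being a function of the energy means being a multiple of one power of
  it; the factor \<open>a\<close> is the same at all points.\<close>

definition trivial_on :: "nat \<Rightarrow> (real ^ 'n::finite) set \<Rightarrow> (real ^ 'n \<Rightarrow> real ^ 'n ^ 'n) \<Rightarrow>
   (real ^ 'n \<Rightarrow> real ^ 'n \<Rightarrow> real) \<Rightarrow> bool" where
  "trivial_on d D g P \<longleftrightarrow> (\<exists>a. \<forall>x\<in>D. \<forall>v. P x v = a * energy_power d (qform (g x) v))"

lemma spray_scaleR: "spray g x (b *\<^sub>R v) = b\<^sup>2 *\<^sub>R spray g x v"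
  by (simp add: spray_def vec_eq_iff sum_distrib_left power2_eq_square algebra_simps)

text \<open>Lets two points of an arbitrary geodesic be moved to times 0 and 1.\<close>

lemma geodesic_on_affine:
  assumes "geodesic_on D g T c v" "b \<noteq> 0"
  shows "geodesic_on D g ((\<lambda>t. a + b * t) -` T) (\<lambda>t. c (a + b * t)) (\<lambda>t. b *\<^sub>R v (a + b * t))"
  unfolding geodesic_on_spray
proof (intro conjI ballI)
  let ?f = "\<lambda>t. a + b * t"
  have T: "open T" "is_interval T" using assms(1) by (auto simp: geodesic_on_def)
  show "open (?f -` T)" using T(1) by (intro open_vimage) (auto intro!: continuous_intros)
  have "convex (?f -` T)"
  proof (rule convexI)
    fix x y u w :: real assume *: "x \<in> ?f -` T" "y \<in> ?f -` T" "0 \<le> u" "0 \<le> w" "u + w = 1"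
    then have "u *\<^sub>R ?f x + w *\<^sub>R ?f y \<in> T"
      using T(2) is_interval_convex convexD by (metis vimageD)
    moreover have "u *\<^sub>R ?f x + w *\<^sub>R ?f y = (u + w) * a + b * (u * x + w * y)" by (simp add: algebra_simps)
    ultimately show "u *\<^sub>R x + w *\<^sub>R y \<in> ?f -` T" using *(5) by simp
  qed
  then show "is_interval (?f -` T)" by (simp add: is_interval_convex_1)
  fix t assume t: "t \<in> ?f -` T"
  then have cv: "c (?f t) \<in> D" "(c has_vector_derivative v (?f t)) (at (?f t))"
    "(v has_vector_derivative spray g (c (?f t)) (v (?f t))) (at (?f t))"
    using assms(1) by (auto simp: geodesic_on_spray)
  show "c (?f t) \<in> D" by fact
  have f: "(?f has_vector_derivative b) (at t)" by (auto intro!: derivative_eq_intros)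
  show "((\<lambda>t. c (?f t)) has_vector_derivative b *\<^sub>R v (?f t)) (at t)"
    using vector_diff_chain_at[OF f cv(2)] by (simp add: o_def)
  have "((\<lambda>t. v (?f t)) has_vector_derivative b *\<^sub>R spray g (c (?f t)) (v (?f t))) (at t)"
    using vector_diff_chain_at[OF f cv(3)] by (simp add: o_def)
  then have "((\<lambda>t. b *\<^sub>R v (?f t)) has_vector_derivative b *\<^sub>R b *\<^sub>R spray g (c (?f t)) (v (?f t))) (at t)"
    by (rule bounded_linear.has_vector_derivative[OF bounded_linear_scaleR_right])
  moreover have "b *\<^sub>R b *\<^sub>R spray g (c (?f t)) (v (?f t)) = spray g (c (?f t)) (b *\<^sub>R v (?f t))"
    by (simp add: spray_scaleR power2_eq_square)
  ultimately show "((\<lambda>t. b *\<^sub>R v (?f t)) has_vector_derivative spray g (c (?f t)) (b *\<^sub>R v (?f t))) (at t)"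
    by simp
qed

lemma path_geodesic:
  fixes g :: "real ^ 'n::finite \<Rightarrow> real ^ 'n ^ 'n"
  assumes "bvp R L \<rho>" "spray_bound p R L (spray g)" "cball p R \<subseteq> D" "x \<in> ball p \<rho>" "y \<in> ball p \<rho>"
  shows "geodesic_on D g {-1<..<2} (bvp.path \<rho> (spray g) x y) (bvp.vel \<rho> (spray g) x y)"
proof -
  interpret bvp p R L \<rho> by fact
  show ?thesis unfolding geodesic_on_spray
    using path_deriv[OF assms(2,4,5)] path_bound(1)[OF assms(2,4,5)] assms(3)
    by (auto simp: is_interval_1)
qed

text \<open>The relation through which values at different base points are compared: departure
  velocity at \<open>x\<close> against arrival velocity at \<open>y\<close>.\<close>

lemma killing_bvp:
  fixes g :: "real ^ 'n::finite \<Rightarrow> real ^ 'n ^ 'n"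
  assumes "bvp R L \<rho>" "spray_bound p R L (spray g)" "cball p R \<subseteq> D" "x \<in> ball p \<rho>" "y \<in> ball p \<rho>"
    and P: "killing d D g P"
  shows "P x (bvp.vel \<rho> (spray g) x y 0) = P y (bvp.vel \<rho> (spray g) x y 1)"
proof -
  interpret bvp p R L \<rho> by fact
  show ?thesis using killingD(2)[OF P path_geodesic[OF assms(1-5)], of 0 1] by simp
qed

section \<open>Local charts by short geodesics\<close>

text \<open>In \<open>ball p \<rho>\<close> any two points are joined by a short geodesic, uniformly for all metrics that
  are \<open>C\<^sup>2\<close>-close to \<open>g\<close>.\<close>

definition chart where
  "chart D (g :: real ^ 'n::finite \<Rightarrow> real ^ 'n ^ 'n) p R L \<rho> \<epsilon> \<longleftrightarrow>
     bvp R L \<rho> \<and> \<epsilon> > 0 \<and> cball p R \<subseteq> D \<and>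
     (\<forall>g'. Ck_metric_on 2 D g' \<and> Ck_close_on 2 D \<epsilon> g g' \<longrightarrow> spray_bound p R L (spray g')) \<and>
     (\<forall>g' e x v. Ck_metric_on 2 D g' \<and> Ck_close_on 2 D \<epsilon> g g' \<and> Ck_close_on 2 D e g g' \<and> x \<in> cball p R \<longrightarrow>
       norm (spray g x v - spray g' x v) \<le> L * e * (norm v)\<^sup>2)"

lemma chart_exists:
  assumes "Ck_metric_on 2 D g" "open D" "p \<in> D"
  obtains R L \<rho> \<epsilon> where "chart D g p R L \<rho> \<epsilon>"
proof -
  obtain R L \<epsilon> where *: "R > 0" "L \<ge> 1" "\<epsilon> > 0" "cball p R \<subseteq> D"
    "\<And>g'. Ck_metric_on 2 D g' \<Longrightarrow> Ck_close_on 2 D \<epsilon> g g' \<Longrightarrow> spray_bound p R L (spray g')"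
    "\<And>g' e x v. Ck_metric_on 2 D g' \<Longrightarrow> Ck_close_on 2 D \<epsilon> g g' \<Longrightarrow> Ck_close_on 2 D e g g' \<Longrightarrow> x \<in> cball p R \<Longrightarrow>
       norm (spray g x v - spray g' x v) \<le> L * e * (norm v)\<^sup>2"
    by (rule local_spray_bounds[OF assms]) blast
  \<comment> \<open>The two bounds are those demanded by the locale \<open>bvp\<close>.\<close>
  define \<rho> where "\<rho> = min (R / 100) (1 / (10 ^ 6 * L))"
  have "\<rho> * L \<le> 1 / (10 ^ 6 * L) * L" using *(2) by (intro mult_right_mono) (auto simp: \<rho>_def)
  then have "bvp R L \<rho>" using *(1,2) by unfold_locales (auto simp: \<rho>_def)
  with * show ?thesis by (intro that[of R L \<rho> \<epsilon>]) (simp add: chart_def)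
qed

lemma chartD:
  assumes "chart D g p R L \<rho> \<epsilon>"
  shows "bvp R L \<rho>" "\<epsilon> > 0" "cball p R \<subseteq> D" "\<rho> > 0" "L \<ge> 1" "ball p \<rho> \<subseteq> D"
    "Ck_metric_on 2 D g' \<Longrightarrow> Ck_close_on 2 D \<epsilon> g g' \<Longrightarrow> spray_bound p R L (spray g')"
    "Ck_metric_on 2 D g \<Longrightarrow> spray_bound p R L (spray g)"
    "Ck_metric_on 2 D g' \<Longrightarrow> Ck_close_on 2 D \<epsilon> g g' \<Longrightarrow> Ck_close_on 2 D e g g' \<Longrightarrow> x \<in> cball p R \<Longrightarrow>
       norm (spray g x v - spray g' x v) \<le> L * e * (norm v)\<^sup>2"
proof -
  show b: "bvp R L \<rho>" "\<epsilon> > 0" "cball p R \<subseteq> D" using assms by (auto simp: chart_def)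
  then show "\<rho> > 0" "L \<ge> 1" by (auto simp: bvp_def)
  have "\<rho> \<le> R" using b(1) by (auto simp: bvp_def)
  then show "ball p \<rho> \<subseteq> D" using b(3) by auto
  show *: "Ck_metric_on 2 D g' \<Longrightarrow> Ck_close_on 2 D \<epsilon> g g' \<Longrightarrow> spray_bound p R L (spray g')" for g'
    using assms by (auto simp: chart_def)
  show "Ck_metric_on 2 D g \<Longrightarrow> spray_bound p R L (spray g)"
    using * Ck_close_on_refl[OF b(2)] by blast
  show "Ck_metric_on 2 D g' \<Longrightarrow> Ck_close_on 2 D \<epsilon> g g' \<Longrightarrow> Ck_close_on 2 D e g g' \<Longrightarrow> x \<in> cball p R \<Longrightarrow>
       norm (spray g x v - spray g' x v) \<le> L * e * (norm v)\<^sup>2"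
    using assms by (auto simp: chart_def)
qed

lemma Ck_close_on_pos:
  assumes "Ck_close_on k D e g g'" "x \<in> D"
  shows "e > 0"
  using Ck_close_onD[OF assms, of "[]" undefined undefined] by simp

lemma chart_vel_close:
  fixes g :: "real ^ 'n::finite \<Rightarrow> real ^ 'n ^ 'n"
  assumes ch: "chart D g p R L \<rho> \<epsilon>" and g: "Ck_metric_on 2 D g" "Ck_metric_on 2 D g'"
    and cl: "Ck_close_on 2 D \<epsilon> g g'" "Ck_close_on 2 D e g g'"
    and xy: "x \<in> ball p \<rho>" "y \<in> ball p \<rho>" "x' \<in> ball p \<rho>" "y' \<in> ball p \<rho>" and t: "t \<in> {-1..2}"
  shows "norm (bvp.vel \<rho> (spray g) x y t - bvp.vel \<rho> (spray g') x' y' t) \<le> 120 * L * e + 3 * (norm (x - x') + norm (y - y'))"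
    and "norm (bvp.path \<rho> (spray g) x y t - bvp.path \<rho> (spray g') x' y' t) \<le> 120 * L * e + 3 * (norm (x - x') + norm (y - y'))"
proof -
  interpret bvp p R L \<rho> using chartD(1)[OF ch] .
  have e: "e > 0" using Ck_close_on_pos[OF cl(2)] xy(1) chartD(6)[OF ch] by blast
  have Le: "0 \<le> L * e" using e L1 by simp
  note P = path_close[OF chartD(8)[OF ch g(1)] chartD(7)[OF ch g(2) cl(1)] chartD(9)[OF ch g(2) cl] Le xy t]
  show "norm (path (spray g) x y t - path (spray g') x' y' t) \<le> 120 * L * e + 3 * (norm (x - x') + norm (y - y'))"
    using P(2) by (simp add: mult.assoc)
  have "vel (spray g) x y t - vel (spray g') x' y' t =
    (vel (spray g) x y t - vel (spray g') x' y' t - ((y - x) - (y' - x'))) + ((y - y') - (x - x'))" by simp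
  also have "norm \<dots> \<le> (60 * (L * e) + (norm (x - x') + norm (y - y')) / 6) + (norm (y - y') + norm (x - x'))"
    by (intro norm_add_bound P(1) norm_diff_bound) auto
  also have "\<dots> = 60 * (L * e) + (7 / 6) * (norm (x - x') + norm (y - y'))" by (simp add: field_simps)
  also have "\<dots> \<le> 120 * (L * e) + 3 * (norm (x - x') + norm (y - y'))"
    using Le by (intro add_mono mult_right_mono) auto
  finally show "norm (vel (spray g) x y t - vel (spray g') x' y' t) \<le> 120 * L * e + 3 * (norm (x - x') + norm (y - y'))"
    by (simp add: mult.assoc)
qed

text \<open>Metric and end points vary together along any filter, so that sequences of metrics and
  moving base points are treated at once.\<close>

lemma chart_tendsto:
  fixes g :: "real ^ 'n::finite \<Rightarrow> real ^ 'n ^ 'n"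
  assumes ch: "chart D g p R L \<rho> \<epsilon>" and g: "Ck_metric_on 2 D g"
    and gs: "eventually (\<lambda>m. Ck_metric_on 2 D (gs m)) F" "\<And>e. e > 0 \<Longrightarrow> eventually (\<lambda>m. Ck_close_on 2 D e g (gs m)) F"
    and x: "(xs \<longlongrightarrow> x) F" "x \<in> ball p \<rho>" and y: "(ys \<longlongrightarrow> y) F" "y \<in> ball p \<rho>" and t: "t \<in> {-1..2}"
  shows "((\<lambda>m. bvp.vel \<rho> (spray (gs m)) (xs m) (ys m) t) \<longlongrightarrow> bvp.vel \<rho> (spray g) x y t) F"
proof (rule tendstoI)
  fix r :: real assume r: "r > 0"
  have L: "L \<ge> 1" using chartD(5)[OF ch] .
  define e where "e = r / (480 * L)"
  have e: "e > 0" "120 * L * e = r / 4" using r L by (auto simp: e_def)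
  have "eventually (\<lambda>m. xs m \<in> ball p \<rho>) F" "eventually (\<lambda>m. ys m \<in> ball p \<rho>) F"
    using topological_tendstoD[OF x(1) open_ball x(2)] topological_tendstoD[OF y(1) open_ball y(2)] .
  moreover have "eventually (\<lambda>m. dist (xs m) x < r / 12) F" "eventually (\<lambda>m. dist (ys m) y < r / 12) F"
    using tendstoD[OF x(1), of "r / 12"] tendstoD[OF y(1), of "r / 12"] r by auto
  ultimately show "eventually (\<lambda>m. dist (bvp.vel \<rho> (spray (gs m)) (xs m) (ys m) t) (bvp.vel \<rho> (spray g) x y t) < r) F"
    using gs(1) gs(2)[OF chartD(2)[OF ch]] gs(2)[OF e(1)]
  proof eventually_elim
    case (elim m)
    have "norm (bvp.vel \<rho> (spray g) x y t - bvp.vel \<rho> (spray (gs m)) (xs m) (ys m) t) \<le> 120 * L * e + 3 * (norm (x - xs m) + norm (y - ys m))"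
      by (rule chart_vel_close(1)[OF ch g elim(5-7) x(2) y(2) elim(1,2) t])
    also have "\<dots> < r / 4 + 3 * (r / 12 + r / 12)"
      unfolding e(2) using elim(3,4) by (simp add: dist_norm norm_minus_commute)
    finally show ?case using r by (simp add: dist_norm norm_minus_commute)
  qed
qed

lemma chart_separates:
  assumes ch: "chart D g p R L \<rho> \<epsilon>" and g: "Ck_metric_on 2 D g"
    and "open U" "U \<noteq> {}" "U \<subseteq> ball p \<rho>" "y \<in> ball p \<rho>"
  shows "separates ((\<lambda>x. bvp.vel \<rho> (spray g) y x 0) ` U) d"
proof -
  interpret bvp p R L \<rho> using chartD(1)[OF ch] .
  show ?thesis
    using vel_open_map[OF chartD(8)[OF ch g] assms(6,3,5)] assms(4) by (intro separates_open) auto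
qed

section \<open>Convergence, unique continuation and continuity of integrals\<close>

text \<open>The values at \<open>y\<close> are determined by those at the points of \<open>X\<close>, since the integrals are
  constant along the geodesics from \<open>y\<close> to \<open>X\<close>.\<close>

lemma killing_convergence_at:
  fixes g :: "real ^ 'n::finite \<Rightarrow> real ^ 'n ^ 'n"
  assumes ch: "chart D g p R L \<rho> \<epsilon>" and g: "Ck_metric_on 2 D g" and F: "F \<noteq> bot"
    and gs: "eventually (\<lambda>m. Ck_metric_on 2 D (gs m)) F" "\<And>e. e > 0 \<Longrightarrow> eventually (\<lambda>m. Ck_close_on 2 D e g (gs m)) F"
    and Q: "eventually (\<lambda>m. killing d D (gs m) (Q m)) F"
    and y: "(ys \<longlongrightarrow> y) F" "y \<in> ball p \<rho>"
    and X: "X \<subseteq> ball p \<rho>" "separates ((\<lambda>x. bvp.vel \<rho> (spray g) y x 0) ` X) d"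
    and lim: "\<And>x v. x \<in> X \<Longrightarrow> \<exists>l. ((\<lambda>m. Q m x v) \<longlongrightarrow> l) F"
  shows "\<exists>l. ((\<lambda>m. Q m (ys m) v) \<longlongrightarrow> l) F"
proof -
  obtain M u l where u: "\<And>b::nat. b < M \<Longrightarrow> u b \<in> (\<lambda>x. bvp.vel \<rho> (spray g) y x 0) ` X"
    and l: "\<And>b. b < M \<Longrightarrow> l b \<in> hom_poly d"
    and rep: "\<And>p v. p \<in> hom_poly d \<Longrightarrow> p v = (\<Sum>b<M. p (u b) * l b v)"
    by (rule separates_interpolation[OF X(2)]) auto
  have "\<exists>x. x \<in> X \<and> u b = bvp.vel \<rho> (spray g) y x 0" if "b < M" for b using u[OF that] by auto
  then obtain x where x: "\<And>b. b < M \<Longrightarrow> x b \<in> X" "\<And>b. b < M \<Longrightarrow> u b = bvp.vel \<rho> (spray g) y (x b) 0"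
    by metis
  obtain q where q: "\<And>x v. x \<in> X \<Longrightarrow> ((\<lambda>m. Q m x v) \<longlongrightarrow> q x v) F" using lim by metis
  have evy: "eventually (\<lambda>m. ys m \<in> ball p \<rho>) F" using topological_tendstoD[OF y(1) open_ball y(2)] .
  have D: "ball p \<rho> \<subseteq> D" using chartD(6)[OF ch] .
  have "((\<lambda>m. Q m (ys m) v) \<longlongrightarrow> (\<Sum>b<M. q (x b) (bvp.vel \<rho> (spray g) y (x b) 1) * l b v)) F"
  \<comment> \<open>The moving nodes are the departure velocities, for \<open>gs m\<close>, from
    \<open>ys m\<close> to the fixed points \<open>x b\<close>. The value there equals that of
    \<open>Q m\<close> at \<open>x b\<close> on the arrival velocity, which converges by
    hypothesis.\<close>
  proof (rule interpolation_tendsto[OF l rep])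
    show "eventually (\<lambda>m. Q m (ys m) \<in> hom_poly d) F"
      using Q evy by eventually_elim (use D killingD(1) in blast)
    fix b assume b: "b < M"
    have xb: "x b \<in> ball p \<rho>" using x(1)[OF b] X(1) by blast
    show "((\<lambda>m. bvp.vel \<rho> (spray (gs m)) (ys m) (x b) 0) \<longlongrightarrow> u b) F"
      unfolding x(2)[OF b] by (rule chart_tendsto[OF ch g gs y tendsto_const xb]) auto
    have v1: "((\<lambda>m. bvp.vel \<rho> (spray (gs m)) (ys m) (x b) 1) \<longlongrightarrow> bvp.vel \<rho> (spray g) y (x b) 1) F"
      by (rule chart_tendsto[OF ch g gs y tendsto_const xb]) auto
    have "eventually (\<lambda>m. Q m (x b) \<in> hom_poly d) F"
      using Q by eventually_elim (use D killingD(1) xb in blast)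
    from hom_poly_limit(2)[OF this F q[OF x(1)[OF b]] v1]
    have "((\<lambda>m. Q m (x b) (bvp.vel \<rho> (spray (gs m)) (ys m) (x b) 1)) \<longlongrightarrow> q (x b) (bvp.vel \<rho> (spray g) y (x b) 1)) F" .
    moreover have "eventually (\<lambda>m. Q m (x b) (bvp.vel \<rho> (spray (gs m)) (ys m) (x b) 1)
        = Q m (ys m) (bvp.vel \<rho> (spray (gs m)) (ys m) (x b) 0)) F"
      using Q evy gs(1) gs(2)[OF chartD(2)[OF ch]]
    proof eventually_elim
      case (elim m)
      show ?case
        by (rule killing_bvp[OF chartD(1)[OF ch] chartD(7)[OF ch elim(3,4)] chartD(3)[OF ch] elim(2) xb elim(1), symmetric])
    qed
    ultimately show "((\<lambda>m. Q m (ys m) (bvp.vel \<rho> (spray (gs m)) (ys m) (x b) 0)) \<longlongrightarrow> q (x b) (bvp.vel \<rho> (spray g) y (x b) 1)) F"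
      by (rule Lim_transform_eventually)
  qed auto
  then show ?thesis by blast
qed

text \<open>Open-closed argument for the interior of the set where \<open>\<Phi>\<close> holds. The
  step condition says that each small ball is all or nothing: \<open>\<Phi>\<close> on any nonempty
  open part of it spreads to the whole ball, so the complement of that interior is open.\<close>

lemma connected_propagation:
  fixes D :: "'a::metric_space set"
  assumes D: "open D" "connected D" and V: "open V" "V \<noteq> {}" "V \<subseteq> D" "\<And>y. y \<in> V \<Longrightarrow> \<Phi> y"
    and step: "\<And>z. z \<in> D \<Longrightarrow> \<exists>r>0. ball z r \<subseteq> D \<and>
      (\<forall>U. open U \<longrightarrow> U \<noteq> {} \<longrightarrow> U \<subseteq> ball z r \<longrightarrow> (\<forall>y\<in>U. \<Phi> y) \<longrightarrow> (\<forall>y\<in>ball z r. \<Phi> y))"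
    and y: "y \<in> D"
  shows "\<Phi> y"
proof -
  define S where "S = interior {y \<in> D. \<Phi> y}"
  have "V \<subseteq> S" unfolding S_def using V by (intro interior_maximal) auto
  then have S: "open S" "S \<subseteq> D" "\<And>y. y \<in> S \<Longrightarrow> \<Phi> y" "S \<noteq> {}"
    using V(2) interior_subset[of "{y \<in> D. \<Phi> y}"] by (auto simp: S_def)
  have "open (D - S)"
    unfolding open_contains_ball
  proof
    fix z assume z: "z \<in> D - S"
    then obtain r where r: "r > 0" "ball z r \<subseteq> D"
      "\<And>U. open U \<Longrightarrow> U \<noteq> {} \<Longrightarrow> U \<subseteq> ball z r \<Longrightarrow> \<forall>y\<in>U. \<Phi> y \<Longrightarrow> \<forall>y\<in>ball z r. \<Phi> y"
      using step[of z] by blast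
    have "ball z r \<inter> S = {}"
    proof (rule ccontr)
      assume ne: "ball z r \<inter> S \<noteq> {}"
      have "\<forall>y\<in>ball z r. \<Phi> y" by (rule r(3)[of "ball z r \<inter> S"]) (use ne S in auto)
      then have "ball z r \<subseteq> S" unfolding S_def using r(2) by (intro interior_maximal) auto
      moreover have "z \<in> ball z r" using r(1) by simp
      ultimately show False using z by blast
    qed
    then show "\<exists>e>0. ball z e \<subseteq> D - S" using r by auto
  qed
  moreover have "D \<subseteq> S \<union> (D - S)" "S \<inter> (D - S) \<inter> D = {}" by auto
  ultimately have "S \<inter> D = {} \<or> (D - S) \<inter> D = {}"
    using connectedD[OF D(2) S(1), of "D - S"] by auto
  then have "y \<in> S" using S y by auto
  then show ?thesis by (rule S(3))
qed

lemma killing_convergence: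
  fixes g :: "real ^ 'n::finite \<Rightarrow> real ^ 'n ^ 'n"
  assumes D: "open D" "connected D" and g: "Ck_metric_on 2 D g" and F: "F \<noteq> bot"
    and gs: "eventually (\<lambda>m. Ck_metric_on 2 D (gs m)) F" "\<And>e. e > 0 \<Longrightarrow> eventually (\<lambda>m. Ck_close_on 2 D e g (gs m)) F"
    and Q: "eventually (\<lambda>m. killing d D (gs m) (Q m)) F"
    and V: "open V" "V \<noteq> {}" "V \<subseteq> D" and lim: "\<And>x v. x \<in> V \<Longrightarrow> \<exists>l. ((\<lambda>m. Q m x v) \<longlongrightarrow> l) F"
    and y: "y \<in> D"
  shows "\<exists>l. ((\<lambda>m. Q m y v) \<longlongrightarrow> l) F"
proof -
  have "\<forall>v. \<exists>l. ((\<lambda>m. Q m y v) \<longlongrightarrow> l) F"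
  proof (rule connected_propagation[OF D V _ _ y])
    show "\<forall>v. \<exists>l. ((\<lambda>m. Q m y v) \<longlongrightarrow> l) F" if "y \<in> V" for y using lim[OF that] by blast
    fix z assume z: "z \<in> D"
    obtain R L \<rho> \<epsilon> where ch: "chart D g z R L \<rho> \<epsilon>" by (rule chart_exists[OF g D(1) z])
    show "\<exists>r>0. ball z r \<subseteq> D \<and> (\<forall>U. open U \<longrightarrow> U \<noteq> {} \<longrightarrow> U \<subseteq> ball z r \<longrightarrow>
        (\<forall>y\<in>U. \<forall>v. \<exists>l. ((\<lambda>m. Q m y v) \<longlongrightarrow> l) F) \<longrightarrow> (\<forall>y\<in>ball z r. \<forall>v. \<exists>l. ((\<lambda>m. Q m y v) \<longlongrightarrow> l) F))"
    proof (rule exI[of _ \<rho>], intro conjI allI impI ballI)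
      show "\<rho> > 0" "ball z \<rho> \<subseteq> D" using chartD[OF ch] by auto
      fix U y v assume U: "open U" "U \<noteq> {}" "U \<subseteq> ball z \<rho>" "\<forall>y\<in>U. \<forall>v. \<exists>l. ((\<lambda>m. Q m y v) \<longlongrightarrow> l) F"
        and y: "y \<in> ball z \<rho>"
      have U4: "\<exists>l. ((\<lambda>m. Q m x w) \<longlongrightarrow> l) F" if "x \<in> U" for x w using U(4) that by blast
      show "\<exists>l. ((\<lambda>m. Q m y v) \<longlongrightarrow> l) F"
        by (rule killing_convergence_at[OF ch g F gs Q tendsto_const y U(3) chart_separates[OF ch g U(1,2,3) y] U4])
    qed
  qed
  then show ?thesis by blast
qed

text \<open>Multiples \<open>m * P\<close> converge exactly at the zeros of \<open>P\<close>.\<close>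

lemma unique_continuation:
  fixes g :: "real ^ 'n::finite \<Rightarrow> real ^ 'n ^ 'n"
  assumes D: "open D" "connected D" and g: "Ck_metric_on 2 D g" and P: "killing d D g P"
    and V: "open V" "V \<noteq> {}" "V \<subseteq> D" and z: "\<And>x v. x \<in> V \<Longrightarrow> P x v = 0" and y: "y \<in> D"
  shows "P y v = 0"
proof -
  have "\<exists>l. (\<lambda>m. real m * P y v) \<longlonglongrightarrow> l"
  proof (rule killing_convergence[where d = d and Q = "\<lambda>m x v. real m * P x v" and gs = "\<lambda>m. g", OF D g sequentially_bot _ _ _ V _ y])
    show "\<exists>l. (\<lambda>m. real m * P x v) \<longlonglongrightarrow> l" if "x \<in> V" for x v using z[OF that] by auto
  qed (simp_all add: g killing_cmult[OF P] Ck_close_on_refl)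
  then obtain l where l: "(\<lambda>m. real m * P y v) \<longlonglongrightarrow> l" by blast
  \<comment> \<open>Dividing the convergent sequence by \<open>m\<close> leaves the constant
    \<open>P y v\<close>, which must therefore be 0.\<close>
  have "(\<lambda>m. real m * P y v * inverse (real m)) \<longlonglongrightarrow> l * 0"
    by (rule tendsto_mult[OF l lim_inverse_n])
  moreover have "eventually (\<lambda>m. real m * P y v * inverse (real m) = P y v) sequentially"
    using eventually_gt_at_top[of 0] by eventually_elim simp
  ultimately have "(\<lambda>m. P y v) \<longlonglongrightarrow> 0" by (simp add: tendsto_cong)
  then show ?thesis using LIMSEQ_const_iff by blast
qed

lemma unique_continuation_eq:
  assumes "open D" "connected D" "Ck_metric_on 2 D g" "killing d D g P" "killing d D g Q"
    and "open V" "V \<noteq> {}" "V \<subseteq> D" "\<And>x v. x \<in> V \<Longrightarrow> P x v = Q x v" "y \<in> D"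
  shows "P y v = Q y v"
  using unique_continuation[OF assms(1-3) killing_diff[OF assms(4,5), of 1] assms(6-8) _ assms(10), of v] assms(9)
  by simp

text \<open>Convergence applied to a constant integral and metric with a moving base point: the
  values on the ball are fixed, hence trivially convergent, and they control \<open>P x\<close> as
  \<open>x\<close> tends to \<open>y\<close>.\<close>

lemma killing_continuous:
  fixes g :: "real ^ 'n::finite \<Rightarrow> real ^ 'n ^ 'n"
  assumes D: "open D" and g: "Ck_metric_on 2 D g" and P: "killing d D g P" and y: "y \<in> D"
  shows "((\<lambda>x. P x v) \<longlongrightarrow> P y v) (nhds y)"
proof -
  obtain R L \<rho> \<epsilon> where ch: "chart D g y R L \<rho> \<epsilon>" by (rule chart_exists[OF g D y])
  have yb: "y \<in> ball y \<rho>" using chartD(4)[OF ch] by simp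
  have id: "((\<lambda>x. x) \<longlongrightarrow> y) (nhds y)" by (simp add: filterlim_ident)
  have "\<exists>l. ((\<lambda>x. P x v) \<longlongrightarrow> l) (nhds y)"
    by (rule killing_convergence_at[where Q = "\<lambda>m. P" and gs = "\<lambda>m. g" and ys = "\<lambda>x. x", OF ch g _ _ _ _ id yb order_refl
          chart_separates[OF ch g open_ball _ order_refl yb]])
       (use g P Ck_close_on_refl yb in auto)
  then obtain l where l: "((\<lambda>x. P x v) \<longlongrightarrow> l) (nhds y)" by blast
  \<comment> \<open>The filter \<open>nhds y\<close> includes \<open>y\<close> itself, so the limit
    cannot differ from the value there.\<close>
  have "((\<lambda>x. P x v) \<longlongrightarrow> l) (principal {y})"
    by (rule tendsto_mono[OF _ l]) (simp add: le_principal eventually_nhds_x_imp_x le_filter_def eventually_principal)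
  then have "l = P y v"
    using tendsto_principal_singleton[of "\<lambda>x. P x v" y] tendsto_unique[of "principal {y}"] by (simp add: principal_eq_bot_iff)
  with l show ?thesis by simp
qed

text \<open>Finitely many velocities from \<open>c\<close> to points of \<open>V\<close> already
  separate. Changing the base point or the metric slightly moves these velocities slightly, and
  separation is stable; hence one \<open>X\<close> works for all of them.\<close>

lemma determining_set:
  fixes g :: "real ^ 'n::finite \<Rightarrow> real ^ 'n ^ 'n"
  assumes D: "open D" and g: "Ck_metric_on 2 D g" and c: "c \<in> D" and V: "open V" "c \<in> V"
  obtains X r \<epsilon> R L \<rho> where "finite X" "X \<subseteq> V" "r > 0" "r \<le> \<rho>" "\<epsilon> > 0" "chart D g c R L \<rho> \<epsilon>" "X \<subseteq> ball c \<rho>"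
    "\<And>g' y. Ck_metric_on 2 D g' \<Longrightarrow> Ck_close_on 2 D \<epsilon> g g' \<Longrightarrow> y \<in> ball c r \<Longrightarrow>
       separates ((\<lambda>x. bvp.vel \<rho> (spray g') y x 0) ` X) d"
proof -
  obtain R L \<rho> \<epsilon>0 where ch: "chart D g c R L \<rho> \<epsilon>0" by (rule chart_exists[OF g D c])
  have \<rho>: "\<rho> > 0" using chartD(4)[OF ch] .
  have L: "L \<ge> 1" using chartD(5)[OF ch] .
  have cb: "c \<in> ball c \<rho>" using \<rho> by simp
  have "separates ((\<lambda>x. bvp.vel \<rho> (spray g) c x 0) ` (V \<inter> ball c \<rho>)) d"
    by (rule chart_separates[OF ch g]) (use V cb in auto)
  then obtain M u l where u: "\<And>b::nat. b < M \<Longrightarrow> u b \<in> (\<lambda>x. bvp.vel \<rho> (spray g) c x 0) ` (V \<inter> ball c \<rho>)"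
    and l: "\<And>b. b < M \<Longrightarrow> l b \<in> hom_poly d"
    and rep: "\<And>p v. p \<in> hom_poly d \<Longrightarrow> p v = (\<Sum>b<M. p (u b) * l b v)"
    by (rule separates_interpolation) auto
  have "\<exists>x. x \<in> V \<inter> ball c \<rho> \<and> u b = bvp.vel \<rho> (spray g) c x 0" if "b < M" for b using u[OF that] by auto
  then obtain x where x: "\<And>b. b < M \<Longrightarrow> x b \<in> V \<inter> ball c \<rho>" "\<And>b. b < M \<Longrightarrow> u b = bvp.vel \<rho> (spray g) c (x b) 0"
    by metis
  obtain \<delta> where \<delta>: "\<delta> > 0" "\<And>w. (\<And>b. b < M \<Longrightarrow> dist (w b) (u b) < \<delta>) \<Longrightarrow> separates (w ` {..<M}) d"
    by (rule interpolation_separates[OF l rep]) auto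
  \<comment> \<open>The change of metric and the change of base point
    (\<open>r \<le> \<delta> / 12\<close> below) each move a velocity by at most
    \<open>\<delta> / 4\<close>.\<close>
  define \<epsilon> where "\<epsilon> = min \<epsilon>0 (\<delta> / (480 * L))"
  have \<epsilon>: "\<epsilon> > 0" "\<epsilon> \<le> \<epsilon>0" "120 * L * \<epsilon> \<le> \<delta> / 4"
    using \<delta>(1) L chartD(2)[OF ch] by (auto simp: \<epsilon>_def min_def field_simps)
  have close0: "Ck_close_on 2 D \<epsilon>0 g g'" if "Ck_close_on 2 D \<epsilon> g g'" for g'
    by (rule Ck_close_on_mono[OF that]) (use \<epsilon>(2) in auto)
  define r where "r = min \<rho> (\<delta> / 12)"
  have ch': "chart D g c R L \<rho> \<epsilon>"
    unfolding chart_def using chartD(1,3)[OF ch] \<epsilon>(1) chartD(7)[OF ch] chartD(9)[OF ch] close0 by blast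
  show ?thesis
  proof
    show "finite (x ` {..<M})" "x ` {..<M} \<subseteq> V" "r > 0" "r \<le> \<rho>" "\<epsilon> > 0" "chart D g c R L \<rho> \<epsilon>" "x ` {..<M} \<subseteq> ball c \<rho>"
      using x(1) \<delta>(1) \<rho> \<epsilon>(1) ch' by (auto simp: r_def)
    fix g' y assume g': "Ck_metric_on 2 D g'" "Ck_close_on 2 D \<epsilon> g g'" and y: "y \<in> ball c r"
    have "separates ((\<lambda>b. bvp.vel \<rho> (spray g') y (x b) 0) ` {..<M}) d"
    proof (rule \<delta>(2))
      fix b assume b: "b < M"
      have "norm (bvp.vel \<rho> (spray g) c (x b) 0 - bvp.vel \<rho> (spray g') y (x b) 0) \<le> 120 * L * \<epsilon> + 3 * (norm (c - y) + norm (x b - x b))"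
        by (rule chart_vel_close(1)[OF ch' g g'(1) g'(2) g'(2)]) (use x(1)[OF b] y cb in \<open>auto simp: r_def\<close>)
      also have "\<dots> < \<delta>" using \<epsilon>(3) y \<delta>(1) by (auto simp: r_def dist_norm)
      finally show "dist (bvp.vel \<rho> (spray g') y (x b) 0) (u b) < \<delta>"
        by (simp add: x(2)[OF b] dist_norm norm_minus_commute)
    qed
    then show "separates ((\<lambda>x. bvp.vel \<rho> (spray g') y x 0) ` (x ` {..<M})) d" by (simp add: image_image)
  qed
qed

text \<open>Each \<open>P y\<close> with \<open>y\<close> near \<open>c\<close> vanishes on the
  separating velocities towards \<open>X\<close>, hence identically; unique continuation does the
  rest.\<close>

lemma killing_zero_of_determining_set:
  fixes g :: "real ^ 'n::finite \<Rightarrow> real ^ 'n ^ 'n"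
  assumes D: "open D" "connected D" and ch: "chart D g0 c R L \<rho> \<epsilon>"
    and g: "Ck_metric_on 2 D g" "Ck_close_on 2 D \<epsilon> g0 g" and X: "X \<subseteq> ball c \<rho>" and r: "0 < r" "r \<le> \<rho>"
    and sep: "\<And>y. y \<in> ball c r \<Longrightarrow> separates ((\<lambda>x. bvp.vel \<rho> (spray g) y x 0) ` X) d"
    and P: "killing d D g P" and z: "\<And>x v. x \<in> X \<Longrightarrow> P x v = 0" and y: "y \<in> D"
  shows "P y v = 0"
proof (rule unique_continuation[OF D g(1) P open_ball, of c r])
  show "ball c r \<noteq> {}" "ball c r \<subseteq> D" "y \<in> D" using r chartD(6)[OF ch] y by auto
  fix x v assume x: "x \<in> ball c r"
  then have x\<rho>: "x \<in> ball c \<rho>" using r(2) by auto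
  show "P x v = 0"
  proof (rule separatesD[OF sep[OF x]])
    show "P x \<in> hom_poly d" using killingD(1)[OF P] x\<rho> chartD(6)[OF ch] by blast
    fix u assume "u \<in> (\<lambda>z. bvp.vel \<rho> (spray g) x z 0) ` X"
    then obtain w where w: "w \<in> X" "u = bvp.vel \<rho> (spray g) x w 0" by blast
    have "P x (bvp.vel \<rho> (spray g) x w 0) = P w (bvp.vel \<rho> (spray g) x w 1)"
      by (rule killing_bvp[OF chartD(1)[OF ch] chartD(7)[OF ch g] chartD(3)[OF ch] x\<rho> _ P]) (use w X in blast)
    then show "P x u = 0" using z[OF w(1)] w(2) by simp
  qed
qed

section \<open>Short pieces of arbitrary geodesics, and limits of integrals\<close>

lemma (in bvp) path_quadratic:
  assumes N: "spray_bound p R L N" and x: "x \<in> ball p \<rho>" and y: "y \<in> ball p \<rho>" and t: "t \<in> {-1..2}"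
  shows "norm (path N x y t - x) \<le> 3 * norm (y - x)" "norm (vel N x y t) \<le> 2 * norm (y - x)"
proof -
  let ?n = "norm (y - x)"
  have "norm (y - p) \<le> \<rho>" "norm (x - p) \<le> \<rho>" using x y by (auto simp: dist_norm norm_minus_commute)
  then have n: "?n \<le> 2 * \<rho>" using norm_triangle_ineq4[of "y - p" "x - p"] by simp
  have "L * ?n\<^sup>2 \<le> L * ((2 * \<rho>) * ?n)"
    unfolding power2_eq_square using n L1 by (intro mult_left_mono mult_right_mono) auto
  also have "\<dots> = 2 * (\<rho> * L) * ?n" by simp
  also have "\<dots> \<le> 2 * (1 / 10 ^ 6) * ?n" using \<rho>L by (intro mult_right_mono) auto
  finally have Ln: "L * ?n\<^sup>2 \<le> ?n / 500000" by simp
  have "norm ((curve_acc (acc N x y) x y t - (x + t *\<^sub>R (y - x))) - (curve_acc (\<lambda>t. 0) x y t - (x + t *\<^sub>R (y - x)))) \<le> 60 * (4 * L * ?n\<^sup>2)"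
    using acc_quadratic(1)[OF N x y] by (intro curve_acc_close(2)[OF acc_continuous[OF N x y] _ _ t]) auto
  then have "norm (path N x y t - (x + t *\<^sub>R (y - x))) \<le> 240 * (L * ?n\<^sup>2)" by (simp add: path_def)
  moreover have "norm (t *\<^sub>R (y - x)) \<le> 2 * ?n" unfolding norm_scaleR using t by (intro mult_right_mono) auto
  ultimately have "norm ((path N x y t - (x + t *\<^sub>R (y - x))) + t *\<^sub>R (y - x)) \<le> 240 * (L * ?n\<^sup>2) + 2 * ?n"
    by (rule norm_add_bound)
  moreover have Ln': "240 * (L * ?n\<^sup>2) \<le> ?n" by (rule order_trans[OF mult_left_mono[OF Ln]]) auto
  ultimately show "norm (path N x y t - x) \<le> 3 * ?n" by simp
  have "norm ((vel N x y t - (y - x)) + (y - x)) \<le> 120 * L * ?n\<^sup>2 + ?n"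
    by (rule norm_add_bound[OF acc_quadratic(2)[OF N x y t] order_refl])
  moreover have "120 * L * ?n\<^sup>2 \<le> 240 * (L * ?n\<^sup>2)" using L1 by simp
  ultimately show "norm (vel N x y t) \<le> 2 * ?n" using Ln' by simp
qed

text \<open>Rescaling time by \<open>t - t0\<close> puts \<open>c t0\<close> and \<open>c t\<close>
  at times 0 and 1. For \<open>t\<close> close to \<open>t0\<close> the rescaled acceleration is at
  most \<open>\<rho>\<close>, so \<open>path_unique\<close> applies.\<close>

lemma short_geodesic:
  fixes g :: "real ^ 'n::finite \<Rightarrow> real ^ 'n ^ 'n"
  assumes ch: "chart D g (c t0) R L \<rho> \<epsilon>" and g: "Ck_metric_on 2 D g"
    and c: "geodesic_on D g T c v" and t0: "t0 \<in> T"
  shows "eventually (\<lambda>t. c t \<in> ball (c t0) \<rho> \<and>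
    bvp.vel \<rho> (spray g) (c t0) (c t) 0 = (t - t0) *\<^sub>R v t0 \<and>
    bvp.vel \<rho> (spray g) (c t0) (c t) 1 = (t - t0) *\<^sub>R v t) (at t0)"
proof -
  define p where "p = c t0"
  interpret bvp p R L \<rho> using chartD(1)[OF ch] .
  have N: "spray_bound p R L (spray g)" using chartD(8)[OF ch g] by (simp add: p_def)
  have pb: "p \<in> ball p \<rho>" using pos by simp
  have d: "(c has_vector_derivative v t0) (at t0)" "(v has_vector_derivative spray g (c t0) (v t0)) (at t0)"
    using c t0 by (auto simp: geodesic_on_spray)
  have cc: "(c \<longlongrightarrow> p) (at t0)" "(v \<longlongrightarrow> v t0) (at t0)"
    using has_vector_derivative_continuous[OF d(1)] has_vector_derivative_continuous[OF d(2)]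
    by (auto simp: continuous_at p_def)
  define m where "m = norm (v t0) + 1"
  have m: "m > 0" by (simp add: m_def add_nonneg_pos)
  have "eventually (\<lambda>t. t \<in> T) (at t0)"
    using c t0 by (auto simp: geodesic_on_def eventually_at_topological)
  moreover have "eventually (\<lambda>t. c t \<in> ball p \<rho>) (at t0)" using topological_tendstoD[OF cc(1) open_ball pb] .
  moreover have "eventually (\<lambda>t. norm (v t) < m) (at t0)"
    using order_tendstoD(2)[OF tendsto_norm[OF cc(2)], of m] by (simp add: m_def)
  ultimately have "eventually (\<lambda>t. t \<in> T \<and> c t \<in> ball p \<rho> \<and> norm (v t) < m) (at t0)" by eventually_elim simp
  then obtain e where e: "e > 0" "\<And>t. t \<noteq> t0 \<Longrightarrow> dist t t0 < e \<Longrightarrow> t \<in> T \<and> c t \<in> ball p \<rho> \<and> norm (v t) < m"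
    unfolding eventually_at by auto
  have e': "t \<in> T \<and> c t \<in> ball p \<rho> \<and> norm (v t) < m" if "\<bar>t - t0\<bar> < e" for t
    using e(2)[of t] t0 that pb by (cases "t = t0") (auto simp: dist_real_def p_def m_def)
  \<comment> \<open>With |h| < e / 3, the times \<open>t0 + h * \<tau>\<close> for
    \<open>\<tau>\<close> in [-1, 2] stay within \<open>e\<close> of \<open>t0\<close>; the other
    bounds give h^2 L m^2 \<le> \<open>\<rho>\<close>.\<close>
  define e1 where "e1 = min (e / 3) (min 1 (\<rho> / (L * m\<^sup>2)))"
  have Lm: "L * m\<^sup>2 > 0" using L1 m by simp
  have e1: "e1 > 0" using e(1) pos Lm by (simp add: e1_def)
  have "c t \<in> ball p \<rho> \<and> vel (spray g) p (c t) 0 = (t - t0) *\<^sub>R v t0 \<and> vel (spray g) p (c t) 1 = (t - t0) *\<^sub>R v t"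
    if t: "t \<noteq> t0" "dist t t0 < e1" for t
  proof -
    define h where "h = t - t0"
    have h: "h \<noteq> 0" "\<bar>h\<bar> < e / 3" "\<bar>h\<bar> < 1" "\<bar>h\<bar> < \<rho> / (L * m\<^sup>2)"
      using t by (auto simp: h_def e1_def dist_real_def)
    have ct: "c t \<in> ball p \<rho>" using e'[of t] h e(1) by (simp add: h_def)
    let ?f = "\<lambda>\<tau>. t0 + h * \<tau>"
    have f: "?f \<tau> \<in> T" "c (?f \<tau>) \<in> ball p \<rho>" "norm (v (?f \<tau>)) < m" if "\<tau> \<in> {-1..2}" for \<tau>
    proof -
      have "\<bar>h * \<tau>\<bar> \<le> \<bar>h\<bar> * 2" unfolding abs_mult using that by (intro mult_left_mono) auto
      then have "\<bar>?f \<tau> - t0\<bar> < e" using h(2) by simp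
      from e'[OF this] show "?f \<tau> \<in> T" "c (?f \<tau>) \<in> ball p \<rho>" "norm (v (?f \<tau>)) < m" by auto
    qed
    note G = geodesic_on_affine[OF c h(1), of t0, unfolded geodesic_on_spray]
    have dd: "((\<lambda>\<tau>. c (?f \<tau>)) has_vector_derivative h *\<^sub>R v (?f \<tau>)) (at \<tau> within {-1..2})"
      "((\<lambda>\<tau>. h *\<^sub>R v (?f \<tau>)) has_vector_derivative spray g (c (?f \<tau>)) (h *\<^sub>R v (?f \<tau>))) (at \<tau> within {-1..2})"
      if "\<tau> \<in> {-1..2}" for \<tau>
      using G f(1)[OF that] by (auto intro: has_vector_derivative_at_within)
    have \<rho>R': "\<rho> \<le> R" using \<rho>R pos by simp
    have sm: "norm (spray g (c (?f \<tau>)) (h *\<^sub>R v (?f \<tau>))) \<le> \<rho>" if \<tau>: "\<tau> \<in> {-1..2}" for \<tau>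
    proof -
      have "norm (spray g (c (?f \<tau>)) (h *\<^sub>R v (?f \<tau>))) \<le> L * (norm (h *\<^sub>R v (?f \<tau>)))\<^sup>2"
      proof -
        have "c (?f \<tau>) \<in> cball p R" using f(2)[OF \<tau>] \<rho>R' by auto
        then show ?thesis using N unfolding spray_bound_def by blast
      qed
      also have "\<dots> \<le> L * (\<bar>h\<bar> * m)\<^sup>2"
        using f(3)[OF \<tau>] L1 by (intro mult_left_mono power_mono) (auto intro!: mult_left_mono)
      also have "\<dots> = \<bar>h\<bar> * (\<bar>h\<bar> * (L * m\<^sup>2))" by (simp add: power2_eq_square)
      also have "\<dots> \<le> 1 * (\<rho> / (L * m\<^sup>2) * (L * m\<^sup>2))"
        using h(3,4) Lm by (intro mult_mono mult_right_mono) auto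
      also have "\<dots> = \<rho>" using L1 m by simp
      finally show ?thesis .
    qed
    have co: "continuous_on {-1..2} (\<lambda>\<tau>. spray g (c (?f \<tau>)) (h *\<^sub>R v (?f \<tau>)))"
    proof (rule spray_bound_continuous_on[OF N])
      show "continuous_on {-1..2} (\<lambda>\<tau>. c (?f \<tau>))" "continuous_on {-1..2} (\<lambda>\<tau>. h *\<^sub>R v (?f \<tau>))"
        using continuous_on_vector_derivative[OF dd(1)] continuous_on_vector_derivative[OF dd(2)] by auto
      show "(\<lambda>\<tau>. c (?f \<tau>)) ` {-1..2} \<subseteq> cball p R" using f(2) \<rho>R' by fastforce
    qed
    have end0: "c (?f 0) = p" and end1: "c (?f 1) = c t" by (auto simp: p_def h_def)
    note U = path_unique(2)[OF N pb ct dd end0 end1 sm co]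
    have "vel (spray g) p (c t) 0 = h *\<^sub>R v (?f 0)" by (rule U) auto
    moreover have "vel (spray g) p (c t) 1 = h *\<^sub>R v (?f 1)" by (rule U) auto
    ultimately show ?thesis using ct by (simp add: h_def)
  qed
  then show ?thesis unfolding eventually_at p_def[symmetric] using e1 by (intro exI[of _ e1]) auto
qed

text \<open>For close times on a geodesic of \<open>g\<close>, the values are compared through short
  geodesics of \<open>gs m\<close> with the same end points and the limit is taken. So the limit is
  locally constant along the geodesic, hence constant on the interval.\<close>

lemma killing_limit:
  fixes g :: "real ^ 'n::finite \<Rightarrow> real ^ 'n ^ 'n"
  assumes D: "open D" and g: "Ck_metric_on 2 D g" and F: "F \<noteq> bot"
    and gs: "eventually (\<lambda>m. Ck_metric_on 2 D (gs m)) F" "\<And>e. e > 0 \<Longrightarrow> eventually (\<lambda>m. Ck_close_on 2 D e g (gs m)) F"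
    and Q: "eventually (\<lambda>m. killing d D (gs m) (Q m)) F"
    and lim: "\<And>x v. x \<in> D \<Longrightarrow> ((\<lambda>m. Q m x v) \<longlongrightarrow> P x v) F"
  shows "killing d D g P"
proof (rule killingI)
  have hom: "eventually (\<lambda>m. Q m x \<in> hom_poly d) F" if "x \<in> D" for x
    using Q by eventually_elim (use killingD(1) that in blast)
  show Px: "P x \<in> hom_poly d" if "x \<in> D" for x
    by (rule hom_poly_limit(1)[OF hom[OF that] F lim[OF that]])
  fix T and c v :: "real \<Rightarrow> real ^ 'n" and s t
  assume c: "geodesic_on D g T c v" and st: "s \<in> T" "t \<in> T"
  have "eventually (\<lambda>t. P (c t) (v t) = P (c t0) (v t0)) (at t0)" if t0: "t0 \<in> T" for t0
  proof -
    have ct0: "c t0 \<in> D" using c t0 by (auto simp: geodesic_on_def)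
    obtain R L \<rho> \<epsilon> where ch: "chart D g (c t0) R L \<rho> \<epsilon>" by (rule chart_exists[OF g D ct0])
    have pb: "c t0 \<in> ball (c t0) \<rho>" using chartD(4)[OF ch] by simp
    have "eventually (\<lambda>t. t \<noteq> t0) (at t0)" by (simp add: eventually_at_filter)
    with short_geodesic[OF ch g c t0] show ?thesis
    proof eventually_elim
      case (elim t)
      let ?V = "\<lambda>g. bvp.vel \<rho> (spray g) (c t0) (c t)"
      have ct: "c t \<in> D" using elim(1) chartD(6)[OF ch] by blast
      have vl: "((\<lambda>m. ?V (gs m) \<tau>) \<longlongrightarrow> ?V g \<tau>) F" if "\<tau> \<in> {-1..2}" for \<tau>
        by (rule chart_tendsto[OF ch g gs tendsto_const pb tendsto_const _ that]) (use elim(1) in auto)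
      have "((\<lambda>m. Q m (c t0) (?V (gs m) 0)) \<longlongrightarrow> P (c t0) (?V g 0)) F"
        by (rule hom_poly_limit(2)[OF hom[OF ct0] F lim[OF ct0] vl]) auto
      moreover have "eventually (\<lambda>m. Q m (c t0) (?V (gs m) 0) = Q m (c t) (?V (gs m) 1)) F"
        using Q gs(1) gs(2)[OF chartD(2)[OF ch]]
      proof eventually_elim
        case (elim m)
        show ?case
          by (rule killing_bvp[OF chartD(1)[OF ch] chartD(7)[OF ch elim(2,3)] chartD(3)[OF ch] pb _ elim(1)])
             (use \<open>c t \<in> ball (c t0) \<rho> \<and> _\<close> in blast)
      qed
      ultimately have "((\<lambda>m. Q m (c t) (?V (gs m) 1)) \<longlongrightarrow> P (c t0) (?V g 0)) F"
        by (rule Lim_transform_eventually)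
      moreover have "((\<lambda>m. Q m (c t) (?V (gs m) 1)) \<longlongrightarrow> P (c t) (?V g 1)) F"
        by (rule hom_poly_limit(2)[OF hom[OF ct] F lim[OF ct] vl]) auto
      ultimately have "P (c t0) (?V g 0) = P (c t) (?V g 1)" by (rule tendsto_unique[OF F])
      \<comment> \<open>Homogeneity turns the rescaled velocities into equal nonzero factors, which
        cancel.\<close>
      then have "(t - t0) ^ d * P (c t0) (v t0) = (t - t0) ^ d * P (c t) (v t)"
        using elim(1) hom_poly_scaleR[OF Px[OF ct0]] hom_poly_scaleR[OF Px[OF ct]] by simp
      then show ?case using elim(2) by simp
    qed
  qed
  note loc = this
  have "\<exists>k. \<forall>t\<in>T. P (c t) (v t) = k"
  proof (rule has_derivative_zero_constant)
    show "convex T" using c by (simp add: geodesic_on_def is_interval_convex)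
    fix t0 assume t0: "t0 \<in> T"
    have "((\<lambda>t. P (c t0) (v t0)) has_derivative (\<lambda>h. 0)) (at t0 within T)" by simp
    moreover have "eventually (\<lambda>t. P (c t0) (v t0) = P (c t) (v t)) (at t0 within T)"
      using loc[OF t0] by (auto simp: eventually_at_filter elim: eventually_mono)
    ultimately show "((\<lambda>t. P (c t) (v t)) has_derivative (\<lambda>h. 0)) (at t0 within T)"
      by (rule has_derivative_transform_eventually) (use t0 in auto)
  qed
  then show "P (c s) (v s) = P (c t) (v t)" using st by metis
qed

section \<open>Variation of an integral along curves that are not geodesics\<close>

lemma vector_derivative_bound:
  fixes f :: "real \<Rightarrow> 'a::real_normed_vector"
  assumes "\<And>s. s \<in> S \<Longrightarrow> (f has_vector_derivative f' s) (at s within S)" "convex S"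
    and "\<And>s. s \<in> S \<Longrightarrow> norm (f' s) \<le> B" "a \<in> S" "b \<in> S"
  shows "norm (f a - f b) \<le> B * \<bar>a - b\<bar>"
proof -
  have "norm (f a - f b) \<le> B * norm (a - b)"
  proof (rule differentiable_bound[OF assms(2) _ _ assms(4,5)])
    fix s assume s: "s \<in> S"
    show "(f has_derivative (\<lambda>h. h *\<^sub>R f' s)) (at s within S)"
      using assms(1)[OF s] by (simp add: has_vector_derivative_def)
    show "onorm (\<lambda>h. h *\<^sub>R f' s) \<le> B"
    proof (rule onorm_le)
      fix h :: real
      show "norm (h *\<^sub>R f' s) \<le> B * norm h"
        using mult_right_mono[OF assms(3)[OF s], of "\<bar>h\<bar>"] by (simp add: mult.commute)
    qed
  qed
  then show ?thesis by simp
qed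

lemma taylor_two_point:
  fixes c :: "real \<Rightarrow> 'a::real_normed_vector"
  assumes c: "\<And>s. s \<in> {0..1} \<Longrightarrow> (c has_vector_derivative v s) (at s within {0..1})"
    and v: "\<And>s. s \<in> {0..1} \<Longrightarrow> (v has_vector_derivative a s) (at s within {0..1})"
    and a: "\<And>s. s \<in> {0..1} \<Longrightarrow> norm (a s - k) \<le> \<delta>"
  shows "norm (v 1 - v 0 - k) \<le> \<delta>" "norm (c 1 - c 0 - v 0 - (1 / 2) *\<^sub>R k) \<le> \<delta>"
proof -
  have V: "norm ((v s - s *\<^sub>R k) - (v 0 - 0 *\<^sub>R k)) \<le> \<delta> * \<bar>s - 0\<bar>" if s: "s \<in> {0..1}" for s
  proof (rule vector_derivative_bound[where S = "{0..1}" and f = "\<lambda>s. v s - s *\<^sub>R k"])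
    show "((\<lambda>s. v s - s *\<^sub>R k) has_vector_derivative a s - k) (at s within {0..1})" if "s \<in> {0..1}" for s
      by (auto intro!: derivative_eq_intros v[OF that])
  qed (use a s in auto)
  from V[of 1] show "norm (v 1 - v 0 - k) \<le> \<delta>" by (simp add: algebra_simps)
  have \<delta>: "\<delta> \<ge> 0" using order_trans[OF norm_ge_zero a[of 0]] by simp
  have "norm ((c 1 - 1 *\<^sub>R v 0 - (1\<^sup>2 / 2) *\<^sub>R k) - (c 0 - 0 *\<^sub>R v 0 - (0\<^sup>2 / 2) *\<^sub>R k)) \<le> \<delta> * \<bar>1 - 0\<bar>"
  proof (rule vector_derivative_bound[where S = "{0..1}" and f = "\<lambda>s. c s - s *\<^sub>R v 0 - (s\<^sup>2 / 2) *\<^sub>R k"])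
    show "((\<lambda>s. c s - s *\<^sub>R v 0 - (s\<^sup>2 / 2) *\<^sub>R k) has_vector_derivative v s - v 0 - s *\<^sub>R k) (at s within {0..1})"
      if "s \<in> {0..1}" for s
      by (auto intro!: derivative_eq_intros c[OF that])
    show "norm (v s - v 0 - s *\<^sub>R k) \<le> \<delta>" if "s \<in> {0..1}" for s
    proof -
      have "norm (v s - v 0 - s *\<^sub>R k) \<le> \<delta> * s" using V[OF that] that by (simp add: algebra_simps)
      also have "\<dots> \<le> \<delta>" using \<delta> that by (simp add: mult_left_le)
      finally show ?thesis .
    qed
  qed auto
  then show "norm (c 1 - c 0 - v 0 - (1 / 2) *\<^sub>R k) \<le> \<delta>" by (simp add: algebra_simps)
qed

lemma has_vector_derivative_quotient:
  fixes f :: "real \<Rightarrow> 'a::real_normed_vector"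
  shows "(f has_vector_derivative D) (at x) \<longleftrightarrow> ((\<lambda>h. (1 / h) *\<^sub>R (f (x + h) - f x)) \<longlongrightarrow> D) (at 0)"
proof -
  have *: "norm (f (x + h) - f x - h *\<^sub>R D) / norm h = norm ((1 / h) *\<^sub>R (f (x + h) - f x) - D)" if "h \<noteq> 0" for h
  proof -
    have "(1 / h) *\<^sub>R (f (x + h) - f x) - D = (1 / h) *\<^sub>R (f (x + h) - f x - h *\<^sub>R D)"
      using that by (simp add: algebra_simps)
    then show ?thesis by (simp add: divide_inverse mult.commute)
  qed
  have "(f has_vector_derivative D) (at x) \<longleftrightarrow> ((\<lambda>h. norm (f (x + h) - f x - h *\<^sub>R D) / norm h) \<longlongrightarrow> 0) (at 0)"
    unfolding has_vector_derivative_def has_derivative_at by (simp add: bounded_linear_scaleR_left)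
  also have "\<dots> \<longleftrightarrow> ((\<lambda>h. norm ((1 / h) *\<^sub>R (f (x + h) - f x) - D)) \<longlongrightarrow> 0) (at 0)"
  proof (rule filterlim_cong[OF refl refl])
    have "eventually (\<lambda>h::real. h \<noteq> 0) (at 0)" by (simp add: eventually_at_filter)
    then show "eventually (\<lambda>h. norm (f (x + h) - f x - h *\<^sub>R D) / norm h = norm ((1 / h) *\<^sub>R (f (x + h) - f x) - D)) (at 0)"
      by eventually_elim (rule *)
  qed
  also have "\<dots> \<longleftrightarrow> ((\<lambda>h. (1 / h) *\<^sub>R (f (x + h) - f x)) \<longlongrightarrow> D) (at 0)"
    unfolding tendsto_norm_zero_iff by (rule Lim_null[symmetric])
  finally show ?thesis .
qed

text \<open>The velocity is assumed differentiable at the single time \<open>t\<close>, hence the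
  remainder in Peano's form.\<close>

lemma peano_taylor:
  fixes c :: "real \<Rightarrow> 'a::real_normed_vector"
  assumes T: "open T" "t \<in> T" and c: "\<And>s. s \<in> T \<Longrightarrow> (c has_vector_derivative w s) (at s)"
    and w: "(w has_vector_derivative a) (at t)"
  shows "((\<lambda>h. (1 / h\<^sup>2) *\<^sub>R (c (t + h) - c t - h *\<^sub>R w t)) \<longlongrightarrow> (1 / 2) *\<^sub>R a) (at 0)"
proof (rule tendstoI)
  fix e :: real assume e: "e > 0"
  have "((\<lambda>h. (1 / h) *\<^sub>R (w (t + h) - w t)) \<longlongrightarrow> a) (at 0)"
    using w by (simp add: has_vector_derivative_quotient)
  then have "eventually (\<lambda>h. dist ((1 / h) *\<^sub>R (w (t + h) - w t)) a < e / 2) (at 0)"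
    using e by (intro tendstoD) auto
  then obtain d1 where d1: "d1 > 0" "\<And>h. h \<noteq> 0 \<Longrightarrow> \<bar>h\<bar> < d1 \<Longrightarrow> dist ((1 / h) *\<^sub>R (w (t + h) - w t)) a < e / 2"
    unfolding eventually_at by (auto simp: dist_real_def)
  obtain d2 where d2: "d2 > 0" "ball t d2 \<subseteq> T" using T open_contains_ball by blast
  have wb: "norm (w (t + h) - w t - h *\<^sub>R a) \<le> e / 2 * \<bar>h\<bar>" if "\<bar>h\<bar> < d1" for h
  proof (cases "h = 0")
    case False
    have "w (t + h) - w t - h *\<^sub>R a = h *\<^sub>R ((1 / h) *\<^sub>R (w (t + h) - w t) - a)"
      using False by (simp add: algebra_simps)
    then have "norm (w (t + h) - w t - h *\<^sub>R a) = \<bar>h\<bar> * dist ((1 / h) *\<^sub>R (w (t + h) - w t)) a"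
      by (simp add: dist_norm)
    also have "\<dots> \<le> \<bar>h\<bar> * (e / 2)" using d1(2)[OF False that] by (intro mult_left_mono) auto
    finally show ?thesis by (simp add: mult.commute)
  qed simp
  have "dist ((1 / h\<^sup>2) *\<^sub>R (c (t + h) - c t - h *\<^sub>R w t)) ((1 / 2) *\<^sub>R a) < e" if h: "h \<noteq> 0" "\<bar>h\<bar> < min d1 d2" for h
  proof -
    let ?S = "{- \<bar>h\<bar>..\<bar>h\<bar>}"
    let ?f = "\<lambda>s. c (t + s) - s *\<^sub>R w t - (s\<^sup>2 / 2) *\<^sub>R a"
    have "norm (?f h - ?f 0) \<le> (e / 2 * \<bar>h\<bar>) * \<bar>h - 0\<bar>"
    proof (rule vector_derivative_bound[where S = ?S])
      fix s assume s: "s \<in> ?S"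
      then have "t + s \<in> T" using h d2(2) by (auto simp: dist_real_def subset_iff)
      have "((\<lambda>s. c (t + s)) has_vector_derivative w (t + s)) (at s within ?S)"
      proof -
        have "((\<lambda>s. t + s) has_vector_derivative 1) (at s)" by (auto intro!: derivative_eq_intros)
        from vector_diff_chain_at[OF this c[OF \<open>t + s \<in> T\<close>]]
        show ?thesis by (auto simp: o_def intro: has_vector_derivative_at_within)
      qed
      then show "(?f has_vector_derivative w (t + s) - w t - s *\<^sub>R a) (at s within ?S)"
        by (auto intro!: derivative_eq_intros)
      have "norm (w (t + s) - w t - s *\<^sub>R a) \<le> e / 2 * \<bar>s\<bar>" by (rule wb) (use s h in auto)
      also have "\<dots> \<le> e / 2 * \<bar>h\<bar>" using s e by (intro mult_left_mono) auto
      finally show "norm (w (t + s) - w t - s *\<^sub>R a) \<le> e / 2 * \<bar>h\<bar>" .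
    qed auto
    then have b: "norm (c (t + h) - c t - h *\<^sub>R w t - (h\<^sup>2 / 2) *\<^sub>R a) \<le> e / 2 * h\<^sup>2"
      by (simp add: power2_eq_square algebra_simps)
    have "(1 / h\<^sup>2) *\<^sub>R (c (t + h) - c t - h *\<^sub>R w t) - (1 / 2) *\<^sub>R a =
      (1 / h\<^sup>2) *\<^sub>R (c (t + h) - c t - h *\<^sub>R w t - (h\<^sup>2 / 2) *\<^sub>R a)"
      using h(1) by (simp add: algebra_simps)
    then have "dist ((1 / h\<^sup>2) *\<^sub>R (c (t + h) - c t - h *\<^sub>R w t)) ((1 / 2) *\<^sub>R a)
      = (1 / h\<^sup>2) * norm (c (t + h) - c t - h *\<^sub>R w t - (h\<^sup>2 / 2) *\<^sub>R a)"
      by (simp add: dist_norm)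
    also have "\<dots> \<le> (1 / h\<^sup>2) * (e / 2 * h\<^sup>2)" using b by (intro mult_left_mono) auto
    also have "\<dots> = e / 2" using h(1) by simp
    finally show ?thesis using e by simp
  qed
  then show "eventually (\<lambda>h. dist ((1 / h\<^sup>2) *\<^sub>R (c (t + h) - c t - h *\<^sub>R w t)) ((1 / 2) *\<^sub>R a) < e) (at 0)"
    unfolding eventually_at using d1(1) d2(1) by (intro exI[of _ "min d1 d2"]) (auto simp: dist_real_def)
qed

text \<open>For the geodesic from p to y h, the acceleration is h^2 N p w up to o(h^2), uniformly on
  [0, 1]. Integrating once and twice gives the two expansions; the curve y need not be a
  geodesic.\<close>

lemma (in bvp) chord_asymptotics:
  assumes N: "spray_bound p R L N" and hom: "\<And>h v. N p (h *\<^sub>R v) = h\<^sup>2 *\<^sub>R N p v"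
    and y: "(y has_vector_derivative w) (at 0)" "y 0 = p"
  shows "((\<lambda>h. (1 / h\<^sup>2) *\<^sub>R (vel N p (y h) 1 - vel N p (y h) 0)) \<longlongrightarrow> N p w) (at 0)"
    and "((\<lambda>h. (1 / h\<^sup>2) *\<^sub>R (y h - p - vel N p (y h) 0)) \<longlongrightarrow> (1 / 2) *\<^sub>R N p w) (at 0)"
proof -
  define z where "z h = (1 / h) *\<^sub>R (y h - p)" for h
  have z: "(z \<longlongrightarrow> w) (at 0)"
    using y unfolding has_vector_derivative_quotient z_def by simp
  have pb: "p \<in> ball p \<rho>" using pos by simp
  have "(y \<longlongrightarrow> p) (at 0)"
    using has_vector_derivative_continuous[OF y(1)] y(2) by (simp add: continuous_at)
  then have "eventually (\<lambda>h. y h \<in> ball p \<rho>) (at 0)" using topological_tendstoD[OF _ open_ball pb] by blast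
  moreover have "eventually (\<lambda>h::real. h \<noteq> 0) (at 0)" by (simp add: eventually_at_filter)
  ultimately have ev: "eventually (\<lambda>h. y h \<in> ball p \<rho> \<and> h \<noteq> 0) (at 0)" by eventually_elim simp
  \<comment> \<open>The error allowed by \<open>spray_bound\<close> when position and velocity on
    the geodesic are replaced by \<open>p\<close> and \<open>h *\<^sub>R w\<close>, divided by
    h^2.\<close>
  define B where "B h = L * (3 * (\<bar>h\<bar> * norm (z h)) * (norm w)\<^sup>2 +
    (norm (w - z h) + 120 * L * (\<bar>h\<bar> * (norm (z h))\<^sup>2)) * (norm w + 2 * norm (z h)))" for h
  have hl: "((\<lambda>h::real. h) \<longlongrightarrow> 0) (at 0)" by (rule tendsto_ident_at)
  have "(B \<longlongrightarrow> L * (3 * (\<bar>0\<bar> * norm w) * (norm w)\<^sup>2 +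
    (norm (w - w) + 120 * L * (\<bar>0\<bar> * (norm w)\<^sup>2)) * (norm w + 2 * norm w))) (at 0)"
    unfolding B_def by (intro tendsto_intros z hl)
  then have B: "(B \<longlongrightarrow> 0) (at 0)" by simp
  have main: "norm ((1 / h\<^sup>2) *\<^sub>R (vel N p (y h) 1 - vel N p (y h) 0) - N p w) \<le> B h \<and>
      norm ((1 / h\<^sup>2) *\<^sub>R (y h - p - vel N p (y h) 0) - (1 / 2) *\<^sub>R N p w) \<le> B h"
    if h: "y h \<in> ball p \<rho>" "h \<noteq> 0" for h
  proof -
    let ?c = "path N p (y h)" and ?v = "vel N p (y h)"
    have yz: "y h - p = h *\<^sub>R z h" using h(2) by (simp add: z_def)
    have q: "norm (y h - p) = \<bar>h\<bar> * norm (z h)" by (simp add: yz)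
    have acc: "norm (N (?c s) (?v s) - h\<^sup>2 *\<^sub>R N p w) \<le> h\<^sup>2 * B h" if s: "s \<in> {0..1}" for s
    proof -
      have s': "s \<in> {-1..2}" using s by auto
      have c1: "norm (p - ?c s) \<le> 3 * (\<bar>h\<bar> * norm (z h))"
        using path_quadratic(1)[OF N pb h(1) s'] unfolding q by (subst norm_minus_commute)
      have v1: "norm (?v s) \<le> 2 * (\<bar>h\<bar> * norm (z h))"
        using path_quadratic(2)[OF N pb h(1) s'] by (simp add: q)
      have v2: "norm (h *\<^sub>R w - ?v s) \<le> \<bar>h\<bar> * (norm (w - z h) + 120 * L * (\<bar>h\<bar> * (norm (z h))\<^sup>2))"
      proof -
        have "h *\<^sub>R w - ?v s = h *\<^sub>R (w - z h) - (?v s - (y h - p))" by (simp add: yz algebra_simps)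
        also have "norm \<dots> \<le> \<bar>h\<bar> * norm (w - z h) + 120 * L * (norm (y h - p))\<^sup>2"
          by (rule norm_diff_bound[OF _ acc_quadratic(2)[OF N pb h(1) s']]) simp
        finally show ?thesis by (simp add: q power2_eq_square algebra_simps)
      qed
      have pR: "p \<in> cball p R" using \<rho>R pos by simp
      have "norm (N p (h *\<^sub>R w) - N (?c s) (?v s)) \<le>
        L * (norm (p - ?c s) * (norm (h *\<^sub>R w))\<^sup>2 + norm (h *\<^sub>R w - ?v s) * (norm (h *\<^sub>R w) + norm (?v s)))"
        using N path_bound(1)[OF N pb h(1) s'] pR unfolding spray_bound_def by blast
      also have "\<dots> \<le> L * (3 * (\<bar>h\<bar> * norm (z h)) * (norm (h *\<^sub>R w))\<^sup>2 +
        (\<bar>h\<bar> * (norm (w - z h) + 120 * L * (\<bar>h\<bar> * (norm (z h))\<^sup>2))) * (norm (h *\<^sub>R w) + 2 * (\<bar>h\<bar> * norm (z h))))"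
        using L1 c1 v1 v2
        by (intro mult_left_mono add_mono mult_right_mono mult_mono) (auto intro!: mult_nonneg_nonneg add_nonneg_nonneg)
      also have "\<dots> = h\<^sup>2 * B h"
      proof -
        define k where "k = \<bar>h\<bar>"
        have hh: "h\<^sup>2 = k\<^sup>2" by (simp add: k_def)
        show ?thesis unfolding B_def norm_scaleR power_mult_distrib hh k_def[symmetric]
          by (simp add: power2_eq_square algebra_simps)
      qed
      finally show ?thesis by (simp add: hom norm_minus_commute)
    qed
    have d: "(?c has_vector_derivative ?v s) (at s within {0..1})"
      "(?v has_vector_derivative N (?c s) (?v s)) (at s within {0..1})" if "s \<in> {0..1}" for s
      using path_deriv_within[OF N pb h(1), of s] that
      by (auto intro: has_vector_derivative_within_subset)
    note T = taylor_two_point[OF d acc]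
    have h2: "h\<^sup>2 > 0" using h(2) by simp
    have sc: "norm ((1 / h\<^sup>2) *\<^sub>R u - k) \<le> B h" if "norm (u - h\<^sup>2 *\<^sub>R k) \<le> h\<^sup>2 * B h" for u k
    proof -
      have "(1 / h\<^sup>2) *\<^sub>R u - k = (1 / h\<^sup>2) *\<^sub>R (u - h\<^sup>2 *\<^sub>R k)" using h(2) by (simp add: algebra_simps)
      then have "norm ((1 / h\<^sup>2) *\<^sub>R u - k) = (1 / h\<^sup>2) * norm (u - h\<^sup>2 *\<^sub>R k)" by simp
      also have "\<dots> \<le> (1 / h\<^sup>2) * (h\<^sup>2 * B h)" using that by (intro mult_left_mono) auto
      finally show ?thesis using h(2) by simp
    qed
    show ?thesis
    proof
      show "norm ((1 / h\<^sup>2) *\<^sub>R (?v 1 - ?v 0) - N p w) \<le> B h" by (rule sc) (rule T(1))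
      show "norm ((1 / h\<^sup>2) *\<^sub>R (y h - p - ?v 0) - (1 / 2) *\<^sub>R N p w) \<le> B h"
        by (rule sc) (use T(2) in \<open>simp add: mult.commute\<close>)
    qed
  qed
  have 1: "((\<lambda>h. (1 / h\<^sup>2) *\<^sub>R (vel N p (y h) 1 - vel N p (y h) 0) - N p w) \<longlongrightarrow> 0) (at 0)"
    by (rule Lim_null_comparison[OF _ B]) (use ev in eventually_elim, use main in blast)
  have 2: "((\<lambda>h. (1 / h\<^sup>2) *\<^sub>R (y h - p - vel N p (y h) 0) - (1 / 2) *\<^sub>R N p w) \<longlongrightarrow> 0) (at 0)"
    by (rule Lim_null_comparison[OF _ B]) (use ev in eventually_elim, use main in blast)
  show "((\<lambda>h. (1 / h\<^sup>2) *\<^sub>R (vel N p (y h) 1 - vel N p (y h) 0)) \<longlongrightarrow> N p w) (at 0)"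
    by (rule Lim_null[THEN iffD2, OF 1])
  show "((\<lambda>h. (1 / h\<^sup>2) *\<^sub>R (y h - p - vel N p (y h) 0)) \<longlongrightarrow> (1 / 2) *\<^sub>R N p w) (at 0)"
    by (rule Lim_null[THEN iffD2, OF 2])
qed

lemma has_real_derivative_compose_curve:
  fixes f :: "'a::real_normed_vector \<Rightarrow> real"
  assumes f: "f differentiable at (c t)" and c: "(c has_vector_derivative v) (at t)"
  shows "((\<lambda>s. f (c s)) has_real_derivative frechet_derivative f (at (c t)) v) (at t)"
proof -
  let ?f = "frechet_derivative f (at (c t))"
  have lin: "linear ?f" using linear_frechet_derivative[OF f] .
  have "((\<lambda>s. f (c s)) has_derivative (\<lambda>h. ?f (h *\<^sub>R v))) (at t)"
    using has_derivative_compose[OF c[unfolded has_vector_derivative_def] f[unfolded frechet_derivative_works]] .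
  then show ?thesis
    by (simp add: has_field_derivative_def linear_scale[OF lin] mult.commute[of _ "?f v"])
qed

text \<open>Only the continuity of \<open>P\<close> in the base point is used: nearby points of the curve are
  compared along the short geodesic joining them.\<close>

lemma killing_variation:
  fixes g :: "real ^ 'n::finite \<Rightarrow> real ^ 'n ^ 'n"
  assumes D: "open D" and g: "Ck_metric_on 2 D g" and P: "killing d D g P"
    and T: "open T" "t \<in> T" and c: "\<And>s. s \<in> T \<Longrightarrow> (c has_vector_derivative w s) (at s)"
    and w: "(w has_vector_derivative a) (at t)" and cD: "c t \<in> D"
  shows "((\<lambda>s. P (c s) (w s)) has_real_derivative
    frechet_derivative (P (c t)) (at (w t)) (a - spray g (c t) (w t))) (at t)"
proof -
  define p where "p = c t"
  define N where "N = spray g p (w t)"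
  obtain R L \<rho> \<epsilon> where ch: "chart D g p R L \<rho> \<epsilon>" by (rule chart_exists[OF g D cD[folded p_def]])
  interpret bvp p R L \<rho> using chartD(1)[OF ch] .
  note Nb = chartD(8)[OF ch g]
  have pb: "p \<in> ball p \<rho>" using pos by simp
  define y where "y h = c (t + h)" for h
  let ?V = "\<lambda>h. vel (spray g) p (y h)"
  have yd: "(y has_vector_derivative w t) (at 0)"
    using c[OF T(2)] unfolding has_vector_derivative_quotient y_def by simp
  have y0: "y 0 = p" by (simp add: y_def p_def)
  note A = chord_asymptotics[OF Nb _ yd y0, folded N_def, simplified spray_scaleR]
  have pt: "((\<lambda>h. (1 / h\<^sup>2) *\<^sub>R (y h - p - h *\<^sub>R w t)) \<longlongrightarrow> (1 / 2) *\<^sub>R a) (at 0)"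
    using peano_taylor[OF T c w] by (simp add: y_def p_def)
  have v0: "((\<lambda>h. (1 / h\<^sup>2) *\<^sub>R (?V h 0 - h *\<^sub>R w t)) \<longlongrightarrow> (1 / 2) *\<^sub>R a - (1 / 2) *\<^sub>R N) (at 0)"
    using tendsto_diff[OF pt A(2)] by (simp add: scaleR_diff_right[symmetric])
  have v1: "((\<lambda>h. (1 / h\<^sup>2) *\<^sub>R (?V h 1 - h *\<^sub>R w t)) \<longlongrightarrow> (1 / 2) *\<^sub>R a + (1 / 2) *\<^sub>R N) (at 0)"
  proof -
    have h: "(1 / 2) *\<^sub>R N + (1 / 2) *\<^sub>R N = N" by (simp flip: scaleR_add_left)
    have "((1 / 2) *\<^sub>R a - (1 / 2) *\<^sub>R N) + N = ((1 / 2) *\<^sub>R a - (1 / 2) *\<^sub>R N) + ((1 / 2) *\<^sub>R N + (1 / 2) *\<^sub>R N)"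
      by (simp only: h)
    also have "\<dots> = (1 / 2) *\<^sub>R a + (1 / 2) *\<^sub>R N" by simp
    finally have "((1 / 2) *\<^sub>R a - (1 / 2) *\<^sub>R N) + N = (1 / 2) *\<^sub>R a + (1 / 2) *\<^sub>R N" .
    then show ?thesis using tendsto_add[OF v0 A(1)] by (simp add: scaleR_add_right[symmetric])
  qed
  \<comment> \<open>Departure and arrival velocities of the chord geodesic, rescaled to unit order
    and extended to \<open>h = 0\<close> so that they can be differentiated there.\<close>
  define w0 where "w0 h = (if h = 0 then w t else (1 / h) *\<^sub>R ?V h 0)" for h
  define w1 where "w1 h = (if h = 0 then w t else (1 / h) *\<^sub>R ?V h 1)" for h
  have quot: "(W has_vector_derivative D) (at 0)"
    if W: "\<And>h. W h = (if h = 0 then w t else (1 / h) *\<^sub>R U h)" and lim: "((\<lambda>h. (1 / h\<^sup>2) *\<^sub>R (U h - h *\<^sub>R w t)) \<longlongrightarrow> D) (at 0)"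
    for W U and D :: "real ^ 'n"
    unfolding has_vector_derivative_quotient
  proof (rule Lim_transform_eventually[OF lim])
    show "eventually (\<lambda>h. (1 / h\<^sup>2) *\<^sub>R (U h - h *\<^sub>R w t) = (1 / h) *\<^sub>R (W (0 + h) - W 0)) (at 0)"
      by (auto simp: eventually_at_filter W power2_eq_square algebra_simps)
  qed
  have w0d: "(w0 has_vector_derivative (1 / 2) *\<^sub>R a - (1 / 2) *\<^sub>R N) (at 0)" by (rule quot[OF w0_def v0])
  have w1d: "(w1 has_vector_derivative (1 / 2) *\<^sub>R a + (1 / 2) *\<^sub>R N) (at 0)" by (rule quot[OF w1_def v1])
  have ud: "((\<lambda>h. w (t + h)) has_vector_derivative a) (at 0)"
    using w unfolding has_vector_derivative_quotient by simp
  have pD: "p \<in> D" using cD by (simp add: p_def)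
  have Pp: "P p \<in> hom_poly d" using killingD(1)[OF P pD] .
  obtain M e and l :: "nat \<Rightarrow> real ^ 'n \<Rightarrow> real" where l: "\<And>b. b < M \<Longrightarrow> l b \<in> hom_poly d"
    and rep: "\<And>p v. p \<in> hom_poly d \<Longrightarrow> p v = (\<Sum>b<M. p (e b) * l b v)"
    by (rule hom_poly_coordinates[of d]) auto
  let ?D = "\<lambda>b. frechet_derivative (l b) (at (w t))"
  let ?DP = "frechet_derivative (P p) (at (w t))"
  have lin: "linear ?DP" using linear_frechet_derivative[OF hom_poly_differentiable[OF Pp]] .
  have DP: "?DP k = (\<Sum>b<M. P p (e b) * ?D b k)" for k
  proof -
    have der: "((\<lambda>v. \<Sum>b<M. P p (e b) * l b v) has_derivative (\<lambda>k. \<Sum>b<M. P p (e b) * ?D b k)) (at (w t))"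
      using hom_poly_has_derivative[OF l]
      by (intro has_derivative_sum has_derivative_mult_right) auto
    have "(\<lambda>v. \<Sum>b<M. P p (e b) * l b v) = P p" by (rule ext) (rule rep[OF Pp, symmetric])
    from der[unfolded this] show ?thesis by (rule fun_cong[OF frechet_derivative_at, symmetric])
  qed
  have fl: "((\<lambda>h. (f (W h) - f (w t)) / h) \<longlongrightarrow> frechet_derivative f (at (w t)) k) (at 0)"
    if "f \<in> hom_poly d" "(W has_vector_derivative k) (at 0)" "W 0 = w t" for f W k
    using has_real_derivative_compose_curve[of f W 0 k] hom_poly_differentiable[OF that(1)] that(2,3)
    by (simp add: DERIV_def)
  have Pe: "((\<lambda>h. P (y h) v) \<longlongrightarrow> P p v) (at 0)" for v
  proof -
    have "(y \<longlongrightarrow> p) (at 0)"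
      using has_vector_derivative_continuous[OF yd] y0 by (simp add: continuous_at)
    then show ?thesis using filterlim_compose[OF killing_continuous[OF D g P pD]] by blast
  qed
  \<comment> \<open>The increment of \<open>P\<close> is split as P(y h)(w(t + h)) - P(y h)(w1 h)
    plus P p (w0 h) - P p (w t), since P(y h)(w1 h) = P p (w0 h). In each part only the velocity
    changes, so no derivative in the base point is needed.\<close>
  have "((\<lambda>h. (\<Sum>b<M. P (y h) (e b) * ((l b (w (t + h)) - l b (w t)) / h - (l b (w1 h) - l b (w t)) / h))
      + (P p (w0 h) - P p (w t)) / h) \<longlongrightarrow>
     (\<Sum>b<M. P p (e b) * (?D b a - ?D b ((1 / 2) *\<^sub>R a + (1 / 2) *\<^sub>R N))) + ?DP ((1 / 2) *\<^sub>R a - (1 / 2) *\<^sub>R N)) (at 0)"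
    by (intro tendsto_intros Pe fl[OF l] fl[OF Pp] ud w1d w0d) (auto simp: w0_def w1_def)
  \<comment> \<open>The velocity increments a - (a + N) / 2 and (a - N) / 2 add up to a - N.\<close>
  moreover have "(\<Sum>b<M. P p (e b) * (?D b a - ?D b ((1 / 2) *\<^sub>R a + (1 / 2) *\<^sub>R N))) + ?DP ((1 / 2) *\<^sub>R a - (1 / 2) *\<^sub>R N)
     = ?DP (a - N)"
  proof -
    have "(\<Sum>b<M. P p (e b) * (?D b a - ?D b ((1 / 2) *\<^sub>R a + (1 / 2) *\<^sub>R N))) = ?DP a - ?DP ((1 / 2) *\<^sub>R a + (1 / 2) *\<^sub>R N)"
      unfolding DP by (simp add: right_diff_distrib sum_subtractf)
    then show ?thesis
      by (simp add: linear_diff[OF lin] linear_add[OF lin] linear_scale[OF lin])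
  qed
  moreover have "eventually (\<lambda>h. (\<Sum>b<M. P (y h) (e b) * ((l b (w (t + h)) - l b (w t)) / h - (l b (w1 h) - l b (w t)) / h))
      + (P p (w0 h) - P p (w t)) / h = (P (c (t + h)) (w (t + h)) - P (c t) (w t)) / h) (at 0)"
  proof -
    have "(y \<longlongrightarrow> p) (at 0)"
      using has_vector_derivative_continuous[OF yd] y0 by (simp add: continuous_at)
    then have "eventually (\<lambda>h. y h \<in> ball p \<rho>) (at 0)" using topological_tendstoD[OF _ open_ball pb] by blast
    moreover have "eventually (\<lambda>h::real. h \<noteq> 0) (at 0)" by (simp add: eventually_at_filter)
    ultimately show ?thesis
    proof eventually_elim
      case (elim h)
      have yD: "y h \<in> D" using elim(1) chartD(6)[OF ch] by blast
      have Py: "P (y h) \<in> hom_poly d" using killingD(1)[OF P yD] .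
      have "P p (?V h 0) = P (y h) (?V h 1)"
        by (rule killing_bvp[OF chartD(1)[OF ch] Nb chartD(3)[OF ch] pb elim(1) P])
      then have eq: "P p (w0 h) = P (y h) (w1 h)"
        using elim(2) by (simp add: w0_def w1_def hom_poly_scaleR[OF Py] hom_poly_scaleR[OF Pp])
      have "(\<Sum>b<M. P (y h) (e b) * ((l b (w (t + h)) - l b (w t)) / h - (l b (w1 h) - l b (w t)) / h))
        = ((\<Sum>b<M. P (y h) (e b) * l b (w (t + h))) - (\<Sum>b<M. P (y h) (e b) * l b (w1 h))) / h"
        by (simp add: sum_subtractf[symmetric] sum_divide_distrib diff_divide_distrib[symmetric] right_diff_distrib[symmetric])
      also have "\<dots> = (P (y h) (w (t + h)) - P p (w0 h)) / h"
        unfolding rep[OF Py, symmetric] eq ..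
      finally show ?case by (simp add: y_def p_def add_divide_distrib[symmetric] diff_divide_distrib[symmetric])
    qed
  qed
  ultimately have "((\<lambda>h. (P (c (t + h)) (w (t + h)) - P (c t) (w t)) / h) \<longlongrightarrow> ?DP (a - N)) (at 0)"
    using Lim_transform_eventually by force
  then show ?thesis by (simp add: DERIV_def p_def N_def)
qed

section \<open>Destroying an integral by a small conformal bump\<close>

lemma real_polynomial_frechet_continuous:
  assumes "real_polynomial_function (p :: 'a::real_normed_vector \<Rightarrow> real)"
  shows "continuous_on UNIV (\<lambda>v. frechet_derivative p (at v) e)"
  using assms
proof (induction p rule: real_polynomial_function.induct)
  case (linear f)
  have "frechet_derivative f (at v) = f" for v
    using frechet_derivative_at[OF bounded_linear_imp_has_derivative[OF linear]] by simp
  then show ?case by simp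
next
  case (const c)
  then show ?case by simp
next
  case (add f g)
  have "frechet_derivative (\<lambda>x. f x + g x) (at v) e = frechet_derivative f (at v) e + frechet_derivative g (at v) e" for v
  proof -
    have "(f has_derivative frechet_derivative f (at v)) (at v)" "(g has_derivative frechet_derivative g (at v)) (at v)"
      using add.hyps differentiable_at_real_polynomial_function frechet_derivative_works by blast+
    from frechet_derivative_at[OF has_derivative_add[OF this]] show ?thesis by metis
  qed
  then show ?case using add.IH by (simp add: continuous_on_add)
next
  case (mult f g)
  have "frechet_derivative (\<lambda>x. f x * g x) (at v) e = f v * frechet_derivative g (at v) e + frechet_derivative f (at v) e * g v" for v
  proof -
    have "(f has_derivative frechet_derivative f (at v)) (at v)" "(g has_derivative frechet_derivative g (at v)) (at v)"
      using mult.hyps differentiable_at_real_polynomial_function frechet_derivative_works by blast+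
    from frechet_derivative_at[OF has_derivative_mult[OF this]] show ?thesis by metis
  qed
  moreover have "continuous_on UNIV f" "continuous_on UNIV g"
    using mult.hyps differentiable_on_real_polynomial_function differentiable_imp_continuous_on by blast+
  ultimately show ?case using mult.IH by (simp add: continuous_on_add continuous_on_mult)
qed

section \<open>Bump metrics, and points where an integral is not critical\<close>

lemma matrix_inv_tendsto:
  fixes A :: "'b \<Rightarrow> real ^ 'n::finite ^ 'n"
  assumes A0: "invertible A0" and inv: "eventually (\<lambda>x. invertible (A x)) F"
    and lim: "\<And>k l. ((\<lambda>x. A x $ k $ l) \<longlongrightarrow> A0 $ k $ l) F"
  shows "((\<lambda>x. matrix_inv (A x) $ i $ j) \<longlongrightarrow> matrix_inv A0 $ i $ j) F"
proof -
  obtain \<delta> B where \<delta>: "\<delta> > 0" "B \<ge> 1"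
    "\<And>A i j. invertible A \<Longrightarrow> (\<And>k l. \<bar>A $ k $ l - A0 $ k $ l\<bar> < \<delta>) \<Longrightarrow> \<bar>matrix_inv A $ i $ j\<bar> \<le> B"
    by (rule matrix_inv_bound_near[OF A0]) blast
  define s where "s x = (\<Sum>k\<in>UNIV. \<Sum>l\<in>UNIV. \<bar>A x $ k $ l - A0 $ k $ l\<bar>)" for x
  have "(s \<longlongrightarrow> (\<Sum>k\<in>(UNIV::'n set). \<Sum>l\<in>(UNIV::'n set). \<bar>A0 $ k $ l - A0 $ k $ l\<bar>)) F"
    unfolding s_def by (intro tendsto_intros lim)
  then have s0: "(s \<longlongrightarrow> 0) F" by simp
  have sb: "\<bar>A x $ k $ l - A0 $ k $ l\<bar> \<le> s x" for x k l
  proof -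
    have "\<bar>A x $ k $ l - A0 $ k $ l\<bar> \<le> (\<Sum>l\<in>UNIV. \<bar>A x $ k $ l - A0 $ k $ l\<bar>)"
      by (rule member_le_sum) auto
    also have "\<dots> \<le> s x" unfolding s_def
      by (rule member_le_sum[of k UNIV "\<lambda>k. \<Sum>l\<in>UNIV. \<bar>A x $ k $ l - A0 $ k $ l\<bar>"]) (auto intro: sum_nonneg)
    finally show ?thesis .
  qed
  have "((\<lambda>x. matrix_inv (A x) $ i $ j - matrix_inv A0 $ i $ j) \<longlongrightarrow> 0) F"
  proof (rule Lim_null_comparison)
    show "eventually (\<lambda>x. norm (matrix_inv (A x) $ i $ j - matrix_inv A0 $ i $ j) \<le> (real CARD('n))\<^sup>2 * B\<^sup>2 * s x) F"
      using inv order_tendstoD(2)[OF s0 \<delta>(1)]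
    proof eventually_elim
      case (elim x)
      have "\<bar>matrix_inv (A x) $ i $ j - matrix_inv A0 $ i $ j\<bar> \<le> (real CARD('n))\<^sup>2 * B\<^sup>2 * s x"
      proof (rule matrix_inv_close[OF elim(1) A0])
        show "\<bar>matrix_inv (A x) $ i $ j\<bar> \<le> B" for i j
          by (rule \<delta>(3)[OF elim(1)]) (rule le_less_trans[OF sb elim(2)])
        show "\<bar>matrix_inv A0 $ i $ j\<bar> \<le> B" for i j
          by (rule \<delta>(3)[OF A0]) (use \<delta>(1) in simp)
      qed (rule sb)
      then show ?case by simp
    qed
    show "((\<lambda>x. (real CARD('n))\<^sup>2 * B\<^sup>2 * s x) \<longlongrightarrow> 0) F" by (rule tendsto_mult_right_zero[OF s0])
  qed
  then show ?thesis by (rule Lim_null[THEN iffD2])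
qed

definition bump_metric where
  "bump_metric k z \<rho> s g = (\<lambda>x. (1 + s * bump (k + 2) z \<rho> x) *\<^sub>R (g x :: real ^ 'n::finite ^ 'n))"

text \<open>The perturbation is \<open>s\<close> times a fixed compactly supported C^k tensor whose
  derivatives are bounded, so it is small for small \<open>s\<close>; a positive conformal factor
  preserves nondegeneracy.\<close>

lemma bump_metric_close:
  fixes g :: "real ^ 'n::finite \<Rightarrow> real ^ 'n ^ 'n"
  assumes D: "open D" and g: "Ck_metric_on k D g" and z: "cball z \<rho> \<subseteq> D" "\<rho> > 0" and \<eta>: "\<eta> > 0"
  obtains s where "s > 0" "Ck_metric_on k D (bump_metric k z \<rho> s g)" "Ck_close_on k D \<eta> g (bump_metric k z \<rho> s g)"
proof -
  let ?f = "bump (k + 2) z \<rho>"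
  have f: "Ck_on k D ?f" using Ck_on_subset[OF bump_Ck[of k 1 z \<rho>], of D] by simp
  have fg: "Ck_on k D (\<lambda>x. ?f x * g x $ i $ j)" for i j
    by (rule Ck_on_mult[OF D f Ck_metric_onD(1)[OF g]])
  define bd where "bd i j M \<longleftrightarrow> M > 0 \<and>
    (\<forall>I x. length I \<le> k \<longrightarrow> x \<in> D \<longrightarrow> \<bar>iter_partial I (\<lambda>x. ?f x * g x $ i $ j) x\<bar> \<le> M)" for i j M
  have "\<exists>M. bd i j M" for i j
  proof -
    have "?f x * g x $ i $ j = 0" if "x \<in> D - cball z \<rho>" for x
      using bump_zero[of "k + 2" \<rho> x z] that z(2) by (simp add: dist_norm norm_minus_commute)
    then show ?thesis
      by (rule Ck_on_compact_support_bound[OF D compact_cball z(1) fg]) (auto simp: bd_def)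
  qed
  then obtain M where "\<And>i j. bd i j (M i j)" by metis
  then have M: "\<And>i j. M i j > 0"
    "\<And>i j I x. length I \<le> k \<Longrightarrow> x \<in> D \<Longrightarrow> \<bar>iter_partial I (\<lambda>x. ?f x * g x $ i $ j) x\<bar> \<le> M i j"
    unfolding bd_def by blast+
  define m where "m = (\<Sum>i\<in>UNIV. \<Sum>j\<in>UNIV. M i j)"
  have Mm: "M i j \<le> m" for i j
  proof -
    have "M i j \<le> (\<Sum>j\<in>UNIV. M i j)" by (rule member_le_sum) (auto intro: less_imp_le M)
    also have "\<dots> \<le> m" unfolding m_def
      by (rule member_le_sum[of i UNIV "\<lambda>i. \<Sum>j\<in>UNIV. M i j"]) (auto intro: sum_nonneg[OF less_imp_le[OF M(1)]])
    finally show ?thesis .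
  qed
  have m: "m > 0" using M(1) Mm less_le_trans by blast
  define s where "s = \<eta> / (2 * m)"
  have s: "s > 0" "s * m < \<eta>" using \<eta> m by (auto simp: s_def)
  have comp: "bump_metric k z \<rho> s g x $ i $ j = g x $ i $ j + s * (?f x * g x $ i $ j)" for x i j
    by (simp add: bump_metric_def algebra_simps)
  have pos: "1 + s * ?f x > 0" for x using bump_nonneg[of "k + 2" z \<rho> x] s(1) by (simp add: add_pos_nonneg)
  show ?thesis
  proof
    show "s > 0" by fact
    show "Ck_metric_on k D (bump_metric k z \<rho> s g)"
      unfolding Ck_metric_on_def
    proof (intro conjI allI ballI)
      show "Ck_on k D (\<lambda>x. bump_metric k z \<rho> s g x $ i $ j)" for i j
        unfolding comp by (intro Ck_on_add Ck_on_mult[OF D Ck_on_const fg] D Ck_metric_onD(1)[OF g])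
      fix x assume x: "x \<in> D"
      show "transpose (bump_metric k z \<rho> s g x) = bump_metric k z \<rho> s g x"
        using Ck_metric_onD(2)[OF g x] by (simp add: bump_metric_def vec_eq_iff transpose_def)
      show "invertible (bump_metric k z \<rho> s g x)"
        unfolding bump_metric_def using matrix_inv_scaleR(2)[OF Ck_metric_onD(3)[OF g x]] pos[of x] by simp
    qed
    show "Ck_close_on k D \<eta> g (bump_metric k z \<rho> s g)"
      unfolding Ck_close_on_def
    proof (intro ballI allI impI)
      fix x i j I assume x: "x \<in> D" and I: "length (I :: 'n list) \<le> k"
      have "\<bar>iter_partial I (\<lambda>y. g y $ i $ j) x - iter_partial I (\<lambda>y. bump_metric k z \<rho> s g y $ i $ j) x\<bar>
        = s * \<bar>iter_partial I (\<lambda>y. ?f y * g y $ i $ j) x\<bar>"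
        unfolding comp using iter_partial_add_cmult[OF D Ck_metric_onD(1)[OF g] fg I x, of i j s i j] s(1)
        by (simp add: abs_mult)
      also have "\<dots> \<le> s * m" using order_trans[OF M(2)[OF I x] Mm] s(1) by (intro mult_left_mono) auto
      finally show "\<bar>iter_partial I (\<lambda>y. g y $ i $ j) x - iter_partial I (\<lambda>y. bump_metric k z \<rho> s g y $ i $ j) x\<bar> < \<eta>"
        using s(2) by linarith
    qed
  qed
qed

text \<open>The set is the union, over small d > 0, of the complements of the open balls of radius r
  + d. These are connected and share a point at distance r + e / 2 from \<open>a\<close>.\<close>

lemma connected_diff_cball:
  fixes S :: "'a::euclidean_space set"
  assumes "open S" "connected S" "cball a r \<subseteq> S" "2 \<le> DIM('a)" "r > 0"
  shows "connected (S - cball a r)"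
proof -
  have "compact (cball a r)" by simp
  then obtain e where e: "e > 0" "\<And>x. x \<in> cball a r \<Longrightarrow> ball x e \<subseteq> S"
    using Lebesgue_number_lemma[of "cball a r" "{S}"] assms(1,3) compact_subset_open_imp_ball_epsilon_subset
    by (metis UN_subset_iff)
  have big: "cball a (r + d) \<subseteq> S" if "0 < d" "d < e" for d
  proof
    fix x assume x: "x \<in> cball a (r + d)"
    show "x \<in> S"
    proof (cases "x \<in> cball a r")
      case False
      \<comment> \<open>Radial projection of \<open>x\<close> to the sphere of radius
        \<open>r\<close>.\<close>
      define y where "y = a + (r / dist a x) *\<^sub>R (x - a)"
      have dx: "dist a x > r" using False by simp
      have xa: "x \<noteq> a" using dx assms(5) by auto
      then have "dist a y = r" using dx assms(5) by (simp add: y_def dist_norm norm_minus_commute)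
      note ay = this
      have "x - y = (1 - r / dist a x) *\<^sub>R (x - a)" by (simp add: y_def algebra_simps)
      then have "dist x y = \<bar>1 - r / dist a x\<bar> * dist a x" by (simp add: dist_norm norm_minus_commute)
      moreover have "1 - r / dist a x \<ge> 0" using dx assms(5) xa by (simp add: field_simps)
      ultimately have "dist x y = (1 - r / dist a x) * dist a x" by simp
      also have "\<dots> = dist a x - r" using xa by (simp add: left_diff_distrib)
      finally have "dist x y = dist a x - r" .
      with ay have "x \<in> ball y e" "y \<in> cball a r" using x that by (auto simp: dist_commute)
      then show ?thesis using e(2) by blast
    qed (use assms(3) in blast)
  qed
  define R where "R = r + e / 2"
  have eq: "S - cball a r = (\<Union>d\<in>{0<..<e / 2}. S - ball a (r + d))"
  proof (intro equalityI subsetI)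
    fix x assume x: "x \<in> S - cball a r"
    define d where "d = min ((dist a x - r) / 2) (e / 4)"
    have "d \<in> {0<..<e / 2}" "x \<in> S - ball a (r + d)" using x e(1) by (auto simp: d_def min_def field_simps)
    then show "x \<in> (\<Union>d\<in>{0<..<e / 2}. S - ball a (r + d))" by blast
  qed (auto simp: dist_commute)
  have "connected (\<Union>d\<in>{0<..<e / 2}. S - ball a (r + d))"
  proof (rule connected_Union)
    fix T assume "T \<in> (\<lambda>d. S - ball a (r + d)) ` {0<..<e / 2}"
    then obtain d where "d \<in> {0<..<e / 2}" "T = S - ball a (r + d)" by blast
    then show "connected T"
      using e(1) by (simp only:) (intro connected_diff_ball assms(2,4) big, auto)
  next
    obtain b :: 'a where b: "norm b = 1" using vector_choose_size[of 1] by auto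
    have "a + R *\<^sub>R b \<in> cball a R" "dist a (a + R *\<^sub>R b) = R"
      using b e(1) assms(5) by (auto simp: dist_norm R_def)
    then have "a + R *\<^sub>R b \<in> S" using big[of "e / 2"] e(1) by (auto simp: R_def)
    then have "a + R *\<^sub>R b \<in> (\<Inter>d\<in>{0<..<e / 2}. S - ball a (r + d))"
      using \<open>dist a (a + R *\<^sub>R b) = R\<close> by (auto simp: R_def)
    then show "(\<Inter>d\<in>{0<..<e / 2}. S - ball a (r + d)) \<noteq> {}" by blast
  qed
  then show ?thesis unfolding eq .
qed

lemma energy_bvp:
  fixes g :: "real ^ 'n::finite \<Rightarrow> real ^ 'n ^ 'n"
  assumes ch: "chart D g p R L \<rho> \<epsilon>" and g: "Ck_metric_on 2 D g" and xy: "x \<in> ball p \<rho>" "y \<in> ball p \<rho>"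
  shows "qform (g x) (bvp.vel \<rho> (spray g) x y 0) = qform (g y) (bvp.vel \<rho> (spray g) x y 1)"
  using killing_bvp[OF chartD(1)[OF ch] chartD(8)[OF ch g] chartD(3)[OF ch] xy killing_energy[OF g, of 2]]
  by (simp add: energy_power_def)

text \<open>Otherwise each \<open>P x\<close> with \<open>x\<close> in \<open>W\<close> is a
  multiple \<open>A x\<close> of the energy power. Conservation of both along short geodesics makes
  \<open>A\<close> locally constant, and unique continuation makes \<open>P\<close> trivial on
  \<open>V\<close>. The velocity found is that of a short geodesic, ready to be perturbed.\<close>

lemma nontrivial_point:
  fixes g :: "real ^ 'n::finite \<Rightarrow> real ^ 'n ^ 'n"
  assumes n: "CARD('n) \<ge> 2" and V: "open V" "connected V" and g: "Ck_metric_on 2 V g"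
    and P: "killing d V g P" and nt: "\<not> trivial_on d V g P" and W: "open W" "W \<noteq> {}" "W \<subseteq> V"
  obtains x R L \<rho> \<epsilon> y e where "x \<in> W" "chart V g x R L \<rho> \<epsilon>" "y \<in> ball x \<rho>"
    "qform (g x) (bvp.vel \<rho> (spray g) x y 0) \<noteq> 0" "bvp.vel \<rho> (spray g) x y 0 \<bullet> (g x *v e) = 0"
    "frechet_derivative (P x) (at (bvp.vel \<rho> (spray g) x y 0)) e \<noteq> 0"
proof (rule ccontr)
  note out = that
  assume no: "\<not> thesis"
  have "\<exists>a. \<forall>v. P x v = a * energy_power d (qform (g x) v)" if x: "x \<in> W" for x
  proof -
    have xV: "x \<in> V" using x W(3) by blast
    obtain R L \<rho> \<epsilon> where ch: "chart V g x R L \<rho> \<epsilon>" by (rule chart_exists[OF g V(1) xV])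
    interpret bvp x R L \<rho> using chartD(1)[OF ch] .
    have xb: "x \<in> ball x \<rho>" using pos by simp
    let ?U = "(\<lambda>y. vel (spray g) x y 0) ` ball x \<rho>"
    have U: "open ?U" "?U \<noteq> {}" using vel_open_map[OF chartD(8)[OF ch g] xb open_ball order_refl] xb by auto
    show ?thesis
    proof (rule hom_poly_eq_energy_power[OF Ck_metric_onD(2,3)[OF g xV] n killingD(1)[OF P xV] U])
      fix v e assume v: "v \<in> ?U" "qform (g x) v \<noteq> 0" "v \<bullet> (g x *v e) = 0"
      then obtain y where y: "y \<in> ball x \<rho>" "v = vel (spray g) x y 0" by blast
      show "frechet_derivative (P x) (at v) e = 0"
        using out[OF x ch y(1)] v(2,3) no unfolding y(2) by blast
    qed
  qed
  then obtain A where A: "\<And>x v. x \<in> W \<Longrightarrow> P x v = A x * energy_power d (qform (g x) v)" by metis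
  obtain x where x: "x \<in> W" using W(2) by blast
  have xV: "x \<in> V" using x W(3) by blast
  obtain R L \<rho> \<epsilon> where ch: "chart V g x R L \<rho> \<epsilon>" by (rule chart_exists[OF g V(1) xV])
  interpret bvp x R L \<rho> using chartD(1)[OF ch] .
  have xb: "x \<in> ball x \<rho>" using pos by simp
  let ?S = "ball x \<rho> \<inter> W"
  let ?v = "\<lambda>y. vel (spray g) x y 0"
  have "x \<in> ?S" using x xb by blast
  have S: "open ?S" by (intro open_Int open_ball W(1))
  have Sne: "?S \<noteq> {}" using \<open>x \<in> ?S\<close> by blast
  have "open (?v ` ?S)" by (rule vel_open_map[OF chartD(8)[OF ch g] xb S]) simp
  moreover have "?v ` ?S \<noteq> {}" using Sne by simp
  ultimately obtain v1 where v1: "v1 \<in> ?v ` ?S" "qform (g x) v1 \<noteq> 0"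
    by (rule qform_nonzero_on_open[OF Ck_metric_onD(2,3)[OF g xV]])
  have "continuous_on ?S (\<lambda>y. qform (g x) (?v y))"
    unfolding continuous_on_def
  proof
    fix y assume y: "y \<in> ?S"
    have "((\<lambda>m. vel (spray g) x m 0) \<longlongrightarrow> vel (spray g) x y 0) (at y within ?S)"
      by (rule chart_tendsto[OF ch g, where gs = "\<lambda>m. g"])
         (use g y xb in \<open>auto simp: Ck_close_on_refl intro: tendsto_ident_at\<close>)
    then show "((\<lambda>y. qform (g x) (?v y)) \<longlongrightarrow> qform (g x) (?v y)) (at y within ?S)"
      by (rule hom_poly_tendsto[OF qform_hom_poly])
  qed
  then have oU: "open (?S \<inter> (\<lambda>y. qform (g x) (?v y)) -` (- {0}))"
    by (intro continuous_open_preimage S) auto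
  have neU: "?S \<inter> (\<lambda>y. qform (g x) (?v y)) -` (- {0}) \<noteq> {}" using v1 by auto
  \<comment> \<open>For even \<open>d\<close>, compare \<open>A x\<close> with \<open>A y\<close>
    along a geodesic of nonzero energy; for odd \<open>d\<close> the energy power is 0 and both
    sides vanish.\<close>
  have PU: "P y w = A x * energy_power d (qform (g y) w)"
    if y: "y \<in> ?S \<inter> (\<lambda>y. qform (g x) (?v y)) -` (- {0})" for y w
  proof (cases "even d")
    case True
    have yb: "y \<in> ball x \<rho>" using y by blast
    have "P x (?v y) = P y (vel (spray g) x y 1)"
      by (rule killing_bvp[OF chartD(1)[OF ch] chartD(8)[OF ch g] chartD(3)[OF ch] xb yb P])
    then have "A x * energy_power d (qform (g x) (?v y)) = A y * energy_power d (qform (g y) (vel (spray g) x y 1))"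
      using A[OF x] A[of y] y by simp
    then have "A x * energy_power d (qform (g x) (?v y)) = A y * energy_power d (qform (g x) (?v y))"
      unfolding energy_bvp[OF ch g xb yb, symmetric] .
    moreover have "energy_power d (qform (g x) (?v y)) \<noteq> 0" using True y by (simp add: energy_power_def)
    ultimately have "A x = A y" by simp
    then show ?thesis using A[of y] y by simp
  qed (use A[of y] y in \<open>simp add: energy_power_def\<close>)
  have "P z w = A x * energy_power d (qform (g z) w)" if "z \<in> V" for z w
    by (rule unique_continuation_eq[OF V g P killing_cmult[OF killing_energy[OF g]] oU neU _ PU that])
       (use W(3) in blast)+
  then show False using nt unfolding trivial_on_def by blast
qed

text \<open>The derivative of \<open>P x\<close> in the velocity with its index raised by the
  metric.\<close>

definition velocity_gradient ::
  "(real ^ 'n::finite \<Rightarrow> real ^ 'n ^ 'n) \<Rightarrow> (real ^ 'n \<Rightarrow> real ^ 'n \<Rightarrow> real) \<Rightarrow> real ^ 'n \<Rightarrow> real ^ 'n \<Rightarrow> real ^ 'n" where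
  "velocity_gradient g P x w =
     (\<chi> l. \<Sum>k\<in>UNIV. frechet_derivative (P x) (at w) (axis k 1) * matrix_inv (g x) $ k $ l)"

lemma linear_axis_expansion:
  fixes f :: "real ^ 'n::finite \<Rightarrow> real"
  assumes "linear f"
  shows "f v = (\<Sum>k\<in>UNIV. v $ k * f (axis k 1))"
proof -
  have "f (\<Sum>k\<in>UNIV. v $ k *\<^sub>R axis k 1) = (\<Sum>k\<in>UNIV. v $ k * f (axis k 1))"
    by (simp add: linear_sum[OF assms] linear_scale[OF assms])
  moreover have "(\<Sum>k\<in>UNIV. v $ k *\<^sub>R axis k 1) = v"
    by (simp add: vec_eq_iff axis_def if_distrib cong: if_cong)
  ultimately show ?thesis by simp
qed

lemma velocity_gradient_gradient:
  fixes P :: "real ^ 'n::finite \<Rightarrow> real ^ 'n \<Rightarrow> real"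
  assumes "P x \<in> hom_poly d"
  shows "frechet_derivative (P x) (at w) (gradient g (\<lambda>e. u \<bullet> e) x) = u \<bullet> velocity_gradient g P x w"
proof -
  have "linear (frechet_derivative (P x) (at w))"
    using linear_frechet_derivative[OF hom_poly_differentiable[OF assms]] .
  from linear_axis_expansion[OF this, of "gradient g (\<lambda>e. u \<bullet> e) x"]
  have "frechet_derivative (P x) (at w) (gradient g (\<lambda>e. u \<bullet> e) x) =
    (\<Sum>k\<in>UNIV. \<Sum>l\<in>UNIV. matrix_inv (g x) $ k $ l * u $ l * frechet_derivative (P x) (at w) (axis k 1))"
    by (simp add: gradient_def inner_axis sum_distrib_right)
  also have "\<dots> = u \<bullet> velocity_gradient g P x w"
    by (subst sum.swap) (simp add: velocity_gradient_def inner_vec_def sum_distrib_left algebra_simps)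
  finally show ?thesis .
qed

lemma velocity_gradient_lower:
  fixes P :: "real ^ 'n::finite \<Rightarrow> real ^ 'n \<Rightarrow> real" and g :: "real ^ 'n \<Rightarrow> real ^ 'n ^ 'n"
  assumes P: "P x \<in> hom_poly d" and g: "invertible (g x)"
  shows "velocity_gradient g P x w \<bullet> (g x *v e) = frechet_derivative (P x) (at w) e"
proof -
  define f where "f = frechet_derivative (P x) (at w)"
  have lin: "linear f"
    unfolding f_def using linear_frechet_derivative[OF hom_poly_differentiable[OF P]] .
  have "velocity_gradient g P x w \<bullet> (g x *v e) =
    (\<Sum>l\<in>UNIV. \<Sum>k\<in>UNIV. \<Sum>m\<in>UNIV. f (axis k 1) * matrix_inv (g x) $ k $ l * (g x $ l $ m * e $ m))"
    by (simp add: velocity_gradient_def inner_vec_def matrix_vector_mult_def sum_product f_def)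
  also have "\<dots> = (\<Sum>k\<in>UNIV. \<Sum>m\<in>UNIV. \<Sum>l\<in>UNIV. f (axis k 1) * matrix_inv (g x) $ k $ l * (g x $ l $ m * e $ m))"
    by (subst sum.swap, rule sum.cong[OF refl], rule sum.swap)
  also have "\<dots> = (\<Sum>k\<in>UNIV. \<Sum>m\<in>UNIV. f (axis k 1) * (\<Sum>l\<in>UNIV. matrix_inv (g x) $ k $ l * g x $ l $ m) * e $ m)"
    by (simp add: sum_distrib_left sum_distrib_right mult.assoc)
  also have "\<dots> = (\<Sum>k\<in>UNIV. \<Sum>m\<in>UNIV. if k = m then f (axis k 1) * e $ m else 0)"
    unfolding matrix_inv_entries(2)[OF g] by (intro sum.cong refl) auto
  also have "\<dots> = f e" by (subst linear_axis_expansion[OF lin, of e]) (simp add: mult.commute)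
  finally show ?thesis by (simp add: f_def)
qed

lemma metric_tendsto:
  fixes g :: "real ^ 'n::finite \<Rightarrow> real ^ 'n ^ 'n"
  assumes V: "open V" and g: "Ck_metric_on 2 V g" and x: "x \<in> V" and X: "(X \<longlongrightarrow> x) F"
  shows "((\<lambda>m. g (X m) $ i $ j) \<longlongrightarrow> g x $ i $ j) F"
proof -
  have "continuous_on V (\<lambda>x. g x $ i $ j)"
    using Ck_metric_onD(1)[OF g, of i j] by (simp add: numeral_2_eq_2 Ck_on_Suc)
  then have "isCont (\<lambda>x. g x $ i $ j) x" using V x by (simp add: continuous_on_eq_continuous_at)
  then show ?thesis using X by (rule isCont_tendsto_compose)
qed

text \<open>Continuity in the base point becomes joint continuity, also of the velocity derivative,
  because both are fixed continuous functions combined with finitely many coordinates of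
  \<open>P\<close>.\<close>

lemma killing_tendsto:
  fixes g :: "real ^ 'n::finite \<Rightarrow> real ^ 'n ^ 'n"
  assumes V: "open V" and g: "Ck_metric_on 2 V g" and P: "killing d V g P" and x: "x \<in> V"
    and X: "(X \<longlongrightarrow> x) F" and W: "(W \<longlongrightarrow> w) F" and F: "F \<noteq> bot"
  shows "((\<lambda>m. P (X m) (W m)) \<longlongrightarrow> P x w) F"
    and "((\<lambda>m. frechet_derivative (P (X m)) (at (W m)) e) \<longlongrightarrow> frechet_derivative (P x) (at w) e) F"
proof -
  have ev: "eventually (\<lambda>m. X m \<in> V) F" using topological_tendstoD[OF X V x] .
  then have hom: "eventually (\<lambda>m. P (X m) \<in> hom_poly d) F"
    by eventually_elim (rule killingD(1)[OF P])
  have lim: "((\<lambda>m. P (X m) v) \<longlongrightarrow> P x v) F" for v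
    using filterlim_compose[OF killing_continuous[OF V g P x] X] .
  show "((\<lambda>m. P (X m) (W m)) \<longlongrightarrow> P x w) F" by (rule hom_poly_limit(2)[OF hom F lim W])
  obtain M b and l :: "nat \<Rightarrow> real ^ 'n \<Rightarrow> real" where l: "\<And>i. i < M \<Longrightarrow> l i \<in> hom_poly d"
    and rep: "\<And>p v. p \<in> hom_poly d \<Longrightarrow> p v = (\<Sum>i<M. p (b i) * l i v)"
    by (rule hom_poly_coordinates[of d]) auto
  have fd: "frechet_derivative p (at v) e = (\<Sum>i<M. p (b i) * frechet_derivative (l i) (at v) e)"
    if p: "p \<in> hom_poly d" for p v
  proof -
    have der: "((\<lambda>v. \<Sum>i<M. p (b i) * l i v) has_derivative (\<lambda>k. \<Sum>i<M. p (b i) * frechet_derivative (l i) (at v) k)) (at v)"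
      using hom_poly_has_derivative[OF l]
      by (intro has_derivative_sum has_derivative_mult_right) auto
    have "(\<lambda>v. \<Sum>i<M. p (b i) * l i v) = p" by (rule ext) (rule rep[OF p, symmetric])
    from der[unfolded this] show ?thesis by (rule fun_cong[OF frechet_derivative_at, symmetric])
  qed
  have "((\<lambda>m. \<Sum>i<M. P (X m) (b i) * frechet_derivative (l i) (at (W m)) e) \<longlongrightarrow>
    (\<Sum>i<M. P x (b i) * frechet_derivative (l i) (at w) e)) F"
  proof (intro tendsto_sum tendsto_mult lim)
    fix i assume "i \<in> {..<M}"
    then have "isCont (\<lambda>v. frechet_derivative (l i) (at v) e) w"
      using real_polynomial_frechet_continuous[OF hom_poly_imp_real_polynomial_function[OF l], of i e]
      by (simp add: continuous_on_eq_continuous_at)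
    then show "((\<lambda>m. frechet_derivative (l i) (at (W m)) e) \<longlongrightarrow> frechet_derivative (l i) (at w) e) F"
      using W by (rule isCont_tendsto_compose)
  qed
  then have "((\<lambda>m. \<Sum>i<M. P (X m) (b i) * frechet_derivative (l i) (at (W m)) e) \<longlongrightarrow> frechet_derivative (P x) (at w) e) F"
    unfolding fd[OF killingD(1)[OF P x]] .
  moreover have "eventually (\<lambda>m. (\<Sum>i<M. P (X m) (b i) * frechet_derivative (l i) (at (W m)) e) = frechet_derivative (P (X m)) (at (W m)) e) F"
    using hom by eventually_elim (rule fd[symmetric])
  ultimately show "((\<lambda>m. frechet_derivative (P (X m)) (at (W m)) e) \<longlongrightarrow> frechet_derivative (P x) (at w) e) F"
    by (rule Lim_transform_eventually)
qed

text \<open>Insert the conformal spray into \<open>killing_variation\<close>: Euler's identity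
  evaluates the tangential term and duality the gradient term. The logarithm contributes a further
  multiple of the tangential term, so \<open>\<kappa>\<close> shifts only the coefficient of
  \<open>w t\<close>.\<close>

lemma bump_variation:
  fixes g :: "real ^ 'n::finite \<Rightarrow> real ^ 'n ^ 'n"
  assumes V: "open V" and g: "Ck_metric_on 2 V g" and P: "killing d V g P" and s: "s > 0"
    and c: "geodesic_on V (bump_metric k z \<rho> s g) T c w" and t: "t \<in> T"
  shows "((\<lambda>t. P (c t) (w t) + \<kappa> * ln (1 + s * bump (k + 2) z \<rho> (c t))) has_real_derivative
    s * (real (k + 2) * bump (k + 1) z \<rho> (c t) * 2) / (1 + s * bump (k + 2) z \<rho> (c t)) *
     ((z - c t) \<bullet> ((qform (g (c t)) (w t) / 2) *\<^sub>R velocity_gradient g P (c t) (w t) - (real d * P (c t) (w t) - \<kappa>) *\<^sub>R w t))) (at t)"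
proof -
  let ?f = "bump (k + 2) z \<rho>"
  define x where "x = c t"
  define v where "v = w t"
  have T: "open T" and cT: "\<And>s. s \<in> T \<Longrightarrow> c s \<in> V" "\<And>s. s \<in> T \<Longrightarrow> (c has_vector_derivative w s) (at s)"
    and wt: "(w has_vector_derivative spray (bump_metric k z \<rho> s g) (c t) (w t)) (at t)"
    using c t by (auto simp: geodesic_on_spray)
  have xV: "x \<in> V" using cT(1)[OF t] by (simp add: x_def)
  have Px: "P x \<in> hom_poly d" using killingD(1)[OF P xV] .
  let ?D = "frechet_derivative (P x) (at v)"
  have lin: "linear ?D" using linear_frechet_derivative[OF hom_poly_differentiable[OF Px]] .
  define u where "u = (s * (real (k + 2) * bump (k + 1) z \<rho> x * 2)) *\<^sub>R (z - x)"
  define h where "h = 1 + s * ?f x"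
  have h: "h > 0" using bump_nonneg[of "k + 2" z \<rho> x] s by (simp add: h_def add_pos_nonneg)
  have df: "(?f has_derivative (\<lambda>e. real (k + 2) * bump (k + 1) z \<rho> x * (2 * ((z - x) \<bullet> e)))) (at x)"
    using bump_deriv[of "k + 1" z \<rho> x] by simp
  have "((\<lambda>y. s * ?f y) has_derivative (\<lambda>e. s * (real (k + 2) * bump (k + 1) z \<rho> x * (2 * ((z - x) \<bullet> e))))) (at x)"
    by (rule has_derivative_mult_right[OF df])
  then have dsf: "((\<lambda>y. s * ?f y) has_derivative (\<lambda>e. u \<bullet> e)) (at x)"
    by (simp add: u_def algebra_simps)
  have "spray (bump_metric k z \<rho> s g) x v = spray g x v
    - (1 / h) *\<^sub>R ((u \<bullet> v) *\<^sub>R v - (qform (g x) v / 2) *\<^sub>R gradient g (\<lambda>e. u \<bullet> e) x)"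
    unfolding bump_metric_def h_def
    by (rule spray_conformal[where f = "\<lambda>y. s * ?f y"])
       (use Ck_metric_onD(3)[OF g xV] C2_metric_partials(1)[OF g xV] dsf h metric_sym[OF g xV] in \<open>auto simp: h_def\<close>)
  then have "?D (spray (bump_metric k z \<rho> s g) x v - spray g x v) =
    - (1 / h) * ((u \<bullet> v) * ?D v - (qform (g x) v / 2) * ?D (gradient g (\<lambda>e. u \<bullet> e) x))"
    by (simp add: linear_neg[OF lin] linear_scale[OF lin] linear_diff[OF lin])
  also have "\<dots> = (1 / h) * ((qform (g x) v / 2) * (u \<bullet> velocity_gradient g P x v) - (u \<bullet> v) * (real d * P x v))"
    unfolding velocity_gradient_gradient[where P = P and x = x, OF Px] euler_hom_poly[OF Px] by (simp add: algebra_simps)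
  finally have "((\<lambda>s. P (c s) (w s)) has_real_derivative
     (1 / h) * ((qform (g x) v / 2) * (u \<bullet> velocity_gradient g P x v) - (u \<bullet> v) * (real d * P x v))) (at t)"
    using killing_variation[OF V g P T t cT(2) wt cT(1)[OF t]] by (simp add: x_def v_def)
  moreover have "((\<lambda>t. ln (1 + s * ?f (c t))) has_real_derivative (u \<bullet> v) / h) (at t)"
  proof -
    have "((\<lambda>t. s * ?f (c t)) has_derivative (\<lambda>e. u \<bullet> (e *\<^sub>R v))) (at t)"
      using has_derivative_compose[OF cT(2)[OF t, unfolded has_vector_derivative_def] dsf[unfolded x_def]]
      by (simp add: v_def)
    then have "((\<lambda>t. s * ?f (c t)) has_real_derivative u \<bullet> v) (at t)"
      by (simp add: has_field_derivative_def mult.commute[of _ "u \<bullet> v"])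
    from DERIV_add[OF DERIV_const[of 1] this]
    have d1: "((\<lambda>t. 1 + s * ?f (c t)) has_real_derivative u \<bullet> v) (at t)" by simp
    have hp: "0 < 1 + s * ?f (c t)" using h by (simp add: h_def x_def)
    show ?thesis using DERIV_chain2[OF DERIV_ln_divide[OF hp] d1] by (simp add: h_def x_def)
  qed
  ultimately have "((\<lambda>t. P (c t) (w t) + \<kappa> * ln (1 + s * ?f (c t))) has_real_derivative
     (1 / h) * ((qform (g x) v / 2) * (u \<bullet> velocity_gradient g P x v) - (u \<bullet> v) * (real d * P x v)) + \<kappa> * ((u \<bullet> v) / h)) (at t)"
    by (intro DERIV_add DERIV_cmult)
  then show ?thesis
  proof (rule DERIV_cong)
    show "(1 / h) * ((qform (g x) v / 2) * (u \<bullet> velocity_gradient g P x v) - (u \<bullet> v) * (real d * P x v)) + \<kappa> * ((u \<bullet> v) / h)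
      = s * (real (k + 2) * bump (k + 1) z \<rho> (c t) * 2) / (1 + s * bump (k + 2) z \<rho> (c t)) *
     ((z - c t) \<bullet> ((qform (g (c t)) (w t) / 2) *\<^sub>R velocity_gradient g P (c t) (w t) - (real d * P (c t) (w t) - \<kappa>) *\<^sub>R w t))"
      unfolding x_def[symmetric] v_def[symmetric] h_def[symmetric] u_def
      using h by (simp add: inner_diff_right divide_simps) (simp add: algebra_simps)
  qed
qed

text \<open>If the perturbed metric had an integral agreeing with \<open>P\<close> on \<open>U\<close>, the two would agree
  outside the bump by unique continuation. But along a geodesic of the perturbed metric through
  the bump, \<open>P\<close> plus a multiple of the logarithm of the conformal factor is strictly monotone.\<close>

lemma bump_destroys_integral:
  fixes g :: "real ^ 'n::finite \<Rightarrow> real ^ 'n ^ 'n"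
  assumes n: "CARD('n) \<ge> 2" and k: "k \<ge> 2" and D: "open D" and gD: "Ck_metric_on k D g"
    and V: "open V" "connected V" "V \<subseteq> D" and P: "killing d V g P" and nt: "\<not> trivial_on d V g P"
    and W: "open W" "W \<noteq> {}" "W \<subseteq> V" and U: "open U" "U \<noteq> {}" "U \<subseteq> V" "U \<inter> W = {}"
    and \<eta>: "\<eta> > 0"
  obtains g1 where "Ck_metric_on k D g1" "Ck_close_on k D \<eta> g g1" "\<And>x. x \<notin> W \<Longrightarrow> g1 x = g x"
    "\<And>P1. killing d V g1 P1 \<Longrightarrow> \<exists>x\<in>U. \<exists>v. P1 x v \<noteq> P x v"
proof -
  have g: "Ck_metric_on 2 V g" using Ck_metric_on_mono[OF gD k V(3)] .
  obtain x R L \<rho> \<epsilon> y e where x: "x \<in> W" and ch: "chart V g x R L \<rho> \<epsilon>" and y: "y \<in> ball x \<rho>"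
    and E: "qform (g x) (bvp.vel \<rho> (spray g) x y 0) \<noteq> 0"
    and e: "bvp.vel \<rho> (spray g) x y 0 \<bullet> (g x *v e) = 0"
      "frechet_derivative (P x) (at (bvp.vel \<rho> (spray g) x y 0)) e \<noteq> 0"
    by (rule nontrivial_point[OF n V(1,2) g P nt W])
  interpret bvp x R L \<rho> using chartD(1)[OF ch] .
  have xV: "x \<in> V" using x W(3) by blast
  have xb: "x \<in> ball x \<rho>" using pos by simp
  define c where "c = path (spray g) x y"
  define w where "w = vel (spray g) x y"
  define v where "v = w 0"
  have geo: "geodesic_on V g {-1<..<2} c w"
    unfolding c_def w_def by (rule path_geodesic[OF chartD(1)[OF ch] chartD(8)[OF ch g] chartD(3)[OF ch] xb y])
  have c0: "c 0 = x" by (simp add: c_def)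
  have v0: "v \<noteq> 0" using E by (auto simp: v_def w_def qform_def)
  \<comment> \<open>Chosen to remove the component of \<open>u x v\<close> along \<open>v\<close>,
    in the Euclidean inner product.\<close>
  define \<kappa> where "\<kappa> = real d * P x v - (qform (g x) v / 2) * (velocity_gradient g P x v \<bullet> v) / (v \<bullet> v)"
  define u where "u x' w' = (qform (g x') w' / 2) *\<^sub>R velocity_gradient g P x' w' - (real d * P x' w' - \<kappa>) *\<^sub>R w'"
    for x' w' :: "real ^ 'n"
  define u0 where "u0 = u x v"
  have orth: "v \<bullet> u0 = 0"
  proof -
    have "real d * P x v - \<kappa> = (qform (g x) v / 2) * (velocity_gradient g P x v \<bullet> v) / (v \<bullet> v)"
      by (simp add: \<kappa>_def)
    then show ?thesis
      unfolding u0_def u_def using v0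
      by (simp only: inner_diff_right inner_scaleR_right inner_commute[of v "velocity_gradient g P x v"]) simp
  qed
  \<comment> \<open>If \<open>u0\<close> were 0, the velocity gradient would be parallel to
    \<open>v\<close>; pairing it with \<open>e\<close>, which is orthogonal to \<open>v\<close> for
    the metric, would give a zero derivative in the direction \<open>e\<close>.\<close>
  have u0: "u0 \<noteq> 0"
  proof
    assume "u0 = 0"
    then have eq: "(qform (g x) v / 2) *\<^sub>R velocity_gradient g P x v = (real d * P x v - \<kappa>) *\<^sub>R v"
      by (simp add: u0_def u_def)
    have "(qform (g x) v / 2) * frechet_derivative (P x) (at v) e =
      ((qform (g x) v / 2) *\<^sub>R velocity_gradient g P x v) \<bullet> (g x *v e)"
      using velocity_gradient_lower[where P = P and x = x and g = g, OF killingD(1)[OF P xV] Ck_metric_onD(3)[OF g xV], of v e] by simp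
    also have "\<dots> = 0" unfolding eq using e(1) by (simp add: v_def w_def)
    finally show False using E e(2) by (simp add: v_def w_def)
  qed
  have u_lim: "((\<lambda>q. u (fst q) (snd q)) \<longlongrightarrow> u0) (nhds (x, v))"
  proof -
    have X: "(fst \<longlongrightarrow> x) (nhds (x, v))" and Y: "(snd \<longlongrightarrow> v) (nhds (x, v))"
      using tendsto_fst[OF filterlim_ident[of "nhds (x, v)"]] tendsto_snd[OF filterlim_ident[of "nhds (x, v)"]] by simp_all
    have F: "nhds (x, v) \<noteq> bot" by simp
    have q: "((\<lambda>q. qform (g (fst q)) (snd q)) \<longlongrightarrow> qform (g x) v) (nhds (x, v))"
      unfolding qform_sum
      by (intro tendsto_sum tendsto_mult tendsto_vec_nth[OF Y] metric_tendsto[OF V(1) g xV X])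
    have inv: "eventually (\<lambda>q. invertible (g (fst q))) (nhds (x, v))"
      using topological_tendstoD[OF X V(1) xV] by eventually_elim (rule Ck_metric_onD(3)[OF g])
    have vg: "((\<lambda>q. velocity_gradient g P (fst q) (snd q)) \<longlongrightarrow> velocity_gradient g P x v) (nhds (x, v))"
      unfolding velocity_gradient_def
      by (intro tendsto_vec_lambda tendsto_sum tendsto_mult killing_tendsto(2)[OF V(1) g P xV X Y F]
          matrix_inv_tendsto[OF Ck_metric_onD(3)[OF g xV] inv metric_tendsto[OF V(1) g xV X]])
    show ?thesis
      unfolding u0_def u_def by (intro tendsto_intros q vg Y killing_tendsto(1)[OF V(1) g P xV X Y F]) auto
  qed
  have "eventually (\<lambda>q. dist (u (fst q) (snd q)) u0 < norm u0 / 8) (nhds (x, v))"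
    using u0 by (intro tendstoD[OF u_lim]) simp
  then obtain \<delta> where \<delta>: "\<delta> > 0" "\<And>q. dist q (x, v) < \<delta> \<Longrightarrow> dist (u (fst q) (snd q)) u0 < norm u0 / 8"
    unfolding eventually_nhds_metric by blast
  have u_near: "norm (u x' w' - u0) \<le> norm u0 / 8" if "norm (x' - x) < \<delta> / 2" "norm (w' - v) < \<delta> / 2" for x' w'
  proof -
    have "dist (x', w') (x, v) \<le> dist x' x + dist w' v"
      unfolding dist_Pair_Pair by (rule sqrt_sum_squares_le_sum) auto
    also have "\<dots> < \<delta>" using that by (simp add: dist_norm)
    finally show ?thesis using \<delta>(2)[of "(x', w')"] by (simp add: dist_norm)
  qed
  have d0: "(c has_vector_derivative v) (at 0)" "(w has_vector_derivative spray g x v) (at 0)"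
  proof -
    have "\<forall>t\<in>{-1<..<2}. c t \<in> V \<and> (c has_vector_derivative w t) (at t) \<and> (w has_vector_derivative spray g (c t) (w t)) (at t)"
      using geo unfolding geodesic_on_spray by blast
    from bspec[OF this, of 0] show "(c has_vector_derivative v) (at 0)" "(w has_vector_derivative spray g x v) (at 0)"
      by (simp_all add: v_def c0)
  qed
  have cw: "(c \<longlongrightarrow> x) (nhds 0)" "(w \<longlongrightarrow> v) (nhds 0)"
    using has_vector_derivative_continuous[OF d0(1)] has_vector_derivative_continuous[OF d0(2)] c0
    by (auto simp: isCont_def tendsto_at_iff_tendsto_nhds v_def)
  have \<delta>4: "\<delta> / 4 > 0" using \<delta>(1) by simp
  have "eventually (\<lambda>t. dist (c t) x < \<delta> / 4) (nhds 0)" "eventually (\<lambda>t. dist (w t) v < \<delta> / 4) (nhds 0)"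
    by (rule tendstoD[OF cw(1) \<delta>4], rule tendstoD[OF cw(2) \<delta>4])
  moreover have "eventually (\<lambda>t. norm (c t - x - t *\<^sub>R v) \<le> norm v / 32 * \<bar>t\<bar>) (nhds 0)"
  proof -
    have "((\<lambda>h. (1 / h) *\<^sub>R (c h - x)) \<longlongrightarrow> v) (at 0)" using d0(1) by (simp add: has_vector_derivative_quotient c0)
    then have "eventually (\<lambda>h. dist ((1 / h) *\<^sub>R (c h - x)) v < norm v / 32) (at 0)"
      using v0 by (intro tendstoD) auto
    then have "eventually (\<lambda>h. h \<noteq> 0 \<longrightarrow> norm (c h - x - h *\<^sub>R v) \<le> norm v / 32 * \<bar>h\<bar>) (nhds 0)"
      unfolding eventually_at_filter
    proof eventually_elim
      case (elim h)
      show ?case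
      proof
        assume h: "h \<noteq> 0"
        then have "c h - x - h *\<^sub>R v = h *\<^sub>R ((1 / h) *\<^sub>R (c h - x) - v)" by (simp add: algebra_simps)
        then have "norm (c h - x - h *\<^sub>R v) = \<bar>h\<bar> * dist ((1 / h) *\<^sub>R (c h - x)) v" by (simp add: dist_norm)
        also have "\<dots> \<le> \<bar>h\<bar> * (norm v / 32)" using elim h by (intro mult_left_mono) auto
        finally show "norm (c h - x - h *\<^sub>R v) \<le> norm v / 32 * \<bar>h\<bar>" by (simp add: mult.commute)
      qed
    qed
    then show ?thesis by eventually_elim (auto simp: c0)
  qed
  ultimately have "eventually (\<lambda>t. dist (c t) x < \<delta> / 4 \<and> dist (w t) v < \<delta> / 4 \<and>
      norm (c t - x - t *\<^sub>R v) \<le> norm v / 32 * \<bar>t\<bar>) (nhds 0)"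
    by eventually_elim simp
  then obtain \<tau>1 where \<tau>1: "\<tau>1 > 0" "\<And>t. \<bar>t\<bar> < \<tau>1 \<Longrightarrow> dist (c t) x < \<delta> / 4 \<and> dist (w t) v < \<delta> / 4 \<and>
      norm (c t - x - t *\<^sub>R v) \<le> norm v / 32 * \<bar>t\<bar>"
    unfolding eventually_nhds_metric by (auto simp: dist_real_def)
  obtain r1 where r1: "r1 > 0" "ball x r1 \<subseteq> W" using W(1) x open_contains_ball by blast
  \<comment> \<open>Radius of the bump: small enough for the ball to stay in \<open>W\<close>, and
    for the geodesic to cross it within times where it is nearly straight.\<close>
  define rb where "rb = min (min \<tau>1 (1 / 2) * norm v / 4) (r1 / 4)"
  have rb: "rb > 0" "rb \<le> r1 / 4" "rb \<le> min \<tau>1 (1 / 2) * norm v / 4"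
    using \<tau>1(1) v0 r1(1) by (auto simp: rb_def)
  define \<tau> where "\<tau> = 2 * rb / norm v"
  have \<tau>v: "\<tau> * norm v = 2 * rb" using v0 by (simp add: \<tau>_def)
  have \<tau>0: "\<tau> > 0" using rb(1) v0 by (simp add: \<tau>_def)
  have "2 * rb \<le> min \<tau>1 (1 / 2) * norm v / 2" using rb(3) by linarith
  then have "\<tau> \<le> min \<tau>1 (1 / 2) * norm v / 2 / norm v" unfolding \<tau>_def by (rule divide_right_mono) simp
  moreover have "m * norm v / 2 / norm v = m / 2" for m using v0 by simp
  ultimately have "\<tau> \<le> min \<tau>1 (1 / 2) / 2" by (simp only:)
  then have \<tau>: "\<tau> < \<tau>1" "\<tau> < 1" using \<tau>1(1) by auto
  \<comment> \<open>The centre is shifted by half a radius towards \<open>u0\<close>: the geodesic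
    still meets the bump at \<open>x\<close>, but always on the same side of the centre.\<close>
  define z where "z = x + (rb / (2 * norm u0)) *\<^sub>R u0"
  have zx: "norm (z - x) = rb / 2" using u0 rb(1) by (simp add: z_def)
  have zW: "cball z rb \<subseteq> W"
  proof
    fix q assume "q \<in> cball z rb"
    then have "dist x q \<le> rb / 2 + rb"
      using dist_triangle[of x q z] zx by (simp add: dist_norm norm_minus_commute)
    then show "q \<in> W" using r1(2) rb(1,2) by auto
  qed
  \<comment> \<open>Makes \<open>120 * L * e1\<close> half of the smaller tolerance, so the
    perturbed geodesic stays close in position and velocity.\<close>
  define e1 where "e1 = min (\<delta> / 4) (rb / 16) / (240 * L)"
  have e1: "e1 > 0" "120 * L * e1 < \<delta> / 4" "120 * L * e1 \<le> rb / 16"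
    using \<delta>(1) rb(1) L1 by (auto simp: e1_def)
  have "min \<eta> (min \<epsilon> e1) > 0" using \<eta> chartD(2)[OF ch] e1(1) by simp
  then obtain s where s: "s > 0" "Ck_metric_on k D (bump_metric k z rb s g)"
    "Ck_close_on k D (min \<eta> (min \<epsilon> e1)) g (bump_metric k z rb s g)"
    by (rule bump_metric_close[OF D gD order_trans[OF zW order_trans[OF W(3) V(3)]] rb(1)])
  let ?g = "bump_metric k z rb s g"
  have out: "?g q = g q" if "q \<notin> ball z rb" for q
    using bump_zero[of "k + 2" rb q z] that rb(1) by (simp add: bump_metric_def dist_norm norm_minus_commute)
  have gV: "Ck_metric_on 2 V ?g" using Ck_metric_on_mono[OF s(2) k V(3)] .
  have clV: "Ck_close_on 2 V \<epsilon> g ?g" "Ck_close_on 2 V e1 g ?g"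
    using Ck_close_on_mono[OF s(3) k V(3)] by auto
  define c' where "c' = path (spray ?g) x y"
  define w' where "w' = vel (spray ?g) x y"
  have geo': "geodesic_on V ?g {-1<..<2} c' w'"
    unfolding c'_def w'_def
    by (rule path_geodesic[OF chartD(1)[OF ch] chartD(7)[OF ch gV clV(1)] chartD(3)[OF ch] xb y])
  have close: "norm (c' t - c t) < \<delta> / 4" "norm (c' t - c t) \<le> rb / 16" "norm (w' t - w t) < \<delta> / 4" if "t \<in> {-1..2}" for t
    using chart_vel_close[OF ch g gV clV xb y xb y that] e1
    by (simp_all add: c_def c'_def w_def w'_def norm_minus_commute)
  have c'0: "c' 0 = x" by (simp add: c'_def)
  have lin: "norm (c' t - x - t *\<^sub>R v) \<le> rb / 8" and un: "norm (u (c' t) (w' t) - u0) \<le> norm u0 / 8" if t: "\<bar>t\<bar> \<le> \<tau>" for t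
  proof -
    have t': "t \<in> {-1..2}" "\<bar>t\<bar> < \<tau>1" using t \<tau> by auto
    have "norm v / 32 * \<bar>t\<bar> \<le> norm v / 32 * \<tau>" using t by (intro mult_left_mono) auto
    then have "norm (c t - x - t *\<^sub>R v) \<le> rb / 16" using \<tau>1(2)[OF t'(2)] \<tau>v by (simp add: mult.commute)
    then have "norm ((c' t - c t) + (c t - x - t *\<^sub>R v)) \<le> rb / 16 + rb / 16"
      by (intro norm_add_bound close(2)[OF t'(1)])
    moreover have "(c' t - c t) + (c t - x - t *\<^sub>R v) = c' t - x - t *\<^sub>R v" by simp
    ultimately have "norm (c' t - x - t *\<^sub>R v) \<le> rb / 16 + rb / 16" by (simp only:)
    then show "norm (c' t - x - t *\<^sub>R v) \<le> rb / 8" by linarith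
    show "norm (u (c' t) (w' t) - u0) \<le> norm u0 / 8"
    proof (rule u_near)
      have "norm ((c' t - c t) + (c t - x)) < \<delta> / 4 + \<delta> / 4"
        using \<tau>1(2)[OF t'(2)] close(1)[OF t'(1)] by (intro norm_add_less) (auto simp: dist_norm)
      then show "norm (c' t - x) < \<delta> / 2" by simp
      have "norm ((w' t - w t) + (w t - v)) < \<delta> / 4 + \<delta> / 4"
        using \<tau>1(2)[OF t'(2)] close(3)[OF t'(1)] by (intro norm_add_less) (auto simp: dist_norm)
      then show "norm (w' t - v) < \<delta> / 2" by simp
    qed
  qed
  \<comment> \<open>Moving along \<open>v\<close> does not change the product with
    \<open>u0\<close>. The main term is rb |u0| / 2, and the curvature of the path and the variation
    of \<open>u\<close> each cost at most rb |u0| / 8.\<close>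
  have inner_pos: "(z - c' t) \<bullet> u (c' t) (w' t) > 0" if t: "\<bar>t\<bar> \<le> \<tau>" and near: "norm (z - c' t) \<le> rb" for t
  proof -
    have "(z - c' t) \<bullet> u (c' t) (w' t) = (z - x) \<bullet> u0 - (c' t - x - t *\<^sub>R v) \<bullet> u0 + (z - c' t) \<bullet> (u (c' t) (w' t) - u0)"
      using orth by (simp add: algebra_simps)
    moreover have "(z - x) \<bullet> u0 = rb / 2 * norm u0"
      using u0 by (simp add: z_def dot_square_norm power2_eq_square)
    moreover have "\<bar>(c' t - x - t *\<^sub>R v) \<bullet> u0\<bar> \<le> rb / 8 * norm u0"
      using Cauchy_Schwarz_ineq2[of "c' t - x - t *\<^sub>R v" u0] mult_right_mono[OF lin[OF t] norm_ge_zero[of u0]] by linarith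
    moreover have "\<bar>(z - c' t) \<bullet> (u (c' t) (w' t) - u0)\<bar> \<le> rb * (norm u0 / 8)"
      using Cauchy_Schwarz_ineq2[of "z - c' t" "u (c' t) (w' t) - u0"] mult_mono[OF near un[OF t]] rb(1) by force
    moreover have "rb * norm u0 > 0" using rb(1) u0 by simp
    ultimately show ?thesis by simp
  qed
  define \<psi> where "\<psi> t = P (c' t) (w' t) + \<kappa> * ln (1 + s * bump (k + 2) z rb (c' t))" for t
  define \<beta> where "\<beta> t = s * (real (k + 2) * bump (k + 1) z rb (c' t) * 2) / (1 + s * bump (k + 2) z rb (c' t))" for t
  have \<psi>': "(\<psi> has_real_derivative \<beta> t * ((z - c' t) \<bullet> u (c' t) (w' t))) (at t)" if "t \<in> {-1<..<2}" for t
    unfolding \<psi>_def \<beta>_def u_def by (rule bump_variation[OF V(1) g P s(1) geo' that])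
  have den: "1 + s * bump (k + 2) z rb q > 0" for q
    using bump_nonneg[of "k + 2" z rb q] s(1) by (simp add: add_pos_nonneg)
  have nonneg: "\<beta> t * ((z - c' t) \<bullet> u (c' t) (w' t)) \<ge> 0" if t: "\<bar>t\<bar> \<le> \<tau>" for t
  proof (cases "norm (z - c' t) \<le> rb")
    case True
    have "\<beta> t \<ge> 0" unfolding \<beta>_def using s(1) den[of "c' t"] bump_nonneg[of "k + 1" z rb "c' t"] by simp
    then show ?thesis using inner_pos[OF t True] by simp
  next
    case False
    then have "bump (k + 1) z rb (c' t) = 0" using rb(1) by (intro bump_zero) (auto simp: norm_minus_commute)
    then show ?thesis by (simp add: \<beta>_def)
  qed
  have pos0: "\<beta> 0 * ((z - c' 0) \<bullet> u (c' 0) (w' 0)) > 0"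
  proof -
    have "bump (k + 1) z rb x > 0" using zx rb(1) by (intro bump_pos) (simp add: norm_minus_commute)
    then have "\<beta> 0 > 0" unfolding \<beta>_def c'0 using s(1) den[of x] by (intro divide_pos_pos mult_pos_pos) auto
    then show ?thesis using inner_pos[of 0] zx rb(1) \<tau>0 by (simp add: c'0)
  qed
  have mono: "\<psi> a \<le> \<psi> b" if "- \<tau> \<le> a" "a \<le> b" "b \<le> \<tau>" for a b
  proof (rule DERIV_nonneg_imp_nondecreasing[OF that(2)])
    fix t assume t: "a \<le> t" "t \<le> b"
    show "\<exists>y. (\<psi> has_real_derivative y) (at t) \<and> 0 \<le> y"
      using \<psi>'[of t] nonneg[of t] t that \<tau>(2) by (intro exI conjI) auto
  qed
  \<comment> \<open>The derivative is nonnegative on the whole interval and positive at time 0,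
    where the geodesic is inside the bump.\<close>
  have strict: "\<psi> (- \<tau>) < \<psi> \<tau>"
  proof -
    obtain h where h: "h > 0" "\<And>a. 0 < a \<Longrightarrow> a < h \<Longrightarrow> \<psi> 0 < \<psi> (0 + a)"
      using DERIV_pos_inc_right[OF \<psi>'[of 0] pos0] by auto
    have "\<psi> 0 < \<psi> (0 + min (h / 2) \<tau>)" using h(1) \<tau>0 by (intro h(2)) auto
    then show ?thesis using mono[of "- \<tau>" 0] mono[of "min (h / 2) \<tau>" \<tau>] h(1) \<tau>0 by simp
  qed
  \<comment> \<open>At times \<open>\<tau>\<close> and \<open>- \<tau>\<close> the straight motion
    amounts to \<open>2 * rb\<close>; subtracting \<open>rb / 2\<close> and \<open>rb / 8\<close>
    still leaves more than \<open>rb\<close>.\<close>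
  have ends: "c' t \<in> V - cball z rb" if "t = \<tau> \<or> t = - \<tau>" for t
  proof -
    have t: "\<bar>t\<bar> = \<tau>" using that \<tau>0 by auto
    have "2 * rb = norm (t *\<^sub>R v)" using t \<tau>v by simp
    also have "t *\<^sub>R v = (c' t - z) + (z - x) - (c' t - x - t *\<^sub>R v)" by simp
    also have "norm \<dots> \<le> (norm (c' t - z) + rb / 2) + rb / 8"
      by (intro norm_diff_bound norm_add_bound) (use zx lin[of t] t in auto)
    finally have "norm (c' t - z) > rb" using rb(1) by simp
    moreover have "-1 < t" "t < 2" using t \<tau>(2) by linarith+
    then have "t \<in> {-1<..<2}" by simp
    then have "c' t \<in> V" using geo' unfolding geodesic_on_spray by blast
    ultimately show ?thesis by (simp add: dist_norm norm_minus_commute)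
  qed
  \<comment> \<open>Outside the closed ball the metrics agree and the domain is connected, so
    \<open>P1\<close> equals \<open>P\<close> there, in particular at both ends of the perturbed
    geodesic. As the logarithm vanishes at the ends, \<open>\<psi>\<close> would take equal
    values.\<close>
  have "\<exists>x\<in>U. \<exists>v. P1 x v \<noteq> P x v" if P1: "killing d V ?g P1" for P1
  proof (rule ccontr)
    assume "\<not> (\<exists>x\<in>U. \<exists>v. P1 x v \<noteq> P x v)"
    then have eqU: "P1 q p = P q p" if "q \<in> U" for q p using that by blast
    let ?V = "V - cball z rb"
    have oV: "open ?V" using V(1) by (simp add: open_Diff)
    have cV: "connected ?V"
      using n by (intro connected_diff_cball V(1,2) order_trans[OF zW W(3)] rb(1)) simp
    have k1: "killing d ?V g P" by (rule killing_subset[OF P]) simp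
    have "killing d ?V ?g P1" by (rule killing_subset[OF P1]) simp
    then have k2: "killing d ?V g P1"
      using killing_cong[OF oV, of ?g g] out by (auto simp: subset_iff)
    have g': "Ck_metric_on 2 ?V g" by (rule Ck_metric_on_mono[OF g]) auto
    have UV: "U \<subseteq> ?V" using U(3,4) zW by blast
    have eq: "P1 q p = P q p" if "q \<in> ?V" for q p
      by (rule unique_continuation_eq[OF oV cV g' k2 k1 U(1,2) UV eqU that])
    have "P1 (c' (- \<tau>)) (w' (- \<tau>)) = P1 (c' \<tau>) (w' \<tau>)"
      by (rule killingD(2)[OF P1 geo']) (use \<tau>(2) \<tau>0 in auto)
    then have "P (c' (- \<tau>)) (w' (- \<tau>)) = P (c' \<tau>) (w' \<tau>)" using eq ends by simp
    moreover have "bump (k + 2) z rb (c' t) = 0" if "t = \<tau> \<or> t = - \<tau>" for t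
      using ends[OF that] rb(1) by (intro bump_zero) (auto simp: dist_norm norm_minus_commute)
    ultimately have "\<psi> (- \<tau>) = \<psi> \<tau>" by (simp add: \<psi>_def)
    then show False using strict by simp
  qed
  moreover have "?g q = g q" if "q \<notin> W" for q
    by (rule out) (use that zW ball_subset_cball[of z rb] in blast)
  moreover have "Ck_close_on k D \<eta> g ?g" by (rule Ck_close_on_mono[OF s(3)]) auto
  ultimately show ?thesis using that[OF s(2)] by blast
qed

section \<open>Genericity of metrics without nontrivial integrals\<close>

lemma sum_lists_Suc:
  fixes f :: "'a::finite list \<Rightarrow> real"
  shows "(\<Sum>I | length I = Suc n. f I) = (\<Sum>i\<in>UNIV. \<Sum>I | length I = n. f (i # I))"
proof -
  have "(\<Sum>i\<in>UNIV. \<Sum>I | length I = n. f (i # I)) = (\<Sum>(i, I)\<in>UNIV \<times> {I. length I = n}. f (i # I))"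
    by (simp add: sum.cartesian_product)
  also have "\<dots> = (\<Sum>I | length I = Suc n. f I)"
    by (rule sum.reindex_bij_witness[where i = "\<lambda>I. (hd I, tl I)" and j = "\<lambda>(i, I). i # I"])
       (auto simp: length_Suc_conv)
  finally show ?thesis by simp
qed

lemma prod_list_matrix_vector:
  fixes A :: "real ^ 'n::finite ^ 'n"
  shows "(\<Prod>i\<leftarrow>I. (A *v v) $ i) =
    (\<Sum>J | length J = length I. (\<Prod>l<length I. A $ (I ! l) $ (J ! l)) * (\<Prod>j\<leftarrow>J. v $ j))"
proof (induction I)
  case (Cons i I)
  have "(\<Prod>i\<leftarrow>i # I. (A *v v) $ i) = (\<Sum>j\<in>UNIV. A $ i $ j * v $ j) *
      (\<Sum>J | length J = length I. (\<Prod>l<length I. A $ (I ! l) $ (J ! l)) * (\<Prod>j\<leftarrow>J. v $ j))"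
    unfolding list.map prod_list.Cons Cons.IH by (simp add: matrix_vector_mult_def)
  also have "\<dots> = (\<Sum>j\<in>UNIV. \<Sum>J | length J = length I.
      (A $ i $ j * v $ j) * ((\<Prod>l<length I. A $ (I ! l) $ (J ! l)) * (\<Prod>j\<leftarrow>J. v $ j)))"
    by (rule sum_product)
  also have "\<dots> = (\<Sum>J | length J = length (i # I).
      (\<Prod>l<length (i # I). A $ ((i # I) ! l) $ (J ! l)) * (\<Prod>j\<leftarrow>J. v $ j))"
    unfolding length_Cons sum_lists_Suc
    by (intro sum.cong refl) (simp add: prod.lessThan_Suc_shift del: prod.lessThan_Suc)
  finally show ?case .
qed simp

text \<open>Lowering every index amounts to substituting the momentum \<open>g x *v v\<close> of the
  velocity \<open>v\<close>; expand the product and exchange the sums.\<close>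

lemma tensor_eval_lower_indices:
  assumes "transpose (g x) = g x"
  shows "tensor_eval d (lower_indices d g K x) v = tensor_eval d (K x) (g x *v v)"
proof -
  have s: "g x $ i $ j = g x $ j $ i" for i j
    using arg_cong[OF assms, of "\<lambda>A. A $ i $ j"] by (simp add: transpose_def)
  have "tensor_eval d (lower_indices d g K x) v =
      (\<Sum>J | length J = d. \<Sum>I | length I = d. (\<Prod>l<d. g x $ (J ! l) $ (I ! l)) * K x I * (\<Prod>j\<leftarrow>J. v $ j))"
    by (simp add: tensor_eval_def lower_indices_def sum_distrib_right)
  also have "\<dots> = (\<Sum>I | length I = d. \<Sum>J | length J = d. (\<Prod>l<d. g x $ (J ! l) $ (I ! l)) * K x I * (\<Prod>j\<leftarrow>J. v $ j))"
    by (rule sum.swap)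
  also have "\<dots> = (\<Sum>I | length I = d. K x I * (\<Prod>i\<leftarrow>I. (g x *v v) $ i))"
  proof (rule sum.cong[OF refl])
    fix I :: "'a list" assume "I \<in> {I. length I = d}"
    then have I: "length I = d" by simp
    have "K x I * (\<Prod>i\<leftarrow>I. (g x *v v) $ i) =
        (\<Sum>J | length J = d. K x I * ((\<Prod>l<d. g x $ (I ! l) $ (J ! l)) * (\<Prod>j\<leftarrow>J. v $ j)))"
      unfolding prod_list_matrix_vector I by (rule sum_distrib_left)
    also have "\<dots> = (\<Sum>J | length J = d. (\<Prod>l<d. g x $ (J ! l) $ (I ! l)) * K x I * (\<Prod>j\<leftarrow>J. v $ j))"
    proof (rule sum.cong[OF refl])
      fix J :: "'a list"
      have "(\<Prod>l<d. g x $ (I ! l) $ (J ! l)) = (\<Prod>l<d. g x $ (J ! l) $ (I ! l))" by (rule prod.cong[OF refl s])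
      then show "K x I * ((\<Prod>l<d. g x $ (I ! l) $ (J ! l)) * (\<Prod>j\<leftarrow>J. v $ j)) =
          (\<Prod>l<d. g x $ (J ! l) $ (I ! l)) * K x I * (\<Prod>j\<leftarrow>J. v $ j)" by simp
    qed
    finally show "(\<Sum>J | length J = d. (\<Prod>l<d. g x $ (J ! l) $ (I ! l)) * K x I * (\<Prod>j\<leftarrow>J. v $ j)) =
        K x I * (\<Prod>i\<leftarrow>I. (g x *v v) $ i)" by (rule sym)
  qed
  also have "\<dots> = tensor_eval d (K x) (g x *v v)" by (simp add: tensor_eval_def)
  finally show ?thesis .
qed

text \<open>Passing to velocities turns the integral into one in the sense of
  \<open>killing\<close>. Going back with \<open>v = matrix_inv (g x) *v p\<close>, the form becomes
  twice the Hamiltonian.\<close>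

lemma trivial_integral_of_trivial_killing:
  fixes g :: "real ^ 'n::finite \<Rightarrow> real ^ 'n ^ 'n"
  assumes g: "Ck_metric_on k D g" and F: "polynomial_integral D g d F"
    and rigid: "\<And>P. killing d D g P \<Longrightarrow> trivial_on d D g P"
  shows "trivial_integral D g F"
proof -
  obtain K where K: "\<And>x p. x \<in> D \<Longrightarrow> F x p = tensor_eval d (K x) p"
    "\<And>T \<gamma> v. geodesic_on D g T \<gamma> v \<Longrightarrow> (\<lambda>t. tensor_eval d (lower_indices d g K (\<gamma> t)) (v t)) constant_on T"
    using F unfolding polynomial_integral_def by blast
  have low: "tensor_eval d (lower_indices d g K x) v = tensor_eval d (K x) (g x *v v)" if "x \<in> D" for x v
    by (rule tensor_eval_lower_indices[where g = g and x = x, OF Ck_metric_onD(2)[OF g that]])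
  have "killing d D g (\<lambda>x v. tensor_eval d (K x) (g x *v v))"
  proof (rule killingI)
    show "(\<lambda>v. tensor_eval d (K x) (g x *v v)) \<in> hom_poly d" for x
      by (rule hom_poly_comp_matrix[OF tensor_eval_in_hom_poly])
    fix T \<gamma> v s t assume geo: "geodesic_on D g T \<gamma> v" and st: "s \<in> T" "t \<in> T"
    then have "\<gamma> s \<in> D" "\<gamma> t \<in> D" by (auto simp: geodesic_on_def)
    then show "tensor_eval d (K (\<gamma> s)) (g (\<gamma> s) *v v s) = tensor_eval d (K (\<gamma> t)) (g (\<gamma> t) *v v t)"
      using K(2)[OF geo] st by (auto simp: low[symmetric] constant_on_def)
  qed
  from rigid[OF this] obtain a where a: "\<And>x v. x \<in> D \<Longrightarrow>
      tensor_eval d (K x) (g x *v v) = a * energy_power d (qform (g x) v)"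
    unfolding trivial_on_def by blast
  have "F x p = a * energy_power d (2 * hamiltonian g x p)" if x: "x \<in> D" for x p
  proof -
    define v where "v = matrix_inv (g x) *v p"
    have gv: "g x *v v = p"
      using matrix_inv_works(1)[OF Ck_metric_onD(3)[OF g x]] by (simp add: v_def matrix_vector_mul_assoc)
    have "qform (g x) v = v \<bullet> p" by (simp add: qform_def gv)
    also have "\<dots> = (\<Sum>i\<in>UNIV. (\<Sum>j\<in>UNIV. matrix_inv (g x) $ i $ j * p $ j) * p $ i)"
      by (simp add: v_def inner_vec_def matrix_vector_mult_def)
    also have "\<dots> = 2 * hamiltonian g x p"
      by (simp add: hamiltonian_def sum_distrib_left sum_distrib_right mult_ac)
    finally show ?thesis using a[OF x, of v] K(1)[OF x, of p] by (simp add: gv)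
  qed
  then show ?thesis unfolding trivial_integral_def
    by (intro exI[of _ "\<lambda>h. a * energy_power d (2 * h)"]) blast
qed

text \<open>The space of integrals on \<open>D\<close> has dimension at most \<open>n\<close>.
  Families are used since values outside \<open>D\<close> are arbitrary and would have to be divided
  out.\<close>

definition killing_dependent :: "nat \<Rightarrow> nat \<Rightarrow> (real ^ 'n::finite) set \<Rightarrow>
   (real ^ 'n \<Rightarrow> real ^ 'n ^ 'n) \<Rightarrow> bool" where
  "killing_dependent n d D g \<longleftrightarrow> (\<forall>Q. (\<forall>i\<le>n. killing d D g (Q i)) \<longrightarrow>
     (\<exists>a. (\<exists>i\<le>n. a i \<noteq> 0) \<and> (\<forall>x\<in>D. \<forall>v. (\<Sum>i\<le>n. a i * Q i x v) = 0)))"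

text \<open>An integral is determined by its values on a finite determining set \<open>X\<close>,
  each given by \<open>M\<close> coordinates. With one integral more than \<open>card X * M\<close>,
  some nontrivial combination has all these values 0.\<close>

lemma killing_finite_dimensional:
  fixes g :: "real ^ 'n::finite \<Rightarrow> real ^ 'n ^ 'n"
  assumes D: "open D" "connected D" "c \<in> D" and g: "Ck_metric_on 2 D g"
  shows "\<exists>n. killing_dependent n d D g"
proof -
  obtain X r \<epsilon> R L \<rho> where X: "finite X" "X \<subseteq> D" and r: "r > 0" "r \<le> \<rho>" and \<epsilon>: "\<epsilon> > 0"
    and ch: "chart D g c R L \<rho> \<epsilon>" and Xb: "X \<subseteq> ball c \<rho>"
    and sep: "\<And>g' y. Ck_metric_on 2 D g' \<Longrightarrow> Ck_close_on 2 D \<epsilon> g g' \<Longrightarrow> y \<in> ball c r \<Longrightarrow>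
       separates ((\<lambda>x. bvp.vel \<rho> (spray g') y x 0) ` X) d"
    using determining_set[where d = d, OF D(1) g D(3) D(1) D(3)] by metis
  have cl: "Ck_close_on 2 D \<epsilon> g g" by (rule Ck_close_on_refl[OF \<epsilon>])
  obtain M and e :: "nat \<Rightarrow> real ^ 'n" and l where
    rep: "\<And>p v. p \<in> hom_poly d \<Longrightarrow> p v = (\<Sum>b<M. p (e b) * l b v)"
    by (rule hom_poly_coordinates[of d]) blast
  obtain h where h: "bij_betw h {0..<card (X \<times> {..<M})} (X \<times> {..<M})"
    using ex_bij_betw_nat_finite[of "X \<times> {..<M}"] X(1) by auto
  define n where "n = card (X \<times> {..<M})"
  have h: "h ` {..<n} = X \<times> {..<M}" using bij_betw_imp_surj_on[OF h] by (simp add: n_def atLeast0LessThan)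
  have "\<exists>a. (\<exists>i\<le>n. a i \<noteq> 0) \<and> (\<forall>x\<in>D. \<forall>v. (\<Sum>i\<le>n. a i * Q i x v) = 0)"
    if Q: "\<forall>i\<le>n. killing d D g (Q i)" for Q
  proof -
    obtain a where a: "\<exists>i\<le>n. a i \<noteq> 0" "\<And>j. j < n \<Longrightarrow> (\<Sum>i\<le>n. a i * Q i (fst (h j)) (e (snd (h j)))) = 0"
      using underdetermined_system[of n "\<lambda>i j. Q i (fst (h j)) (e (snd (h j)))"] by blast
    define P where "P = (\<lambda>x v. \<Sum>i\<le>n. a i * Q i x v)"
    have P: "killing d D g P" unfolding P_def by (rule killing_sum) (use Q in auto)
    have z: "P x v = 0" if x: "x \<in> X" for x v
    proof -
      have "P x (e b) = 0" if b: "b < M" for b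
      proof -
        have "(x, b) \<in> h ` {..<n}" using x b h by blast
        then obtain j where j: "j < n" "h j = (x, b)" by auto
        show ?thesis using a(2)[OF j(1)] by (simp add: P_def j(2))
      qed
      then have "(\<Sum>b<M. P x (e b) * l b v) = 0" by (intro sum.neutral) auto
      moreover have "P x v = (\<Sum>b<M. P x (e b) * l b v)"
        by (rule rep[OF killingD(1)[OF P]]) (use x X(2) in blast)
      ultimately show ?thesis by (simp only:)
    qed
    have "P y v = 0" if "y \<in> D" for y v
      by (rule killing_zero_of_determining_set[OF D(1,2) ch g cl Xb r sep[OF g cl] P z that])
    then show ?thesis using a(1) unfolding P_def by blast
  qed
  then show ?thesis unfolding killing_dependent_def by blast
qed

text \<open>Each step either enlarges the ball to one onto which a given integral does not extend, or bumps
  the metric outside the old ball so that it no longer extends; the dimension drops by one.\<close>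

lemma rigid_metric_exists:
  fixes g :: "real ^ 'n::finite \<Rightarrow> real ^ 'n ^ 'n"
  assumes n: "CARD('n) \<ge> 2" and k: "k \<ge> 2"
    and dep: "killing_dependent m d (ball c \<rho>) g" and \<rho>: "0 < \<rho>" "\<rho> < R"
    and g: "Ck_metric_on k (ball c R) g" and \<eta>: "\<eta> > 0"
  shows "\<exists>g1 \<rho>1. Ck_metric_on k (ball c R) g1 \<and> Ck_close_on k (ball c R) \<eta> g g1 \<and> 0 < \<rho>1 \<and> \<rho>1 < R \<and>
    (\<forall>P. killing d (ball c \<rho>1) g1 P \<longrightarrow> trivial_on d (ball c \<rho>1) g1 P)"
  using dep \<rho> g \<eta>
proof (induction m arbitrary: g \<rho> \<eta>)
  case 0
  \<comment> \<open>In dimension 0 the integral vanishes, which is the trivial case with factor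
    0.\<close>
  have "trivial_on d (ball c \<rho>) g P" if "killing d (ball c \<rho>) g P" for P
  proof -
    have "\<exists>a. (\<exists>i\<le>0::nat. a i \<noteq> 0) \<and> (\<forall>x\<in>ball c \<rho>. \<forall>v. (\<Sum>i\<le>0::nat. a i * P x v) = 0)"
      by (rule "0.prems"(1)[unfolded killing_dependent_def, THEN spec, THEN mp]) (simp add: that)
    then have "P x v = 0" if "x \<in> ball c \<rho>" for x v using that by auto
    then show ?thesis unfolding trivial_on_def by (intro exI[of _ 0]) auto
  qed
  then show ?case using "0.prems" Ck_close_on_refl by blast
next
  case (Suc m)
  note \<rho> = Suc.prems(2,3) and g = Suc.prems(4)
  show ?case
  proof (cases "\<forall>P. killing d (ball c \<rho>) g P \<longrightarrow> trivial_on d (ball c \<rho>) g P")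
    case True
    then show ?thesis using Suc.prems Ck_close_on_refl by blast
  next
    case False
    then obtain P where P: "killing d (ball c \<rho>) g P" "\<not> trivial_on d (ball c \<rho>) g P" by blast
    \<comment> \<open>Halfway to \<open>R\<close>, so that any finite number of enlargements stays
      below \<open>R\<close>.\<close>
    define \<rho>2 where "\<rho>2 = (\<rho> + R) / 2"
    have \<rho>2: "\<rho> < \<rho>2" "\<rho>2 < R" "0 < \<rho>2" using \<rho> by (auto simp: \<rho>2_def)
    have sub: "ball c \<rho> \<subseteq> ball c \<rho>2" "ball c \<rho>2 \<subseteq> ball c R" using \<rho>2 by auto
    \<comment> \<open>If \<open>P\<close> has no extension to the larger ball, \<open>g\<close>
      itself serves. Otherwise a bump in the annulus destroys every extension, while the metric on
      the old ball is untouched.\<close>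
    have "\<exists>g2. Ck_metric_on k (ball c R) g2 \<and> Ck_close_on k (ball c R) (\<eta> / 2) g g2 \<and>
        (\<forall>x\<in>ball c \<rho>. g x = g2 x) \<and>
        (\<forall>P1. killing d (ball c \<rho>2) g2 P1 \<longrightarrow> (\<exists>x\<in>ball c \<rho>. \<exists>v. P1 x v \<noteq> P x v))"
    proof (cases "\<exists>P'. killing d (ball c \<rho>2) g P' \<and> (\<forall>x\<in>ball c \<rho>. \<forall>v. P' x v = P x v)")
      case False
      have "Ck_close_on k (ball c R) (\<eta> / 2) g g" by (rule Ck_close_on_refl) (use Suc.prems(5) in simp)
      then show ?thesis using False g by blast
    next
      case True
      then obtain P' where P': "killing d (ball c \<rho>2) g P'" "\<And>x v. x \<in> ball c \<rho> \<Longrightarrow> P' x v = P x v" by blast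
      have nt: "\<not> trivial_on d (ball c \<rho>2) g P'"
      proof
        assume "trivial_on d (ball c \<rho>2) g P'"
        then obtain a where "\<And>x v. x \<in> ball c \<rho>2 \<Longrightarrow> P' x v = a * energy_power d (qform (g x) v)"
          unfolding trivial_on_def by blast
        then have "P x v = a * energy_power d (qform (g x) v)" if "x \<in> ball c \<rho>" for x v
          using P'(2)[OF that, of v] subsetD[OF sub(1) that] by simp
        then show False using P(2) unfolding trivial_on_def by blast
      qed
      obtain u :: "real ^ 'n" where u: "norm u = (\<rho> + \<rho>2) / 2" using vector_choose_size[of "(\<rho> + \<rho>2) / 2"] \<rho> \<rho>2 by auto
      have "c + u \<in> ball c \<rho>2 - cball c \<rho>" using \<rho>2 u by (simp add: dist_norm)
      then have W: "ball c \<rho>2 - cball c \<rho> \<noteq> {}" by blast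
      obtain g2 where g2: "Ck_metric_on k (ball c R) g2" "Ck_close_on k (ball c R) (\<eta> / 2) g g2"
        "\<And>x. x \<notin> ball c \<rho>2 - cball c \<rho> \<Longrightarrow> g2 x = g x"
        "\<And>P1. killing d (ball c \<rho>2) g2 P1 \<Longrightarrow> \<exists>x\<in>ball c \<rho>. \<exists>v. P1 x v \<noteq> P' x v"
      proof (rule bump_destroys_integral[OF n k open_ball g open_ball connected_ball sub(2) P'(1) nt _ W, of "ball c \<rho>" "\<eta> / 2"])
        show "open (ball c \<rho>2 - cball c \<rho>)" by (intro open_Diff) auto
        show "ball c \<rho> \<noteq> {}" using \<rho> by simp
        show "ball c \<rho> \<inter> (ball c \<rho>2 - cball c \<rho>) = {}" by auto
        show "\<eta> / 2 > 0" using Suc.prems(5) by simp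
      qed (use sub in auto)
      have "g x = g2 x" if "x \<in> ball c \<rho>" for x using g2(3)[of x] that by auto
      moreover have "\<exists>x\<in>ball c \<rho>. \<exists>v. P1 x v \<noteq> P x v" if "killing d (ball c \<rho>2) g2 P1" for P1
        using g2(4)[OF that] P'(2) by auto
      ultimately show ?thesis using g2(1,2) by blast
    qed
    then obtain g2 where g2: "Ck_metric_on k (ball c R) g2" "Ck_close_on k (ball c R) (\<eta> / 2) g g2"
        "\<And>x. x \<in> ball c \<rho> \<Longrightarrow> g x = g2 x"
        "\<And>P1. killing d (ball c \<rho>2) g2 P1 \<Longrightarrow> \<exists>x\<in>ball c \<rho>. \<exists>v. P1 x v \<noteq> P x v"
      by blast
    have g22: "Ck_metric_on 2 (ball c \<rho>2) g2" using Ck_metric_on_mono[OF g2(1) k sub(2)] .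
    have eq: "killing d (ball c \<rho>) g Q \<longleftrightarrow> killing d (ball c \<rho>) g2 Q" for Q
      by (rule killing_cong[OF open_ball g2(3)])
    have "killing_dependent m d (ball c \<rho>2) g2"
      unfolding killing_dependent_def
    proof (intro allI impI)
      fix Q assume Q: "\<forall>i\<le>m. killing d (ball c \<rho>2) g2 (Q i)"
      \<comment> \<open>Restrict the family to the old ball and prepend \<open>P\<close>, which
        gives one more member; the old dependence then applies.\<close>
      define Q' where "Q' = (\<lambda>i. case i of 0 \<Rightarrow> P | Suc i \<Rightarrow> Q i)"
      have "\<forall>i\<le>Suc m. killing d (ball c \<rho>) g (Q' i)"
      proof (intro allI impI)
        fix i assume "i \<le> Suc m"
        then show "killing d (ball c \<rho>) g (Q' i)"
          unfolding Q'_def using P(1) Q eq killing_subset[OF _ sub(1)] by (cases i) auto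
      qed
      then have "\<exists>a. (\<exists>i\<le>Suc m. a i \<noteq> 0) \<and> (\<forall>x\<in>ball c \<rho>. \<forall>v. (\<Sum>i\<le>Suc m. a i * Q' i x v) = 0)"
        by (rule Suc.prems(1)[unfolded killing_dependent_def, THEN spec, THEN mp])
      then obtain a where a: "\<exists>i\<le>Suc m. a i \<noteq> 0" "\<And>x v. x \<in> ball c \<rho> \<Longrightarrow> (\<Sum>i\<le>Suc m. a i * Q' i x v) = 0"
        by blast
      have a2: "a 0 * P x v + (\<Sum>i\<le>m. a (Suc i) * Q i x v) = 0" if "x \<in> ball c \<rho>" for x v
        using a(2)[OF that, of v] by (simp add: sum.atMost_Suc_shift Q'_def del: sum.atMost_Suc)
      \<comment> \<open>Were this coefficient nonzero, solving for \<open>P\<close> would extend it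
        to the larger ball as a combination of the \<open>Q i\<close>.\<close>
      have a0: "a 0 = 0"
      proof (rule ccontr)
        assume nz: "a 0 \<noteq> 0"
        have "killing d (ball c \<rho>2) g2 (\<lambda>x v. \<Sum>i\<le>m. (- a (Suc i) / a 0) * Q i x v)"
          by (rule killing_sum) (use Q in auto)
        then obtain x v where x: "x \<in> ball c \<rho>" "(\<Sum>i\<le>m. (- a (Suc i) / a 0) * Q i x v) \<noteq> P x v"
          using g2(4) by blast
        have "a 0 * (\<Sum>i\<le>m. (- a (Suc i) / a 0) * Q i x v) = - (\<Sum>i\<le>m. a (Suc i) * Q i x v)"
          using nz by (simp add: sum_distrib_left sum_negf)
        also have "\<dots> = a 0 * P x v" using a2[OF x(1), of v] by simp
        finally show False using nz x(2) by simp
      qed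
      have kil: "killing d (ball c \<rho>2) g2 (\<lambda>x v. \<Sum>i\<le>m. a (Suc i) * Q i x v)"
        by (rule killing_sum) (use Q in auto)
      have "(\<Sum>i\<le>m. a (Suc i) * Q i x v) = 0" if "x \<in> ball c \<rho>2" for x v
        by (rule unique_continuation[OF open_ball connected_ball g22 kil open_ball _ sub(1) _ that])
           (use \<rho> a2 a0 in auto)
      moreover have "\<exists>i\<le>m. a (Suc i) \<noteq> 0" using a(1) a0 by (metis Suc_le_mono old.nat.exhaust)
      ultimately show "\<exists>a. (\<exists>i\<le>m. a i \<noteq> 0) \<and> (\<forall>x\<in>ball c \<rho>2. \<forall>v. (\<Sum>i\<le>m. a i * Q i x v) = 0)"
        by (intro exI[of _ "\<lambda>i. a (Suc i)"]) blast
    qed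
    from Suc.IH[OF this \<rho>2(3,2) g2(1), of "\<eta> / 2"] Suc.prems(5) obtain g1 \<rho>1 where
      g1: "Ck_metric_on k (ball c R) g1" "Ck_close_on k (ball c R) (\<eta> / 2) g2 g1" "0 < \<rho>1" "\<rho>1 < R"
        "\<forall>P. killing d (ball c \<rho>1) g1 P \<longrightarrow> trivial_on d (ball c \<rho>1) g1 P" by auto
    have "Ck_close_on k (ball c R) \<eta> g g1" using Ck_close_on_trans[OF g2(2) g1(2)] by simp
    then show ?thesis using g1 by blast
  qed
qed

section \<open>Persistence of rigidity under C^2-small perturbations\<close>

lemma bounded_family_convergent_subsequence:
  fixes f :: "nat \<Rightarrow> 'a \<Rightarrow> real"
  assumes "finite A" "\<And>m a. a \<in> A \<Longrightarrow> \<bar>f m a\<bar> \<le> B"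
  obtains s where "strict_mono s" "\<And>a. a \<in> A \<Longrightarrow> \<exists>l. (\<lambda>m. f (s m) a) \<longlonglongrightarrow> l"
proof -
  have "\<exists>s. strict_mono s \<and> (\<forall>a\<in>A. \<exists>l. (\<lambda>m. f (s m) a) \<longlonglongrightarrow> l)"
    using assms
  proof (induction A rule: finite_induct)
    case empty
    then show ?case by (intro exI[of _ id]) (simp add: strict_mono_def)
  next
    case (insert b A)
    then obtain s where s: "strict_mono s" "\<And>a. a \<in> A \<Longrightarrow> \<exists>l. (\<lambda>m. f (s m) a) \<longlonglongrightarrow> l" by blast
    have "\<forall>m. f (s m) b \<in> {-B..B}" using insert.prems[of b] by (auto simp: abs_le_iff minus_le_iff)
    then obtain l t where t: "strict_mono t" "((\<lambda>m. f (s m) b) \<circ> t) \<longlonglongrightarrow> l"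
      using compact_Icc[of "-B" B, unfolded compact_eq_seq_compact_metric seq_compact_def] by metis
    show ?case
    proof (intro exI[of _ "s \<circ> t"] conjI ballI)
      show "strict_mono (s \<circ> t)" using s(1) t(1) by (rule strict_mono_o)
      fix a assume "a \<in> insert b A"
      then show "\<exists>l. (\<lambda>m. f ((s \<circ> t) m) a) \<longlonglongrightarrow> l"
      proof
        assume "a = b"
        then show ?thesis using t(2) by (auto simp: o_def)
      next
        assume "a \<in> A"
        then obtain l where "(\<lambda>m. f (s m) a) \<longlonglongrightarrow> l" using s(2) by blast
        from LIMSEQ_subseq_LIMSEQ[OF this t(1)] show ?thesis by (auto simp: o_def)
      qed
    qed
  qed
  then show ?thesis using that by blast
qed

lemma qform_tendsto:
  fixes g :: "real ^ 'n::finite \<Rightarrow> real ^ 'n ^ 'n"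
  assumes gs: "\<And>e. e > 0 \<Longrightarrow> eventually (\<lambda>m. Ck_close_on k D e g (gs m)) F" and x: "x \<in> D"
  shows "((\<lambda>m. qform (gs m x) v) \<longlongrightarrow> qform (g x) v) F"
proof -
  have "((\<lambda>m. gs m x $ i $ j) \<longlongrightarrow> g x $ i $ j) F" for i j
  proof (rule tendstoI)
    fix e :: real assume "e > 0"
    from gs[OF this] show "eventually (\<lambda>m. dist (gs m x $ i $ j) (g x $ i $ j) < e) F"
    proof eventually_elim
      case (elim m)
      show ?case using Ck_close_onD[OF elim x, of "[]" i j] by (simp add: iter_partial_def dist_real_def abs_minus_commute)
    qed
  qed
  then show ?thesis
    unfolding qform_def inner_vec_def matrix_vector_mult_def vec_lambda_beta inner_real_def
    by (intro tendsto_sum tendsto_mult tendsto_const)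
qed

text \<open>If rigidity failed arbitrarily close to \<open>g\<close>, suitably normalised nontrivial integrals would
  converge to a nontrivial integral of \<open>g\<close>.\<close>

lemma rigidity_open:
  fixes g :: "real ^ 'n::finite \<Rightarrow> real ^ 'n ^ 'n"
  assumes D: "open D" "connected D" and g: "Ck_metric_on 2 D g"
    and V: "open V" "c \<in> V" "V \<subseteq> D" and rigid: "\<And>P. killing d V g P \<Longrightarrow> trivial_on d V g P"
  shows "\<exists>e>0. \<forall>g'. Ck_metric_on 2 D g' \<and> Ck_close_on 2 D e g g' \<longrightarrow>
    (\<forall>P. killing d D g' P \<longrightarrow> trivial_on d D g' P)"
proof (rule ccontr)
  assume neg: "\<not> ?thesis"
  have "\<exists>g' P. Ck_metric_on 2 D g' \<and> Ck_close_on 2 D (inverse (real (Suc m))) g g' \<and>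
      killing d D g' P \<and> \<not> trivial_on d D g' P" for m
  proof -
    have "inverse (real (Suc m)) > 0" by simp
    with neg show ?thesis by blast
  qed
  then obtain gs Ps where gs: "\<And>m. Ck_metric_on 2 D (gs m)" "\<And>m. Ck_close_on 2 D (inverse (real (Suc m))) g (gs m)"
    and Ps: "\<And>m. killing d D (gs m) (Ps m)" "\<And>m. \<not> trivial_on d D (gs m) (Ps m)"
    by metis
  have close: "eventually (\<lambda>m. Ck_close_on 2 D e g (gs m)) sequentially" if "e > 0" for e
    using order_tendstoD(2)[OF LIMSEQ_inverse_real_of_nat that]
  proof eventually_elim
    case (elim m)
    show ?case by (rule Ck_close_on_mono[OF gs(2)]) (use elim in auto)
  qed
  have cD: "c \<in> D" using V by blast
  obtain X r \<epsilon> R L \<rho> where X: "finite X" "X \<subseteq> V" and r: "r > 0" "r \<le> \<rho>" and \<epsilon>: "\<epsilon> > 0"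
    and ch: "chart D g c R L \<rho> \<epsilon>" and Xb: "X \<subseteq> ball c \<rho>"
    and sep: "\<And>g' y. Ck_metric_on 2 D g' \<Longrightarrow> Ck_close_on 2 D \<epsilon> g g' \<Longrightarrow> y \<in> ball c r \<Longrightarrow>
       separates ((\<lambda>x. bvp.vel \<rho> (spray g') y x 0) ` X) d"
    using determining_set[where d = d, OF D(1) g cD V(1,2)] by metis
  have cl: "Ck_close_on 2 D \<epsilon> g g" by (rule Ck_close_on_refl[OF \<epsilon>])
  obtain M and e :: "nat \<Rightarrow> real ^ 'n" and l where
    rep: "\<And>p v. p \<in> hom_poly d \<Longrightarrow> p v = (\<Sum>b<M. p (e b) * l b v)"
    by (rule hom_poly_coordinates[of d]) blast
  have zero: "p v = 0" if "p \<in> hom_poly d" "\<And>b. b < M \<Longrightarrow> p (e b) = 0" for p v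
  proof -
    have "(\<Sum>b<M. p (e b) * l b v) = 0" using that(2) by (intro sum.neutral) auto
    with rep[OF that(1), of v] show ?thesis by (simp only:)
  qed
  obtain v0 where v0: "qform (g c) v0 \<noteq> 0"
    by (rule qform_nonzero_on_open[OF Ck_metric_onD(2,3)[OF g cD] open_UNIV]) auto
  define E where "E = (\<lambda>m x v. energy_power d (qform (gs m x) v))"
  \<comment> \<open>Subtracting this multiple of the energy power makes the integral vanish at
    \<open>c\<close>, \<open>v0\<close>, so that no trivial part can survive normalization. For odd
    \<open>d\<close> the division by zero gives 0, which fits the vanishing energy power.\<close>
  define \<kappa> where "\<kappa> = (\<lambda>m. Ps m c v0 / E m c v0)"
  define P1 where "P1 = (\<lambda>m x v. Ps m x v - \<kappa> m * E m x v)"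
  have P1: "killing d D (gs m) (P1 m)" for m
    unfolding P1_def E_def by (rule killing_diff[OF Ps(1) killing_energy[OF gs(1)]])
  \<comment> \<open>The l1 norm of the coordinates on the determining set. Near \<open>g\<close> it
    is nonzero, for otherwise \<open>Ps m\<close> would be trivial.\<close>
  define \<nu> where "\<nu> = (\<lambda>m. \<Sum>x\<in>X. \<Sum>b<M. \<bar>P1 m x (e b)\<bar>)"
  define Q where "Q = (\<lambda>m x v. inverse (\<nu> m) * P1 m x v)"
  have Q: "killing d D (gs m) (Q m)" for m unfolding Q_def by (rule killing_cmult[OF P1])
  have \<nu>_pos: "\<nu> m \<ge> 0" for m unfolding \<nu>_def by (intro sum_nonneg) auto
  have \<nu>_ge: "\<bar>P1 m x (e b)\<bar> \<le> \<nu> m" if "x \<in> X" "b < M" for m x b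
  proof -
    have "\<bar>P1 m x (e b)\<bar> \<le> (\<Sum>b<M. \<bar>P1 m x (e b)\<bar>)"
      by (rule member_le_sum[where f = "\<lambda>b. \<bar>P1 m x (e b)\<bar>"]) (use that in auto)
    also have "\<dots> \<le> \<nu> m" unfolding \<nu>_def
      by (rule member_le_sum[where f = "\<lambda>x. \<Sum>b<M. \<bar>P1 m x (e b)\<bar>"]) (use that X(1) in \<open>auto intro: sum_nonneg\<close>)
    finally show ?thesis .
  qed
  have \<nu>_nz: "eventually (\<lambda>m. \<nu> m \<noteq> 0) sequentially"
    using close[OF \<epsilon>]
  proof eventually_elim
    case (elim m)
    show ?case
    proof
      assume 0: "\<nu> m = 0"
      have z: "P1 m x v = 0" if x: "x \<in> X" for x v
      proof (rule zero)
        show "P1 m x \<in> hom_poly d" using killingD(1)[OF P1] x X(2) V(3) by blast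
        show "P1 m x (e b) = 0" if "b < M" for b using \<nu>_ge[OF x that, of m] 0 by simp
      qed
      have "P1 m y v = 0" if "y \<in> D" for y v
        by (rule killing_zero_of_determining_set[OF D(1,2) ch gs(1) elim Xb r sep[OF gs(1) elim] P1 z that])
      then have "Ps m y v = \<kappa> m * energy_power d (qform (gs m y) v)" if "y \<in> D" for y v
        using that by (simp add: P1_def E_def)
      then show False using Ps(2)[of m] unfolding trivial_on_def by blast
    qed
  qed
  \<comment> \<open>Valid for every \<open>m\<close>: if \<open>\<nu> m\<close> is 0, its inverse is
    0 as well.\<close>
  have bd: "\<bar>Q m (fst a) (e (snd a))\<bar> \<le> 1" if "a \<in> X \<times> {..<M}" for m a
  proof -
    have "\<bar>P1 m (fst a) (e (snd a))\<bar> \<le> \<nu> m" by (rule \<nu>_ge) (use that in auto)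
    then have "inverse (\<nu> m) * \<bar>P1 m (fst a) (e (snd a))\<bar> \<le> inverse (\<nu> m) * \<nu> m"
      by (intro mult_left_mono) (use \<nu>_pos in auto)
    also have "\<dots> \<le> 1" by (cases "\<nu> m = 0") auto
    finally show ?thesis using \<nu>_pos by (simp add: Q_def abs_mult)
  qed
  obtain s where s: "strict_mono s" "\<And>a. a \<in> X \<times> {..<M} \<Longrightarrow> \<exists>l. (\<lambda>m. Q (s m) (fst a) (e (snd a))) \<longlonglongrightarrow> l"
    by (rule bounded_family_convergent_subsequence[where A = "X \<times> {..<M}" and B = 1 and f = "\<lambda>m a. Q m (fst a) (e (snd a))"])
       (use X(1) bd in auto)
  \<comment> \<open>The filter of the subsequence, so that the convergence lemmas apply to the
    original families without reindexing.\<close>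
  define F where "F = filtermap s sequentially"
  have F: "F \<noteq> bot" by (simp add: F_def filtermap_bot_iff)
  have ev: "eventually A F" if "eventually A sequentially" for A
    by (rule filter_leD[OF _ that]) (use filterlim_subseq[OF s(1)] in \<open>simp add: F_def filterlim_def\<close>)
  have gF: "eventually (\<lambda>m. Ck_metric_on 2 D (gs m)) F" using gs(1) by simp
  have cF: "eventually (\<lambda>m. Ck_close_on 2 D e g (gs m)) F" if "e > 0" for e by (rule ev[OF close[OF that]])
  have QF: "eventually (\<lambda>m. killing d D (gs m) (Q m)) F" using Q by simp
  have limX: "\<exists>l. ((\<lambda>m. Q m x v) \<longlongrightarrow> l) F" if x: "x \<in> X" for x v
  proof -
    have "\<exists>l. ((\<lambda>m. Q m x (e b)) \<longlongrightarrow> l) F" if b: "b < M" for b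
      using s(2)[of "(x, b)"] x b by (simp add: F_def filterlim_filtermap)
    then obtain q where q: "\<And>b. b < M \<Longrightarrow> ((\<lambda>m. Q m x (e b)) \<longlongrightarrow> q b) F" by metis
    have "((\<lambda>m. \<Sum>b<M. Q m x (e b) * l b v) \<longlongrightarrow> (\<Sum>b<M. q b * l b v)) F"
      by (intro tendsto_intros q) auto
    moreover have "(\<lambda>m. \<Sum>b<M. Q m x (e b) * l b v) = (\<lambda>m. Q m x v)"
      by (rule ext, rule rep[symmetric, OF killingD(1)[OF Q]]) (use x X(2) V(3) in blast)
    ultimately show ?thesis by (intro exI) (simp only:)
  qed
  have limr: "\<exists>l. ((\<lambda>m. Q m y v) \<longlongrightarrow> l) F" if y: "y \<in> ball c r" for y v
    by (rule killing_convergence_at[OF ch g F gF cF QF tendsto_const _ Xb sep[OF g cl y] limX]) (use y r(2) in auto)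
  have "\<exists>l. ((\<lambda>m. Q m y v) \<longlongrightarrow> l) F" if y: "y \<in> D" for y v
    by (rule killing_convergence[OF D g F gF cF QF open_ball _ _ limr y]) (use r chartD(6)[OF ch] in auto)
  then obtain P where P: "\<And>y v. y \<in> D \<Longrightarrow> ((\<lambda>m. Q m y v) \<longlongrightarrow> P y v) F" by metis
  have "killing d D g P" by (rule killing_limit[OF D(1) g F gF cF QF P])
  then have "trivial_on d V g P" by (intro rigid killing_subset[OF _ V(3)])
  then obtain a where a: "\<And>x v. x \<in> V \<Longrightarrow> P x v = a * energy_power d (qform (g x) v)"
    unfolding trivial_on_def by blast
  \<comment> \<open>The limit is trivial on \<open>V\<close> by rigidity of \<open>g\<close>. Its
    value at \<open>c\<close>, \<open>v0\<close>, where the energy is nonzero, is 0, so for even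
    \<open>d\<close> the factor \<open>a\<close> is 0; for odd \<open>d\<close> triviality already
    means 0.\<close>
  have PV: "P x v = 0" if x: "x \<in> V" for x v
  proof (cases "even d")
    case True
    have "eventually (\<lambda>m. qform (gs m c) v0 \<noteq> 0) F"
      by (rule tendsto_imp_eventually_ne[OF qform_tendsto[OF cF cD] v0])
    then have "eventually (\<lambda>m. Q m c v0 = 0) F"
    proof eventually_elim
      case (elim m)
      have "E m c v0 \<noteq> 0" using elim True by (simp add: E_def energy_power_def)
      then show ?case by (simp add: Q_def P1_def \<kappa>_def)
    qed
    then have "((\<lambda>m. Q m c v0) \<longlongrightarrow> 0) F" by (rule tendsto_eventually)
    then have "P c v0 = 0" using tendsto_unique[OF F P[OF cD]] by blast
    then have "a = 0" using a[OF V(2), of v0] v0 True by (simp add: energy_power_def)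
    then show ?thesis using a[OF x, of v] by simp
  next
    case False
    then show ?thesis using a[OF x, of v] by (simp add: energy_power_def)
  qed
  have lim: "((\<lambda>m. \<Sum>x\<in>X. \<Sum>b<M. \<bar>Q m x (e b)\<bar>) \<longlongrightarrow> (\<Sum>x\<in>X. \<Sum>b<M. \<bar>P x (e b)\<bar>)) F"
    by (intro tendsto_sum tendsto_rabs P) (use X(2) V(3) in blast)
  have one: "eventually (\<lambda>m. (\<Sum>x\<in>X. \<Sum>b<M. \<bar>Q m x (e b)\<bar>) = 1) F"
    using ev[OF \<nu>_nz]
  proof eventually_elim
    case (elim m)
    have "(\<Sum>x\<in>X. \<Sum>b<M. \<bar>Q m x (e b)\<bar>) = \<bar>inverse (\<nu> m)\<bar> * \<nu> m"
      by (simp add: Q_def \<nu>_def abs_mult sum_distrib_left)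
    then show ?case using elim \<nu>_pos[of m] by simp
  qed
  \<comment> \<open>Normalization passes to the limit, because the norm involves finitely many
    values.\<close>
  have "(\<Sum>x\<in>X. \<Sum>b<M. \<bar>P x (e b)\<bar>) = 1"
    by (rule tendsto_unique[OF F lim tendsto_eventually[OF one]])
  moreover have "(\<Sum>x\<in>X. \<Sum>b<M. \<bar>P x (e b)\<bar>) = 0"
    using PV X(2) by (intro sum.neutral ballI) auto
  ultimately show False by simp
qed

theorem theorem1:
  fixes D :: "(real ^ 'n::finite) set" and c :: "real ^ 'n" and r :: real
    and g :: "real ^ 'n \<Rightarrow> real ^ 'n ^ 'n"
    and k d :: nat and \<epsilon> :: real
  assumes "CARD('n) \<ge> 2"
    and "D = ball c r" and "r > 0"
    and "k \<ge> 2"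
    and "Ck_metric_on k D g"
    and "\<epsilon> > 0"
  shows "\<exists>g\<^sub>1 \<epsilon>'. Ck_metric_on k D g\<^sub>1 \<and> Ck_close_on k D \<epsilon> g g\<^sub>1 \<and> \<epsilon>' > 0 \<and>
           (\<forall>g'. Ck_metric_on 2 D g' \<and> Ck_close_on 2 D \<epsilon>' g\<^sub>1 g' \<longrightarrow>
              \<not> (\<exists>F. polynomial_integral D g' d F \<and> \<not> trivial_integral D g' F))"
proof -
  note D = assms(2)
  have oD: "open D" "connected D" by (simp_all add: D)
  \<comment> \<open>The starting ball is smaller than \<open>D\<close>, which leaves an annulus for
    the successive bumps.\<close>
  have g2: "Ck_metric_on 2 (ball c (r / 2)) g"
    by (rule Ck_metric_on_mono[OF assms(5) assms(4)]) (use assms(3) D in auto)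
  obtain m where m: "killing_dependent m d (ball c (r / 2)) g"
    using killing_finite_dimensional[OF open_ball connected_ball _ g2, of c] assms(3) by auto
  obtain g1 \<rho> where g1: "Ck_metric_on k D g1" "Ck_close_on k D \<epsilon> g g1" and \<rho>: "0 < \<rho>" "\<rho> < r"
    and rigid: "\<And>P. killing d (ball c \<rho>) g1 P \<Longrightarrow> trivial_on d (ball c \<rho>) g1 P"
    using rigid_metric_exists[OF assms(1,4) m _ _ assms(5)[unfolded D] assms(6)] assms(3) unfolding D by auto
  have g12: "Ck_metric_on 2 D g1" by (rule Ck_metric_on_mono[OF g1(1) assms(4) subset_refl])
  have "\<exists>e>0. \<forall>g'. Ck_metric_on 2 D g' \<and> Ck_close_on 2 D e g1 g' \<longrightarrow>
      (\<forall>P. killing d D g' P \<longrightarrow> trivial_on d D g' P)"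
    by (rule rigidity_open[OF oD g12 open_ball _ _ rigid, of c]) (use \<rho> D in auto)
  then obtain e where e: "e > 0" "\<And>g' P. Ck_metric_on 2 D g' \<Longrightarrow> Ck_close_on 2 D e g1 g' \<Longrightarrow>
      killing d D g' P \<Longrightarrow> trivial_on d D g' P"
    by blast
  have "\<not> (\<exists>F. polynomial_integral D g' d F \<and> \<not> trivial_integral D g' F)"
    if "Ck_metric_on 2 D g' \<and> Ck_close_on 2 D e g1 g'" for g'
    using trivial_integral_of_trivial_killing[OF _ _ e(2)] that by blast
  then show ?thesis using g1 e(1) by blast
qed

end
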